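(* Let $U$ be the $\mathrm{mdG}(q)$ solution of $\dot u=f(u,t)$, $u(0)=u_0$, let $\pi u=\pi_{\mathrm{dG}}^{[q]}u$, let $\Phi$ be the corresponding $\mathrm{mdG}(q)^*$ solution of the dual problem with data $(\psi,g)$, and let $\bar e=U-\pi_{\mathrm{dG}}^{[q]}u$. Then there is a constant $C=C(q)>0$ such that $$|L_{\psi,g}(\bar e)|\le C\,S(T)\,\big\|k^{q+1}\bar u^{(q+1)}\big\|_{L_\infty([0,T],l_2)},$$ where $(k^{q+1}\bar u^{(q+1)})_i(t)=k_{ij}^{q_{ij}+1}\|u_i^{(q_{ij}+1)}\|_{L_\infty(I_{ij})}$ for $t\in I_{ij}$, and $S(T)=\int_0^T\|J^\top(\pi_{\mathrm{dG}}^{[q]}u,u,\cdot)\Phi\|_{l_2}\,dt$. Furthermore, suppose that there are $\alpha\in(0,1)$ and $c_k>0$ such that in every time slab: all degrees $q_{ij}$ equal a common value $\bar q$; $k_{ij}>\alpha k_{mn}$ for every pair $I_{ij},I_{mn}$ of local intervals in the slab; $f$ is autonomous ($\partial f_i/\partial t=0$ for all $i$); $\|f_i\|_{D^{\bar q+1}(\mathcal T)}<\infty$ for all $i$; and $k_{ij}C_f\le c_k$ for every local interval $I_{ij}$. Then there is a constant $C=C(q,c_k,\alpha)>0$ such that $$|L_{\psi,g}(\bar e)|\le C\,\bar S(T)\,\big\|k^{2q+1}\bar{\bar u}^{(2q+1)}\big\|_{L_\infty([0,T],l_1)},$$ where $(k^{2q+1}\bar{\bar u}^{(2q+1)})_i(t)=k_{ij}^{2q_{ij}+1}C_f^{q_{ij}}\|u_i^{(q_{ij}+1)}\|_{L_\infty(I_{ij})}$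 for $t\in I_{ij}$, and $$\bar S(T)=\int_0^T C_f\|\Phi\|_{L_\infty(\mathcal T,l_\infty)}\,dt=\sum_{n=1}^M K_nC_f\|\Phi\|_{L_\infty(\mathcal T_n,l_\infty)}.$$
   Context: Setting. Let $T>0$, $u_0\in\mathbb R^N$, $f:\mathbb R^N\times(0,T]\to\mathbb R^N$ bounded and Lipschitz-continuous in its first argument; $u:[0,T]\to\mathbb R^N$ solves $\dot u(t)=f(u(t),t)$, $t\in(0,T]$, $u(0)=u_0$. For each component $i=1,\dots,N$, $(0,T]$ is partitioned into subintervals $I_{ij}=(t_{i,j-1},t_{ij}]$, $j=1,\dots,M_i$, of length $k_{ij}=t_{ij}-t_{i,j-1}$, each with a polynomial degree $q_{ij}$. There are synchronized time levels $0=T_0<T_1<\dots<T_M=T$ (nodes common to all components); the time slab $\mathcal T_n$ is the set of $I_{ij}$ with $T_{n-1}\le t_{i,j-1}<t_{ij}\le T_n$, and $K_n=T_n-T_{n-1}$. $\mathcal P^q(I)$: polynomials of degree (at most) $q$ on $I$. $(\cdot,\cdot)$: inner product of $\mathbb R^N$. $\|v\|_{L_\infty(I,\|\cdot\|)}=\sup_{t\in I}\|v(t)\|$; $L_\infty(\mathcal T_n,\cdot)$ is the sup over the interval of the slab, $\mathcal T$ denoting the slab containing $t$. Jumps: $[v]_t=v(t^+)-v(t^-)$ and $[v_i]_{ij}=[v_i]_{t_{ij}}$. $\mathrm{mdG}(q)$ method ($q_{ij}\ge0$). $V=\hat V$ is the space of (possibly discontinuous) $v$ with $v_i|_{I_{ij}}\in\mathcal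 P^{q_{ij}}(I_{ij})$ for all $i,j$. $U\in V$ (left-continuous) with $U(0^-)=u_0$ satisfies $\sum_{i=1}^N\sum_{j=1}^{M_i}\big[[U_i]_{i,j-1}v_i(t_{i,j-1}^+)+\int_{I_{ij}}\dot U_iv_i\,dt\big]=\int_0^T(f(U,\cdot),v)\,dt$ for all $v\in\hat V$. Dual problem. For functions $x,y$, $J(x,y,t)=\int_0^1\frac{\partial f}{\partial u}(s\,x(t)+(1-s)y(t),t)\,ds$. With $\psi\in\mathbb R^N$, $g:[0,T]\to\mathbb R^N$, the dual problem is $-\dot\phi=J^\top(\pi u,U,t)\phi+g$ on $[0,T)$, $\phi(T)=\psi$. $L_{\psi,g}(v)=(v(T),\psi)+\int_0^T(v,g)\,dt$. The $\mathrm{mdG}(q)^*$ solution is $\Phi\in\hat V$ with $\Phi(T^+)=\psi$ and $\sum_{i=1}^N\sum_{j=1}^{M_i}\big[[v_i]_{i,j-1}\Phi_i(t_{i,j-1}^+)+\int_{I_{ij}}\dot v_i\Phi_i\,dt\big]=\int_0^T(J(\pi u,U,\cdot)v,\Phi)\,dt+L_{\psi,g}(v)$ for all $v\in V$ with $v(0^-)=0$. Interpolant. For $q\ge0$ and $v$ bounded and piecewise $\mathcal C^{q+1}$ on $[a,b]$, $\pi_{\mathrm{dG}}^{[q]}v\in\mathcal P^q([a,b])$ is defined by $\pi_{\mathrm{dG}}^{[q]}v(b)=v(b)$ and $\int_a^b(v-\pi_{\mathrm{dG}}^{[q]}v)w\,dx=0$ for all $w\in\mathcal P^{q-1}([a,b])$.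 For vector functions it is applied to component $i$ on each $I_{ij}$ with degree $q_{ij}$. Norm and constant $C_f$. For $v:\mathbb R^N\to\mathbb R$, $D^nv\,w^1\cdots w^n=\sum_{i_1,\dots,i_n}\frac{\partial^nv}{\partial x_{i_1}\cdots\partial x_{i_n}}w^1_{i_1}\cdots w^n_{i_n}$; $\|D^nv\|_{L_\infty(\mathcal T,l_\infty)}$ is the (smallest) constant with $\|D^nv\,w^1\cdots w^n\|_{L_\infty(\mathcal T)}\le\|D^nv\|_{L_\infty(\mathcal T,l_\infty)}\|w^1\|_{l_\infty}\cdots\|w^n\|_{l_\infty}$ for all $w^1,\dots,w^n\in\mathbb R^N$ (derivatives evaluated at the arguments occurring on the slab $\mathcal T$); $\|v\|_{D^p(\mathcal T)}=\max_{n=0,\dots,p}\|D^nv\|_{L_\infty(\mathcal T,l_\infty)}$. On each slab, $C_f$ is a constant with $C_f\ge\max_i\|f_i\|_{D^{\bar q+1}(\mathcal T)}$ and such that, for any $x:\mathbb R\to\mathbb R^N$ and $C_x>0$ with $\|x^{(n)}\|_{L_\infty(\mathcal T,l_\infty)}\le C_x^n$, $n=1,\dots,p$: $\|\frac{d^p}{dt^p}(\frac{\partial f}{\partial u})^\top(x(t))\|_{l_\infty}\le C_fC_x^p$ for $p=0,\dots,\bar q$, and $\|[\frac{d^p}{dt^p}(\frac{\partial f}{\partial u})^\top(x(t))]_t\|_{l_\infty}\le C_f\sum_{n=0}^pC_x^{p-n}\|[x^{(n)}]_t\|_{l_\infty}$ for $p=0,\dots,\bar q-1$. Thus $C_f=C_f(t)$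 is piecewise constant on $0=T_0<\dots<T_M=T$.
   Formalization: In the second estimate g is assumed to vanish on every time slab with common degree q̄>0 (for general g that estimate is false); u_i is taken to be C^{q_ij+1} up to the ends of each I_ij, f to be C^1 in u and measurable in t, and g integrable. *)

theory Defs
  imports "HOL-Analysis.Analysis" "HOL-Computational_Algebra.Polynomial"
begin

text \<open>
  The constants of the error estimates do not depend on the dimension \<open>N\<close>, so \<open>N\<close> has to be
  quantified inside the statement and cannot be a type.  Vectors of \<open>\<real>\<^sup>N\<close> are functions
  \<open>nat \<Rightarrow> real\<close> of which only the components \<open>i < N\<close> matter (components are numbered from 0), and
  \<open>N \<times> N\<close> matrices are functions \<open>nat \<Rightarrow> nat \<Rightarrow> real\<close> (row, column).  A function depending on the
  first \<open>N\<close> components only is continuous on \<open>\<real>\<^sup>N\<close> iff it is continuous for the product topology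
  of \<open>nat \<Rightarrow> real\<close>.
\<close>

type_synonym rvec = "nat \<Rightarrow> real"
type_synonym rmat = "nat \<Rightarrow> nat \<Rightarrow> real"

definition inner_N :: "nat \<Rightarrow> rvec \<Rightarrow> rvec \<Rightarrow> real" where
  "inner_N N x y = (\<Sum>i<N. x i * y i)"

definition norm_l1 :: "nat \<Rightarrow> rvec \<Rightarrow> real" where
  "norm_l1 N x = (\<Sum>i<N. \<bar>x i\<bar>)"

definition norm_l2 :: "nat \<Rightarrow> rvec \<Rightarrow> real" where
  "norm_l2 N x = L2_set x {..<N}"

definition norm_linf :: "nat \<Rightarrow> rvec \<Rightarrow> real" where
  "norm_linf N x = Max ((\<lambda>i. \<bar>x i\<bar>) ` {..<N})"

definition mat_vec :: "nat \<Rightarrow> rmat \<Rightarrow> rvec \<Rightarrow> rvec" where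
  "mat_vec N A x = (\<lambda>i. \<Sum>j<N. A i j * x j)"

definition transp :: "rmat \<Rightarrow> rmat" where
  "transp A = (\<lambda>i j. A j i)"

definition opnorm_linf :: "nat \<Rightarrow> rmat \<Rightarrow> real" where
  "opnorm_linf N A = (SUP w\<in>{w. norm_linf N w \<le> 1}. norm_linf N (mat_vec N A w))"

definition conv_hull :: "rvec set \<Rightarrow> rvec set" where
  "conv_hull X = {x. \<exists>m c y. (\<forall>k<m. 0 \<le> c k \<and> y k \<in> X) \<and> (\<Sum>k<(m::nat). c k) = (1::real)
                         \<and> x = (\<lambda>i. \<Sum>k<m. c k * y k i)}"


text \<open>Functions of one real variable with break points, jumps\<close>

definition jump :: "(real \<Rightarrow> real) \<Rightarrow> real \<Rightarrow> real" where
  "jump v t = Lim (at_right t) v - Lim (at_left t) v"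

text \<open>
  \<open>y\<close> is piecewise \<open>C\<^sup>m\<close> on \<open>[a,b]\<close> with break points in \<open>F\<close>.  The \<open>n\<close>-th derivative is
  \<open>(deriv ^^ n) y\<close>; it is only ever looked at off \<open>F\<close>, or through one-sided limits.  With
  \<open>F = {}\<close>, the restriction of \<open>y\<close> to \<open>(a,b)\<close> extends to a \<open>C\<^sup>m\<close> function on \<open>[a,b]\<close>.
\<close>

definition pw_smooth :: "nat \<Rightarrow> real \<Rightarrow> real \<Rightarrow> real set \<Rightarrow> (real \<Rightarrow> real) \<Rightarrow> bool" where
  "pw_smooth m a b F y \<longleftrightarrow>
     finite F \<and>
     (\<forall>n<m. \<forall>t\<in>{a<..<b} - F. (deriv ^^ n) y differentiable (at t)) \<and>
     (\<forall>n\<le>m. continuous_on ({a<..<b} - F) ((deriv ^^ n) y)) \<and>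
     (\<forall>n\<le>m. \<forall>t\<in>{a..<b}. \<exists>l. ((deriv ^^ n) y \<longlongrightarrow> l) (at_right t)) \<and>
     (\<forall>n\<le>m. \<forall>t\<in>{a<..b}. \<exists>l. ((deriv ^^ n) y \<longlongrightarrow> l) (at_left t))"


text \<open>Partial derivatives; \<open>pds [i\<^sub>1, \<dots>, i\<^sub>n] v\<close> is \<open>\<partial>\<^sup>n v / \<partial>x\<^sub>i\<^sub>1 \<dots> \<partial>x\<^sub>i\<^sub>n\<close>\<close>

definition pd :: "nat \<Rightarrow> (rvec \<Rightarrow> real) \<Rightarrow> rvec \<Rightarrow> real" where
  "pd j v x = deriv (\<lambda>h. v (x(j := h))) (x j)"

definition pds :: "nat list \<Rightarrow> (rvec \<Rightarrow> real) \<Rightarrow> rvec \<Rightarrow> real" where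
  "pds js v = foldr pd js v"

definition Ck :: "nat \<Rightarrow> nat \<Rightarrow> (rvec \<Rightarrow> real) \<Rightarrow> bool" where
  "Ck N m v \<longleftrightarrow>
     (\<forall>js. set js \<subseteq> {..<N} \<and> length js < m \<longrightarrow>
        (\<forall>j<N. \<forall>x. (\<lambda>h. pds js v (x(j := h))) differentiable (at (x j)))) \<and>
     (\<forall>js. set js \<subseteq> {..<N} \<and> length js \<le> m \<longrightarrow> continuous_on UNIV (pds js v))"

text \<open>\<open>Dn N n v w x\<close> is \<open>D\<^sup>nv w\<^sup>1\<cdots>w\<^sup>n\<close> at \<open>x\<close>, the directions being \<open>w 0, \<dots>, w (n-1)\<close>\<close>

definition Dn :: "nat \<Rightarrow> nat \<Rightarrow> (rvec \<Rightarrow> real) \<Rightarrow> (nat \<Rightarrow> rvec) \<Rightarrow> rvec \<Rightarrow> real" where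
  "Dn N n v w x = (\<Sum>js | set js \<subseteq> {..<N} \<and> length js = n. pds js v x * (\<Prod>k<n. w k (js ! k)))"

text \<open>
  The norms \<open>\<parallel>D\<^sup>n v\<parallel>\<close> and \<open>\<parallel>v\<parallel>\<close> in \<open>D\<^sup>p\<close>, where \<open>v x t\<close> is differentiated in \<open>x\<close> and evaluated at
  the arguments \<open>(x, t) \<in> A\<close>; the infimum over the empty set is \<open>\<infinity>\<close>.
\<close>

definition Dn_norm :: "nat \<Rightarrow> nat \<Rightarrow> (rvec \<Rightarrow> real \<Rightarrow> real) \<Rightarrow> (rvec \<times> real) set \<Rightarrow> ereal" where
  "Dn_norm N n v A =
     Inf (ereal ` {c. 0 \<le> c \<and>
       (\<forall>(x, t)\<in>A. \<forall>w. \<bar>Dn N n (\<lambda>z. v z t) w x\<bar> \<le> c * (\<Prod>k<n. norm_linf N (w k)))})"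

definition Dp_norm :: "nat \<Rightarrow> nat \<Rightarrow> (rvec \<Rightarrow> real \<Rightarrow> real) \<Rightarrow> (rvec \<times> real) set \<Rightarrow> ereal" where
  "Dp_norm N p v A = (MAX n\<in>{..p}. Dn_norm N n v A)"

definition dfdu :: "(rvec \<Rightarrow> real \<Rightarrow> rvec) \<Rightarrow> rvec \<Rightarrow> real \<Rightarrow> rmat" where
  "dfdu f x t = (\<lambda>i j. pd j (\<lambda>z. f z t i) x)"

definition Jmat :: "(rvec \<Rightarrow> real \<Rightarrow> rvec) \<Rightarrow> (real \<Rightarrow> rvec) \<Rightarrow> (real \<Rightarrow> rvec) \<Rightarrow> real \<Rightarrow> rmat" where
  "Jmat f x y t =
     (\<lambda>i j. integral {0..1} (\<lambda>s. dfdu f (\<lambda>l. s * x t l + (1 - s) * y t l) t i j))"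


text \<open>
  Multi-adaptive partitions: \<open>N\<close> components, final time \<open>T\<close>, \<open>M\<^sub>i\<close> local intervals of component \<open>i\<close>
  with nodes \<open>t\<^sub>i\<^sub>j\<close> (\<open>0 \<le> j \<le> M\<^sub>i\<close>) and degrees \<open>q\<^sub>i\<^sub>j\<close> (\<open>1 \<le> j \<le> M\<^sub>i\<close>), and \<open>M\<close> time slabs delimited
  by the synchronized time levels \<open>T\<^sub>n\<close> (\<open>0 \<le> n \<le> M\<close>).
\<close>

record grid =
  ncomp :: nat
  tfin :: real
  ncell :: "nat \<Rightarrow> nat"
  node :: "nat \<Rightarrow> nat \<Rightarrow> real"
  deg :: "nat \<Rightarrow> nat \<Rightarrow> nat"
  nslab :: nat
  level :: "nat \<Rightarrow> real"

definition is_grid :: "grid \<Rightarrow> bool" where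
  "is_grid G \<longleftrightarrow>
     1 \<le> ncomp G \<and> 0 < tfin G \<and>
     (\<forall>i<ncomp G. node G i 0 = 0 \<and> node G i (ncell G i) = tfin G
                 \<and> strict_mono_on {..ncell G i} (node G i)) \<and>
     level G 0 = 0 \<and> level G (nslab G) = tfin G \<and> strict_mono_on {..nslab G} (level G) \<and>
     (\<forall>n\<le>nslab G. \<forall>i<ncomp G. level G n \<in> node G i ` {..ncell G i})"

definition cell :: "grid \<Rightarrow> nat \<Rightarrow> nat \<Rightarrow> real set" where
  "cell G i j = {node G i (j - 1)<..node G i j}"

definition step :: "grid \<Rightarrow> nat \<Rightarrow> nat \<Rightarrow> real" where
  "step G i j = node G i j - node G i (j - 1)"

definition slab_ival :: "grid \<Rightarrow> nat \<Rightarrow> real set" where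
  "slab_ival G n = {level G (n - 1)<..level G n}"

definition slab :: "grid \<Rightarrow> nat \<Rightarrow> (nat \<times> nat) set" where
  "slab G n = {(i, j). i < ncomp G \<and> 1 \<le> j \<and> j \<le> ncell G i \<and>
                 level G (n - 1) \<le> node G i (j - 1) \<and> node G i j \<le> level G n}"

text \<open>\<open>index_at s t\<close> is the \<open>j\<close> with \<open>s (j - 1) < t \<le> s j\<close>\<close>

definition index_at :: "(nat \<Rightarrow> real) \<Rightarrow> real \<Rightarrow> nat" where
  "index_at s t = (LEAST j. t \<le> s j)"


text \<open>
  The trial and test space \<open>V\<close>.  Only the values on \<open>(0,T]\<close> and, as one-sided limits, \<open>v(0\<^sup>-)\<close> and \<open>v(T\<^sup>+)\<close>
  are ever used.
\<close>

definition Vspace :: "grid \<Rightarrow> (real \<Rightarrow> rvec) set" where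
  "Vspace G = {v. \<forall>i<ncomp G. \<forall>j\<in>{1..ncell G i}.
                 \<exists>p::real poly. degree p \<le> deg G i j \<and> (\<forall>t\<in>cell G i j. v t i = poly p t)}"

text \<open>The polynomials of degree at most \<open>q - 1\<close> are only the zero polynomial if \<open>q = 0\<close>\<close>

definition dG_poly :: "nat \<Rightarrow> real \<Rightarrow> real \<Rightarrow> (real \<Rightarrow> real) \<Rightarrow> real poly" where
  "dG_poly q a b v =
     (THE p. degree p \<le> q \<and> poly p b = v b \<and>
        (\<forall>w. degree w < q \<longrightarrow> integral {a..b} (\<lambda>x. (v x - poly p x) * poly w x) = 0))"

definition dG_interp :: "grid \<Rightarrow> (real \<Rightarrow> rvec) \<Rightarrow> real \<Rightarrow> rvec" where
  "dG_interp G u t =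
     (\<lambda>i. let j = index_at (node G i) t
          in poly (dG_poly (deg G i j) (node G i (j - 1)) (node G i j) (\<lambda>s. u s i)) t)"

text \<open>
  The initial value problem.  Continuous differentiability in the first argument is what gives
  \<open>\<partial>f/\<partial>u\<close> and \<open>J\<close> a meaning, and measurability in time is what gives the integrals a meaning.
  The Lipschitz condition also says that \<open>f\<close> depends on the first \<open>N\<close> components only.
\<close>

definition is_ivp :: "grid \<Rightarrow> (rvec \<Rightarrow> real \<Rightarrow> rvec) \<Rightarrow> rvec \<Rightarrow> (real \<Rightarrow> rvec) \<Rightarrow> bool" where
  "is_ivp G f u0 u \<longleftrightarrow>
     (\<exists>B. \<forall>x. \<forall>t\<in>{0<..tfin G}. norm_l2 (ncomp G) (f x t) \<le> B) \<and>
     (\<exists>L. \<forall>x y. \<forall>t\<in>{0<..tfin G}.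
        norm_l2 (ncomp G) (\<lambda>i. f x t i - f y t i) \<le> L * norm_l2 (ncomp G) (\<lambda>i. x i - y i)) \<and>
     (\<forall>i<ncomp G. \<forall>x. set_borel_measurable borel {0<..tfin G} (\<lambda>t. f x t i)) \<and>
     (\<forall>i<ncomp G. \<forall>t\<in>{0<..tfin G}. Ck (ncomp G) 1 (\<lambda>x. f x t i)) \<and>
     (\<forall>i<ncomp G. continuous_on {0..tfin G} (\<lambda>t. u t i) \<and> u 0 i = u0 i \<and>
        (\<forall>t\<in>{0<..tfin G}.
           ((\<lambda>s. u s i) has_real_derivative f (u t) t i) (at t within {0..tfin G})))"

text \<open>The smoothness of \<open>u\<close> required by its interpolant and by the norms of \<open>u\<^sub>i\<close> on \<open>I\<^sub>i\<^sub>j\<close>\<close>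

definition smooth_on_cells :: "grid \<Rightarrow> (real \<Rightarrow> rvec) \<Rightarrow> bool" where
  "smooth_on_cells G u \<longleftrightarrow>
     (\<forall>i<ncomp G. \<forall>j\<in>{1..ncell G i}.
        pw_smooth (deg G i j + 1) (node G i (j - 1)) (node G i j) {} (\<lambda>t. u t i))"

definition mdG_solution ::
  "grid \<Rightarrow> (rvec \<Rightarrow> real \<Rightarrow> rvec) \<Rightarrow> rvec \<Rightarrow> (real \<Rightarrow> rvec) \<Rightarrow> bool" where
  "mdG_solution G f u0 U \<longleftrightarrow>
     U \<in> Vspace G \<and>
     (\<forall>i<ncomp G. ((\<lambda>s. U s i) \<longlongrightarrow> u0 i) (at_left 0)) \<and>
     (\<forall>v\<in>Vspace G.
        (\<Sum>i<ncomp G. \<Sum>j=1..ncell G i.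
           jump (\<lambda>s. U s i) (node G i (j - 1)) * Lim (at_right (node G i (j - 1))) (\<lambda>s. v s i)
           + integral (cell G i j) (\<lambda>t. deriv (\<lambda>s. U s i) t * v t i))
        = integral {0..tfin G} (\<lambda>t. inner_N (ncomp G) (f (U t) t) (v t)))"

definition Lfun :: "grid \<Rightarrow> rvec \<Rightarrow> (real \<Rightarrow> rvec) \<Rightarrow> (real \<Rightarrow> rvec) \<Rightarrow> real" where
  "Lfun G \<psi> g v = inner_N (ncomp G) (v (tfin G)) \<psi>
                  + integral {0..tfin G} (\<lambda>t. inner_N (ncomp G) (v t) (g t))"

definition mdG_dual_solution ::
  "grid \<Rightarrow> (rvec \<Rightarrow> real \<Rightarrow> rvec) \<Rightarrow> (real \<Rightarrow> rvec) \<Rightarrow> (real \<Rightarrow> rvec) \<Rightarrow>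
   rvec \<Rightarrow> (real \<Rightarrow> rvec) \<Rightarrow> (real \<Rightarrow> rvec) \<Rightarrow> bool" where
  "mdG_dual_solution G f u U \<psi> g \<Phi> \<longleftrightarrow>
     \<Phi> \<in> Vspace G \<and>
     (\<forall>i<ncomp G. ((\<lambda>s. \<Phi> s i) \<longlongrightarrow> \<psi> i) (at_right (tfin G))) \<and>
     (\<forall>v\<in>Vspace G. (\<forall>i<ncomp G. ((\<lambda>s. v s i) \<longlongrightarrow> 0) (at_left 0)) \<longrightarrow>
        (\<Sum>i<ncomp G. \<Sum>j=1..ncell G i.
           jump (\<lambda>s. v s i) (node G i (j - 1)) * Lim (at_right (node G i (j - 1))) (\<lambda>s. \<Phi> s i)
           + integral (cell G i j) (\<lambda>t. deriv (\<lambda>s. v s i) t * \<Phi> t i))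
        = integral {0..tfin G}
            (\<lambda>t. inner_N (ncomp G) (mat_vec (ncomp G) (Jmat f (dG_interp G u) U t) (v t)) (\<Phi> t))
          + Lfun G \<psi> g v)"

text \<open>The common standing assumptions, with all degrees bounded by \<open>Q\<close>\<close>

definition mdG_setting ::
  "nat \<Rightarrow> grid \<Rightarrow> (rvec \<Rightarrow> real \<Rightarrow> rvec) \<Rightarrow> rvec \<Rightarrow> (real \<Rightarrow> rvec) \<Rightarrow> (real \<Rightarrow> rvec) \<Rightarrow>
   rvec \<Rightarrow> (real \<Rightarrow> rvec) \<Rightarrow> (real \<Rightarrow> rvec) \<Rightarrow> bool" where
  "mdG_setting Q G f u0 u U \<psi> g \<Phi> \<longleftrightarrow>
     is_grid G \<and> (\<forall>i<ncomp G. \<forall>j\<in>{1..ncell G i}. deg G i j \<le> Q) \<and>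
     is_ivp G f u0 u \<and> smooth_on_cells G u \<and>
     (\<forall>i<ncomp G. (\<lambda>t. g t i) absolutely_integrable_on {0..tfin G}) \<and>
     mdG_solution G f u0 U \<and> mdG_dual_solution G f u U \<psi> g \<Phi>"


text \<open>
  The \<open>L\<^sub>\<infinity>\<close> norm of the derivative on \<open>I\<^sub>i\<^sub>j\<close>; the right end point, where \<open>u\<^sub>i\<close> may have one-sided
  derivatives only, does not contribute to an essential supremum.
\<close>

definition cell_norm :: "grid \<Rightarrow> (real \<Rightarrow> rvec) \<Rightarrow> nat \<Rightarrow> nat \<Rightarrow> real" where
  "cell_norm G u i j =
     (SUP t\<in>{node G i (j - 1)<..<node G i j}. \<bar>(deriv ^^ (deg G i j + 1)) (\<lambda>s. u s i) t\<bar>)"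

definition ku :: "grid \<Rightarrow> (real \<Rightarrow> rvec) \<Rightarrow> real \<Rightarrow> rvec" where
  "ku G u t = (\<lambda>i. let j = index_at (node G i) t
                   in step G i j ^ (deg G i j + 1) * cell_norm G u i j)"

definition kkCu :: "grid \<Rightarrow> (nat \<Rightarrow> real) \<Rightarrow> (real \<Rightarrow> rvec) \<Rightarrow> real \<Rightarrow> rvec" where
  "kkCu G Cf u t = (\<lambda>i. let j = index_at (node G i) t
                   in step G i j ^ (2 * deg G i j + 1) * Cf (index_at (level G) t) ^ deg G i j
                      * cell_norm G u i j)"

definition stab_S ::
  "grid \<Rightarrow> (rvec \<Rightarrow> real \<Rightarrow> rvec) \<Rightarrow> (real \<Rightarrow> rvec) \<Rightarrow> (real \<Rightarrow> rvec) \<Rightarrow> real" where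
  "stab_S G f u \<Phi> =
     integral {0..tfin G}
       (\<lambda>t. norm_l2 (ncomp G) (mat_vec (ncomp G) (transp (Jmat f (dG_interp G u) u t)) (\<Phi> t)))"

definition slab_norm :: "grid \<Rightarrow> (real \<Rightarrow> rvec) \<Rightarrow> nat \<Rightarrow> real" where
  "slab_norm G v n = (SUP t\<in>slab_ival G n. norm_linf (ncomp G) (v t))"

text \<open>\<open>Cf n\<close> is the value of the piecewise constant \<open>C\<^sub>f\<close> on the slab number \<open>n\<close>\<close>

definition stab_Sbar :: "grid \<Rightarrow> (nat \<Rightarrow> real) \<Rightarrow> (real \<Rightarrow> rvec) \<Rightarrow> real" where
  "stab_Sbar G Cf \<Phi> =
     integral {0..tfin G}
       (\<lambda>t. Cf (index_at (level G) t) * slab_norm G \<Phi> (index_at (level G) t))"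

text \<open>
  The arguments of \<open>f\<close> and its derivatives occurring on a slab: the values of \<open>u\<close>, its interpolant
  and \<open>U\<close>, and the convex combinations of these (as in \<open>J\<close>, and in mean values across jumps).
\<close>

definition slab_args :: "grid \<Rightarrow> (real \<Rightarrow> rvec) \<Rightarrow> (real \<Rightarrow> rvec) \<Rightarrow> nat \<Rightarrow> (rvec \<times> real) set" where
  "slab_args G u U n =
     conv_hull (u ` slab_ival G n \<union> dG_interp G u ` slab_ival G n \<union> U ` slab_ival G n)
     \<times> slab_ival G n"

text \<open>
  The defining conditions of \<open>C\<^sub>f\<close> on a slab with interval \<open>(a,b]\<close>, common degree \<open>q\<close> and arguments
  \<open>A\<close>.  The test functions \<open>x\<close> are piecewise \<open>C\<^sup>p\<close>.
\<close>

definition is_Cf ::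
  "nat \<Rightarrow> nat \<Rightarrow> real \<Rightarrow> real \<Rightarrow> (rvec \<Rightarrow> real \<Rightarrow> rvec) \<Rightarrow> (rvec \<times> real) set \<Rightarrow> real \<Rightarrow> bool" where
  "is_Cf N q a b f A c \<longleftrightarrow>
     (\<forall>i<N. Dp_norm N (q + 1) (\<lambda>x t. f x t i) A \<le> ereal c) \<and>
     (\<forall>p\<le>q. \<forall>x F Cx. 0 < Cx \<and> (\<forall>i<N. pw_smooth p a b F (\<lambda>t. x t i)) \<and>
        (\<forall>n\<in>{1..p}. \<forall>t\<in>{a<..<b} - F. norm_linf N (\<lambda>i. (deriv ^^ n) (\<lambda>s. x s i) t) \<le> Cx ^ n) \<longrightarrow>
        (\<forall>t\<in>{a<..<b} - F.
           opnorm_linf N (\<lambda>i j. (deriv ^^ p) (\<lambda>s. transp (dfdu f (x s) s) i j) t) \<le> c * Cx ^ p) \<and>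
        (p < q \<longrightarrow> (\<forall>t\<in>{a<..<b}.
           opnorm_linf N (\<lambda>i j. jump ((deriv ^^ p) (\<lambda>s. transp (dfdu f (x s) s) i j)) t)
           \<le> c * (\<Sum>n\<le>p. Cx ^ (p - n) * norm_linf N (\<lambda>i. jump ((deriv ^^ n) (\<lambda>s. x s i)) t)))))"

text \<open>
  The additional assumptions on every time slab.  The last condition, that the dual datum \<open>g\<close>
  vanishes on the slabs of positive degree, is needed for the improved estimate: every element of
  \<open>V\<close> is a discrete dual solution for a suitable \<open>g\<close>, so that without it derivatives of \<open>\<Phi>\<close> of
  size \<open>k\<^sup>-\<^sup>1\<close> are possible and the additional powers of \<open>k\<close> are lost.
\<close>

definition slab_assms ::
  "grid \<Rightarrow> (rvec \<Rightarrow> real \<Rightarrow> rvec) \<Rightarrow> (real \<Rightarrow> rvec) \<Rightarrow> (real \<Rightarrow> rvec) \<Rightarrow> (real \<Rightarrow> rvec) \<Rightarrow>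
   (nat \<Rightarrow> real) \<Rightarrow> real \<Rightarrow> real \<Rightarrow> bool" where
  "slab_assms G f u U g Cf ck \<alpha> \<longleftrightarrow>
     (\<forall>n\<in>{1..nslab G}. \<exists>qb.
        (\<forall>(i, j)\<in>slab G n. deg G i j = qb) \<and>
        (\<forall>(i, j)\<in>slab G n. \<forall>(l, m)\<in>slab G n. step G i j > \<alpha> * step G l m) \<and>
        (\<forall>i<ncomp G. \<forall>x. \<forall>t\<in>slab_ival G n.
           ((\<lambda>s. f x s i) has_real_derivative 0) (at t within slab_ival G n)) \<and>
        (\<forall>i<ncomp G. \<forall>t\<in>slab_ival G n. Ck (ncomp G) (qb + 1) (\<lambda>x. f x t i)) \<and>
        (\<forall>i<ncomp G. Dp_norm (ncomp G) (qb + 1) (\<lambda>x t. f x t i) (slab_args G u U n) < \<infinity>) \<and>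
        is_Cf (ncomp G) qb (level G (n - 1)) (level G n) f (slab_args G u U n) (Cf n) \<and>
        (\<forall>(i, j)\<in>slab G n. step G i j * Cf n \<le> ck) \<and>
        (0 < qb \<longrightarrow> (\<forall>i<ncomp G. \<forall>t\<in>slab_ival G n. g t i = 0)))"

end

theory Submission
  imports Defs
begin

text \<open>
  Write \<open>e = U - \<pi>u\<close> and \<open>A = J\<^sup>T(\<pi>u, u) \<Phi>\<close>, where \<open>J\<close> is the averaged Jacobian; \<open>A\<close> is
  \<open>adjoint_rhs\<close> below.

  \<^bold>\<open>Error representation.\<close>  The interpolant agrees with \<open>u\<close> at the right end of every cell and
  \<open>u - \<pi>u\<close> is orthogonal to the derivatives of the test functions.  Partial integration therefore
  shows that \<open>\<pi>u\<close> satisfies the discrete equation with the data \<open>f(u)\<close>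
  (\<open>interpolant_cell_identity\<close>).  Subtract this from the equation for \<open>U\<close>, test with \<open>\<Phi>\<close>, and compare
  with the dual equation tested with \<open>e\<close>: the terms containing \<open>f(U)\<close> cancel by the mean value
  property of \<open>J\<close>, and \<open>L(e) = \<integral> (f(\<pi>u) - f(u), \<Phi>) = \<integral> (\<pi>u - u, A)\<close> remains
  (\<open>error_representation\<close>).  The first estimate follows by Cauchy-Schwarz from the interpolation
  error \<open>C k\<^sup>q\<^sup>+\<^sup>1 max |u\<^sup>(\<^sup>q\<^sup>+\<^sup>1\<^sup>)|\<close>.

  \<^bold>\<open>Improvement.\<close>  On every cell \<open>\<pi>u - u\<close> is orthogonal to the polynomials of degree less than \<open>q\<close>,
  so \<open>A\<close> may be replaced by \<open>A - w\<close> for any such polynomial \<open>w\<close>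
  (\<open>cell_integral_estimate\<close>).  It remains to approximate \<open>A\<close> on a cell by polynomials
  of degree less than \<open>q\<close> up to \<open>C C\<^sub>f (k C\<^sub>f)\<^sup>q \<parallel>\<Phi>\<parallel>\<close>.  As \<open>U\<close> and \<open>\<Phi>\<close> are discontinuous, and the
  nodes of different components do not match, the argument works with approximability by polynomials
  of low degree on windows of a few steps (\<open>apx\<close>) and not with derivatives and jumps.  Two facts
  feed each other.

  \<^item> \<^emph>\<open>A curve is one order better than its velocity.\<close>  For \<open>u\<close> this is integration (\<open>u_step\<close>).  For
    \<open>U\<close> and \<open>\<Phi>\<close>, the derivative on a cell is a weighted \<open>L\<^sub>2\<close>-projection of the right-hand side, hence as
    close to a polynomial \<open>w\<close> as the right-hand side itself, and a jump is the integral of the local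
    defect (\<open>U_drives\<close>, \<open>Phi_drives\<close>).  The steps in a window are comparable, so only boundedly many
    jumps occur and summation costs a constant (\<open>growth\<close>, \<open>drive_step\<close>).

  \<^item> \<^emph>\<open>A composition is as good as its arguments.\<close>  If the curves \<open>y\<close> and \<open>\<Phi>\<close> are approximable to
    order \<open>r\<close>, so are \<open>f(y)\<close> and \<open>J\<^sup>T\<Phi>\<close>: expand \<open>f\<close> or its derivative by Taylor's formula at a base
    point, substitute the approximating polynomials and drop the high powers
    (\<open>flow_composition\<close>, \<open>adjoint_apx\<close>).

  Starting from boundedness, alternation reaches order \<open>q\<close> after \<open>q\<close> rounds, each of which may widen the
  window by one step (\<open>uniform_adjoint_regularity\<close>).  The constants do not depend on the number of
  components: the condition on \<open>C\<^sub>f\<close> bounds the derivatives of \<open>f\<close> as multilinear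
  forms in the maximum norm, and all coefficients are read off from univariate polynomials through
  their values on the unit interval (\<open>coeff_bound\<close>).
\<close>

section \<open>Polynomials on an interval\<close>

text \<open>
  Equidistant interpolation nodes. They express the coefficients of a polynomial by finitely many
  of its values, which is how sizes of polynomials are compared below.
\<close>

definition lag_node :: "nat \<Rightarrow> nat \<Rightarrow> real" where
  "lag_node d l = real l / real (Suc d)"

definition lag_poly :: "nat \<Rightarrow> nat \<Rightarrow> real poly" where
  "lag_poly d l =
     (\<Prod>k\<in>{..d} - {l}. smult (1 / (lag_node d l - lag_node d k)) [:- lag_node d k, 1:])"

lemma lag_node_inj: "lag_node d l = lag_node d k \<longleftrightarrow> l = k"
  by (simp add: lag_node_def field_simps)

lemma lag_node_unit: "l \<le> d \<Longrightarrow> lag_node d l \<in> {0..1}"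
  by (simp add: lag_node_def field_simps)

lemma poly_lag_poly:
  assumes "l \<le> d" "m \<le> d"
  shows "poly (lag_poly d l) (lag_node d m) = (if l = m then 1 else 0)"
proof (cases "l = m")
  case True
  have "(\<Prod>k\<in>{..d} - {l}. poly (smult (1 / (lag_node d l - lag_node d k)) [:- lag_node d k, 1:]) (lag_node d l))
        = (\<Prod>k\<in>{..d} - {l}. 1)"
    by (intro prod.cong refl) (auto simp: divide_simps lag_node_inj)
  then show ?thesis using True by (simp add: lag_poly_def poly_prod)
next
  case False
  then show ?thesis using assms
    by (auto simp: lag_poly_def poly_prod intro!: prod_zero bexI[of _ m])
qed

lemma degree_lag_poly: "l \<le> d \<Longrightarrow> degree (lag_poly d l) \<le> d"
proof -
  assume l: "l \<le> d"
  have "degree (lag_poly d l)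
        \<le> sum (degree \<circ> (\<lambda>k. smult (1 / (lag_node d l - lag_node d k)) [:- lag_node d k, 1:])) ({..d} - {l})"
    unfolding lag_poly_def by (rule degree_prod_sum_le) simp
  also have "\<dots> \<le> (\<Sum>k\<in>{..d} - {l}. 1)" by (intro sum_mono) simp
  also have "\<dots> = d" using l by simp
  finally show ?thesis .
qed

lemma lagrange_interpolation:
  assumes "degree p \<le> d"
  shows "p = (\<Sum>l\<le>d. smult (poly p (lag_node d l)) (lag_poly d l))"
proof (rule poly_eqI_degree)
  show "poly p x = poly (\<Sum>l\<le>d. smult (poly p (lag_node d l)) (lag_poly d l)) x"
    if "x \<in> lag_node d ` {..d}" for x
  proof -
    from that obtain m where m: "m \<le> d" "x = lag_node d m" by auto
    have "(\<Sum>l\<le>d. poly p (lag_node d l) * poly (lag_poly d l) x)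
          = (\<Sum>l\<le>d. if l = m then poly p (lag_node d l) else 0)"
      by (intro sum.cong) (auto simp: m poly_lag_poly)
    then show ?thesis using m by (simp add: poly_sum)
  qed
  have "card (lag_node d ` {..d}) = Suc d"
    by (subst card_image) (auto simp: inj_on_def lag_node_inj)
  then show "degree p < card (lag_node d ` {..d})"
    "degree (\<Sum>l\<le>d. smult (poly p (lag_node d l)) (lag_poly d l)) < card (lag_node d ` {..d})"
    using assms by (auto simp: less_Suc_eq_le intro!: degree_sum_le order.trans[OF degree_smult_le] degree_lag_poly)
qed

text \<open>
  All coefficients are fixed linear combinations of the values at the interpolation nodes.
\<close>

lemma coeff_bound:
  "\<exists>C>0. \<forall>(p::real poly) B. degree p \<le> d \<longrightarrow> (\<forall>x\<in>{0..1}. \<bar>poly p x\<bar> \<le> B) \<longrightarrow> (\<forall>m. \<bar>coeff p m\<bar> \<le> C * B)"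
proof -
  define C where "C = 1 + (\<Sum>l\<le>d. \<Sum>m\<le>d. \<bar>coeff (lag_poly d l) m\<bar>)"
  have C: "C > 0" unfolding C_def by (intro add_pos_nonneg sum_nonneg) auto
  have "\<bar>coeff p m\<bar> \<le> C * B"
    if p: "degree p \<le> d" and B: "\<forall>x\<in>{0..1}. \<bar>poly p x\<bar> \<le> B" for p :: "real poly" and B m
  proof -
    have B0: "B \<ge> 0" using B[rule_format, of 0] by (meson abs_ge_zero atLeastAtMost_iff order.refl order.trans zero_le_one)
    show ?thesis
    proof (cases "m \<le> d")
      case False
      then show ?thesis using p B0 C by (simp add: coeff_eq_0)
    next
      case True
      have "coeff p m = (\<Sum>l\<le>d. poly p (lag_node d l) * coeff (lag_poly d l) m)"
        by (subst lagrange_interpolation[OF p]) (simp add: coeff_sum)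
      also have "\<bar>\<dots>\<bar> \<le> (\<Sum>l\<le>d. B * \<bar>coeff (lag_poly d l) m\<bar>)"
        by (rule order.trans[OF sum_abs], intro sum_mono)
           (auto simp: abs_mult intro!: mult_right_mono B[rule_format] lag_node_unit)
      also have "\<dots> \<le> (\<Sum>l\<le>d. B * (\<Sum>m\<le>d. \<bar>coeff (lag_poly d l) m\<bar>))"
        using True B0 by (intro sum_mono mult_left_mono member_le_sum) auto
      also have "\<dots> = B * (\<Sum>l\<le>d. \<Sum>m\<le>d. \<bar>coeff (lag_poly d l) m\<bar>)"
        by (simp add: sum_distrib_left)
      also have "\<dots> \<le> B * C" using B0 unfolding C_def by (intro mult_left_mono) auto
      finally show ?thesis by (simp add: mult.commute)
    qed
  qed
  with C show ?thesis by blast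
qed

text \<open>
  An inequality of Markov type, derived from \<open>coeff_bound\<close> monomial by monomial.
\<close>

lemma poly_lipschitz:
  "\<exists>C\<ge>1. \<forall>(p::real poly) B. degree p \<le> d \<longrightarrow> (\<forall>x\<in>{0..1}. \<bar>poly p x\<bar> \<le> B) \<longrightarrow>
     (\<forall>x\<in>{0..1}. \<forall>y\<in>{0..1}. \<bar>poly p x - poly p y\<bar> \<le> C * B * \<bar>x - y\<bar>)"
proof -
  obtain C where C: "C > 0" and cb: "\<And>(p::real poly) B m. degree p \<le> d \<Longrightarrow> (\<forall>x\<in>{0..1}. \<bar>poly p x\<bar> \<le> B) \<Longrightarrow> \<bar>coeff p m\<bar> \<le> C * B"
    using coeff_bound[of d] by blast
  have pw: "\<bar>x ^ m - y ^ m\<bar> \<le> real m * \<bar>x - y\<bar>" if "x \<in> {0..1}" "y \<in> {0..1}" for x y :: real and m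
  proof (induction m)
    case (Suc m)
    have "x ^ Suc m - y ^ Suc m = x * (x ^ m - y ^ m) + y ^ m * (x - y)" by (simp add: algebra_simps)
    also have "\<bar>\<dots>\<bar> \<le> \<bar>x\<bar> * \<bar>x ^ m - y ^ m\<bar> + \<bar>y ^ m\<bar> * \<bar>x - y\<bar>"
      by (rule order.trans[OF abs_triangle_ineq]) (simp add: abs_mult)
    also have "\<dots> \<le> 1 * (real m * \<bar>x - y\<bar>) + 1 * \<bar>x - y\<bar>"
      using that Suc by (intro add_mono mult_mono) (auto simp: power_le_one)
    finally show ?case by (simp add: algebra_simps)
  qed simp
  have "\<bar>poly p x - poly p y\<bar> \<le> (1 + C * real d * real (Suc d)) * B * \<bar>x - y\<bar>"
    if p: "degree p \<le> d" and B: "\<forall>x\<in>{0..1}. \<bar>poly p x\<bar> \<le> B" and xy: "x \<in> {0..1}" "y \<in> {0..1}"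
    for p :: "real poly" and B x y
  proof -
    have B0: "B \<ge> 0" using B xy by (meson abs_ge_zero order.trans)
    have "poly p x - poly p y = (\<Sum>m\<le>degree p. coeff p m * (x ^ m - y ^ m))"
      by (simp add: poly_altdef sum_subtractf algebra_simps)
    also have "\<bar>\<dots>\<bar> \<le> (\<Sum>m\<le>degree p. (C * B) * (real d * \<bar>x - y\<bar>))"
      using p C B0 by (intro order.trans[OF sum_abs] sum_mono)
        (auto simp: abs_mult intro!: mult_mono cb B order.trans[OF pw[OF xy]] mult_right_mono)
    also have "\<dots> = real (Suc (degree p)) * ((C * B) * (real d * \<bar>x - y\<bar>))" by simp
    also have "\<dots> \<le> real (Suc d) * ((C * B) * (real d * \<bar>x - y\<bar>))"
      using p C B0 by (intro mult_right_mono) auto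
    also have "\<dots> = (C * real d * real (Suc d)) * (B * \<bar>x - y\<bar>)" by simp
    also have "\<dots> \<le> (1 + C * real d * real (Suc d)) * (B * \<bar>x - y\<bar>)"
      using B0 by (intro mult_right_mono) auto
    finally show ?thesis by (simp add: mult.assoc)
  qed
  moreover have "1 + C * real d * real (Suc d) \<ge> 1" using C by simp
  ultimately show ?thesis by blast
qed

text \<open>
  On the finite-dimensional space of polynomials of bounded degree all norms are equivalent. The
  explicit argument: by the Lipschitz bound the polynomial keeps half of its maximum on an
  interval of length comparable to 1, and that interval can be taken away from the zero of the
  weight.
\<close>

lemma unit_norm_equivalence:
  "\<exists>C>0. \<forall>p::real poly. degree p \<le> d \<longrightarrow>
     (\<forall>x\<in>{0..1}. (poly p x)\<^sup>2 \<le> C * integral {0..1} (\<lambda>t. (1 - t) * (poly p t)\<^sup>2))"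
proof -
  obtain L where L: "L \<ge> 1" and lip: "\<And>(p::real poly) B x y. degree p \<le> d \<Longrightarrow> (\<forall>x\<in>{0..1}. \<bar>poly p x\<bar> \<le> B) \<Longrightarrow>
     x \<in> {0..1} \<Longrightarrow> y \<in> {0..1} \<Longrightarrow> \<bar>poly p x - poly p y\<bar> \<le> L * B * \<bar>x - y\<bar>"
    using poly_lipschitz[of d] by blast
  (* |p| stays above half of its maximum S at distance at most h from the maximum point z; the
     interval [c, c + h/2] within this distance also keeps distance h/2 from the point 1. *)
  define h where "h = 1 / (2 * L)"
  have h: "0 < h" "h \<le> 1/2" using L by (auto simp: h_def field_simps)
  have "(poly p x)\<^sup>2 \<le> (16 / h\<^sup>2) * integral {0..1} (\<lambda>t. (1 - t) * (poly p t)\<^sup>2)"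
    if p: "degree p \<le> d" and x: "x \<in> {0..1}" for p :: "real poly" and x
  proof -
    have "\<exists>z\<in>{0..1::real}. \<forall>y\<in>{0..1}. \<bar>poly p y\<bar> \<le> \<bar>poly p z\<bar>"
      by (intro continuous_attains_sup continuous_intros) auto
    then obtain z where z: "z \<in> {0..1}" and S: "\<forall>y\<in>{0..1}. \<bar>poly p y\<bar> \<le> \<bar>poly p z\<bar>" by blast
    define S where "S = \<bar>poly p z\<bar>"
    define c where "c = (if z \<ge> 1/2 then z - h else z)"
    have cz: "0 \<le> c" "c + h \<le> 1" "\<And>t. t \<in> {c..c+h/2} \<Longrightarrow> \<bar>t - z\<bar> \<le> h" "c + h/2 \<le> 1"
      using h z by (auto simp: c_def split: if_splits)
    let ?g = "\<lambda>t. (1 - t) * (poly p t)\<^sup>2"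
    have ge: "(h/2) * (S/2)\<^sup>2 \<le> ?g t" if t: "t \<in> {c..c+h/2}" for t
    proof (rule mult_mono)
      have t01: "t \<in> {0..1}" using t cz by auto
      have "\<bar>poly p t - poly p z\<bar> \<le> L * S * \<bar>t - z\<bar>"
        using lip[OF p, of S t z] S z t01 by (auto simp: S_def)
      also have "\<dots> \<le> L * S * h" using cz(3)[OF t] L by (intro mult_left_mono) (auto simp: S_def)
      also have "\<dots> = S/2" using L by (simp add: h_def)
      finally have "S/2 \<le> \<bar>poly p t\<bar>" unfolding S_def by linarith
      then show "(S/2)\<^sup>2 \<le> (poly p t)\<^sup>2"
        by (metis S_def abs_ge_zero abs_le_square_iff abs_of_nonneg half_gt_zero_iff less_eq_real_def zero_less_divide_iff divide_eq_0_iff)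
      show "h / 2 \<le> 1 - t" using t cz by auto
    qed (use t cz h in auto)
    have int: "?g integrable_on {u..v}" for u v
      by (intro integrable_continuous_interval continuous_intros)
    have "(h/2) * ((h/2) * (S/2)\<^sup>2) = integral {c..c+h/2} (\<lambda>t. (h/2) * (S/2)\<^sup>2)" using h by simp
    also have "\<dots> \<le> integral {c..c+h/2} ?g"
      by (intro integral_le int integrable_const_ivl ge)
    also have "\<dots> \<le> integral {0..1} ?g"
      by (intro integral_subset_le int) (use cz h in auto)
    finally have "S\<^sup>2 \<le> (16 / h\<^sup>2) * integral {0..1} ?g"
      using h by (simp add: field_simps power2_eq_square)
    moreover have "(poly p x)\<^sup>2 \<le> S\<^sup>2" using S x by (simp add: S_def abs_le_square_iff)
    ultimately show ?thesis by linarith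
  qed
  moreover have "16 / h\<^sup>2 > 0" using h by simp
  ultimately show ?thesis by blast
qed

text \<open>
  The jump term of the Galerkin equation disappears for test functions that vanish at one end of
  the cell. Such functions are a linear factor times a polynomial; this factor becomes the weight.
\<close>

definition end_weight :: "real \<Rightarrow> real \<Rightarrow> (real \<Rightarrow> real) \<Rightarrow> bool" where
  "end_weight a b w \<longleftrightarrow> w = (\<lambda>t. b - t) \<or> w = (\<lambda>t. t - a)"

lemma end_weight_bounds: "end_weight a b w \<Longrightarrow> t \<in> {a..b} \<Longrightarrow> 0 \<le> w t \<and> w t \<le> b - a"
  by (auto simp: end_weight_def)

lemma end_weight_continuous: "end_weight a b w \<Longrightarrow> continuous_on S w"
  by (auto simp: end_weight_def intro!: continuous_intros)

lemma integral_affine_unit: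
  fixes g :: "real \<Rightarrow> real"
  assumes ab: "a < b" and g: "continuous_on {a..b} g"
  shows "integral {a..b} g = (b - a) * integral {0..1} (\<lambda>x. g (a + (b - a) * x))"
    and "integral {a..b} g = (b - a) * integral {0..1} (\<lambda>x. g (b - (b - a) * x))"
proof -
  have I: "(g has_integral integral {a..b} g) (cbox a b)"
    using g by (simp add: integrable_continuous_interval integrable_integral)
  have "((\<lambda>x. g ((b - a) *\<^sub>R x + a)) has_integral (1 / \<bar>b - a\<bar> ^ DIM(real)) *\<^sub>R integral {a..b} g)
     ((\<lambda>x. (1 / (b - a)) *\<^sub>R x + - ((1 / (b - a)) *\<^sub>R a)) ` cbox a b)"
    using ab by (intro has_integral_affinity I) auto
  moreover have "(\<lambda>x. (1 / (b - a)) *\<^sub>R x + - ((1 / (b - a)) *\<^sub>R a)) ` cbox a b = {0..1}"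
    using ab image_affinity_atLeastAtMost[of "1/(b-a)" "- a/(b-a)" a b]
    by (simp add: divide_simps)
  ultimately have "((\<lambda>x. g (a + (b - a) * x)) has_integral (1 / (b - a)) * integral {a..b} g) {0..1}"
    using ab by (simp add: add.commute)
  then show 1: "integral {a..b} g = (b - a) * integral {0..1} (\<lambda>x. g (a + (b - a) * x))"
    using ab by (simp add: integral_unique)
  have "((\<lambda>x. g (-(b - a) *\<^sub>R x + b)) has_integral (1 / \<bar>-(b - a)\<bar> ^ DIM(real)) *\<^sub>R integral {a..b} g)
     ((\<lambda>x. (1 / (-(b - a))) *\<^sub>R x + - ((1 / (-(b - a))) *\<^sub>R b)) ` cbox a b)"
    using ab by (intro has_integral_affinity I) auto
  moreover have "(\<lambda>x. (1 / (-(b - a))) *\<^sub>R x + - ((1 / (-(b - a))) *\<^sub>R b)) ` cbox a b = {0..1}"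
  proof -
    have "(\<lambda>x. (1 / (-(b - a))) *\<^sub>R x + - ((1 / (-(b - a))) *\<^sub>R b)) = (\<lambda>x. (- (1/(b-a))) * x + b/(b-a))"
    proof
      fix x show "(1 / (-(b - a))) *\<^sub>R x + - ((1 / (-(b - a))) *\<^sub>R b) = (- (1/(b-a))) * x + b/(b-a)"
        by (metis (no_types, opaque_lifting) divide_minus_right minus_minus mult_minus_left real_scaleR_def times_divide_eq_left mult_1)
    qed
    show ?thesis
      unfolding \<open>_ = (\<lambda>x. (- (1/(b-a))) * x + b/(b-a))\<close> cbox_interval
    proof (intro equalityI subsetI)
      fix y :: real assume "y \<in> {0..1}"
      then have "0 \<le> (b - a) * y" "(b - a) * y \<le> (b - a) * 1" using ab by (auto intro!: mult_left_mono mult_nonneg_nonneg)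
      then have "b - (b - a) * y \<in> {a..b}" by simp
      moreover have "y = - (1/(b-a)) * (b - (b - a) * y) + b/(b-a)" using ab by (simp add: diff_divide_distrib)
      ultimately show "y \<in> (\<lambda>x. - (1/(b-a)) * x + b/(b-a)) ` {a..b}" by blast
    next
      fix y assume "y \<in> (\<lambda>x. - (1/(b-a)) * x + b/(b-a)) ` {a..b}"
      then obtain x where x: "x \<in> {a..b}" "y = - (1/(b-a)) * x + b/(b-a)" by blast
      then have "y = (b - x) / (b - a)" by (simp add: diff_divide_distrib)
      then show "y \<in> {0..1}" using ab x(1) by simp
    qed
  qed
  ultimately have "((\<lambda>x. g (b - (b - a) * x)) has_integral (1 / (b - a)) * integral {a..b} g) {0..1}"
    using ab by (simp add: algebra_simps)
  then show "integral {a..b} g = (b - a) * integral {0..1} (\<lambda>x. g (b - (b - a) * x))"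
    using ab by (simp add: integral_unique)
qed

text \<open>
  Scaling of \<open>unit_norm_equivalence\<close>; the two weights are exchanged by a reflection. The factor
  \<open>(b - a)\<^sup>2\<close> is one power of the length for the integral and one for the weight.
\<close>

lemma weighted_norm_equivalence:
  "\<exists>C>0. \<forall>(p::real poly) a b w. degree p \<le> d \<longrightarrow> a < b \<longrightarrow> end_weight a b w \<longrightarrow>
     (\<forall>x\<in>{a..b}. (poly p x)\<^sup>2 * (b - a)\<^sup>2 \<le> C * integral {a..b} (\<lambda>t. w t * (poly p t)\<^sup>2))"
proof -
  obtain C where C: "C > 0" and eq: "\<And>(p::real poly) x. degree p \<le> d \<Longrightarrow> x \<in> {0..1} \<Longrightarrow>
      (poly p x)\<^sup>2 \<le> C * integral {0..1} (\<lambda>t. (1 - t) * (poly p t)\<^sup>2)"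
    using unit_norm_equivalence[of d] by blast
  have "(poly p x)\<^sup>2 * (b - a)\<^sup>2 \<le> C * integral {a..b} (\<lambda>t. w t * (poly p t)\<^sup>2)"
    if p: "degree p \<le> d" and ab: "a < b" and w: "end_weight a b w" and x: "x \<in> {a..b}"
    for p :: "real poly" and a b w x
  proof -
    have cont: "continuous_on {a..b} (\<lambda>t. w t * (poly p t)\<^sup>2)"
      by (intro continuous_intros end_weight_continuous[OF w])
    from w consider "w = (\<lambda>t. b - t)" | "w = (\<lambda>t. t - a)" by (auto simp: end_weight_def)
    then show ?thesis
    proof cases
      case 1
      define r where "r = pcompose p [:a, b - a:]"
      have r: "degree r \<le> d" "\<And>y. poly r y = poly p (a + (b - a) * y)"
        using p by (auto simp: r_def poly_pcompose degree_pcompose mult.commute)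
      have "(poly r ((x - a) / (b - a)))\<^sup>2 \<le> C * integral {0..1} (\<lambda>t. (1 - t) * (poly r t)\<^sup>2)"
        using x ab by (intro eq r) (auto simp: field_simps)
      moreover have "integral {a..b} (\<lambda>t. w t * (poly p t)\<^sup>2)
         = (b - a)\<^sup>2 * integral {0..1} (\<lambda>x. (1 - x) * (poly r x)\<^sup>2)" (is "?I = _ * ?J")
      proof -
        have "?I = (b - a) * integral {0..1} (\<lambda>x. (b - a) * ((1 - x) * (poly r x)\<^sup>2))"
          unfolding integral_affine_unit(1)[OF ab cont]
          by (rule arg_cong[where f = "\<lambda>x. (b - a) * x"], rule integral_cong) (simp add: 1 r(2) algebra_simps)
        then show ?thesis by (simp add: power2_eq_square)
      qed
      moreover have "poly r ((x - a) / (b - a)) = poly p x"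
        using ab by (simp add: r(2))
      ultimately show ?thesis
        using mult_right_mono[of "(poly p x)\<^sup>2" "C * integral {0..1} (\<lambda>t. (1 - t) * (poly r t)\<^sup>2)" "(b - a)\<^sup>2"]
        by (simp only: mult.assoc mult.commute zero_le_power2 mult.left_commute)
    next
      case 2
      define r where "r = pcompose p [:b, - (b - a):]"
      have r: "degree r \<le> d" "\<And>y. poly r y = poly p (b - (b - a) * y)"
        using p by (auto simp: r_def poly_pcompose degree_pcompose mult.commute algebra_simps)
      have "(poly r ((b - x) / (b - a)))\<^sup>2 \<le> C * integral {0..1} (\<lambda>t. (1 - t) * (poly r t)\<^sup>2)"
        using x ab by (intro eq r) (auto simp: field_simps)
      moreover have "integral {a..b} (\<lambda>t. w t * (poly p t)\<^sup>2)
         = (b - a)\<^sup>2 * integral {0..1} (\<lambda>x. (1 - x) * (poly r x)\<^sup>2)" (is "?I = _ * ?J")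
      proof -
        have "?I = (b - a) * integral {0..1} (\<lambda>x. (b - a) * ((1 - x) * (poly r x)\<^sup>2))"
          unfolding integral_affine_unit(2)[OF ab cont]
          by (rule arg_cong[where f = "\<lambda>x. (b - a) * x"], rule integral_cong) (simp add: 2 r(2) algebra_simps)
        then show ?thesis by (simp add: power2_eq_square)
      qed
      moreover have "poly r ((b - x) / (b - a)) = poly p x"
        using ab by (simp add: r(2))
      ultimately show ?thesis
        using mult_right_mono[of "(poly p x)\<^sup>2" "C * integral {0..1} (\<lambda>t. (1 - t) * (poly r t)\<^sup>2)" "(b - a)\<^sup>2"]
        by (simp only: mult.assoc mult.commute zero_le_power2 mult.left_commute)
    qed
  qed
  with C show ?thesis by blast
qed

lemma end_weight_positive:
  assumes "a < b" "end_weight a b w" "p \<noteq> 0"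
  shows "integral {a..b} (\<lambda>t. w t * (poly p t)\<^sup>2) > 0"
proof -
  obtain C where C: "C > 0" and eq: "\<forall>x\<in>{a..b}. (poly p x)\<^sup>2 * (b - a)\<^sup>2 \<le> C * integral {a..b} (\<lambda>t. w t * (poly p t)\<^sup>2)"
    using weighted_norm_equivalence[of "degree p"] assms by blast
  have "\<exists>x\<in>{a..b}. poly p x \<noteq> 0"
  proof (rule ccontr)
    assume "\<not> ?thesis"
    then have "{a..b} \<subseteq> {x. poly p x = 0}" by auto
    then have "finite {a..b}" using poly_roots_finite[OF assms(3)] finite_subset by blast
    then show False using assms(1) infinite_Icc by blast
  qed
  then obtain x where "x \<in> {a..b}" "poly p x \<noteq> 0" by blast
  then have "0 < (poly p x)\<^sup>2 * (b - a)\<^sup>2" using assms(1) by simp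
  also have "\<dots> \<le> C * integral {a..b} (\<lambda>t. w t * (poly p t)\<^sup>2)" using eq \<open>x \<in> {a..b}\<close> by blast
  finally show ?thesis using C by (simp add: zero_less_mult_iff)
qed

text \<open>
  The hypothesis says that \<open>p\<close> and \<open>H\<close> have the same weighted inner product with \<open>p\<close>, as is the
  case for the weighted projection \<open>p\<close> of \<open>H\<close>. Such constants are given a name because the
  regularity argument quantifies over many data before it fixes them.
\<close>

definition projection_const :: "nat \<Rightarrow> real \<Rightarrow> bool" where
  "projection_const d C \<longleftrightarrow> 0 < C \<and> (\<forall>(p::real poly) a b w H \<delta>. degree p \<le> d \<longrightarrow> a < b \<longrightarrow> end_weight a b w \<longrightarrow>
     (\<lambda>t. w t * poly p t * H t) integrable_on {a..b} \<longrightarrow> (\<forall>t\<in>{a<..<b}. \<bar>H t\<bar> \<le> \<delta>) \<longrightarrow>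
     integral {a..b} (\<lambda>t. w t * (poly p t)\<^sup>2) = integral {a..b} (\<lambda>t. w t * poly p t * H t) \<longrightarrow>
     (\<forall>x\<in>{a..b}. \<bar>poly p x\<bar> \<le> C * \<delta>))"

text \<open>
  The projection is stable in the maximum norm: its weighted \<open>L\<^sub>2\<close>-norm is controlled by \<open>\<delta>\<close>, and
  on polynomials this norm controls the maximum.
\<close>

lemma weighted_projection_bound:
  "\<exists>C. projection_const d C"
proof -
  obtain C where C: "C > 0" and eq: "\<And>(p::real poly) a b w x. degree p \<le> d \<Longrightarrow> a < b \<Longrightarrow> end_weight a b w \<Longrightarrow>
     x \<in> {a..b} \<Longrightarrow> (poly p x)\<^sup>2 * (b - a)\<^sup>2 \<le> C * integral {a..b} (\<lambda>t. w t * (poly p t)\<^sup>2)"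
    using weighted_norm_equivalence[of d] by blast
  have "\<bar>poly p x\<bar> \<le> C * \<delta>"
    if p: "degree p \<le> d" and ab: "a < b" and w: "end_weight a b w"
      and int: "(\<lambda>t. w t * poly p t * H t) integrable_on {a..b}" and H: "\<forall>t\<in>{a<..<b}. \<bar>H t\<bar> \<le> \<delta>"
      and orth: "integral {a..b} (\<lambda>t. w t * (poly p t)\<^sup>2) = integral {a..b} (\<lambda>t. w t * poly p t * H t)"
      and x: "x \<in> {a..b}" for p :: "real poly" and a b w H \<delta> x
  proof -
    have d0: "0 \<le> \<delta>" using H ab dense[OF ab] by (meson abs_ge_zero greaterThanLessThan_iff order.trans)
    have "\<exists>z\<in>{a..b}. \<forall>y\<in>{a..b}. \<bar>poly p y\<bar> \<le> \<bar>poly p z\<bar>"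
      using ab by (intro continuous_attains_sup continuous_intros) auto
    then obtain z where z: "z \<in> {a..b}" and S: "\<forall>y\<in>{a..b}. \<bar>poly p y\<bar> \<le> \<bar>poly p z\<bar>" by blast
    let ?S = "\<bar>poly p z\<bar>"
    have "integral {a..b} (\<lambda>t. w t * poly p t * H t) = integral {a<..<b} (\<lambda>t. w t * poly p t * H t)"
      by (simp add: integral_open_interval_real)
    also have "\<dots> \<le> integral {a<..<b} (\<lambda>t. (b - a) * ?S * \<delta>)"
    proof (rule integral_le)
      show "(\<lambda>t. w t * poly p t * H t) integrable_on {a<..<b}"
        using int by (simp add: integrable_on_open_interval_real)
      show "(\<lambda>t. (b - a) * ?S * \<delta>) integrable_on {a<..<b}"
        unfolding integrable_on_open_interval_real by (rule integrable_const_ivl)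
      fix t assume t: "t \<in> {a<..<b}"
      have "w t * poly p t * H t \<le> \<bar>w t\<bar> * \<bar>poly p t\<bar> * \<bar>H t\<bar>"
        by (metis abs_ge_self abs_mult)
      also have "\<dots> \<le> (b - a) * ?S * \<delta>"
        using t S H end_weight_bounds[OF w, of t] d0 ab by (intro mult_mono) auto
      finally show "w t * poly p t * H t \<le> (b - a) * ?S * \<delta>" .
    qed
    also have "\<dots> = (b - a)\<^sup>2 * ?S * \<delta>" using ab integral_open_interval_real[of a b "\<lambda>t. (b - a) * ?S * \<delta>"]
      by (simp only: integral_const_real) (auto simp add: power2_eq_square)
    finally have "C * integral {a..b} (\<lambda>t. w t * poly p t * H t) \<le> C * ((b - a)\<^sup>2 * ?S * \<delta>)"
      using C by simp
    then have "?S\<^sup>2 * (b - a)\<^sup>2 \<le> C * ((b - a)\<^sup>2 * ?S * \<delta>)"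
      using eq[OF p ab w z] unfolding orth power2_abs by linarith
    then have "(b - a)\<^sup>2 * (?S * ?S) \<le> (b - a)\<^sup>2 * (?S * (C * \<delta>))" by (simp add: power2_eq_square algebra_simps)
    then have "?S * ?S \<le> ?S * (C * \<delta>)" using ab by simp
    then have "?S \<le> C * \<delta>"
      using C d0 by (cases "?S = 0") (simp, metis abs_ge_zero mult_le_cancel_left_pos order_le_less)
    then show ?thesis using S x by fastforce
  qed
  with C show ?thesis unfolding projection_const_def by blast
qed

text \<open>
  Representation of linear functionals on polynomials of degree less than \<open>n\<close> with respect to a
  weighted inner product. The space is described by vanishing coefficients, so that \<open>n = 0\<close> gives
  the zero space; the induction orthogonalizes the monomials.
\<close>

lemma poly_riesz:
  fixes l :: "real poly \<Rightarrow> real"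
  assumes ab: "a < b" and w: "end_weight a b w"
    and add: "\<And>p r. l (p + r) = l p + l r" and sm: "\<And>c p. l (smult c p) = c * l p"
  shows "\<exists>r. (\<forall>m\<ge>n. coeff r m = 0) \<and>
     (\<forall>v. (\<forall>m\<ge>n. coeff v m = 0) \<longrightarrow> integral {a..b} (\<lambda>t. w t * (poly r t * poly v t)) = l v)"
  using add sm
proof (induction n arbitrary: l)
  case 0
  have "l 0 = 0" using 0(2)[of 0 0] by simp
  have "v = 0" if "\<forall>m\<ge>0. coeff v m = 0" for v :: "real poly" using that by (auto simp: poly_eq_iff)
  then show ?case using \<open>l 0 = 0\<close> by (intro exI[of _ 0]) auto
next
  case (Suc n)
  define B where "B r v = integral {a..b} (\<lambda>t. w t * (poly r t * poly v t))" for r v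
  have int: "(\<lambda>t. w t * (poly r t * poly v t)) integrable_on {a..b}" for r v
    by (intro integrable_continuous_interval continuous_intros end_weight_continuous[OF w])
  have Badd: "B r (p + q) = B r p + B r q" for r p q
    unfolding B_def by (subst integral_add[symmetric, OF int int]) (simp add: algebra_simps)
  have Bcomm: "B r p = B p r" for r p by (simp add: B_def mult.commute)
  have Bsm: "B r (smult c p) = c * B r p" for r p c
    unfolding B_def by (simp add: mult.left_commute)
  obtain r0 where r0: "\<forall>m\<ge>n. coeff r0 m = 0" "\<And>v. \<forall>m\<ge>n. coeff v m = 0 \<Longrightarrow> B r0 v = l v"
    using Suc.IH[of l, OF Suc.prems] by (auto simp: B_def)
  obtain x0 where x0: "\<forall>m\<ge>n. coeff x0 m = 0" "\<And>v. \<forall>m\<ge>n. coeff v m = 0 \<Longrightarrow> B x0 v = B (monom 1 n) v"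
    using Suc.IH[of "B (monom 1 n)", OF Badd Bsm] by (auto simp: B_def)
  (* e is the component of the new monomial orthogonal to the polynomials of degree less than
     n. *)
  define e where "e = monom 1 n - x0"
  have ce: "coeff e m = (if m = n then 1 else 0)" if "m \<ge> n" for m
    using that x0(1) by (simp add: e_def)
  have e0: "e \<noteq> 0" using ce[of n] by auto
  have Be: "B e v = 0" if "\<forall>m\<ge>n. coeff v m = 0" for v
  proof -
    have "B (monom 1 n) v = B (e + x0) v" by (simp add: e_def)
    also have "\<dots> = B e v + B x0 v" by (metis Badd Bcomm)
    finally show ?thesis using x0(2)[OF that] by simp
  qed
  have Bee: "B e e > 0" using end_weight_positive[OF ab w e0] by (simp add: B_def power2_eq_square)
  define r where "r = r0 + smult (l e / B e e) e"
  have "coeff r m = 0" if "m \<ge> Suc n" for m using that r0(1) ce[of m] by (simp add: r_def)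
  moreover have "B r v = l v" if v: "\<forall>m\<ge>Suc n. coeff v m = 0" for v
  proof -
    define v' where "v' = v - smult (coeff v n) e"
    have v': "\<forall>m\<ge>n. coeff v' m = 0" using v ce by (auto simp: v'_def le_Suc_eq)
    have veq: "v = v' + smult (coeff v n) e" by (simp add: v'_def)
    have "B r u = B r0 u + l e / B e e * B e u" for u
      unfolding r_def by (metis Badd Bcomm Bsm)
    moreover have "B r0 e = 0" using Be[OF r0(1)] by (simp add: Bcomm)
    ultimately have 1: "B r e = l e" "B r v' = l v'" using Bee r0(2)[OF v'] Be[OF v'] by auto
    have "B r v = B r v' + coeff v n * B r e" by (subst veq) (simp only: Badd Bsm)
    also have "\<dots> = l v' + coeff v n * l e" by (simp only: 1)
    also have "\<dots> = l (v' + smult (coeff v n) e)" by (simp only: Suc.prems)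
    also have "\<dots> = l v" by (simp only: veq[symmetric])
    finally show ?thesis .
  qed
  ultimately show ?case unfolding B_def by blast
qed

section \<open>The discontinuous Galerkin interpolant\<close>

definition is_dG :: "nat \<Rightarrow> real \<Rightarrow> real \<Rightarrow> (real \<Rightarrow> real) \<Rightarrow> real poly \<Rightarrow> bool" where
  "is_dG q a b v p \<longleftrightarrow> degree p \<le> q \<and> poly p b = v b \<and>
     (\<forall>w. degree w < q \<longrightarrow> integral {a..b} (\<lambda>x. (v x - poly p x) * poly w x) = 0)"

lemma is_dG_diff_poly:
  assumes "is_dG q a b v p" "degree w \<le> q"
  shows "is_dG q a b (\<lambda>x. v x - poly w x) (p - w)"
  using assms by (auto simp: is_dG_def degree_diff_le)

text \<open>
  The factor is stated through vanishing coefficients since for \<open>q = 0\<close> it is the zero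
  polynomial.
\<close>

lemma degree_divide_root:
  fixes p :: "real poly"
  assumes "degree p \<le> q" "poly p b = 0"
  obtains r where "p = [:b, -1:] * r" "\<forall>m\<ge>q. coeff r m = 0"
proof -
  obtain r where r: "p = [:-b, 1:] * r" using assms(2) by (auto simp: poly_eq_0_iff_dvd elim: dvdE)
  have "p = [:b, -1:] * (- r)" using r by (simp add: algebra_simps)
  moreover have "\<forall>m\<ge>q. coeff (- r) m = 0"
  proof (cases "r = 0")
    case False
    then have "degree p = Suc (degree r)" unfolding r by (subst degree_mult_eq) auto
    then show ?thesis using assms(1) by (auto simp: coeff_eq_0)
  qed simp
  ultimately show ?thesis using that by blast
qed

lemma coeff_zero_imp_degree:
  "(\<forall>m\<ge>q. coeff r m = 0) \<Longrightarrow> r \<noteq> 0 \<Longrightarrow> degree r < q"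
  by (metis leading_coeff_0_iff not_le_imp_less)

text \<open>
  Write \<open>p = v(b) + (b - x) r\<close>. Testing the orthogonality with \<open>r\<close> bounds the weighted norm of
  \<open>r\<close>, and \<open>weighted_norm_equivalence\<close> turns this into a bound of \<open>r\<close> itself.
\<close>

lemma dG_stability:
  "\<exists>C\<ge>1. \<forall>a b v p B. a < b \<longrightarrow> continuous_on {a..b} v \<longrightarrow> is_dG q a b v p \<longrightarrow> (\<forall>x\<in>{a..b}. \<bar>v x\<bar> \<le> B) \<longrightarrow>
     (\<forall>x\<in>{a..b}. \<bar>poly p x\<bar> \<le> C * B)"
proof -
  obtain C where C: "C > 0" and eq: "\<And>(p::real poly) a b w x. degree p \<le> q \<Longrightarrow> a < b \<Longrightarrow> end_weight a b w \<Longrightarrow>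
     x \<in> {a..b} \<Longrightarrow> (poly p x)\<^sup>2 * (b - a)\<^sup>2 \<le> C * integral {a..b} (\<lambda>t. w t * (poly p t)\<^sup>2)"
    using weighted_norm_equivalence[of q] by blast
  have "\<bar>poly p x\<bar> \<le> (1 + 2 * C) * B"
    if ab: "a < b" and v: "continuous_on {a..b} v" and dG: "is_dG q a b v p" and B: "\<forall>x\<in>{a..b}. \<bar>v x\<bar> \<le> B"
      and x: "x \<in> {a..b}" for a b v p B x
  proof -
    have B0: "0 \<le> B" using B x by (meson abs_ge_zero order.trans)
    have "degree (p - [:v b:]) \<le> q" "poly (p - [:v b:]) b = 0"
      using dG by (auto simp: is_dG_def intro: degree_diff_le)
    then obtain r where r: "p - [:v b:] = [:b, -1:] * r" and r0: "\<forall>m\<ge>q. coeff r m = 0"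
      by (rule degree_divide_root)
    have pr: "poly p y = v b + (b - y) * poly r y" for y
    proof -
      have "poly p y = poly (p - [:v b:]) y + v b" by simp
      then show ?thesis unfolding r by (simp add: algebra_simps)
    qed
    have main: "(b - a) * \<bar>poly r y\<bar> \<le> 2 * C * B" if y: "y \<in> {a..b}" for y
    proof (cases "r = 0")
      case True then show ?thesis using C B0 by simp
    next
      case False
      have dr: "degree r < q" using coeff_zero_imp_degree[OF r0 False] .
      have int1: "(\<lambda>t. (v t - v b) * poly r t) integrable_on {a..b}"
        by (intro integrable_continuous_interval continuous_intros v)
      have int2: "(\<lambda>t. (b - t) * (poly r t)\<^sup>2) integrable_on {a..b}"
        by (intro integrable_continuous_interval continuous_intros)
      have "0 = integral {a..b} (\<lambda>t. (v t - poly p t) * poly r t)" using dG dr by (simp add: is_dG_def)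
      also have "\<dots> = integral {a..b} (\<lambda>t. (v t - v b) * poly r t - (b - t) * (poly r t)\<^sup>2)"
        by (rule integral_cong) (simp add: pr power2_eq_square algebra_simps)
      also have "\<dots> = integral {a..b} (\<lambda>t. (v t - v b) * poly r t) - integral {a..b} (\<lambda>t. (b - t) * (poly r t)\<^sup>2)"
        by (rule integral_diff[OF int1 int2])
      finally have id: "integral {a..b} (\<lambda>t. (b - t) * (poly r t)\<^sup>2) = integral {a..b} (\<lambda>t. (v t - v b) * poly r t)" by simp
      have "\<exists>z\<in>{a..b}. \<forall>y\<in>{a..b}. \<bar>poly r y\<bar> \<le> \<bar>poly r z\<bar>"
        using ab by (intro continuous_attains_sup continuous_intros) auto
      then obtain z where z: "z \<in> {a..b}" and S: "\<forall>y\<in>{a..b}. \<bar>poly r y\<bar> \<le> \<bar>poly r z\<bar>" by blast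
      let ?S = "\<bar>poly r z\<bar>"
      have "integral {a..b} (\<lambda>t. (v t - v b) * poly r t) \<le> integral {a..b} (\<lambda>t. (2 * B) * ?S)"
      proof (rule integral_le[OF int1])
        fix t assume t: "t \<in> {a..b}"
        have "(v t - v b) * poly r t \<le> \<bar>v t - v b\<bar> * \<bar>poly r t\<bar>" by (metis abs_ge_self abs_mult)
        also have "\<dots> \<le> (2 * B) * ?S"
        proof (intro mult_mono)
          have "\<bar>v t\<bar> \<le> B" "\<bar>v b\<bar> \<le> B" using B t ab by auto
          then show "\<bar>v t - v b\<bar> \<le> 2 * B" by linarith
        qed (use t S B0 in auto)
        finally show "(v t - v b) * poly r t \<le> (2 * B) * ?S" .
      qed auto
      also have "\<dots> = (b - a) * (2 * B * ?S)" using ab by simp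
      finally have "C * integral {a..b} (\<lambda>t. (b - t) * (poly r t)\<^sup>2) \<le> C * ((b - a) * (2 * B * ?S))"
        unfolding id using C by simp
      moreover have "?S\<^sup>2 * (b - a)\<^sup>2 \<le> C * integral {a..b} (\<lambda>t. (b - t) * (poly r t)\<^sup>2)"
        using eq[of r a b "\<lambda>t. b - t" z] dr ab z by (simp add: end_weight_def)
      ultimately have "?S\<^sup>2 * (b - a)\<^sup>2 \<le> C * ((b - a) * (2 * B * ?S))" by linarith
      then have "((b - a) * ?S) * ((b - a) * ?S) \<le> ((b - a) * ?S) * (2 * C * B)"
        by (simp add: power2_eq_square algebra_simps)
      then have "(b - a) * ?S \<le> 2 * C * B"
        using ab C B0 by (cases "?S = 0") (auto simp: mult_le_cancel_left)
      moreover have "(b - a) * \<bar>poly r y\<bar> \<le> (b - a) * ?S" using S y ab by (intro mult_left_mono) auto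
      ultimately show ?thesis by linarith
    qed
    have "\<bar>poly p x\<bar> \<le> \<bar>v b\<bar> + (b - x) * \<bar>poly r x\<bar>"
      unfolding pr using x by (intro order.trans[OF abs_triangle_ineq]) (simp add: abs_mult)
    also have "\<dots> \<le> B + (b - a) * \<bar>poly r x\<bar>"
      using B ab x by (intro add_mono mult_right_mono) auto
    also have "\<dots> \<le> B + 2 * C * B" using main[OF x] by simp
    finally show ?thesis by (simp add: algebra_simps)
  qed
  moreover have "1 + 2 * C \<ge> 1" using C by simp
  ultimately show ?thesis by blast
qed

text \<open>
  With the same splitting \<open>p = v(b) + (b - x) r\<close>, the conditions say that \<open>r\<close> represents a linear
  functional for the weight \<open>b - x\<close>.
\<close>

lemma is_dG_exists:
  assumes ab: "a < b" and v: "continuous_on {a..b} v"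
  shows "\<exists>p. is_dG q a b v p"
proof -
  define l where "l w = integral {a..b} (\<lambda>t. (v t - v b) * poly w t)" for w
  have int: "(\<lambda>t. (v t - v b) * poly w t) integrable_on {a..b}" for w
    by (intro integrable_continuous_interval continuous_intros v)
  have ew: "end_weight a b (\<lambda>t. b - t)" by (simp add: end_weight_def)
  have "l (p + r) = l p + l r" for p r
    unfolding l_def by (subst integral_add[symmetric, OF int int]) (simp add: algebra_simps)
  moreover have "l (smult c p) = c * l p" for c p
    unfolding l_def by (simp add: mult.left_commute)
  ultimately obtain r where r: "\<forall>m\<ge>q. coeff r m = 0"
    "\<And>w. (\<forall>m\<ge>q. coeff w m = 0) \<Longrightarrow> integral {a..b} (\<lambda>t. (b - t) * (poly r t * poly w t)) = l w"
    using poly_riesz[OF ab ew, of l q] by blast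
  define p where "p = [:v b:] + [:b, -1:] * r"
  have "degree p \<le> q"
  proof (cases "r = 0")
    case False
    have "degree ([:b, -1:] * r) = Suc (degree r)" using False by (subst degree_mult_eq) auto
    also have "\<dots> \<le> q" using coeff_zero_imp_degree[OF r(1) False] by simp
    finally show ?thesis unfolding p_def by (intro degree_add_le) auto
  qed (simp add: p_def)
  moreover have "poly p b = v b" by (simp add: p_def)
  moreover have "integral {a..b} (\<lambda>x. (v x - poly p x) * poly w x) = 0" if w: "degree w < q" for w
  proof -
    have int2: "(\<lambda>t. (b - t) * (poly r t * poly w t)) integrable_on {a..b}"
      by (intro integrable_continuous_interval continuous_intros)
    have "integral {a..b} (\<lambda>x. (v x - poly p x) * poly w x)
        = integral {a..b} (\<lambda>t. (v t - v b) * poly w t - (b - t) * (poly r t * poly w t))"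
      by (rule integral_cong) (simp add: p_def algebra_simps)
    also have "\<dots> = 0" using r(2)[of w] w by (subst integral_diff[OF int int2]) (simp add: l_def coeff_eq_0)
    finally show ?thesis .
  qed
  ultimately show ?thesis unfolding is_dG_def by blast
qed

lemma is_dG_unique:
  assumes ab: "a < b" and v: "continuous_on {a..b} v" and p: "is_dG q a b v p" and p': "is_dG q a b v p'"
  shows "p = p'"
proof -
  obtain C where C: "C \<ge> 1" and st: "\<And>a b v p B x. a < b \<Longrightarrow> continuous_on {a..b} v \<Longrightarrow> is_dG q a b v p \<Longrightarrow> (\<forall>x\<in>{a..b}. \<bar>v x\<bar> \<le> B) \<Longrightarrow>
     x \<in> {a..b} \<Longrightarrow> \<bar>poly p x\<bar> \<le> C * B"
    using dG_stability[of q] by blast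
  have int: "(\<lambda>x. (v x - poly p x) * poly w x) integrable_on {a..b}" for w p
    by (intro integrable_continuous_interval continuous_intros v)
  have "is_dG q a b (\<lambda>_. 0) (p - p')"
    unfolding is_dG_def
  proof (intro conjI allI impI)
    fix w :: "real poly" assume w: "degree w < q"
    have "integral {a..b} (\<lambda>x. (0 - poly (p - p') x) * poly w x) =
      integral {a..b} (\<lambda>x. (v x - poly p x) * poly w x - (v x - poly p' x) * poly w x)"
      by (rule integral_cong) (simp add: algebra_simps)
    also have "\<dots> = 0" using p p' w by (subst integral_diff[OF int int]) (simp add: is_dG_def)
    finally show "integral {a..b} (\<lambda>x. (0 - poly (p - p') x) * poly w x) = 0" .
  qed (use p p' in \<open>auto simp: is_dG_def intro: degree_diff_le\<close>)
  then have z: "poly (p - p') x = 0" if "x \<in> {a..b}" for x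
    using st[OF ab _ _ _ that, of "\<lambda>_. 0" "p - p'" 0] by simp
  show ?thesis
  proof (rule ccontr)
    assume "p \<noteq> p'"
    then have "finite {x. poly (p - p') x = 0}" by (intro poly_roots_finite) simp
    moreover have "{a..b} \<subseteq> {x. poly (p - p') x = 0}" using z by auto
    ultimately have "finite {a..b}" using finite_subset by blast
    then show False using ab infinite_Icc by blast
  qed
qed

lemma dG_poly_is_dG:
  assumes "a < b" "continuous_on {a..b} v"
  shows "is_dG q a b v (dG_poly q a b v)"
proof -
  have "\<exists>!p. is_dG q a b v p" using is_dG_exists[OF assms] is_dG_unique[OF assms] by blast
  then have "is_dG q a b v (THE p. is_dG q a b v p)" by (rule theI')
  then show ?thesis unfolding dG_poly_def is_dG_def .
qed

text \<open>
  The interpolation reproduces polynomials of degree at most \<open>q\<close>; apply \<open>dG_stability\<close> to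
  \<open>v - w\<close>.
\<close>

lemma dG_best_approximation:
  "\<exists>C\<ge>1. \<forall>a b v p w B. a < b \<longrightarrow> continuous_on {a..b} v \<longrightarrow> is_dG q a b v p \<longrightarrow> degree w \<le> q \<longrightarrow>
     (\<forall>x\<in>{a<..<b}. \<bar>v x - poly w x\<bar> \<le> B) \<longrightarrow> (\<forall>x\<in>{a..b}. \<bar>poly p x - poly w x\<bar> \<le> C * B)"
proof -
  obtain C where C: "C \<ge> 1" and st: "\<And>a b v p B x. a < b \<Longrightarrow> continuous_on {a..b} v \<Longrightarrow> is_dG q a b v p \<Longrightarrow> (\<forall>x\<in>{a..b}. \<bar>v x\<bar> \<le> B) \<Longrightarrow>
     x \<in> {a..b} \<Longrightarrow> \<bar>poly p x\<bar> \<le> C * B"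
    using dG_stability[of q] by blast
  have "\<bar>poly p x - poly w x\<bar> \<le> C * B"
    if ab: "a < b" and v: "continuous_on {a..b} v" and p: "is_dG q a b v p" and w: "degree w \<le> q"
     and B: "\<forall>x\<in>{a<..<b}. \<bar>v x - poly w x\<bar> \<le> B" and x: "x \<in> {a..b}" for a b v p w B x
  proof -
    have cont: "continuous_on {a..b} (\<lambda>x. v x - poly w x)" by (intro continuous_intros v)
    have "\<bar>v y - poly w y\<bar> \<le> B" if "y \<in> {a..b}" for y
    proof (rule continuous_ge_on_closure[of "{a<..<b}" "\<lambda>x. B - \<bar>v x - poly w x\<bar>" y 0, simplified])
      show "continuous_on (closure {a<..<b}) (\<lambda>x. B - \<bar>v x - poly w x\<bar>)"
        using ab cont by (intro continuous_intros v) (auto intro: v)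
    qed (use that ab B in auto)
    then show ?thesis using st[OF ab cont is_dG_diff_poly[OF p w], of B x] x by auto
  qed
  with C show ?thesis by blast
qed

section \<open>Differential calculus in coordinates\<close>

text \<open>
  Only the first \<open>N\<close> coordinates of a point belong to \<open>\<real>\<^sup>N\<close>.
\<close>

definition dep :: "nat \<Rightarrow> (rvec \<Rightarrow> real) \<Rightarrow> bool" where
  "dep N v \<longleftrightarrow> (\<forall>x y. (\<forall>i<N. x i = y i) \<longrightarrow> v x = v y)"

lemma depD: "dep N v \<Longrightarrow> (\<And>i. i < N \<Longrightarrow> x i = y i) \<Longrightarrow> v x = v y"
  by (auto simp: dep_def)

lemma dep_pd:
  assumes "dep N v" "j < N"
  shows "dep N (pd j v)"
  unfolding dep_def
proof (intro allI impI)
  fix x y :: rvec assume xy: "\<forall>i<N. x i = y i"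
  have "v (x(j := h)) = v (y(j := h))" for h
    by (rule depD[OF assms(1)]) (use xy in auto)
  then show "pd j v x = pd j v y" using xy assms(2) by (simp add: pd_def)
qed

lemma pds_Cons: "pds (j # js) v = pd j (pds js v)" by (simp add: pds_def)
lemma pds_Nil: "pds [] v = v" by (simp add: pds_def)
lemma pds_append: "pds (js @ ks) v = pds js (pds ks v)" by (simp add: pds_def)

lemma dep_pds: "dep N v \<Longrightarrow> set js \<subseteq> {..<N} \<Longrightarrow> dep N (pds js v)"
  by (induction js) (auto simp: pds_Cons pds_Nil intro: dep_pd)

lemma Ck_pds:
  assumes "Ck N m v" "set ks \<subseteq> {..<N}" "length ks + n \<le> m"
  shows "Ck N n (pds ks v)"
proof -
  have D: "\<And>js j x. set js \<subseteq> {..<N} \<Longrightarrow> length js < m \<Longrightarrow> j < N \<Longrightarrow>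
      (\<lambda>h. pds js v (x(j := h))) differentiable (at (x j))"
    and C: "\<And>js. set js \<subseteq> {..<N} \<Longrightarrow> length js \<le> m \<Longrightarrow> continuous_on UNIV (pds js v)"
    using assms(1) unfolding Ck_def by auto
  show ?thesis
    unfolding Ck_def pds_append[symmetric]
    by (intro conjI allI impI D C) (use assms in auto)
qed

lemma Ck_mono: "Ck N m v \<Longrightarrow> n \<le> m \<Longrightarrow> Ck N n v"
  using Ck_pds[of N m v "[]" n] by (simp add: pds_Nil)

lemma Ck_continuous: "Ck N m v \<Longrightarrow> continuous_on UNIV v"
  unfolding Ck_def by (metis empty_subsetI le0 list.set(1) list.size(3) pds_Nil)

lemma Ck_pd:
  assumes "Ck N (Suc n) v" "j < N"
  shows "Ck N n (pd j v)"
  using Ck_pds[of N "Suc n" v "[j]" n] assms by (simp add: pds_Cons pds_Nil)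

lemma pd_has_derivative:
  assumes "Ck N 1 v" "j < N"
  shows "((\<lambda>h. v (x(j := h))) has_real_derivative pd j v x) (at (x j))"
proof -
  have "(\<lambda>h. pds [] v (x(j := h))) differentiable (at (x j))"
    using assms unfolding Ck_def by (auto simp del: fun_upd_apply)
  then show ?thesis unfolding pds_Nil pd_def by (simp add: DERIV_deriv_iff_real_differentiable)
qed

text \<open>
  Continuity of the partial derivatives suffices for the chain rule along a line: the coordinates
  are set in motion one after the other, and only the partial derivative in the newest one needs
  to be jointly continuous.
\<close>

lemma chain_rule_line_aux:
  assumes v: "Ck N 1 v" and m: "m \<le> N"
  shows "((\<lambda>s. v (\<lambda>i. x i + (if i < m then s * d i else 0))) has_real_derivative
          (\<Sum>j<m. pd j v (\<lambda>i. x i + (if i < m then s * d i else 0)) * d j)) (at s)"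
  using m
proof (induction m arbitrary: x)
  case 0
  then show ?case by simp
next
  case (Suc m)
  define z where "z a b = (\<lambda>i. x i + (if i < m then a * d i else 0) + (if i = m then b * d i else 0))" for a b
  have IH: "((\<lambda>a. v (z a b)) has_real_derivative (\<Sum>j<m. pd j v (z s b) * d j)) (at s)" for b
    using Suc.IH[of "\<lambda>i. x i + (if i = m then b * d i else 0)"] Suc.prems
    by (simp add: z_def algebra_simps)
  have D2: "((\<lambda>b. v (z a b)) has_real_derivative pd m v (z a b) * d m) (at b)" for a b
  proof -
    have eq: "v (z a b) = v ((z a b')(m := x m + b * d m))" for b b'
      by (rule arg_cong[where f = v]) (auto simp: z_def)
    have "((\<lambda>h. v ((z a b)(m := h))) has_real_derivative pd m v (z a b)) (at (x m + b * d m))"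
      using pd_has_derivative[OF v, of m "z a b"] Suc.prems by (simp add: z_def)
    moreover have "((\<lambda>b. x m + b * d m) has_real_derivative d m) (at b)"
      by (auto intro!: derivative_eq_intros)
    ultimately have "((\<lambda>y. v ((z a b)(m := x m + y * d m))) has_real_derivative pd m v (z a b) * d m) (at b)"
      by (rule DERIV_chain2)
    then show ?thesis using eq[of _ b] by simp
  qed
  have cont: "continuous_on UNIV (\<lambda>(a, b). pd m v (z a b) * d m)"
  proof -
    have "continuous_on UNIV (pd m v)"
      using Ck_continuous[OF Ck_pd[of N 0 v m]] v Suc.prems by simp
    moreover have "continuous_on UNIV (\<lambda>p. z (fst p) (snd p))"
    proof (rule continuous_on_coordinatewise_then_product)
      fix i show "continuous_on UNIV (\<lambda>p. z (fst p) (snd p) i)"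
        by (cases "i < m"; cases "i = m") (auto simp: z_def intro!: continuous_intros)
    qed
    ultimately have "continuous_on UNIV (\<lambda>p. pd m v (z (fst p) (snd p)))"
      by (rule continuous_on_compose2) auto
    then show ?thesis by (auto simp: case_prod_beta intro!: continuous_intros)
  qed
  have "((\<lambda>(a, b). v (z a b)) has_derivative
      (\<lambda>(ta, tb). (\<Sum>j<m. pd j v (z s s) * d j) * ta + blinfun_apply (blinfun_mult_right (pd m v (z s s) * d m)) tb)) (at (s, s) within UNIV \<times> UNIV)"
  proof (rule has_derivative_partialsI[where fy = "\<lambda>a b. blinfun_mult_right (pd m v (z a b) * d m)"
        and fx = "(*) (\<Sum>j<m. pd j v (z s s) * d j)"])
    show "((\<lambda>a. v (z a s)) has_derivative (*) (\<Sum>j<m. pd j v (z s s) * d j)) (at s within UNIV)"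
      using IH[of s] by (simp add: has_field_derivative_def)
    show "((\<lambda>b. v (z a b)) has_derivative blinfun_apply (blinfun_mult_right (pd m v (z a b) * d m))) (at b within UNIV)" for a b
      using D2[of a b] by (simp add: has_field_derivative_def blinfun_mult_right.rep_eq)
    have "continuous_on UNIV (\<lambda>p. blinfun_mult_right (case p of (a, b) \<Rightarrow> pd m v (z a b) * d m))"
      by (rule bounded_linear.continuous_on[OF bounded_linear_blinfun_mult_right cont])
    then show "continuous (at (s, s) within UNIV \<times> UNIV) (\<lambda>(a, b). blinfun_mult_right (pd m v (z a b) * d m))"
      by (simp add: continuous_on_eq_continuous_within case_prod_beta')
  qed auto
  then have D: "((\<lambda>p. v (z (fst p) (snd p))) has_derivative
      (\<lambda>p. (\<Sum>j<m. pd j v (z s s) * d j) * fst p + pd m v (z s s) * d m * snd p)) (at (s, s))"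
    by (simp add: case_prod_beta' blinfun_mult_right.rep_eq)
  have "((\<lambda>s. (s, s)) has_derivative (\<lambda>h. (h, h))) (at s)"
    by (auto intro!: derivative_eq_intros)
  from has_derivative_compose[OF this D] have "((\<lambda>s. v (z s s)) has_derivative
      (\<lambda>h. (\<Sum>j<m. pd j v (z s s) * d j) * h + pd m v (z s s) * d m * h)) (at s)"
    by simp
  then have "((\<lambda>s. v (z s s)) has_real_derivative (\<Sum>j<Suc m. pd j v (z s s) * d j)) (at s)"
    unfolding has_field_derivative_def by (rule has_derivative_eq_rhs) (auto simp: algebra_simps fun_eq_iff)
  moreover have "z s s = (\<lambda>i. x i + (if i < Suc m then s * d i else 0))" for s
    by (auto simp: z_def)
  ultimately show ?case by simp
qed

lemma chain_rule_line:
  assumes v: "Ck N 1 v" and dp: "dep N v"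
  shows "((\<lambda>s. v (\<lambda>i. x i + s * d i)) has_real_derivative
          (\<Sum>j<N. pd j v (\<lambda>i. x i + s * d i) * d j)) (at s)"
proof -
  have 1: "v (\<lambda>i. x i + (if i < N then s * d i else 0)) = v (\<lambda>i. x i + s * d i)" for s
    by (rule depD[OF dp]) auto
  have 2: "pd j v (\<lambda>i. x i + (if i < N then s * d i else 0)) = pd j v (\<lambda>i. x i + s * d i)" if "j < N" for j
    by (rule depD[OF dep_pd[OF dp that]]) auto
  show ?thesis using chain_rule_line_aux[OF v order.refl, of x d s] by (simp add: 1 2)
qed

lemma finite_indices: "finite {js. set js \<subseteq> {..<N::nat} \<and> length js = n}"
  by (rule finite_lists_length_eq) simp

lemma Dn_0: "Dn N 0 v w x = v x"
proof -
  have "{js. set js \<subseteq> {..<N} \<and> length js = 0} = {[]}" by auto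
  then show ?thesis by (simp add: Dn_def pds_Nil)
qed

text \<open>
  Splits the first direction off the multilinear form \<open>D\<^sup>n\<^sup>+\<^sup>1v\<close>, so that derivatives along lines
  can be taken one at a time.
\<close>

lemma Dn_Suc:
  "Dn N (Suc n) v w x = (\<Sum>js | set js \<subseteq> {..<N} \<and> length js = n.
     (\<Sum>j<N. pd j (pds js v) x * w 0 j) * (\<Prod>k<n. w (Suc k) (js ! k)))"
proof -
  have eq: "{js. set js \<subseteq> {..<N} \<and> length js = Suc n}
      = (\<lambda>(js, j). j # js) ` ({js. set js \<subseteq> {..<N} \<and> length js = n} \<times> {..<N})" (is "_ = _ ` ?A")
    by (auto simp: image_iff length_Suc_conv)
  have inj: "inj_on (\<lambda>(js, j). j # js) ?A" by (auto simp: inj_on_def)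
  have "Dn N (Suc n) v w x = (\<Sum>(js, j)\<in>?A. pds (j # js) v x * (\<Prod>k<Suc n. w k ((j # js) ! k)))"
    unfolding Dn_def eq by (subst sum.reindex[OF inj]) (simp add: case_prod_beta)
  also have "\<dots> = (\<Sum>js | set js \<subseteq> {..<N} \<and> length js = n. \<Sum>j<N. pds (j # js) v x * (\<Prod>k<Suc n. w k ((j # js) ! k)))"
    by (subst sum.cartesian_product) simp
  also have "\<dots> = (\<Sum>js | set js \<subseteq> {..<N} \<and> length js = n.
     (\<Sum>j<N. pd j (pds js v) x * w 0 j) * (\<Prod>k<n. w (Suc k) (js ! k)))"
    by (intro sum.cong refl) (simp only: prod.lessThan_Suc_shift pds_Cons sum_distrib_right, simp add: mult.assoc)
  finally show ?thesis .
qed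

lemma Dn_line_derivative:
  assumes v: "Ck N m v" and dp: "dep N v" and n: "n < m"
  shows "((\<lambda>s. Dn N n v (\<lambda>_. d) (\<lambda>i. x i + s * d i)) has_real_derivative
          Dn N (Suc n) v (\<lambda>_. d) (\<lambda>i. x i + s * d i)) (at s)"
  unfolding Dn_Suc unfolding Dn_def
proof (intro DERIV_sum DERIV_cmult_right)
  fix js assume js: "js \<in> {js. set js \<subseteq> {..<N} \<and> length js = n}"
  show "((\<lambda>s. pds js v (\<lambda>i. x i + s * d i)) has_real_derivative
         (\<Sum>j<N. pd j (pds js v) (\<lambda>i. x i + s * d i) * d j)) (at s)"
    by (rule chain_rule_line) (use js n v dp in \<open>auto intro: Ck_pds dep_pds\<close>)
qed

lemma deriv_iterate_line:
  assumes v: "Ck N m v" and dp: "dep N v" and n: "n \<le> m"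
  shows "(deriv ^^ n) (\<lambda>s. v (\<lambda>i. x i + s * d i)) = (\<lambda>s. Dn N n v (\<lambda>_. d) (\<lambda>i. x i + s * d i))"
  using n
proof (induction n)
  case 0
  then show ?case by (simp add: Dn_0)
next
  case (Suc n)
  then show ?case
    using Dn_line_derivative[OF v dp, of n d x] by (auto intro!: ext DERIV_imp_deriv)
qed

text \<open>
  Taylor's formula is applied to a linear combination of functions rather than to each function:
  the bounds on \<open>J\<^sup>T\<close> below concern combinations of the partial derivatives of all components, and
  adding bounds of single terms would bring in the factor \<open>N\<close>.
\<close>

lemma taylor_line:
  fixes b :: "nat \<Rightarrow> real"
  assumes v: "\<And>j. j < J \<Longrightarrow> Ck N m (v j)" and dp: "\<And>j. j < J \<Longrightarrow> dep N (v j)" and n: "n \<le> m"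
  shows "\<exists>s\<in>{0..1}. (\<Sum>j<J. b j * v j (\<lambda>i. x i + d i)) =
      (\<Sum>k<n. (\<Sum>j<J. b j * Dn N k (v j) (\<lambda>_. d) x) / fact k)
      + (\<Sum>j<J. b j * Dn N n (v j) (\<lambda>_. d) (\<lambda>i. x i + s * d i)) / fact n"
proof (cases "n = 0")
  case True
  then show ?thesis by (intro bexI[of _ 1]) (auto simp: Dn_0)
next
  case False
  define D where "D k s = (\<Sum>j<J. b j * Dn N k (v j) (\<lambda>_. d) (\<lambda>i. x i + s * d i))" for k s
  have "\<exists>s>0. s < 1 \<and> D 0 1 = (\<Sum>k<n. D k 0 / fact k * 1 ^ k) + D n s / fact n * 1 ^ n"
  proof (rule Maclaurin)
    show "\<forall>k s. k < n \<and> 0 \<le> s \<and> s \<le> 1 \<longrightarrow> (D k has_real_derivative D (Suc k) s) (at s)"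
      unfolding D_def using v dp n by (auto intro!: DERIV_sum DERIV_cmult Dn_line_derivative)
  qed (use False in auto)
  then obtain s where "0 < s" "s < 1" "D 0 1 = (\<Sum>k<n. D k 0 / fact k) + D n s / fact n" by auto
  then show ?thesis by (intro bexI[of _ s]) (auto simp: D_def Dn_0)
qed

text \<open>
  This is the identity \<open>J(x, y) (x - y) = f(x) - f(y)\<close> for one component.
\<close>

lemma mean_value_line_integral:
  assumes v: "Ck N 1 v" and dp: "dep N v"
  shows "(\<Sum>j<N. integral {0..1} (\<lambda>s. pd j v (\<lambda>l. s * x l + (1 - s) * y l)) * (x j - y j)) = v x - v y"
proof -
  have l: "(\<lambda>l. s * x l + (1 - s) * y l) = (\<lambda>l. y l + s * (x l - y l))" for s
    by (simp add: algebra_simps)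
  have "((\<lambda>s. \<Sum>j<N. pd j v (\<lambda>l. y l + s * (x l - y l)) * (x j - y j)) has_integral
      (v (\<lambda>l. y l + 1 * (x l - y l)) - v (\<lambda>l. y l + 0 * (x l - y l)))) {0..1}"
    by (rule fundamental_theorem_of_calculus)
       (auto simp: has_real_derivative_iff_has_vector_derivative[symmetric]
             intro!: has_field_derivative_at_within chain_rule_line[OF v dp])
  moreover have "(\<lambda>s. pd j v (\<lambda>l. y l + s * (x l - y l))) integrable_on {0..1}" if "j < N" for j
  proof -
    have "continuous_on UNIV (pd j v)" using Ck_continuous[OF Ck_pd[of N 0 v j]] v that by simp
    then have "continuous_on {0..1} (\<lambda>s. pd j v (\<lambda>l. y l + s * (x l - y l)))"
      by (rule continuous_on_compose2) (auto intro!: continuous_on_coordinatewise_then_product continuous_intros)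
    then show ?thesis by (rule integrable_continuous_interval)
  qed
  ultimately have "(\<Sum>j<N. integral {0..1} (\<lambda>s. pd j v (\<lambda>l. y l + s * (x l - y l)) * (x j - y j))) = v x - v y"
    by (subst integral_sum[symmetric]) (auto simp: integral_unique intro!: integrable_on_mult_left)
  then show ?thesis unfolding l by simp
qed

section \<open>Measurability of the right-hand side and of its derivative\<close>

text \<open>
  A function that is measurable in time and continuous in space may be evaluated along a
  measurable curve. The coordinates are inserted one by one, each as a limit of countably-valued
  roundings.
\<close>

lemma caratheodory_measurable:
  fixes h :: "rvec \<Rightarrow> 'm \<Rightarrow> real"
  assumes cont: "\<And>t. t \<in> space M \<Longrightarrow> continuous_on UNIV (\<lambda>x. h x t)"
    and dp: "\<And>t. t \<in> space M \<Longrightarrow> dep N (\<lambda>x. h x t)"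
    and meas: "\<And>x. h x \<in> borel_measurable M"
    and y: "\<And>i. i < N \<Longrightarrow> (\<lambda>t. y t i) \<in> borel_measurable M"
  shows "(\<lambda>t. h (y t) t) \<in> borel_measurable M"
proof -
  have "(\<lambda>t. h (\<lambda>i. if i < m then y t i else z i) t) \<in> borel_measurable M" if "m \<le> N" for m z
    using that
  proof (induction m arbitrary: z)
    case 0
    then show ?case using meas by simp
  next
    case (Suc m)
    define w where "w s t = (\<lambda>i. if i < m then y t i else (z(m := s)) i)" for s t
    define c where "c n t = real_of_int \<lfloor>real (Suc n) * y t m\<rfloor> / real (Suc n)" for n t
    have ym[measurable]: "(\<lambda>t. y t m) \<in> borel_measurable M" using y Suc.prems by simp
    have wm: "(\<lambda>t. h (w s t) t) \<in> borel_measurable M" for s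
      using Suc.IH[of "z(m := s)"] Suc.prems by (simp add: w_def)
    have "(\<lambda>t. h (w (c n t) t) t) \<in> borel_measurable M" for n
    proof -
      have "(\<lambda>t. (\<lambda>k t. h (w (real_of_int k / real (Suc n)) t) t) \<lfloor>real (Suc n) * y t m\<rfloor> t) \<in> borel_measurable M"
        by (rule measurable_compose_countable[OF wm]) measurable
      then show ?thesis by (simp add: c_def)
    qed
    moreover have "(\<lambda>n. h (w (c n t) t) t) \<longlonglongrightarrow> h (w (y t m) t) t" if t: "t \<in> space M" for t
    proof -
      have lim: "(\<lambda>n. c n t) \<longlonglongrightarrow> y t m"
      proof (rule tendsto_sandwich[where f = "\<lambda>n. y t m - 1 / real (Suc n)" and h = "\<lambda>n. y t m"])
        have "y t m - 1 / real (Suc n) \<le> c n t \<and> c n t \<le> y t m" for n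
        proof -
          have "real (Suc n) * y t m - 1 \<le> real_of_int \<lfloor>real (Suc n) * y t m\<rfloor>" by linarith
          moreover have "real_of_int \<lfloor>real (Suc n) * y t m\<rfloor> \<le> real (Suc n) * y t m" by linarith
          ultimately have "(real (Suc n) * y t m - 1) / real (Suc n) \<le> c n t \<and> c n t \<le> real (Suc n) * y t m / real (Suc n)"
            unfolding c_def by (intro conjI divide_right_mono) auto
          then show ?thesis by (simp add: diff_divide_distrib del: of_nat_Suc)
        qed
        then show "\<forall>\<^sub>F n in sequentially. y t m - 1 / real (Suc n) \<le> c n t" "\<forall>\<^sub>F n in sequentially. c n t \<le> y t m" by auto
        show "(\<lambda>n. y t m - 1 / real (Suc n)) \<longlonglongrightarrow> y t m"
          using tendsto_diff[OF tendsto_const LIMSEQ_Suc[OF lim_1_over_n], of "y t m"] by simp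
      qed simp
      have "continuous_on UNIV (\<lambda>s. h (w s t) t)"
      proof (rule continuous_on_compose2[OF cont[OF t]])
        show "continuous_on UNIV (\<lambda>s. w s t)"
        proof (rule continuous_on_coordinatewise_then_product)
          fix i show "continuous_on UNIV (\<lambda>s. w s t i)"
            by (cases "i < m"; cases "i = m") (auto simp: w_def intro!: continuous_intros)
        qed
      qed simp
      then show ?thesis using lim by (auto simp: continuous_on_eq_continuous_at isCont_def intro: tendsto_compose filterlim_compose isCont_tendsto_compose)
    qed
    ultimately have "(\<lambda>t. h (w (y t m) t) t) \<in> borel_measurable M"
      by (rule borel_measurable_LIMSEQ_real[rotated])
    moreover have "w (y t m) t = (\<lambda>i. if i < Suc m then y t i else z i)" for t
      by (auto simp: w_def fun_eq_iff less_Suc_eq)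
    ultimately show ?case by simp
  qed
  from this[OF order.refl, of "\<lambda>_. 0"] show ?thesis
  proof (rule subst[OF measurable_cong, rotated -1])
    fix t assume "t \<in> space M"
    show "h (\<lambda>i. if i < N then y t i else 0) t = h (y t) t"
      by (rule depD[OF dp[OF \<open>t \<in> space M\<close>]]) auto
  qed
qed

text \<open>
  The partial derivative is a pointwise limit of difference quotients.
\<close>

lemma pd_measurable:
  assumes F: "\<And>x. F x \<in> borel_measurable M" and C: "\<And>t. t \<in> space M \<Longrightarrow> Ck N 1 (\<lambda>x. F x t)" and j: "j < N"
  shows "(\<lambda>t. pd j (\<lambda>z. F z t) x) \<in> borel_measurable M"
proof (rule borel_measurable_LIMSEQ_real)
  show "(\<lambda>t. real (Suc n) * (F (x(j := x j + 1 / real (Suc n))) t - F x t)) \<in> borel_measurable M" for n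
    using F by measurable
  fix t assume t: "t \<in> space M"
  have "((\<lambda>h. (F (x(j := x j + h)) t - F (x(j := x j)) t) / h) \<longlongrightarrow> pd j (\<lambda>z. F z t) x) (at 0)"
    using pd_has_derivative[OF C[OF t] j, of x] by (simp add: DERIV_def)
  moreover have "filterlim (\<lambda>n. 1 / real (Suc n)) (at 0) sequentially"
    by (simp add: filterlim_at LIMSEQ_Suc[OF lim_1_over_n] del: of_nat_Suc)
  ultimately have "((\<lambda>n. (F (x(j := x j + 1 / real (Suc n))) t - F (x(j := x j)) t) / (1 / real (Suc n))) \<longlongrightarrow> pd j (\<lambda>z. F z t) x) sequentially"
    by (rule filterlim_compose)
  then show "(\<lambda>n. real (Suc n) * (F (x(j := x j + 1 / real (Suc n))) t - F x t)) \<longlonglongrightarrow> pd j (\<lambda>z. F z t) x"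
    by (simp add: mult.commute del: of_nat_Suc)
qed

text \<open>
  The integrand is jointly measurable in time and the segment parameter by
  \<open>caratheodory_measurable\<close>, and the parameter is integrated out.
\<close>

lemma averaged_pd_measurable:
  fixes F :: "rvec \<Rightarrow> real \<Rightarrow> real"
  assumes F: "\<And>x. F x \<in> borel_measurable borel" and C: "\<And>t. Ck N 1 (\<lambda>x. F x t)" and j: "j < N"
    and dp: "\<And>t. dep N (\<lambda>x. F x t)"
    and X: "\<And>i. i < N \<Longrightarrow> (\<lambda>t. X t i) \<in> borel_measurable borel"
    and Y: "\<And>i. i < N \<Longrightarrow> (\<lambda>t. Y t i) \<in> borel_measurable borel"
  shows "(\<lambda>t. integral {0..1} (\<lambda>s. pd j (\<lambda>z. F z t) (\<lambda>l. s * X t l + (1 - s) * Y t l))) \<in> borel_measurable borel"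
proof -
  define G where "G t s = pd j (\<lambda>z. F z t) (\<lambda>l. s * X t l + (1 - s) * Y t l)" for t s
  have contG: "continuous_on UNIV (pd j (\<lambda>z. F z t))" for t
    using Ck_continuous[OF Ck_pd[of N 0]] C j by simp
  have [measurable]: "(\<lambda>p. G (fst p) (snd p)) \<in> borel_measurable (borel \<Otimes>\<^sub>M lborel)"
    unfolding G_def
  proof (rule caratheodory_measurable[where N = N and h = "\<lambda>x p. pd j (\<lambda>z. F z (fst p)) x"
        and y = "\<lambda>p l. snd p * X (fst p) l + (1 - snd p) * Y (fst p) l"])
    show "continuous_on UNIV (\<lambda>x. pd j (\<lambda>z. F z (fst p)) x)" for p :: "real \<times> real" using contG .
    show "dep N (\<lambda>x. pd j (\<lambda>z. F z (fst p)) x)" for p :: "real \<times> real" using dep_pd[OF dp j] .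
    show "(\<lambda>p. pd j (\<lambda>z. F z (fst p)) x) \<in> borel_measurable (borel \<Otimes>\<^sub>M lborel)" for x
      by (rule measurable_compose[OF measurable_fst pd_measurable[OF F C j]])
    show "(\<lambda>p. snd p * X (fst p) i + (1 - snd p) * Y (fst p) i) \<in> borel_measurable (borel \<Otimes>\<^sub>M lborel)" if "i < N" for i
      using X[OF that] Y[OF that] by measurable
  qed
  have "(\<lambda>t. \<integral>s. indicator {0..1} s *\<^sub>R G t s \<partial>lborel) \<in> borel_measurable borel"
    by (rule lborel.borel_measurable_lebesgue_integral) (simp add: case_prod_beta)
  moreover have "(\<integral>s. indicator {0..1} s *\<^sub>R G t s \<partial>lborel) = integral {0..1} (G t)" for t
  proof -
    have "continuous_on {0..1} (G t)"
      unfolding G_def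
      by (rule continuous_on_compose2[OF contG]) (auto intro!: continuous_on_coordinatewise_then_product continuous_intros)
    then have "set_integrable lborel {0..1} (G t)" by (rule borel_integrable_atLeastAtMost')
    then show ?thesis using set_borel_integral_eq_integral(2)[of "{0..1}" "G t"] by (simp add: set_lebesgue_integral_def)
  qed
  ultimately show ?thesis by (simp only: G_def[abs_def] mult.commute)
qed

text \<open>
  The data are prescribed on \<open>{0<..T}\<close> only; multiplication by the indicator removes the
  arbitrary values outside.
\<close>

definition mble :: "real \<Rightarrow> (real \<Rightarrow> real) \<Rightarrow> bool" where
  "mble T g \<longleftrightarrow> (\<lambda>t. indicator {0<..T} t * g t) \<in> borel_measurable borel"

lemma mble_mult: "mble T g \<Longrightarrow> mble T h \<Longrightarrow> mble T (\<lambda>t. g t * h t)"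
proof -
  assume "mble T g" "mble T h"
  then have "(\<lambda>t. (indicator {0<..T} t * g t) * (indicator {0<..T} t * h t)) \<in> borel_measurable borel"
    unfolding mble_def by measurable
  moreover have "(\<lambda>t. (indicator {0<..T} t * g t) * (indicator {0<..T} t * h t)) = (\<lambda>t. indicator {0<..T} t * (g t * h t))"
    by (auto simp: indicator_def)
  ultimately show ?thesis unfolding mble_def by simp
qed

lemma mble_diff: "mble T g \<Longrightarrow> mble T h \<Longrightarrow> mble T (\<lambda>t. g t - h t)"
  unfolding mble_def by (simp add: right_diff_distrib)

lemma mble_sum: "(\<And>i. i \<in> A \<Longrightarrow> mble T (g i)) \<Longrightarrow> mble T (\<lambda>t. \<Sum>i\<in>A. g i t)"
  unfolding mble_def by (simp add: sum_distrib_left)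

lemma mble_borel: "g \<in> borel_measurable borel \<Longrightarrow> mble T g"
  unfolding mble_def by measurable

lemma mble_continuous: "continuous_on UNIV g \<Longrightarrow> mble T g"
  by (intro mble_borel borel_measurable_continuous_onI)

lemma mble_sqrt: "mble T g \<Longrightarrow> mble T (\<lambda>t. sqrt (g t))"
proof -
  assume "mble T g"
  then have "(\<lambda>t. sqrt (indicator {0<..T} t * g t)) \<in> borel_measurable borel"
    unfolding mble_def by measurable
  moreover have "(\<lambda>t. sqrt (indicator {0<..T} t * g t)) = (\<lambda>t. indicator {0<..T} t * sqrt (g t))"
    by (auto simp: indicator_def)
  ultimately show ?thesis unfolding mble_def by simp
qed

lemma mble_bounded_integrable:
  assumes "mble T g" "\<And>t. t \<in> {0<..T} \<Longrightarrow> \<bar>g t\<bar> \<le> B"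
  shows "g absolutely_integrable_on {0<..T}"
proof -
  let ?h = "\<lambda>t. indicator {0<..T} t * g t"
  have h: "?h \<in> borel_measurable borel" using assms(1) by (simp add: mble_def)
  have "integrable lborel (\<lambda>t. indicator {0<..T} t *\<^sub>R B)"
    using set_integrable_subset[OF borel_integrable_atLeastAtMost'[of 0 T "\<lambda>_. B"], of "{0<..T}"]
    by (simp add: set_integrable_def subset_eq)
  then have "integrable lborel ?h"
    by (rule Bochner_Integration.integrable_bound) (use h assms(2) in \<open>force simp: indicator_def intro!: AE_I2\<close>)+
  then have "set_integrable lborel {0<..T} g" by (simp add: set_integrable_def)
  then show ?thesis by (simp add: set_integrable_def integrable_completion)
qed

section \<open>Grids and cellwise equations\<close>

lemma integral_Ioc: "integral {a<..b} (g :: real \<Rightarrow> real) = integral {a..b} g"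
  by (rule integral_spike_set; rule negligible_subset[of "{a}"]) auto

lemma integrable_Ioc: "(g :: real \<Rightarrow> real) integrable_on {a<..b} \<longleftrightarrow> g integrable_on {a..b}"
  by (rule integrable_spike_set_eq; rule negligible_subset[of "{a}"]) auto

lemma index_at_eq:
  assumes s: "strict_mono_on {..m} s" and j: "j \<in> {1..m}" and t: "t \<in> {s (j - 1)<..s j}"
  shows "index_at s t = j"
  unfolding index_at_def
proof (rule Least_equality)
  show "t \<le> s j" using t by simp
  fix l assume l: "t \<le> s l"
  show "j \<le> l"
  proof (rule ccontr)
    assume "\<not> j \<le> l"
    then have "s l \<le> s (j - 1)" using j strict_mono_on_leD[OF s, of l "j - 1"] by auto
    then show False using l t by auto
  qed
qed

lemma index_at_exists:
  assumes s: "strict_mono_on {..m} s" and t: "t \<in> {s 0<..s m}"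
  shows "index_at s t \<in> {1..m} \<and> t \<in> {s (index_at s t - 1)<..s (index_at s t)}"
proof -
  let ?j = "index_at s t"
  have 1: "t \<le> s ?j" unfolding index_at_def by (rule LeastI[of _ m]) (use t in auto)
  have 2: "?j \<le> m" unfolding index_at_def by (rule Least_le) (use t in auto)
  have 3: "?j \<noteq> 0" using 1 t by (metis greaterThanAtMost_iff not_le)
  then have "?j - 1 < ?j" by simp
  then have "\<not> t \<le> s (?j - 1)" unfolding index_at_def by (rule not_less_Least)
  then show ?thesis using 1 2 3 by auto
qed

lemma integral_partition:
  fixes g :: "real \<Rightarrow> real" and s :: "nat \<Rightarrow> real"
  assumes s: "strict_mono_on {..m} s" and g: "g integrable_on {s 0..s m}"
  shows "integral {s 0..s m} g = (\<Sum>j=1..m. integral {s (j - 1)..s j} g)"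
proof -
  have "integral {s 0..s l} g = (\<Sum>j=1..l. integral {s (j - 1)..s j} g)" if "l \<le> m" for l
    using that
  proof (induction l)
    case (Suc l)
    have le: "s 0 \<le> s l" "s l \<le> s (Suc l)" "s (Suc l) \<le> s m"
      using Suc.prems by (auto intro!: strict_mono_on_leD[OF s])
    have "integral {s 0..s l} g + integral {s l..s (Suc l)} g = integral {s 0..s (Suc l)} g"
      using le by (intro Henstock_Kurzweil_Integration.integral_combine integrable_subinterval_real[OF g]) auto
    then show ?case using Suc by simp
  qed simp
  then show ?thesis by simp
qed

lemma Lim_right: "(f \<longlongrightarrow> l) (at_right (a::real)) \<Longrightarrow> Lim (at_right a) f = l"
  by (rule tendsto_Lim) simp_all

lemma Lim_left: "(f \<longlongrightarrow> l) (at_left (a::real)) \<Longrightarrow> Lim (at_left a) f = l"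
  by (rule tendsto_Lim) simp_all

lemma jump_eq:
  "(f \<longlongrightarrow> l) (at_right a) \<Longrightarrow> (f \<longlongrightarrow> k) (at_left a) \<Longrightarrow> jump f a = l - k"
  unfolding jump_def by (simp add: Lim_right Lim_left)

lemma tendsto_right_poly:
  fixes v :: "real \<Rightarrow> real"
  assumes "a < b" "\<And>t. t \<in> {a<..<b} \<Longrightarrow> v t = poly p t"
  shows "(v \<longlongrightarrow> poly p a) (at_right a)"
proof (rule Lim_transform_eventually)
  show "(poly p \<longlongrightarrow> poly p a) (at_right a)" by (intro tendsto_intros)
  show "\<forall>\<^sub>F t in at_right a. poly p t = v t"
    using assms by (auto simp: eventually_at_right intro!: exI[of _ b])
qed

lemma tendsto_left_poly:
  fixes v :: "real \<Rightarrow> real"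
  assumes "a < b" "\<And>t. t \<in> {a<..<b} \<Longrightarrow> v t = poly p t"
  shows "(v \<longlongrightarrow> poly p b) (at_left b)"
proof (rule Lim_transform_eventually)
  show "(poly p \<longlongrightarrow> poly p b) (at_left b)" by (intro tendsto_intros)
  show "\<forall>\<^sub>F t in at_left b. poly p t = v t"
    using assms by (auto simp: eventually_at_left intro!: exI[of _ a])
qed

lemma deriv_eq_poly:
  fixes v :: "real \<Rightarrow> real"
  assumes "t \<in> {a<..<b}" "\<And>t. t \<in> {a<..<b} \<Longrightarrow> v t = poly p t"
  shows "deriv v t = poly (pderiv p) t"
proof (rule DERIV_imp_deriv)
  have "(poly p has_real_derivative poly (pderiv p) t) (at t)" by (rule poly_DERIV)
  then show "(v has_real_derivative poly (pderiv p) t) (at t)"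
    by (rule has_field_derivative_transform_within_open[of _ _ _ "{a<..<b}"]) (use assms in auto)
qed

lemma integral_cong_interior:
  fixes g h :: "real \<Rightarrow> real"
  assumes "\<And>t. t \<in> {a<..<b} \<Longrightarrow> g t = h t"
  shows "integral {a<..b} g = integral {a<..b} h"
proof -
  have "integral {a<..<b} g = integral {a<..<b} h" by (rule integral_cong) (use assms in auto)
  then show ?thesis unfolding integral_Ioc integral_open_interval_real .
qed

lemma inner_transp: "inner_N N (mat_vec N A x) y = inner_N N x (mat_vec N (transp A) y)"
  unfolding inner_N_def mat_vec_def transp_def sum_distrib_right sum_distrib_left
  by (subst sum.swap) (simp add: algebra_simps)

text \<open>
  The test functions supported in a single cell turn the global variational equations into
  equations on cells.
\<close>

definition cell_test :: "grid \<Rightarrow> nat \<Rightarrow> nat \<Rightarrow> real poly \<Rightarrow> real \<Rightarrow> rvec" where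
  "cell_test G i j w t l = (if l = i \<and> t \<in> cell G i j then poly w t else 0)"

definition cell_poly :: "grid \<Rightarrow> (real \<Rightarrow> rvec) \<Rightarrow> nat \<Rightarrow> nat \<Rightarrow> real poly" where
  "cell_poly G v i j = (SOME p. degree p \<le> deg G i j \<and> (\<forall>t\<in>cell G i j. v t i = poly p t))"

locale valid_grid =
  fixes G :: grid
  assumes grid: "is_grid G"
begin

abbreviation "N \<equiv> ncomp G"
abbreviation "T \<equiv> tfin G"
abbreviation "M \<equiv> ncell G"
abbreviation "nd \<equiv> node G"

lemma N_pos: "1 \<le> N" and T_pos: "0 < T"
  and nd0: "i < N \<Longrightarrow> nd i 0 = 0" and ndM: "i < N \<Longrightarrow> nd i (M i) = T"
  and nd_mono: "i < N \<Longrightarrow> strict_mono_on {..M i} (nd i)"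
  and lv0: "level G 0 = 0" and lvM: "level G (nslab G) = T" and lv_mono: "strict_mono_on {..nslab G} (level G)"
  and lv_nd: "n \<le> nslab G \<Longrightarrow> i < N \<Longrightarrow> level G n \<in> nd i ` {..M i}"
  using grid unfolding is_grid_def by auto

lemma nd_less: "i < N \<Longrightarrow> j < k \<Longrightarrow> k \<le> M i \<Longrightarrow> nd i j < nd i k"
  by (rule strict_mono_onD[OF nd_mono]) auto

lemma nd_le: "i < N \<Longrightarrow> j \<le> k \<Longrightarrow> k \<le> M i \<Longrightarrow> nd i j \<le> nd i k"
  by (rule strict_mono_on_leD[OF nd_mono]) auto

lemma nd_step: "i < N \<Longrightarrow> j \<in> {1..M i} \<Longrightarrow> nd i (j - 1) < nd i j"
  by (rule nd_less) auto

lemma nd_bounds: "i < N \<Longrightarrow> j \<le> M i \<Longrightarrow> 0 \<le> nd i j \<and> nd i j \<le> T"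
  using nd_le[of i 0 j] nd_le[of i j "M i"] nd0 ndM by auto

lemma step_pos: "i < N \<Longrightarrow> j \<in> {1..M i} \<Longrightarrow> 0 < step G i j"
  using nd_step by (simp add: step_def)

lemma cell_subset: "i < N \<Longrightarrow> j \<in> {1..M i} \<Longrightarrow> cell G i j \<subseteq> {0<..T}"
proof -
  assume ij: "i < N" "j \<in> {1..M i}"
  then have "j - 1 \<le> M i" "j \<le> M i" by auto
  then have "0 \<le> nd i (j - 1)" "nd i j \<le> T" using nd_bounds[OF ij(1)] by blast+
  then show ?thesis by (auto simp: cell_def)
qed

lemma index_cell: "i < N \<Longrightarrow> j \<in> {1..M i} \<Longrightarrow> t \<in> cell G i j \<Longrightarrow> index_at (nd i) t = j"
  unfolding cell_def by (rule index_at_eq[OF nd_mono]) auto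

lemma index_cell_exists:
  assumes "i < N" "t \<in> {0<..T}"
  shows "index_at (nd i) t \<in> {1..M i}" "t \<in> cell G i (index_at (nd i) t)"
  using index_at_exists[OF nd_mono[OF assms(1)], of t] assms by (auto simp: nd0 ndM cell_def)

lemma index_slab: "n \<in> {1..nslab G} \<Longrightarrow> t \<in> slab_ival G n \<Longrightarrow> index_at (level G) t = n"
  unfolding slab_ival_def by (rule index_at_eq[OF lv_mono]) auto

lemma index_slab_exists:
  assumes "t \<in> {0<..T}"
  shows "index_at (level G) t \<in> {1..nslab G}" "t \<in> slab_ival G (index_at (level G) t)"
  using index_at_exists[OF lv_mono, of t] assms by (auto simp: lv0 lvM slab_ival_def)

lemma lv_le: "m \<le> n \<Longrightarrow> n \<le> nslab G \<Longrightarrow> level G m \<le> level G n"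
  by (rule strict_mono_on_leD[OF lv_mono]) auto

lemma lv_step: "n \<in> {1..nslab G} \<Longrightarrow> level G (n - 1) < level G n"
  by (rule strict_mono_onD[OF lv_mono]) auto

lemma slab_ival_subset: "n \<in> {1..nslab G} \<Longrightarrow> slab_ival G n \<subseteq> {0<..T}"
proof -
  assume n: "n \<in> {1..nslab G}"
  then have "level G 0 \<le> level G (n - 1)" "level G n \<le> level G (nslab G)" by (auto intro!: lv_le)
  then show ?thesis by (auto simp: slab_ival_def lv0 lvM)
qed

text \<open>
  The time levels are nodes of every component, so no cell crosses a level.
\<close>

lemma level_le_node:
  assumes n: "n \<le> nslab G" and i: "i < N" and j: "j \<in> {1..M i}"
  shows "level G n < nd i j \<Longrightarrow> level G n \<le> nd i (j - 1)"
    and "nd i (j - 1) < level G n \<Longrightarrow> nd i j \<le> level G n"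
proof -
  obtain l where l: "l \<le> M i" "level G n = nd i l" using lv_nd[OF n i] by auto
  show "level G n \<le> nd i (j - 1)" if "level G n < nd i j"
  proof -
    have "l < j" using that l j nd_le[OF i, of j l] by (metis atLeastAtMost_iff not_le)
    then show ?thesis using l nd_le[OF i, of l "j - 1"] j by auto
  qed
  show "nd i j \<le> level G n" if "nd i (j - 1) < level G n"
  proof -
    have "j - 1 < l" using that l j nd_le[OF i, of l "j - 1"] by (metis atLeastAtMost_iff diff_le_self le_trans not_le)
    then show ?thesis using l nd_le[OF i, of j l] j by auto
  qed
qed

lemma slab_cell_iff:
  assumes n: "n \<in> {1..nslab G}" and i: "i < N" and j: "j \<in> {1..M i}" and t: "t \<in> cell G i j" "t \<in> slab_ival G n"
  shows "(i, j) \<in> slab G n"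
proof -
  have "level G (n - 1) \<le> nd i (j - 1)"
    by (rule level_le_node) (use n i j t in \<open>auto simp: cell_def slab_ival_def\<close>)
  moreover have "nd i j \<le> level G n"
    by (rule level_le_node) (use n i j t in \<open>auto simp: cell_def slab_ival_def\<close>)
  ultimately show ?thesis using i j by (simp add: slab_def)
qed

lemma slab_cell_subset:
  "(i, j) \<in> slab G n \<Longrightarrow> i < N \<and> j \<in> {1..M i} \<and> cell G i j \<subseteq> slab_ival G n"
  by (auto simp: slab_def cell_def slab_ival_def)

lemma cell_in_slab:
  assumes "i < N" "j \<in> {1..M i}"
  obtains n where "n \<in> {1..nslab G}" "(i, j) \<in> slab G n" "\<And>t. t \<in> cell G i j \<Longrightarrow> index_at (level G) t = n"
proof -
  have t: "nd i j \<in> cell G i j" using nd_step[OF assms] by (simp add: cell_def)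
  then have tT: "nd i j \<in> {0<..T}" using cell_subset[OF assms] by blast
  define n where "n = index_at (level G) (nd i j)"
  have n: "n \<in> {1..nslab G}" "nd i j \<in> slab_ival G n"
    using index_slab_exists[OF tT] by (auto simp: n_def)
  have s: "(i, j) \<in> slab G n" by (rule slab_cell_iff[OF n(1) assms t n(2)])
  show ?thesis
    by (rule that[OF n(1) s]) (use slab_cell_subset[OF s] index_slab[OF n(1)] in auto)
qed

lemma integral_cells:
  fixes g :: "real \<Rightarrow> real"
  assumes i: "i < N" and g: "g integrable_on {0<..T}"
  shows "integral {0..T} g = (\<Sum>j=1..M i. integral (cell G i j) g)"
proof -
  have "g integrable_on {nd i 0..nd i (M i)}"
    unfolding nd0[OF i] ndM[OF i] using g integrable_Ioc by blast
  from integral_partition[OF nd_mono[OF i] this] show ?thesis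
    using i by (simp add: nd0 ndM integral_Ioc cell_def)
qed

lemma integral_slabs:
  fixes g :: "real \<Rightarrow> real"
  assumes g: "g integrable_on {0<..T}"
  shows "integral {0..T} g = (\<Sum>n=1..nslab G. integral (slab_ival G n) g)"
proof -
  have "g integrable_on {level G 0..level G (nslab G)}"
    unfolding lv0 lvM using g integrable_Ioc by blast
  from integral_partition[OF lv_mono this] show ?thesis
    by (simp add: lv0 lvM integral_Ioc slab_ival_def)
qed

lemma cell_poly:
  assumes "v \<in> Vspace G" "i < N" "j \<in> {1..M i}"
  shows "degree (cell_poly G v i j) \<le> deg G i j" "t \<in> cell G i j \<Longrightarrow> v t i = poly (cell_poly G v i j) t"
proof -
  have "\<exists>p. degree p \<le> deg G i j \<and> (\<forall>t\<in>cell G i j. v t i = poly p t)"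
    using assms by (auto simp: Vspace_def)
  from someI_ex[OF this] show "degree (cell_poly G v i j) \<le> deg G i j"
    "t \<in> cell G i j \<Longrightarrow> v t i = poly (cell_poly G v i j) t"
    by (auto simp: cell_poly_def)
qed

lemma Vspace_right_limit:
  assumes "v \<in> Vspace G" "i < N" "j \<in> {1..M i}"
  shows "((\<lambda>s. v s i) \<longlongrightarrow> poly (cell_poly G v i j) (nd i (j - 1))) (at_right (nd i (j - 1)))"
  by (rule tendsto_right_poly[OF nd_step[OF assms(2,3)]]) (auto intro!: cell_poly[OF assms] simp: cell_def)

lemma Vspace_left_limit:
  assumes "v \<in> Vspace G" "i < N" "j \<in> {1..M i}"
  shows "((\<lambda>s. v s i) \<longlongrightarrow> poly (cell_poly G v i j) (nd i j)) (at_left (nd i j))"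
  by (rule tendsto_left_poly[OF nd_step[OF assms(2,3)]]) (auto intro!: cell_poly[OF assms] simp: cell_def)

lemma Vspace_jump:
  assumes "v \<in> Vspace G" "i < N" "j \<in> {2..M i}"
  shows "jump (\<lambda>s. v s i) (nd i (j - 1))
    = poly (cell_poly G v i j) (nd i (j - 1)) - poly (cell_poly G v i (j - 1)) (nd i (j - 1))"
proof -
  have "j - 1 \<in> {1..M i}" "j \<in> {1..M i}" using assms by auto
  then show ?thesis
    by (intro jump_eq Vspace_right_limit Vspace_left_limit assms)
qed

lemma Vspace_deriv:
  assumes "v \<in> Vspace G" "i < N" "j \<in> {1..M i}" "t \<in> {nd i (j - 1)<..<nd i j}"
  shows "deriv (\<lambda>s. v s i) t = poly (pderiv (cell_poly G v i j)) t"
  by (rule deriv_eq_poly[OF assms(4)]) (auto intro!: cell_poly[OF assms(1-3)] simp: cell_def)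

lemma Vspace_mble:
  assumes v: "v \<in> Vspace G" and i: "i < N"
  shows "mble T (\<lambda>t. v t i)"
proof -
  have "indicator {0<..T} t * v t i = (\<Sum>j=1..M i. indicator (cell G i j) t * poly (cell_poly G v i j) t)" for t
  proof (cases "t \<in> {0<..T}")
    case True
    define k where "k = index_at (nd i) t"
    have k: "k \<in> {1..M i}" "t \<in> cell G i k" using index_cell_exists[OF i True] by (auto simp: k_def)
    have "(\<Sum>j=1..M i. indicator (cell G i j) t * poly (cell_poly G v i j) t)
        = (\<Sum>j=1..M i. if j = k then v t i else 0)"
    proof (rule sum.cong)
      fix j assume j: "j \<in> {1..M i}"
      show "indicator (cell G i j) t * poly (cell_poly G v i j) t = (if j = k then v t i else 0)"
        using k(2) cell_poly(2)[OF v i k(1,2)] index_cell[OF i j, of t]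
        by (cases "j = k") (simp_all add: indicator_def k_def[symmetric], metis)
    qed simp
    then show ?thesis using k True by simp
  next
    case False
    then have "t \<notin> cell G i j" if "j \<in> {1..M i}" for j using cell_subset[OF i that] by blast
    then have "(\<Sum>j=1..M i. indicator (cell G i j) t * poly (cell_poly G v i j) t) = 0"
      by (intro sum.neutral) (auto simp: indicator_def)
    then show ?thesis using False by (simp add: indicator_def)
  qed
  moreover have "(\<lambda>t. \<Sum>j=1..M i. indicator (cell G i j) t * poly (cell_poly G v i j) t) \<in> borel_measurable borel"
  proof (rule borel_measurable_sum)
    fix j
    have [measurable]: "poly (cell_poly G v i j) \<in> borel_measurable borel"
      by (intro borel_measurable_continuous_onI continuous_intros)
    have [measurable]: "cell G i j \<in> sets borel" by (simp add: cell_def)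
    show "(\<lambda>t. indicator (cell G i j) t * poly (cell_poly G v i j) t) \<in> borel_measurable borel"
      by measurable
  qed
  ultimately show ?thesis unfolding mble_def by simp
qed

lemma Vspace_bounded:
  assumes v: "v \<in> Vspace G"
  shows "\<exists>B\<ge>0. \<forall>i<N. \<forall>t\<in>{0<..T}. \<bar>v t i\<bar> \<le> B"
proof -
  have "\<exists>B. \<forall>t\<in>cell G i j. \<bar>v t i\<bar> \<le> B" if i: "i < N" and j: "j \<in> {1..M i}" for i j
  proof -
    have "\<exists>z\<in>{nd i (j - 1)..nd i j}. \<forall>t\<in>{nd i (j - 1)..nd i j}. \<bar>poly (cell_poly G v i j) t\<bar> \<le> \<bar>poly (cell_poly G v i j) z\<bar>"
      using nd_step[OF i j] by (intro continuous_attains_sup continuous_intros) auto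
    then obtain B where "\<And>t. t \<in> {nd i (j - 1)..nd i j} \<Longrightarrow> \<bar>poly (cell_poly G v i j) t\<bar> \<le> B"
      by blast
    then show ?thesis using cell_poly(2)[OF v i j] by (intro exI[of _ B]) (auto simp: cell_def)
  qed
  then obtain B where B: "\<And>i j t. i < N \<Longrightarrow> j \<in> {1..M i} \<Longrightarrow> t \<in> cell G i j \<Longrightarrow> \<bar>v t i\<bar> \<le> B i j" by metis
  have "\<bar>v t i\<bar> \<le> (\<Sum>i<N. \<Sum>j=1..M i. \<bar>B i j\<bar>)" if i: "i < N" and t: "t \<in> {0<..T}" for i t
  proof -
    define j where "j = index_at (nd i) t"
    have j: "j \<in> {1..M i}" "t \<in> cell G i j" using index_cell_exists[OF i t] by (auto simp: j_def)
    have "\<bar>v t i\<bar> \<le> \<bar>B i j\<bar>" using B[OF i j] by linarith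
    also have "\<dots> \<le> (\<Sum>j=1..M i. \<bar>B i j\<bar>)" by (rule member_le_sum) (use j in auto)
    also have "\<dots> \<le> (\<Sum>i<N. \<Sum>j=1..M i. \<bar>B i j\<bar>)"
      by (rule member_le_sum) (use i in \<open>auto intro: sum_nonneg\<close>)
    finally show ?thesis .
  qed
  then show ?thesis by (intro exI[of _ "\<Sum>i<N. \<Sum>j=1..M i. \<bar>B i j\<bar>"]) (auto intro: sum_nonneg)
qed

lemma cell_disjoint:
  assumes "i < N" "j \<in> {1..M i}" "l \<in> {1..M i}" "t \<in> cell G i j" "t \<in> cell G i l"
  shows "j = l"
  using index_cell[OF assms(1,2,4)] index_cell[OF assms(1,3,5)] by simp

lemma cell_test_on_cell:
  assumes "i < N" "j \<in> {1..M i}" "l \<in> {1..M i}" "t \<in> cell G i l"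
  shows "cell_test G i j w t i = poly (if l = j then w else 0) t"
  using cell_disjoint[OF assms(1-3), of t] assms by (auto simp: cell_test_def)

lemma cell_test_Vspace:
  assumes "i < N" "j \<in> {1..M i}" "degree w \<le> deg G i j"
  shows "cell_test G i j w \<in> Vspace G"
  unfolding Vspace_def
proof (intro CollectI allI impI ballI)
  fix k l assume k: "k < N" and l: "l \<in> {1..M k}"
  show "\<exists>p. degree p \<le> deg G k l \<and> (\<forall>t\<in>cell G k l. cell_test G i j w t k = poly p t)"
  proof (cases "k = i")
    case True
    then show ?thesis using assms l cell_test_on_cell[OF assms(1,2), of l _ w]
      by (intro exI[of _ "if l = j then w else 0"]) auto
  next
    case False
    then show ?thesis by (intro exI[of _ 0]) (auto simp: cell_test_def)
  qed
qed

lemma cell_test_right: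
  assumes i: "i < N" and j: "j \<in> {1..M i}" and l: "l \<in> {1..M i}"
  shows "((\<lambda>s. cell_test G i j w s i) \<longlongrightarrow> (if l = j then poly w (nd i (l - 1)) else 0)) (at_right (nd i (l - 1)))"
proof -
  have "((\<lambda>s. cell_test G i j w s i) \<longlongrightarrow> poly (if l = j then w else 0) (nd i (l - 1))) (at_right (nd i (l - 1)))"
    by (rule tendsto_right_poly[OF nd_step[OF i l]])
       (rule cell_test_on_cell[OF i j l], auto simp: cell_def)
  then show ?thesis by (cases "l = j") auto
qed

lemma cell_test_left:
  assumes i: "i < N" and j: "j \<in> {1..M i}" and l: "l \<le> M i"
  shows "((\<lambda>s. cell_test G i j w s i) \<longlongrightarrow> (if l = j then poly w (nd i l) else 0)) (at_left (nd i l))"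
proof (cases "l = 0")
  case True
  have "((\<lambda>s. cell_test G i j w s i) \<longlongrightarrow> poly 0 (nd i l)) (at_left (nd i l))"
    by (rule tendsto_left_poly[of "nd i l - 1"])
       (use True i j cell_subset[OF i j] nd0[OF i] in \<open>auto simp: cell_test_def\<close>)
  then show ?thesis using True j by auto
next
  case False
  then have l': "l \<in> {1..M i}" using l by simp
  have "((\<lambda>s. cell_test G i j w s i) \<longlongrightarrow> poly (if l = j then w else 0) (nd i l)) (at_left (nd i l))"
    by (rule tendsto_left_poly[OF nd_step[OF i l']])
       (rule cell_test_on_cell[OF i j l'], auto simp: cell_def)
  then show ?thesis by (cases "l = j") auto
qed

lemma integral_cell_restrict:
  fixes g :: "real \<Rightarrow> real"
  assumes "i < N" "j \<in> {1..M i}"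
  shows "integral {0..T} (\<lambda>t. if t \<in> cell G i j then g t else 0) = integral (cell G i j) g"
proof -
  have "cell G i j \<subseteq> {0..T}" using cell_subset[OF assms] by auto
  then have "cell G i j \<inter> {0..T} = cell G i j" by blast
  then show ?thesis using integral_restrict_Int[of "{0..T}" "cell G i j" g] by (simp add: Int_commute)
qed

text \<open>
  Evaluates the double sum of a variational equation for a test function supported in one cell.
\<close>

lemma single_cell_sum:
  fixes X :: real
  assumes "i < N" "j \<in> {1..M i}"
    and "\<And>k l. k < N \<Longrightarrow> l \<in> {1..M k} \<Longrightarrow> h k l = (if k = i \<and> l = j then X else 0)"
  shows "(\<Sum>k<N. \<Sum>l=1..M k. h k l) = X"
proof -
  have "(\<Sum>l=1..M k. h k l) = (if k = i then X else 0)" if "k < N" for k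
  proof -
    have "(\<Sum>l=1..M k. h k l) = (\<Sum>l=1..M k. if l = j then (if k = i then X else 0) else 0)"
      by (rule sum.cong) (use assms(3) that in auto)
    then show ?thesis using assms(2) by auto
  qed
  then have "(\<Sum>k<N. \<Sum>l=1..M k. h k l) = (\<Sum>k<N. if k = i then X else 0)" by simp
  then show ?thesis using assms(1) by simp
qed

lemma cell_test_zero: "k \<noteq> i \<Longrightarrow> cell_test G i j w t k = 0"
  by (simp add: cell_test_def)

text \<open>
  The test function lives on cell \<open>(i, j)\<close>; only its right limit at the left node and its values
  in the cell enter.
\<close>

lemma mdG_cell_equation:
  assumes U: "mdG_solution G f u0 U" and i: "i < N" and j: "j \<in> {1..M i}" and w: "degree w \<le> deg G i j"
  shows "jump (\<lambda>s. U s i) (nd i (j - 1)) * poly w (nd i (j - 1))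
      + integral (cell G i j) (\<lambda>t. poly (pderiv (cell_poly G U i j)) t * poly w t)
      = integral (cell G i j) (\<lambda>t. f (U t) t i * poly w t)"
proof -
  let ?v = "cell_test G i j w"
  have UV: "U \<in> Vspace G" using U by (simp add: mdG_solution_def)
  have "(\<Sum>k<N. \<Sum>l=1..M k.
           jump (\<lambda>s. U s k) (nd k (l - 1)) * Lim (at_right (nd k (l - 1))) (\<lambda>s. ?v s k)
           + integral (cell G k l) (\<lambda>t. deriv (\<lambda>s. U s k) t * ?v t k))
        = integral {0..T} (\<lambda>t. inner_N N (f (U t) t) (?v t))"
    using U cell_test_Vspace[OF i j w] unfolding mdG_solution_def by blast
  also have "(\<Sum>k<N. \<Sum>l=1..M k.
           jump (\<lambda>s. U s k) (nd k (l - 1)) * Lim (at_right (nd k (l - 1))) (\<lambda>s. ?v s k)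
           + integral (cell G k l) (\<lambda>t. deriv (\<lambda>s. U s k) t * ?v t k))
     = jump (\<lambda>s. U s i) (nd i (j - 1)) * poly w (nd i (j - 1))
      + integral (cell G i j) (\<lambda>t. poly (pderiv (cell_poly G U i j)) t * poly w t)"
  proof (rule single_cell_sum[OF i j])
    fix k l assume k: "k < N" and l: "l \<in> {1..M k}"
    show "jump (\<lambda>s. U s k) (nd k (l - 1)) * Lim (at_right (nd k (l - 1))) (\<lambda>s. ?v s k)
           + integral (cell G k l) (\<lambda>t. deriv (\<lambda>s. U s k) t * ?v t k)
        = (if k = i \<and> l = j then jump (\<lambda>s. U s i) (nd i (j - 1)) * poly w (nd i (j - 1))
      + integral (cell G i j) (\<lambda>t. poly (pderiv (cell_poly G U i j)) t * poly w t) else 0)"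
    proof (cases "k = i")
      case True
      have l': "l \<in> {1..M i}" using l True by simp
      have "integral (cell G i l) (\<lambda>t. deriv (\<lambda>s. U s i) t * ?v t i)
          = integral (cell G i l) (\<lambda>t. poly (pderiv (cell_poly G U i l)) t * poly (if l = j then w else 0) t)"
        unfolding cell_def
        by (rule integral_cong_interior, subst Vspace_deriv[OF UV i l'], assumption,
            subst cell_test_on_cell[OF i j l']) (auto simp: cell_def)
      then show ?thesis using True Lim_right[OF cell_test_right[OF i j l', of w]] by (cases "l = j") auto
    next
      case False
      have "Lim (at_right (nd k (l - 1))) (\<lambda>s. ?v s k) = 0"
        by (rule Lim_right) (simp add: cell_test_zero[OF False])
      then show ?thesis using False by (simp add: cell_test_zero)
    qed
  qed
  also have "integral {0..T} (\<lambda>t. inner_N N (f (U t) t) (?v t))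
      = integral {0..T} (\<lambda>t. if t \<in> cell G i j then f (U t) t i * poly w t else 0)"
  proof (rule integral_cong)
    fix t
    have "inner_N N (f (U t) t) (?v t) = (\<Sum>k<N. if k = i then (if t \<in> cell G i j then f (U t) t i * poly w t else 0) else 0)"
      unfolding inner_N_def by (rule sum.cong) (auto simp: cell_test_def)
    then show "inner_N N (f (U t) t) (?v t) = (if t \<in> cell G i j then f (U t) t i * poly w t else 0)"
      using i by simp
  qed
  finally show ?thesis using integral_cell_restrict[OF i j] by simp
qed

text \<open>
  Minus the velocity of the dual solution (up to the source \<open>g\<close>), for the Jacobian averaged
  between \<open>x\<close> and \<open>y\<close>.
\<close>

definition adjoint_rhs :: "(rvec \<Rightarrow> real \<Rightarrow> rvec) \<Rightarrow> (real \<Rightarrow> rvec) \<Rightarrow> (real \<Rightarrow> rvec) \<Rightarrow> (real \<Rightarrow> rvec) \<Rightarrow> real \<Rightarrow> rvec" where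
  "adjoint_rhs f x y \<Phi> t = mat_vec N (transp (Jmat f x y t)) (\<Phi> t)"

text \<open>
  Now the test function is the one that is differentiated. It also jumps down at the right node,
  which brings in \<open>\<Phi>\<close> from the next cell, or \<open>\<psi>\<close> at the final time.
\<close>

lemma dual_cell_equation:
  assumes Phi: "mdG_dual_solution G f u U \<psi> g \<Phi>" and i: "i < N" and j: "j \<in> {1..M i}" and w: "degree w \<le> deg G i j"
    and g: "\<And>t. t \<in> cell G i j \<Longrightarrow> g t i = 0"
  shows "poly w (nd i (j - 1)) * poly (cell_poly G \<Phi> i j) (nd i (j - 1))
      + integral (cell G i j) (\<lambda>t. poly (pderiv w) t * poly (cell_poly G \<Phi> i j) t)
      = poly w (nd i j) * (if j = M i then \<psi> i else poly (cell_poly G \<Phi> i (Suc j)) (nd i j))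
      + integral (cell G i j) (\<lambda>t. poly w t * adjoint_rhs f (dG_interp G u) U \<Phi> t i)"
proof -
  let ?v = "cell_test G i j w"
  let ?J = "Jmat f (dG_interp G u) U"
  have V: "\<Phi> \<in> Vspace G" using Phi by (simp add: mdG_dual_solution_def)
  define h where "h k l = jump (\<lambda>s. ?v s k) (nd k (l - 1)) * Lim (at_right (nd k (l - 1))) (\<lambda>s. \<Phi> s k)
           + integral (cell G k l) (\<lambda>t. deriv (\<lambda>s. ?v s k) t * \<Phi> t k)" for k l
  have "\<forall>k<N. ((\<lambda>s. ?v s k) \<longlongrightarrow> 0) (at_left 0)"
  proof (intro allI impI)
    fix k assume "k < N"
    show "((\<lambda>s. ?v s k) \<longlongrightarrow> 0) (at_left 0)"
    proof (cases "k = i")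
      case True
      then show ?thesis using cell_test_left[OF i j, of 0 w] nd0[OF i] j by simp
    qed (simp add: cell_test_zero)
  qed
  then have "(\<Sum>k<N. \<Sum>l=1..M k. h k l)
        = integral {0..T} (\<lambda>t. inner_N N (mat_vec N (?J t) (?v t)) (\<Phi> t)) + Lfun G \<psi> g ?v"
    using Phi cell_test_Vspace[OF i j w] unfolding mdG_dual_solution_def h_def by blast
  moreover have "Lfun G \<psi> g ?v = (if j = M i then poly w (nd i j) * \<psi> i else 0)"
  proof -
    have "T \<in> cell G i j \<longleftrightarrow> j = M i"
      using nd_less[OF i, of j "M i"] ndM[OF i] j nd_step[OF i j] by (force simp: cell_def)
    then have "inner_N N (?v T) \<psi> = (\<Sum>k<N. if k = i then (if j = M i then poly w T * \<psi> i else 0) else 0)"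
      unfolding inner_N_def by (intro sum.cong) (auto simp: cell_test_def)
    moreover have "inner_N N (?v t) (g t) = 0" for t
      unfolding inner_N_def using g by (intro sum.neutral) (auto simp: cell_test_def)
    ultimately show ?thesis using i ndM[OF i] by (simp add: Lfun_def)
  qed
  moreover have "integral {0..T} (\<lambda>t. inner_N N (mat_vec N (?J t) (?v t)) (\<Phi> t))
      = integral (cell G i j) (\<lambda>t. poly w t * adjoint_rhs f (dG_interp G u) U \<Phi> t i)"
  proof -
    have "inner_N N (mat_vec N (?J t) (?v t)) (\<Phi> t)
        = (if t \<in> cell G i j then poly w t * adjoint_rhs f (dG_interp G u) U \<Phi> t i else 0)" for t
    proof -
      have "inner_N N (mat_vec N (?J t) (?v t)) (\<Phi> t) = inner_N N (?v t) (adjoint_rhs f (dG_interp G u) U \<Phi> t)"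
        by (simp add: inner_transp adjoint_rhs_def)
      also have "\<dots> = (\<Sum>k<N. if k = i then (if t \<in> cell G i j then poly w t * adjoint_rhs f (dG_interp G u) U \<Phi> t i else 0) else 0)"
        unfolding inner_N_def by (rule sum.cong) (auto simp: cell_test_def)
      finally show ?thesis using i by simp
    qed
    then show ?thesis using integral_cell_restrict[OF i j] by simp
  qed
  moreover have "(\<Sum>k<N. \<Sum>l=1..M k. h k l)
     = poly w (nd i (j - 1)) * poly (cell_poly G \<Phi> i j) (nd i (j - 1))
      + integral (cell G i j) (\<lambda>t. poly (pderiv w) t * poly (cell_poly G \<Phi> i j) t)
      - (if j = M i then 0 else poly w (nd i j) * poly (cell_poly G \<Phi> i (Suc j)) (nd i j))"
  proof -
    have h0: "h k l = 0" if "k \<noteq> i" for k l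
    proof -
      have "jump (\<lambda>s. ?v s k) (nd k (l - 1)) = 0 - 0"
        by (rule jump_eq) (simp_all add: cell_test_zero[OF that])
      moreover have "deriv (\<lambda>s. ?v s k) = (\<lambda>_. 0)" by (simp add: cell_test_zero[OF that] fun_eq_iff)
      ultimately show ?thesis by (simp add: h_def)
    qed
    define X where "X = poly w (nd i (j - 1)) * poly (cell_poly G \<Phi> i j) (nd i (j - 1))
      + integral (cell G i j) (\<lambda>t. poly (pderiv w) t * poly (cell_poly G \<Phi> i j) t)"
    define Y where "Y = poly w (nd i j) * poly (cell_poly G \<Phi> i (Suc j)) (nd i j)"
    have hi: "h i l = (if l = j then X else 0) - (if l = Suc j then Y else 0)" if l: "l \<in> {1..M i}" for l
    proof -
      have "jump (\<lambda>s. ?v s i) (nd i (l - 1))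
          = (if l = j then poly w (nd i (l - 1)) else 0) - (if l - 1 = j then poly w (nd i (l - 1)) else 0)"
        by (rule jump_eq[OF cell_test_right[OF i j l] cell_test_left[OF i j]]) (use l in auto)
      moreover have "Lim (at_right (nd i (l - 1))) (\<lambda>s. \<Phi> s i) = poly (cell_poly G \<Phi> i l) (nd i (l - 1))"
        by (rule Lim_right[OF Vspace_right_limit[OF V i l]])
      moreover have "integral (cell G i l) (\<lambda>t. deriv (\<lambda>s. ?v s i) t * \<Phi> t i)
          = integral (cell G i l) (\<lambda>t. poly (pderiv (if l = j then w else 0)) t * poly (cell_poly G \<Phi> i l) t)"
        unfolding cell_def
      proof (rule integral_cong_interior)
        fix t assume t: "t \<in> {nd i (l - 1)<..<nd i l}"
        have "deriv (\<lambda>s. ?v s i) t = poly (pderiv (if l = j then w else 0)) t"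
          by (rule deriv_eq_poly[OF t]) (rule cell_test_on_cell[OF i j l], auto simp: cell_def)
        moreover have "\<Phi> t i = poly (cell_poly G \<Phi> i l) t"
          by (rule cell_poly[OF V i l]) (use t in \<open>auto simp: cell_def\<close>)
        ultimately show "deriv (\<lambda>s. ?v s i) t * \<Phi> t i = poly (pderiv (if l = j then w else 0)) t * poly (cell_poly G \<Phi> i l) t" by simp
      qed
      ultimately show ?thesis using l j by (auto simp: h_def X_def Y_def)
    qed
    have "(\<Sum>k<N. \<Sum>l=1..M k. h k l) = (\<Sum>k<N. if k = i then (\<Sum>l=1..M i. h i l) else 0)"
      by (rule sum.cong) (auto simp: h0)
    also have "\<dots> = (\<Sum>l=1..M i. (if l = j then X else 0) - (if l = Suc j then Y else 0))"
      using i hi by simp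
    also have "\<dots> = X - (if j = M i then 0 else Y)"
      using j by (auto simp: sum_subtractf)
    finally show ?thesis by (simp add: X_def Y_def)
  qed
  ultimately show ?thesis by (auto split: if_splits)
qed

end

section \<open>Error representation and first estimate\<close>

text \<open>
  The derivatives have one-sided limits at the ends and hence extend continuously to the closed
  interval.
\<close>

lemma pw_smooth_bounded:
  assumes y: "pw_smooth m a b {} y" and ab: "a < b" and n: "n \<le> m"
  shows "\<exists>B. \<forall>t\<in>{a<..<b}. \<bar>(deriv ^^ n) y t\<bar> \<le> B"
proof -
  let ?h = "(deriv ^^ n) y"
  have c: "continuous_on {a<..<b} ?h" using y n by (simp add: pw_smooth_def)
  obtain la where la: "(?h \<longlongrightarrow> la) (at_right a)" using y n ab by (fastforce simp: pw_smooth_def)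
  obtain lb where lb: "(?h \<longlongrightarrow> lb) (at_left b)" using y n ab by (fastforce simp: pw_smooth_def)
  define k where "k t = (if t = a then la else if t = b then lb else ?h t)" for t
  have "continuous_on {a..b} k"
  proof (rule continuous_on_IccI[OF _ _ _ ab])
    have "(k \<longlongrightarrow> la) (at_right a)"
      by (rule Lim_transform_eventually[OF la])
         (use ab in \<open>auto simp: eventually_at_right k_def intro!: exI[of _ b]\<close>)
    then show "(k \<longlongrightarrow> k a) (at_right a)" by (simp add: k_def)
    have "(k \<longlongrightarrow> lb) (at_left b)"
      by (rule Lim_transform_eventually[OF lb])
         (use ab in \<open>auto simp: eventually_at_left k_def intro!: exI[of _ a]\<close>)
    then show "(k \<longlongrightarrow> k b) (at_left b)" using ab by (simp add: k_def)
    fix x assume x: "a < x" "x < b"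
    have "(?h \<longlongrightarrow> ?h x) (at x)"
      using c x by (auto simp: continuous_on_eq_continuous_at isCont_def)
    then have "(k \<longlongrightarrow> ?h x) (at x)"
      by (rule Lim_transform_within_open[of _ _ _ _ "{a<..<b}"]) (use x in \<open>auto simp: k_def\<close>)
    then show "(k \<longlongrightarrow> k x) (at x)" using x by (simp add: k_def)
  qed
  then have "continuous_on {a..b} (\<lambda>t. \<bar>k t\<bar>)" by (intro continuous_intros)
  then have "\<exists>z\<in>{a..b}. \<forall>t\<in>{a..b}. \<bar>k t\<bar> \<le> \<bar>k z\<bar>"
    using ab by (intro continuous_attains_sup) auto
  then obtain B where "\<forall>t\<in>{a..b}. \<bar>k t\<bar> \<le> B" by blast
  then show ?thesis by (intro exI[of _ B]) (auto simp: k_def split: if_splits)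
qed

text \<open>
  The expansion is made at an interior point, since the derivatives are not available at the ends
  of the cell.
\<close>

lemma taylor_polynomial:
  assumes y: "pw_smooth (q + 1) a b {} y" and ab: "a < b"
    and K: "\<And>t. t \<in> {a<..<b} \<Longrightarrow> \<bar>(deriv ^^ (q + 1)) y t\<bar> \<le> K"
  shows "\<exists>w. degree w \<le> q \<and> (\<forall>t\<in>{a<..<b}. \<bar>y t - poly w t\<bar> \<le> (b - a) ^ (q + 1) * K)"
proof -
  obtain c where c: "a < c" "c < b" using dense[OF ab] by blast
  define w where "w = (\<Sum>m<q + 1. smult ((deriv ^^ m) y c / fact m) ([:- c, 1:] ^ m))"
  have K0: "0 \<le> K" using K[of c] c by (auto intro: order.trans[OF abs_ge_zero])
  have "degree w \<le> q"
    unfolding w_def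
    by (intro degree_sum_le) (auto intro!: order.trans[OF degree_smult_le] order.trans[OF degree_power_le])
  moreover have "\<bar>y t - poly w t\<bar> \<le> (b - a) ^ (q + 1) * K" if t: "t \<in> {a<..<b}" for t
  proof (cases "t = c")
    case True
    have "poly w c = (\<Sum>m<q + 1. (deriv ^^ m) y c / fact m * 0 ^ m)" by (simp add: w_def poly_sum)
    also have "\<dots> = y c" by (subst sum.remove[of _ 0]) (auto intro!: sum.neutral)
    finally show ?thesis using True ab K0 by simp
  next
    case False
    have "\<exists>s. (if t < c then t < s \<and> s < c else c < s \<and> s < t) \<and>
        y t = (\<Sum>m<q + 1. (deriv ^^ m) y c / fact m * (t - c) ^ m) + (deriv ^^ (q + 1)) y s / fact (q + 1) * (t - c) ^ (q + 1)"
    proof (rule Taylor[of "q + 1" "\<lambda>m. (deriv ^^ m) y" y "min t c" "max t c"])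
      show "\<forall>m s. m < q + 1 \<and> min t c \<le> s \<and> s \<le> max t c \<longrightarrow>
          ((deriv ^^ m) y has_real_derivative (deriv ^^ Suc m) y s) (at s)"
      proof (intro allI impI)
        fix m s assume "m < q + 1 \<and> min t c \<le> s \<and> s \<le> max t c"
        then have "m < q + 1" "s \<in> {a<..<b}" using t c by auto
        then have "(deriv ^^ m) y differentiable (at s)" using y by (simp add: pw_smooth_def)
        then show "((deriv ^^ m) y has_real_derivative (deriv ^^ Suc m) y s) (at s)"
          by (simp add: DERIV_deriv_iff_real_differentiable)
      qed
    qed (use False in auto)
    then obtain s where s: "min t c < s" "s < max t c"
      and eq: "y t = (\<Sum>m<q + 1. (deriv ^^ m) y c / fact m * (t - c) ^ m) + (deriv ^^ (q + 1)) y s / fact (q + 1) * (t - c) ^ (q + 1)"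
      by (auto split: if_splits)
    have "poly w t = (\<Sum>m<q + 1. (deriv ^^ m) y c / fact m * (t - c) ^ m)" by (simp add: w_def poly_sum)
    then have "y t - poly w t = (deriv ^^ (q + 1)) y s / fact (q + 1) * (t - c) ^ (q + 1)" using eq by simp
    also have "\<bar>\<dots>\<bar> = \<bar>(deriv ^^ (q + 1)) y s\<bar> / fact (q + 1) * \<bar>t - c\<bar> ^ (q + 1)"
      by (simp add: abs_mult power_abs)
    also have "\<dots> \<le> K * (b - a) ^ (q + 1)"
    proof (intro mult_mono power_mono)
      have "\<bar>(deriv ^^ (q + 1)) y s\<bar> / fact (q + 1) \<le> \<bar>(deriv ^^ (q + 1)) y s\<bar> / 1"
        by (rule divide_left_mono[OF fact_ge_1]) auto
      also have "\<dots> \<le> K" unfolding div_by_1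
        by (rule K) (use s t c in \<open>auto simp: min_def max_def split: if_splits\<close>)
      finally show "\<bar>(deriv ^^ (q + 1)) y s\<bar> / fact (q + 1) \<le> K" .
    qed (use t c K0 in auto)
    finally show ?thesis by (simp add: mult.commute)
  qed
  ultimately show ?thesis by blast
qed

text \<open>
  The degrees vary from cell to cell, whereas the final constants may depend on their bound \<open>Q\<close>
  only.
\<close>

definition interpolation_const :: "nat \<Rightarrow> real \<Rightarrow> bool" where
  "interpolation_const Q C \<longleftrightarrow> C \<ge> 1 \<and> (\<forall>q\<le>Q. \<forall>a b v p w B. a < b \<longrightarrow> continuous_on {a..b} v \<longrightarrow> is_dG q a b v p \<longrightarrow> degree w \<le> q \<longrightarrow>
     (\<forall>x\<in>{a<..<b}. \<bar>v x - poly w x\<bar> \<le> B) \<longrightarrow>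
     (\<forall>x\<in>{a..b}. \<bar>poly p x - poly w x\<bar> \<le> C * B \<and> \<bar>poly p x - v x\<bar> \<le> C * B))"

lemma dG_error:
  "\<exists>C. interpolation_const Q C"
proof -
  have "\<forall>q. \<exists>C\<ge>1. \<forall>a b v p w B. a < b \<longrightarrow> continuous_on {a..b} v \<longrightarrow> is_dG q a b v p \<longrightarrow> degree w \<le> q \<longrightarrow>
     (\<forall>x\<in>{a<..<b}. \<bar>v x - poly w x\<bar> \<le> B) \<longrightarrow> (\<forall>x\<in>{a..b}. \<bar>poly p x - poly w x\<bar> \<le> C * B)"
    using dG_best_approximation by blast
  then obtain C where C1: "\<And>q. C q \<ge> (1::real)" and C: "\<And>q a b v p w B x. a < b \<Longrightarrow> continuous_on {a..b} v \<Longrightarrow> is_dG q a b v p \<Longrightarrow> degree w \<le> q \<Longrightarrow>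
     (\<forall>x\<in>{a<..<b}. \<bar>v x - poly w x\<bar> \<le> B) \<Longrightarrow> x \<in> {a..b} \<Longrightarrow> \<bar>poly p x - poly w x\<bar> \<le> C q * B"
    by metis
  define D where "D = 1 + (\<Sum>q\<le>Q. C q)"
  have "\<bar>poly p x - poly w x\<bar> \<le> D * B \<and> \<bar>poly p x - v x\<bar> \<le> D * B"
    if q: "q \<le> Q" and ab: "a < b" and v: "continuous_on {a..b} v" and p: "is_dG q a b v p" and w: "degree w \<le> q"
      and B: "\<forall>x\<in>{a<..<b}. \<bar>v x - poly w x\<bar> \<le> B" and x: "x \<in> {a..b}" for q a b v p w B x
  proof -
    have B0: "0 \<le> B" using B dense[OF ab] by (meson abs_ge_zero greaterThanLessThan_iff order.trans)
    have vB: "\<bar>v x - poly w x\<bar> \<le> B"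
    proof (rule continuous_ge_on_closure[of "{a<..<b}" "\<lambda>x. B - \<bar>v x - poly w x\<bar>" x 0, simplified])
      show "continuous_on (closure {a<..<b}) (\<lambda>x. B - \<bar>v x - poly w x\<bar>)"
        using ab by (intro continuous_intros) (auto intro: v)
    qed (use x ab B in auto)
    have "C q \<le> (\<Sum>q\<le>Q. C q)" using q C1 by (intro member_le_sum) (auto intro: order.trans[OF zero_le_one])
    then have "C q * B + B \<le> D * B" using mult_right_mono[OF _ B0, of "C q + 1" D] by (simp add: D_def algebra_simps)
    moreover have "\<bar>poly p x - poly w x\<bar> \<le> C q * B" by (rule C[OF ab v p w B x])
    ultimately show ?thesis using vB B0 by linarith
  qed
  moreover have "D \<ge> 1" unfolding D_def using C1 by (simp add: sum_nonneg order.trans[OF zero_le_one])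
  ultimately show ?thesis unfolding interpolation_const_def by blast
qed

lemma pds_zero: "pds js (\<lambda>_. 0) = (\<lambda>_. 0)"
  by (induction js) (auto simp: pds_Nil pds_Cons pd_def fun_eq_iff)

lemma Ck_zero: "Ck N m (\<lambda>_. 0)"
  by (simp add: Ck_def pds_zero)

lemma abs_le_norm_l2: "i < N \<Longrightarrow> \<bar>x i\<bar> \<le> norm_l2 N x"
proof -
  assume i: "i < N"
  have "\<bar>x i\<bar> \<le> L2_set (\<lambda>i. \<bar>x i\<bar>) {..<N}" by (rule member_le_L2_set) (use i in auto)
  then show ?thesis by (simp add: norm_l2_def L2_set_def)
qed

lemma inner_le_norm_l2: "\<bar>inner_N N x y\<bar> \<le> norm_l2 N x * norm_l2 N y"
proof -
  have "\<bar>inner_N N x y\<bar> \<le> (\<Sum>i<N. \<bar>x i\<bar> * \<bar>y i\<bar>)"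
    unfolding inner_N_def by (rule order.trans[OF sum_abs]) (simp add: abs_mult)
  also have "\<dots> \<le> norm_l2 N x * norm_l2 N y" unfolding norm_l2_def by (rule L2_set_mult_ineq)
  finally show ?thesis .
qed

lemma continuous_line_in_rvec:
  "continuous_on S (\<lambda>s::real. (\<lambda>l. s * x l + (1 - s) * y l) :: rvec)"
  by (intro continuous_on_coordinatewise_then_product continuous_intros)

locale mdG = valid_grid G for G :: grid +
  fixes Q :: nat and f :: "rvec \<Rightarrow> real \<Rightarrow> rvec" and u0 :: rvec and u U :: "real \<Rightarrow> rvec"
    and \<psi> :: rvec and g \<Phi> :: "real \<Rightarrow> rvec"
  assumes setting: "mdG_setting Q G f u0 u U \<psi> g \<Phi>"
begin

abbreviation "pu \<equiv> dG_interp G u"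

lemma degQ: "i < N \<Longrightarrow> j \<in> {1..M i} \<Longrightarrow> deg G i j \<le> Q"
  and ivp: "is_ivp G f u0 u" and smooth: "smooth_on_cells G u"
  and Usol: "mdG_solution G f u0 U" and Phisol: "mdG_dual_solution G f u U \<psi> g \<Phi>"
  using setting unfolding mdG_setting_def by auto

lemma U_V: "U \<in> Vspace G" and Phi_V: "\<Phi> \<in> Vspace G"
  using Usol Phisol by (auto simp: mdG_solution_def mdG_dual_solution_def)

lemma f_bounded: "\<exists>B\<ge>0. \<forall>x. \<forall>t\<in>{0<..T}. \<forall>i<N. \<bar>f x t i\<bar> \<le> B"
proof -
  obtain B where "\<forall>x. \<forall>t\<in>{0<..T}. norm_l2 N (f x t) \<le> B"
    using ivp unfolding is_ivp_def by blast
  note B = this[rule_format]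
  have "\<bar>f x t i\<bar> \<le> \<bar>B\<bar>" if "t \<in> {0<..T}" "i < N" for x t i
    using abs_le_norm_l2[OF that(2), of "f x t"] B[OF that(1), of x] by linarith
  then show ?thesis by (intro exI[of _ "\<bar>B\<bar>"]) auto
qed

lemma f_lipschitz:
  "\<exists>L\<ge>0. \<forall>x y. \<forall>t\<in>{0<..T}. \<forall>i<N. \<bar>f x t i - f y t i\<bar> \<le> L * norm_l2 N (\<lambda>l. x l - y l)"
proof -
  obtain L where "\<forall>x y. \<forall>t\<in>{0<..T}. norm_l2 N (\<lambda>i. f x t i - f y t i) \<le> L * norm_l2 N (\<lambda>i. x i - y i)"
    using ivp unfolding is_ivp_def by blast
  note L = this[rule_format]
  have "\<bar>f x t i - f y t i\<bar> \<le> \<bar>L\<bar> * norm_l2 N (\<lambda>l. x l - y l)" if "t \<in> {0<..T}" "i < N" for x y t i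
  proof -
    have "\<bar>f x t i - f y t i\<bar> \<le> norm_l2 N (\<lambda>i. f x t i - f y t i)"
      using abs_le_norm_l2[OF that(2), of "\<lambda>i. f x t i - f y t i"] .
    also have "\<dots> \<le> L * norm_l2 N (\<lambda>l. x l - y l)" by (rule L[OF that(1)])
    also have "\<dots> \<le> \<bar>L\<bar> * norm_l2 N (\<lambda>l. x l - y l)"
      by (intro mult_right_mono) (auto simp: norm_l2_def)
    finally show ?thesis .
  qed
  then show ?thesis by (intro exI[of _ "\<bar>L\<bar>"]) auto
qed

lemma f_dep: "t \<in> {0<..T} \<Longrightarrow> i < N \<Longrightarrow> dep N (\<lambda>x. f x t i)"
  unfolding dep_def
proof (intro allI impI)
  fix x y :: rvec assume t: "t \<in> {0<..T}" and i: "i < N" and xy: "\<forall>l<N. x l = y l"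
  have "norm_l2 N (\<lambda>l. x l - y l) = 0" using xy by (simp add: norm_l2_def L2_set_eq_0_iff)
  moreover obtain L where "\<bar>f x t i - f y t i\<bar> \<le> L * norm_l2 N (\<lambda>l. x l - y l)"
    using f_lipschitz t i by blast
  ultimately show "f x t i = f y t i" by simp
qed

lemma f_Ck1: "t \<in> {0<..T} \<Longrightarrow> i < N \<Longrightarrow> Ck N 1 (\<lambda>x. f x t i)"
  using ivp by (auto simp: is_ivp_def)

lemma f_borel: "i < N \<Longrightarrow> (\<lambda>t. indicator {0<..T} t * f x t i) \<in> borel_measurable borel"
  using ivp by (auto simp: is_ivp_def set_borel_measurable_def)

text \<open>
  The Lipschitz constant bounds every difference quotient.
\<close>

lemma pd_bounded: "\<exists>L\<ge>0. \<forall>x. \<forall>t\<in>{0<..T}. \<forall>i<N. \<forall>j<N. \<bar>pd j (\<lambda>z. f z t i) x\<bar> \<le> L"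
proof -
  obtain L where L0: "L \<ge> 0" and L: "\<And>x y t i. t \<in> {0<..T} \<Longrightarrow> i < N \<Longrightarrow> \<bar>f x t i - f y t i\<bar> \<le> L * norm_l2 N (\<lambda>l. x l - y l)"
    using f_lipschitz by blast
  have "\<bar>pd j (\<lambda>z. f z t i) x\<bar> \<le> L" if t: "t \<in> {0<..T}" and i: "i < N" and j: "j < N" for x t i j
  proof -
    have "((\<lambda>h. (f (x(j := x j + h)) t i - f (x(j := x j)) t i) / h) \<longlongrightarrow> pd j (\<lambda>z. f z t i) x) (at 0)"
      using pd_has_derivative[OF f_Ck1[OF t i] j, of x] by (simp add: DERIV_def)
    then have lim: "((\<lambda>h. \<bar>(f (x(j := x j + h)) t i - f (x(j := x j)) t i) / h\<bar>) \<longlongrightarrow> \<bar>pd j (\<lambda>z. f z t i) x\<bar>) (at 0)"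
      by (intro tendsto_intros)
    have "\<bar>(f (x(j := x j + h)) t i - f (x(j := x j)) t i) / h\<bar> \<le> L" if "h \<noteq> 0" for h
    proof -
      have "norm_l2 N (\<lambda>l. (x(j := x j + h)) l - (x(j := x j)) l) \<le> (\<Sum>l<N. \<bar>(x(j := x j + h)) l - (x(j := x j)) l\<bar>)"
        unfolding norm_l2_def by (rule L2_set_le_sum_abs)
      also have "\<dots> = (\<Sum>l<N. if l = j then \<bar>h\<bar> else 0)" by (intro sum.cong) auto
      also have "\<dots> = \<bar>h\<bar>" using j by simp
      finally have "\<bar>f (x(j := x j + h)) t i - f (x(j := x j)) t i\<bar> \<le> L * \<bar>h\<bar>"
        using L[OF t i, of "x(j := x j + h)" "x(j := x j)"] L0 by (meson mult_left_mono order.trans)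
      then show ?thesis using that by (simp add: divide_simps)
    qed
    then show ?thesis
      by (intro tendsto_upperbound[OF lim]) (auto simp: eventually_at intro!: exI[of _ 1])
  qed
  with L0 show ?thesis by blast
qed

lemma f_mble:
  assumes i: "i < N" and y: "\<And>l. l < N \<Longrightarrow> mble T (\<lambda>t. y t l)"
  shows "mble T (\<lambda>t. f (y t) t i)"
proof -
  have "(\<lambda>t. indicator {0<..T} t * f (\<lambda>l. indicator {0<..T} t * y t l) t i) \<in> borel_measurable borel"
  proof (rule caratheodory_measurable[where N = N and h = "\<lambda>x t. indicator {0<..T} t * f x t i"
      and y = "\<lambda>t l. indicator {0<..T} t * y t l"])
    show "continuous_on UNIV (\<lambda>x. indicator {0<..T} t * f x t i)" for t
      using Ck_continuous[OF f_Ck1[OF _ i]] by (cases "t \<in> {0<..T}") (auto simp: indicator_def)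
    show "dep N (\<lambda>x. indicator {0<..T} t * f x t i)" for t
      using f_dep[OF _ i] by (cases "t \<in> {0<..T}") (auto simp: indicator_def dep_def)
    show "(\<lambda>t. indicator {0<..T} t * f x t i) \<in> borel_measurable borel" for x by (rule f_borel[OF i])
    show "(\<lambda>t. indicator {0<..T} t * y t l) \<in> borel_measurable borel" if "l < N" for l
      using y[OF that] by (simp add: mble_def)
  qed
  moreover have "indicator {0<..T} t * f (\<lambda>l. indicator {0<..T} t * y t l) t i = indicator {0<..T} t * f (y t) t i" for t
    by (cases "t \<in> {0<..T}") (auto simp: indicator_def)
  ultimately show ?thesis by (simp add: mble_def)
qed

lemma Jmat_mble:
  assumes i: "i < N" and j: "j < N"
    and x: "\<And>l. l < N \<Longrightarrow> mble T (\<lambda>t. x t l)" and y: "\<And>l. l < N \<Longrightarrow> mble T (\<lambda>t. y t l)"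
  shows "mble T (\<lambda>t. Jmat f x y t i j)"
proof -
  let ?I = "\<lambda>t. indicator {0<..T} t :: real"
  have "(\<lambda>t. integral {0..1} (\<lambda>s. pd j (\<lambda>z. ?I t * f z t i) (\<lambda>l. s * (?I t * x t l) + (1 - s) * (?I t * y t l)))) \<in> borel_measurable borel"
  proof (rule averaged_pd_measurable[where F = "\<lambda>x t. ?I t * f x t i" and N = N])
    show "Ck N 1 (\<lambda>x. ?I t * f x t i)" for t
      using f_Ck1[OF _ i] Ck_zero by (cases "t \<in> {0<..T}") (auto simp: indicator_def)
    show "dep N (\<lambda>x. ?I t * f x t i)" for t
      using f_dep[OF _ i] by (cases "t \<in> {0<..T}") (auto simp: indicator_def dep_def)
  qed (use f_borel[OF i] x y j in \<open>auto simp: mble_def\<close>)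
  then have "(\<lambda>t. ?I t * integral {0..1} (\<lambda>s. pd j (\<lambda>z. ?I t * f z t i) (\<lambda>l. s * (?I t * x t l) + (1 - s) * (?I t * y t l)))) \<in> borel_measurable borel"
    by (intro borel_measurable_times) auto
  moreover have "?I t * integral {0..1} (\<lambda>s. pd j (\<lambda>z. ?I t * f z t i) (\<lambda>l. s * (?I t * x t l) + (1 - s) * (?I t * y t l)))
     = ?I t * Jmat f x y t i j" for t
    by (cases "t \<in> {0<..T}") (auto simp: indicator_def Jmat_def dfdu_def)
  ultimately show ?thesis by (simp add: mble_def)
qed

lemma pd_continuous: "t \<in> {0<..T} \<Longrightarrow> i < N \<Longrightarrow> j < N \<Longrightarrow> continuous_on UNIV (pd j (\<lambda>z. f z t i))"
  using Ck_continuous[OF Ck_pd[of N 0]] f_Ck1 by simp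

lemma Jmat_integrand_continuous:
  assumes "t \<in> {0<..T}" "i < N" "j < N"
  shows "continuous_on {0..1} (\<lambda>s. pd j (\<lambda>z. f z t i) (\<lambda>l. s * x l + (1 - s) * y l))"
  by (rule continuous_on_compose2[OF pd_continuous[OF assms] continuous_line_in_rvec]) simp

lemma Jmat_bounded: "\<exists>L\<ge>0. \<forall>x y. \<forall>t\<in>{0<..T}. \<forall>i<N. \<forall>j<N. \<bar>Jmat f x y t i j\<bar> \<le> L"
proof -
  obtain L where L0: "L \<ge> 0" and L: "\<And>x t i j. t \<in> {0<..T} \<Longrightarrow> i < N \<Longrightarrow> j < N \<Longrightarrow> \<bar>pd j (\<lambda>z. f z t i) x\<bar> \<le> L"
    using pd_bounded by blast
  have "\<bar>Jmat f x y t i j\<bar> \<le> L" if "t \<in> {0<..T}" "i < N" "j < N" for x y t i j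
    unfolding Jmat_def dfdu_def
    using integral_bound[of 0 1 "\<lambda>s. pd j (\<lambda>z. f z t i) (\<lambda>l. s * x t l + (1 - s) * y t l)" L]
      Jmat_integrand_continuous[OF that] L[OF that] by simp
  with L0 show ?thesis by blast
qed

text \<open>
  The property for which the Jacobian is averaged.
\<close>

lemma Jmat_mean_value:
  assumes "t \<in> {0<..T}" "i < N"
  shows "mat_vec N (Jmat f x y t) (\<lambda>l. x t l - y t l) i = f (x t) t i - f (y t) t i"
  unfolding mat_vec_def Jmat_def dfdu_def
  by (rule mean_value_line_integral[OF f_Ck1[OF assms] f_dep[OF assms]])

lemma adjoint_mble:
  assumes i: "i < N" and x: "\<And>l. l < N \<Longrightarrow> mble T (\<lambda>t. x t l)" and y: "\<And>l. l < N \<Longrightarrow> mble T (\<lambda>t. y t l)"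
  shows "mble T (\<lambda>t. adjoint_rhs f x y \<Phi> t i)"
  unfolding adjoint_rhs_def mat_vec_def transp_def
  by (intro mble_sum mble_mult Jmat_mble x y Vspace_mble[OF Phi_V]) (use i in auto)

lemma adjoint_bounded: "\<exists>B\<ge>0. \<forall>x y. \<forall>t\<in>{0<..T}. \<forall>i<N. \<bar>adjoint_rhs f x y \<Phi> t i\<bar> \<le> B"
proof -
  obtain L where L0: "L \<ge> 0" and L: "\<And>x y t i j. t \<in> {0<..T} \<Longrightarrow> i < N \<Longrightarrow> j < N \<Longrightarrow> \<bar>Jmat f x y t i j\<bar> \<le> L"
    using Jmat_bounded by blast
  obtain P where P0: "P \<ge> 0" and P: "\<And>t i. t \<in> {0<..T} \<Longrightarrow> i < N \<Longrightarrow> \<bar>\<Phi> t i\<bar> \<le> P"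
    using Vspace_bounded[OF Phi_V] by blast
  have "\<bar>adjoint_rhs f x y \<Phi> t i\<bar> \<le> (\<Sum>l<N. L * P)" if "t \<in> {0<..T}" "i < N" for x y t i
    unfolding adjoint_rhs_def mat_vec_def transp_def
    by (rule order.trans[OF sum_abs], intro sum_mono) (use L P that L0 in \<open>auto simp: abs_mult intro!: mult_mono\<close>)
  then show ?thesis using L0 P0 by (intro exI[of _ "\<Sum>l<N. L * P"]) (auto intro!: sum_nonneg)
qed

lemma u_continuous: "i < N \<Longrightarrow> continuous_on {0..T} (\<lambda>t. u t i)"
  and u_init: "i < N \<Longrightarrow> u 0 i = u0 i"
  and u_deriv: "i < N \<Longrightarrow> t \<in> {0<..T} \<Longrightarrow> ((\<lambda>s. u s i) has_real_derivative f (u t) t i) (at t within {0..T})"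
  using ivp by (auto simp: is_ivp_def)

lemma u_mble: "i < N \<Longrightarrow> mble T (\<lambda>t. u t i)"
proof -
  assume i: "i < N"
  have I: "(\<lambda>t. indicator {0..T} t * u t i) \<in> borel_measurable borel"
    using borel_measurable_continuous_on_indicator[OF _ u_continuous[OF i]] by simp
  have "(\<lambda>t. indicator {0<..T} t * (indicator {0..T} t * u t i)) \<in> borel_measurable borel"
    by (intro borel_measurable_times[OF _ I] borel_measurable_indicator) auto
  moreover have "indicator {0<..T} t * (indicator {0..T} t * u t i) = indicator {0<..T} t * u t i" for t
    by (auto simp: indicator_def)
  ultimately show ?thesis by (simp add: mble_def)
qed

lemma u_bounded: "\<exists>B\<ge>0. \<forall>i<N. \<forall>t\<in>{0<..T}. \<bar>u t i\<bar> \<le> B"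
proof -
  have "\<exists>B. \<forall>t\<in>{0..T}. \<bar>u t i\<bar> \<le> B" if "i < N" for i
  proof -
    have "\<exists>z\<in>{0..T}. \<forall>t\<in>{0..T}. \<bar>u t i\<bar> \<le> \<bar>u z i\<bar>"
      using T_pos by (intro continuous_attains_sup continuous_intros u_continuous that) auto
    then show ?thesis by blast
  qed
  then obtain B where B: "\<And>i t. i < N \<Longrightarrow> t \<in> {0..T} \<Longrightarrow> \<bar>u t i\<bar> \<le> B i" by metis
  have "\<bar>u t i\<bar> \<le> (\<Sum>i<N. \<bar>B i\<bar>)" if "i < N" "t \<in> {0<..T}" for i t
  proof -
    have "\<bar>u t i\<bar> \<le> \<bar>B i\<bar>" using B[of i t] that by auto
    also have "\<dots> \<le> (\<Sum>i<N. \<bar>B i\<bar>)" by (rule member_le_sum) (use that in auto)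
    finally show ?thesis .
  qed
  then show ?thesis by (intro exI[of _ "\<Sum>i<N. \<bar>B i\<bar>"]) (auto intro: sum_nonneg)
qed

definition ipoly :: "nat \<Rightarrow> nat \<Rightarrow> real poly" where
  "ipoly i j = dG_poly (deg G i j) (nd i (j - 1)) (nd i j) (\<lambda>s. u s i)"

lemma cell_closure_subset: "i < N \<Longrightarrow> j \<in> {1..M i} \<Longrightarrow> {nd i (j - 1)..nd i j} \<subseteq> {0..T}"
proof -
  assume ij: "i < N" "j \<in> {1..M i}"
  then have "j - 1 \<le> M i" "j \<le> M i" by auto
  then have "0 \<le> nd i (j - 1)" "nd i j \<le> T" using nd_bounds[OF ij(1)] by blast+
  then show ?thesis by auto
qed

lemma u_cell_continuous: "i < N \<Longrightarrow> j \<in> {1..M i} \<Longrightarrow> continuous_on {nd i (j - 1)..nd i j} (\<lambda>t. u t i)"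
  using continuous_on_subset[OF u_continuous cell_closure_subset] by blast

lemma ipoly_is_dG: "i < N \<Longrightarrow> j \<in> {1..M i} \<Longrightarrow> is_dG (deg G i j) (nd i (j - 1)) (nd i j) (\<lambda>s. u s i) (ipoly i j)"
  unfolding ipoly_def by (rule dG_poly_is_dG[OF nd_step u_cell_continuous])

lemma pu_cell: "i < N \<Longrightarrow> j \<in> {1..M i} \<Longrightarrow> t \<in> cell G i j \<Longrightarrow> pu t i = poly (ipoly i j) t"
  by (simp add: dG_interp_def index_cell Let_def ipoly_def)

lemma pu_V: "pu \<in> Vspace G"
  unfolding Vspace_def
proof (intro CollectI allI impI ballI)
  fix i j assume ij: "i < N" "j \<in> {1..M i}"
  show "\<exists>p. degree p \<le> deg G i j \<and> (\<forall>t\<in>cell G i j. pu t i = poly p t)"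
    using pu_cell[OF ij] ipoly_is_dG[OF ij] by (intro exI[of _ "ipoly i j"]) (auto simp: is_dG_def)
qed

lemma pu_mble: "l < N \<Longrightarrow> mble T (\<lambda>t. pu t l)" and U_mble: "l < N \<Longrightarrow> mble T (\<lambda>t. U t l)"
  and Phi_mble: "l < N \<Longrightarrow> mble T (\<lambda>t. \<Phi> t l)"
  by (auto intro: Vspace_mble pu_V U_V Phi_V)

lemma error_adjoint_integrable:
  assumes i: "i < N"
  shows "(\<lambda>t. (pu t i - u t i) * adjoint_rhs f pu u \<Phi> t i) integrable_on {0<..T}"
proof -
  obtain Ba where Ba: "\<And>x y t i. t \<in> {0<..T} \<Longrightarrow> i < N \<Longrightarrow> \<bar>adjoint_rhs f x y \<Phi> t i\<bar> \<le> Ba" using adjoint_bounded by blast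
  obtain Bu where Bu: "\<And>t i. t \<in> {0<..T} \<Longrightarrow> i < N \<Longrightarrow> \<bar>u t i\<bar> \<le> Bu" using u_bounded by blast
  obtain Bp where Bp: "\<And>t i. t \<in> {0<..T} \<Longrightarrow> i < N \<Longrightarrow> \<bar>pu t i\<bar> \<le> Bp" using Vspace_bounded[OF pu_V] by blast
  have "(\<lambda>t. (pu t i - u t i) * adjoint_rhs f pu u \<Phi> t i) absolutely_integrable_on {0<..T}"
  proof (rule mble_bounded_integrable)
    show "mble T (\<lambda>t. (pu t i - u t i) * adjoint_rhs f pu u \<Phi> t i)"
      by (intro mble_mult mble_diff pu_mble u_mble i adjoint_mble)
    show "\<bar>(pu t i - u t i) * adjoint_rhs f pu u \<Phi> t i\<bar> \<le> (Bp + Bu) * Ba" if "t \<in> {0<..T}" for t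
    proof -
      have "\<bar>pu t i - u t i\<bar> \<le> Bp + Bu" using Bp[OF that i] Bu[OF that i] by linarith
      then show ?thesis unfolding abs_mult using Ba[OF that i, of pu u] by (intro mult_mono) auto
    qed
  qed
  then show ?thesis by (rule absolutely_integrable_on_def[THEN iffD1, THEN conjunct1])
qed

lemma f_Phi_integrable:
  assumes i: "i < N" and y: "\<And>l. l < N \<Longrightarrow> mble T (\<lambda>t. y t l)"
  shows "(\<lambda>t. f (y t) t i * \<Phi> t i) integrable_on {0<..T}"
proof -
  obtain B where B0: "B \<ge> 0" and B: "\<And>x t i. t \<in> {0<..T} \<Longrightarrow> i < N \<Longrightarrow> \<bar>f x t i\<bar> \<le> B" using f_bounded by blast
  obtain P where P0: "P \<ge> 0" and P: "\<And>t i. t \<in> {0<..T} \<Longrightarrow> i < N \<Longrightarrow> \<bar>\<Phi> t i\<bar> \<le> P"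
    using Vspace_bounded[OF Phi_V] by blast
  have "(\<lambda>t. f (y t) t i * \<Phi> t i) absolutely_integrable_on {0<..T}"
  proof (rule mble_bounded_integrable)
    show "mble T (\<lambda>t. f (y t) t i * \<Phi> t i)" by (intro mble_mult f_mble i y Phi_mble)
    show "\<bar>f (y t) t i * \<Phi> t i\<bar> \<le> B * P" if "t \<in> {0<..T}" for t
      unfolding abs_mult using B P i that B0 by (intro mult_mono) auto
  qed
  then show ?thesis by (rule absolutely_integrable_on_def[THEN iffD1, THEN conjunct1])
qed

text \<open>
  The interpolant satisfies the discrete equation on the cell with right-hand side \<open>f(u)\<close>. Both
  sides are integrated by parts: the terms at the right node agree because the interpolant is
  exact there, and the integrals against the derivative of \<open>p\<close> agree because this derivative has
  degree less than the order of the interpolant.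
\<close>

lemma interpolant_cell_identity:
  assumes i: "i < N" and j: "j \<in> {1..M i}" and p: "degree p \<le> deg G i j"
  shows "(poly (ipoly i j) (nd i (j - 1)) - u (nd i (j - 1)) i) * poly p (nd i (j - 1))
      + integral {nd i (j - 1)..nd i j} (\<lambda>t. poly (pderiv (ipoly i j)) t * poly p t)
      = integral {nd i (j - 1)..nd i j} (\<lambda>t. f (u t) t i * poly p t)"
proof -
  let ?a = "nd i (j - 1)" and ?b = "nd i j" and ?r = "ipoly i j"
  have ab: "?a < ?b" by (rule nd_step[OF i j])
  have dG: "poly ?r ?b = u ?b i" "\<And>w. degree w < deg G i j \<Longrightarrow> integral {?a..?b} (\<lambda>x. (u x i - poly ?r x) * poly w x) = 0"
    using ipoly_is_dG[OF i j] by (auto simp: is_dG_def)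
  have sub: "{?a..?b} \<subseteq> {0..T}" by (rule cell_closure_subset[OF i j])
  have 1: "((\<lambda>t. poly (pderiv ?r) t * poly p t + poly ?r t * poly (pderiv p) t) has_integral
     (poly ?r ?b * poly p ?b - poly ?r ?a * poly p ?a)) {?a..?b}"
    by (rule fundamental_theorem_of_calculus)
       (use ab in \<open>auto simp: has_real_derivative_iff_has_vector_derivative[symmetric]
          intro!: derivative_eq_intros poly_DERIV[THEN DERIV_subset]\<close>)
  have 2: "((\<lambda>t. f (u t) t i * poly p t + u t i * poly (pderiv p) t) has_integral
     (u ?b i * poly p ?b - u ?a i * poly p ?a)) {?a..?b}"
  proof (rule fundamental_theorem_of_calculus_interior)
    show "continuous_on {?a..?b} (\<lambda>t. u t i * poly p t)"
      by (intro continuous_intros u_cell_continuous i j)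
    fix t assume t: "t \<in> {?a<..<?b}"
    moreover have "0 \<le> ?a" "?b \<le> T" using sub ab by auto
    ultimately have tT: "t \<in> {0<..T}" "0 < t" "t < T" by auto
    have "((\<lambda>s. u s i) has_real_derivative f (u t) t i) (at t)"
      using u_deriv[OF i tT(1)] unfolding at_within_Icc_at[OF tT(2,3)] .
    from DERIV_mult[OF this poly_DERIV[of p t]]
    show "((\<lambda>t. u t i * poly p t) has_vector_derivative f (u t) t i * poly p t + u t i * poly (pderiv p) t) (at t)"
      unfolding has_real_derivative_iff_has_vector_derivative[symmetric] by (simp add: algebra_simps)
  qed (use ab in simp)
  have c: "(\<lambda>t. u t i * poly (pderiv p) t) integrable_on {?a..?b}"
     "(\<lambda>t. poly ?r t * poly (pderiv p) t) integrable_on {?a..?b}"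
     "(\<lambda>t. poly (pderiv ?r) t * poly p t) integrable_on {?a..?b}"
    by (intro integrable_continuous_interval continuous_intros u_cell_continuous i j)+
  have c4: "(\<lambda>t. f (u t) t i * poly p t) integrable_on {?a..?b}"
    using integrable_diff[OF has_integral_integrable[OF 2] c(1)] by simp
  have "integral {?a..?b} (\<lambda>t. f (u t) t i * poly p t) + integral {?a..?b} (\<lambda>t. u t i * poly (pderiv p) t)
      = u ?b i * poly p ?b - u ?a i * poly p ?a"
    using integral_add[OF c4 c(1)] integral_unique[OF 2] by simp
  moreover have "integral {?a..?b} (\<lambda>t. poly (pderiv ?r) t * poly p t) + integral {?a..?b} (\<lambda>t. poly ?r t * poly (pderiv p) t)
      = poly ?r ?b * poly p ?b - poly ?r ?a * poly p ?a"
    using integral_add[OF c(3) c(2)] integral_unique[OF 1] by simp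
  moreover have "integral {?a..?b} (\<lambda>t. u t i * poly (pderiv p) t) = integral {?a..?b} (\<lambda>t. poly ?r t * poly (pderiv p) t)"
  proof (cases "deg G i j = 0")
    case True
    then have "pderiv p = 0" using p by (simp add: pderiv_eq_0_iff)
    then show ?thesis by simp
  next
    case False
    then have "degree (pderiv p) < deg G i j" using p by (simp add: degree_pderiv)
    from dG(2)[OF this] show ?thesis using integral_diff[OF c(1,2)] by (simp add: left_diff_distrib)
  qed
  ultimately show ?thesis using dG(1) by (simp add: algebra_simps)
qed

text \<open>
  The dual equation tested with the error \<open>e = U - \<pi>u\<close> gives \<open>L(e)\<close>; its left-hand side is known
  from the equation for \<open>U\<close> and \<open>interpolant_cell_identity\<close>, both tested with \<open>\<Phi>\<close>. The Jacobian
  averaged between \<open>\<pi>u\<close> and \<open>U\<close> produces exactly \<open>f(U) - f(\<pi>u)\<close>, so \<open>f(U)\<close> cancels.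
\<close>

theorem error_representation:
  "Lfun G \<psi> g (\<lambda>t i. U t i - pu t i)
   = integral {0..T} (\<lambda>t. inner_N N (\<lambda>i. pu t i - u t i) (adjoint_rhs f pu u \<Phi> t))"
proof -
  (* An admissible test function has to vanish before time 0; the value of the error at 0 is
     irrelevant for L. *)
  define e where "e t i = (if 0 < t then U t i - pu t i else 0)" for t i
  have e_cell: "e t i = poly (cell_poly G U i j - ipoly i j) t" if "i < N" "j \<in> {1..M i}" "t \<in> cell G i j" for i j t
  proof -
    have "0 < t" using that cell_subset[OF that(1,2)] by auto
    then show ?thesis using cell_poly(2)[OF U_V that] pu_cell[OF that] by (simp add: e_def)
  qed
  have eV: "e \<in> Vspace G"
    unfolding Vspace_def
  proof (intro CollectI allI impI ballI)
    fix i j assume ij: "i < N" "j \<in> {1..M i}"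
    show "\<exists>p. degree p \<le> deg G i j \<and> (\<forall>t\<in>cell G i j. e t i = poly p t)"
      using e_cell[OF ij] cell_poly(1)[OF U_V ij] ipoly_is_dG[OF ij]
      by (intro exI[of _ "cell_poly G U i j - ipoly i j"]) (auto simp: is_dG_def intro: degree_diff_le)
  qed
  have e0: "((\<lambda>s. e s i) \<longlongrightarrow> 0) (at_left 0)" for i
  proof -
    have "((\<lambda>s. e s i) \<longlongrightarrow> poly 0 (0::real)) (at_left 0)"
      by (rule tendsto_left_poly[of "-1"]) (auto simp: e_def)
    then show ?thesis by simp
  qed
  have er: "((\<lambda>s. e s i) \<longlongrightarrow> poly (cell_poly G U i j - ipoly i j) (nd i (j - 1))) (at_right (nd i (j - 1)))"
    and el: "((\<lambda>s. e s i) \<longlongrightarrow> poly (cell_poly G U i j - ipoly i j) (nd i j)) (at_left (nd i j))"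
    if "i < N" "j \<in> {1..M i}" for i j
    by (rule tendsto_right_poly[OF nd_step[OF that]] tendsto_left_poly[OF nd_step[OF that]],
        rule e_cell[OF that], simp add: cell_def)+
  have L: "Lfun G \<psi> g (\<lambda>t i. U t i - pu t i) = Lfun G \<psi> g e"
  proof -
    have "integral {0..T} (\<lambda>t. inner_N N (\<lambda>i. U t i - pu t i) (g t)) = integral {0..T} (\<lambda>t. inner_N N (e t) (g t))"
      by (rule integral_spike[of "{0}"]) (auto simp: e_def[abs_def])
    then show ?thesis using T_pos by (simp add: Lfun_def e_def[abs_def])
  qed
  define h where "h v w i j = jump (\<lambda>s. v s i) (nd i (j - 1)) * Lim (at_right (nd i (j - 1))) (\<lambda>s. w s i)
           + integral (cell G i j) (\<lambda>t. deriv (\<lambda>s. v s i) t * w t i)" for v w :: "real \<Rightarrow> rvec" and i j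
  have hU: "(\<Sum>i<N. \<Sum>j=1..M i. h U \<Phi> i j) = integral {0..T} (\<lambda>t. inner_N N (f (U t) t) (\<Phi> t))"
    using Usol Phi_V unfolding mdG_solution_def h_def by blast
  have he: "(\<Sum>i<N. \<Sum>j=1..M i. h e \<Phi> i j)
     = integral {0..T} (\<lambda>t. inner_N N (mat_vec N (Jmat f pu U t) (e t)) (\<Phi> t)) + Lfun G \<psi> g e"
    using Phisol eV e0 unfolding mdG_dual_solution_def h_def by blast
  have diff: "h e \<Phi> i j = h U \<Phi> i j - integral (cell G i j) (\<lambda>t. f (u t) t i * \<Phi> t i)"
    if i: "i < N" and j: "j \<in> {1..M i}" for i j
  proof -
    let ?a = "nd i (j - 1)" and ?b = "nd i j" and ?p = "cell_poly G \<Phi> i j" and ?PU = "cell_poly G U i j"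
    have LPhi: "Lim (at_right ?a) (\<lambda>s. \<Phi> s i) = poly ?p ?a"
      by (rule Lim_right[OF Vspace_right_limit[OF Phi_V i j]])
    (* At the first node U jumps from u0 = u(0); at the others the interpolant starts from its
       value in the previous cell, which is u there. In both cases the jump of e is that of U
       minus the defect of the interpolant. *)
    have J: "jump (\<lambda>s. e s i) ?a = jump (\<lambda>s. U s i) ?a - (poly (ipoly i j) ?a - u ?a i)"
    proof (cases "j = 1")
      case True
      have U0: "((\<lambda>s. U s i) \<longlongrightarrow> u0 i) (at_left ?a)" using Usol i True by (simp add: mdG_solution_def nd0)
      have "((\<lambda>s. e s i) \<longlongrightarrow> 0) (at_left ?a)" using e0 True i by (simp add: nd0)
      then show ?thesis
        using jump_eq[OF er[OF i j]] jump_eq[OF Vspace_right_limit[OF U_V i j] U0] True i by (simp add: nd0 u_init)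
    next
      case False
      then have j': "j - 1 \<in> {1..M i}" using j by auto
      have "poly (ipoly i (j - 1)) (nd i (j - 1)) = u (nd i (j - 1)) i"
        using ipoly_is_dG[OF i j'] by (simp add: is_dG_def)
      then show ?thesis
        using jump_eq[OF er[OF i j] el[OF i j']] jump_eq[OF Vspace_right_limit[OF U_V i j] Vspace_left_limit[OF U_V i j']]
        by simp
    qed
    have D: "integral (cell G i j) (\<lambda>t. deriv (\<lambda>s. e s i) t * \<Phi> t i)
       = integral {?a..?b} (\<lambda>t. poly (pderiv ?PU) t * poly ?p t - poly (pderiv (ipoly i j)) t * poly ?p t)"
      unfolding integral_Ioc[symmetric] unfolding cell_def
    proof (rule integral_cong_interior)
      fix t assume t: "t \<in> {?a<..<?b}"
      have "deriv (\<lambda>s. e s i) t = poly (pderiv (?PU - ipoly i j)) t"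
        by (rule deriv_eq_poly[OF t]) (rule e_cell[OF i j], simp add: cell_def)
      moreover have "\<Phi> t i = poly ?p t" by (rule cell_poly[OF Phi_V i j]) (use t in \<open>simp add: cell_def\<close>)
      ultimately show "deriv (\<lambda>s. e s i) t * \<Phi> t i = poly (pderiv ?PU) t * poly ?p t - poly (pderiv (ipoly i j)) t * poly ?p t"
        by (simp add: pderiv_diff left_diff_distrib)
    qed
    have D': "integral (cell G i j) (\<lambda>t. deriv (\<lambda>s. U s i) t * \<Phi> t i) = integral {?a..?b} (\<lambda>t. poly (pderiv ?PU) t * poly ?p t)"
      unfolding integral_Ioc[symmetric] unfolding cell_def
    proof (rule integral_cong_interior)
      fix t assume t: "t \<in> {?a<..<?b}"
      have "deriv (\<lambda>s. U s i) t = poly (pderiv ?PU) t" by (rule Vspace_deriv[OF U_V i j t])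
      moreover have "\<Phi> t i = poly ?p t" by (rule cell_poly[OF Phi_V i j]) (use t in \<open>simp add: cell_def\<close>)
      ultimately show "deriv (\<lambda>s. U s i) t * \<Phi> t i = poly (pderiv ?PU) t * poly ?p t" by simp
    qed
    have "integral (cell G i j) (\<lambda>t. f (u t) t i * \<Phi> t i) = integral {?a..?b} (\<lambda>t. f (u t) t i * poly ?p t)"
      unfolding integral_Ioc[symmetric] unfolding cell_def
      by (rule integral_cong) (use cell_poly(2)[OF Phi_V i j] in \<open>auto simp: cell_def\<close>)
    moreover have "integral {?a..?b} (\<lambda>t. poly (pderiv ?PU) t * poly ?p t - poly (pderiv (ipoly i j)) t * poly ?p t)
        = integral {?a..?b} (\<lambda>t. poly (pderiv ?PU) t * poly ?p t) - integral {?a..?b} (\<lambda>t. poly (pderiv (ipoly i j)) t * poly ?p t)"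
      by (intro integral_diff integrable_continuous_interval continuous_intros)
    ultimately show ?thesis
      using interpolant_cell_identity[OF i j cell_poly(1)[OF Phi_V i j]]
      unfolding h_def LPhi J D D' by (simp add: algebra_simps)
  qed
  (* W y collects the integral of (f(y), Phi); the claim becomes L(e) = W(pu) - W(u). *)
  define W where "W y = integral {0..T} (\<lambda>t. inner_N N (f (y t) t) (\<Phi> t))" for y
  have Wsum: "W y = (\<Sum>i<N. integral {0..T} (\<lambda>t. f (y t) t i * \<Phi> t i))"
    and Wint: "(\<lambda>t. inner_N N (f (y t) t) (\<Phi> t)) integrable_on {0..T}"
    if y: "\<And>l. l < N \<Longrightarrow> mble T (\<lambda>t. y t l)" for y
  proof -
    have "(\<lambda>t. f (y t) t i * \<Phi> t i) integrable_on {0..T}" if "i < N" for i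
      using f_Phi_integrable[OF that y] by (simp add: integrable_Ioc[symmetric])
    then show "W y = (\<Sum>i<N. integral {0..T} (\<lambda>t. f (y t) t i * \<Phi> t i))"
      "(\<lambda>t. inner_N N (f (y t) t) (\<Phi> t)) integrable_on {0..T}"
      unfolding W_def inner_N_def by (auto intro!: integral_sum integrable_sum)
  qed
  have "(\<Sum>i<N. \<Sum>j=1..M i. integral (cell G i j) (\<lambda>t. f (u t) t i * \<Phi> t i)) = W u"
  proof -
    have "(\<Sum>j=1..M i. integral (cell G i j) (\<lambda>t. f (u t) t i * \<Phi> t i)) = integral {0..T} (\<lambda>t. f (u t) t i * \<Phi> t i)"
      if "i < N" for i
      by (rule integral_cells[symmetric, OF that f_Phi_integrable[OF that u_mble]])
    then show ?thesis using Wsum[of u] u_mble by simp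
  qed
  moreover have "(\<Sum>i<N. \<Sum>j=1..M i. h e \<Phi> i j)
      = (\<Sum>i<N. \<Sum>j=1..M i. h U \<Phi> i j) - (\<Sum>i<N. \<Sum>j=1..M i. integral (cell G i j) (\<lambda>t. f (u t) t i * \<Phi> t i))"
    by (simp add: diff sum_subtractf)
  ultimately have 1: "integral {0..T} (\<lambda>t. inner_N N (mat_vec N (Jmat f pu U t) (e t)) (\<Phi> t)) + Lfun G \<psi> g e = W U - W u"
    using he hU by (simp add: W_def)
  have "integral {0..T} (\<lambda>t. inner_N N (mat_vec N (Jmat f pu U t) (e t)) (\<Phi> t))
     = integral {0..T} (\<lambda>t. inner_N N (f (U t) t) (\<Phi> t) - inner_N N (f (pu t) t) (\<Phi> t))"
  proof (rule integral_spike[of "{0}"])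
    fix t assume "t \<in> {0..T} - {0}"
    then have t: "t \<in> {0<..T}" by auto
    have "mat_vec N (Jmat f pu U t) (e t) i = f (U t) t i - f (pu t) t i" if "i < N" for i
    proof -
      have "mat_vec N (Jmat f pu U t) (e t) i = - mat_vec N (Jmat f pu U t) (\<lambda>l. pu t l - U t l) i"
        using t by (simp add: mat_vec_def e_def sum_negf[symmetric] algebra_simps)
      then show ?thesis by (simp add: Jmat_mean_value[OF t that])
    qed
    then show "inner_N N (f (U t) t) (\<Phi> t) - inner_N N (f (pu t) t) (\<Phi> t) = inner_N N (mat_vec N (Jmat f pu U t) (e t)) (\<Phi> t)"
      by (simp add: inner_N_def left_diff_distrib sum_subtractf)
  qed auto
  also have "\<dots> = W U - W pu"
    unfolding W_def by (intro integral_diff Wint U_mble pu_mble)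
  finally have "Lfun G \<psi> g e = W pu - W u" using 1 by simp
  also have "\<dots> = integral {0..T} (\<lambda>t. inner_N N (f (pu t) t) (\<Phi> t) - inner_N N (f (u t) t) (\<Phi> t))"
    unfolding W_def by (rule integral_diff[symmetric]) (intro Wint u_mble pu_mble, assumption)+
  also have "\<dots> = integral {0..T} (\<lambda>t. inner_N N (\<lambda>i. pu t i - u t i) (adjoint_rhs f pu u \<Phi> t))"
  proof (rule integral_spike[of "{0}"])
    fix t assume "t \<in> {0..T} - {0}"
    then have t: "t \<in> {0<..T}" by auto
    have "inner_N N (f (pu t) t) (\<Phi> t) - inner_N N (f (u t) t) (\<Phi> t)
        = inner_N N (mat_vec N (Jmat f pu u t) (\<lambda>i. pu t i - u t i)) (\<Phi> t)"
      by (simp add: inner_N_def Jmat_mean_value[OF t] left_diff_distrib sum_subtractf)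
    then show "inner_N N (\<lambda>i. pu t i - u t i) (adjoint_rhs f pu u \<Phi> t) = inner_N N (f (pu t) t) (\<Phi> t) - inner_N N (f (u t) t) (\<Phi> t)"
      by (simp add: inner_transp adjoint_rhs_def)
  qed auto
  finally show ?thesis using L by simp
qed

lemma cell_norm_bound:
  assumes i: "i < N" and j: "j \<in> {1..M i}" and t: "t \<in> {nd i (j - 1)<..<nd i j}"
  shows "\<bar>(deriv ^^ (deg G i j + 1)) (\<lambda>s. u s i) t\<bar> \<le> cell_norm G u i j"
  unfolding cell_norm_def
proof (rule cSUP_upper[OF t])
  have "pw_smooth (deg G i j + 1) (nd i (j - 1)) (nd i j) {} (\<lambda>t. u t i)"
    using smooth i j by (simp add: smooth_on_cells_def)
  from pw_smooth_bounded[OF this nd_step[OF i j] order.refl]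
  show "bdd_above ((\<lambda>t. \<bar>(deriv ^^ (deg G i j + 1)) (\<lambda>s. u s i) t\<bar>) ` {nd i (j - 1)<..<nd i j})"
    by (auto simp: bdd_above_def)
qed

lemma cell_norm_nonneg: "i < N \<Longrightarrow> j \<in> {1..M i} \<Longrightarrow> 0 \<le> cell_norm G u i j"
  using cell_norm_bound dense[OF nd_step] by (meson abs_ge_zero greaterThanLessThan_iff order.trans)

end

lemma mdG_setting_locale:
  assumes "mdG_setting Q G f u0 u U \<psi> g \<Phi>"
  shows "mdG G Q f u0 u U \<psi> g \<Phi>"
proof -
  have "is_grid G" using assms unfolding mdG_setting_def by blast
  then show ?thesis by (intro mdG.intro valid_grid.intro mdG_axioms.intro assms)
qed

text \<open>
  Compare the interpolant with the Taylor polynomial of \<open>u\<close> on the cell.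
\<close>

lemma interpolation_error:
  "\<exists>C\<ge>1. \<forall>G f u0 u U \<psi> g \<Phi>. mdG_setting Q G f u0 u U \<psi> g \<Phi> \<longrightarrow>
     (\<forall>i<ncomp G. \<forall>j\<in>{1..ncell G i}. \<forall>t\<in>cell G i j.
        \<bar>dG_interp G u t i - u t i\<bar> \<le> C * (step G i j ^ (deg G i j + 1) * cell_norm G u i j))"
proof -
  obtain C where C0: "interpolation_const Q C" using dG_error by blast
  note C1 = C0[unfolded interpolation_const_def, THEN conjunct1] and C' = C0[unfolded interpolation_const_def, THEN conjunct2]
  note C = C'[rule_format, THEN conjunct2]
  have "\<bar>dG_interp G u t i - u t i\<bar> \<le> C * (step G i j ^ (deg G i j + 1) * cell_norm G u i j)"
    if S: "mdG_setting Q G f u0 u U \<psi> g \<Phi>" and i: "i < ncomp G" and j: "j \<in> {1..ncell G i}" and t: "t \<in> cell G i j"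
    for G f u0 u U \<psi> g \<Phi> i j t
  proof -
    interpret mdG G Q f u0 u U \<psi> g \<Phi>
      by (rule mdG_setting_locale[OF S])
    have "pw_smooth (deg G i j + 1) (nd i (j - 1)) (nd i j) {} (\<lambda>t. u t i)"
      using smooth i j by (simp add: smooth_on_cells_def)
    from taylor_polynomial[OF this nd_step[OF i j] cell_norm_bound[OF i j]]
    obtain w where w: "degree w \<le> deg G i j"
      "\<forall>t\<in>{nd i (j - 1)<..<nd i j}. \<bar>u t i - poly w t\<bar> \<le> (nd i j - nd i (j - 1)) ^ (deg G i j + 1) * cell_norm G u i j"
      by blast
    have "t \<in> {nd i (j - 1)..nd i j}" using t by (auto simp: cell_def)
    from C[OF degQ[OF i j] nd_step[OF i j] u_cell_continuous[OF i j] ipoly_is_dG[OF i j] w(1) w(2)[rule_format] this]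
    show ?thesis using pu_cell[OF i j t] by (simp add: step_def)
  qed
  then show ?thesis by (intro exI[of _ C] conjI C1 allI impI ballI)
qed

lemma (in mdG) norm_l2_ku_bdd: "bdd_above ((\<lambda>t. norm_l2 N (ku G u t)) ` {0<..T})"
proof -
  define B where "B i = (\<Sum>j=1..M i. step G i j ^ (deg G i j + 1) * cell_norm G u i j)" for i
  have "norm_l2 N (ku G u t) \<le> (\<Sum>i<N. B i)" if t: "t \<in> {0<..T}" for t
  proof -
    have "norm_l2 N (ku G u t) \<le> (\<Sum>i<N. \<bar>ku G u t i\<bar>)"
      unfolding norm_l2_def by (rule L2_set_le_sum_abs)
    also have "\<dots> \<le> (\<Sum>i<N. B i)"
    proof (rule sum_mono)
      fix i assume "i \<in> {..<N}"
      then have i: "i < N" by simp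
      define j where "j = index_at (nd i) t"
      have j: "j \<in> {1..M i}" using index_cell_exists[OF i t] by (simp add: j_def)
      have nn: "0 \<le> step G i j ^ (deg G i j + 1) * cell_norm G u i j" if "j \<in> {1..M i}" for j
        using cell_norm_nonneg[OF i that] step_pos[OF i that] by (intro mult_nonneg_nonneg) auto
      have "\<bar>ku G u t i\<bar> = step G i j ^ (deg G i j + 1) * cell_norm G u i j"
        using nn[OF j] unfolding ku_def Let_def j_def[symmetric] by simp
      also have "\<dots> \<le> B i" unfolding B_def by (rule member_le_sum) (use j nn in auto)
      finally show "\<bar>ku G u t i\<bar> \<le> B i" .
    qed
    finally show ?thesis .
  qed
  then show ?thesis by (auto simp: bdd_above_def intro!: exI[of _ "\<Sum>i<N. B i"])
qed

text \<open>
  Cauchy-Schwarz in \<open>\<real>\<^sup>N\<close> at every time, with the interpolation error measured cell by cell.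
\<close>

theorem a_priori_estimate:
  "\<exists>C>0. \<forall>G f u0 u U \<psi> g \<Phi>. mdG_setting Q G f u0 u U \<psi> g \<Phi> \<longrightarrow>
        \<bar>Lfun G \<psi> g (\<lambda>t i. U t i - dG_interp G u t i)\<bar>
        \<le> C * stab_S G f u \<Phi> * (SUP t\<in>{0<..tfin G}. norm_l2 (ncomp G) (ku G u t))"
proof -
  obtain C where C1: "C \<ge> 1" and C': "\<forall>G f u0 u U \<psi> g \<Phi>. mdG_setting Q G f u0 u U \<psi> g \<Phi> \<longrightarrow>
     (\<forall>i<ncomp G. \<forall>j\<in>{1..ncell G i}. \<forall>t\<in>cell G i j.
        \<bar>dG_interp G u t i - u t i\<bar> \<le> C * (step G i j ^ (deg G i j + 1) * cell_norm G u i j))"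
    using interpolation_error[of Q] by blast
  note C = C'[rule_format]
  have "\<bar>Lfun G \<psi> g (\<lambda>t i. U t i - dG_interp G u t i)\<bar>
        \<le> C * stab_S G f u \<Phi> * (SUP t\<in>{0<..tfin G}. norm_l2 (ncomp G) (ku G u t))"
    if S: "mdG_setting Q G f u0 u U \<psi> g \<Phi>" for G f u0 u U \<psi> g \<Phi>
  proof -
    interpret mdG G Q f u0 u U \<psi> g \<Phi>
      by (rule mdG_setting_locale[OF S])
    let ?a = "adjoint_rhs f pu u \<Phi>"
    let ?K = "SUP t\<in>{0<..T}. norm_l2 N (ku G u t)"
    obtain B where B: "\<And>x y t i. t \<in> {0<..T} \<Longrightarrow> i < N \<Longrightarrow> \<bar>adjoint_rhs f x y \<Phi> t i\<bar> \<le> B"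
      using adjoint_bounded by blast
    have a_m: "mble T (\<lambda>t. ?a t i)" if "i < N" for i by (rule adjoint_mble[OF that pu_mble u_mble])
    have i1: "(\<lambda>t. norm_l2 N (?a t)) integrable_on {0<..T}"
    proof -
      have "(\<lambda>t. norm_l2 N (?a t)) absolutely_integrable_on {0<..T}"
      proof (rule mble_bounded_integrable)
        show "mble T (\<lambda>t. norm_l2 N (?a t))"
          unfolding norm_l2_def L2_set_def power2_eq_square
          by (intro mble_sqrt mble_sum mble_mult a_m) auto
        show "\<bar>norm_l2 N (?a t)\<bar> \<le> (\<Sum>i<N. B)" if "t \<in> {0<..T}" for t
        proof -
          have "\<bar>norm_l2 N (?a t)\<bar> \<le> (\<Sum>i<N. \<bar>?a t i\<bar>)"
            unfolding norm_l2_def using L2_set_le_sum_abs[of "?a t" "{..<N}"] by simp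
          also have "\<dots> \<le> (\<Sum>i<N. B)" by (intro sum_mono B that) auto
          finally show ?thesis .
        qed
      qed
      then show ?thesis by (rule absolutely_integrable_on_def[THEN iffD1, THEN conjunct1])
    qed
    have i2: "(\<lambda>t. inner_N N (\<lambda>i. pu t i - u t i) (?a t)) integrable_on {0<..T}"
      unfolding inner_N_def by (intro integrable_sum error_adjoint_integrable) auto
    have pt: "\<bar>inner_N N (\<lambda>i. pu t i - u t i) (?a t)\<bar> \<le> C * ?K * norm_l2 N (?a t)" if t: "t \<in> {0<..T}" for t
    proof -
      have "norm_l2 N (\<lambda>i. pu t i - u t i) = norm_l2 N (\<lambda>i. \<bar>pu t i - u t i\<bar>)"
        by (simp add: norm_l2_def L2_set_def)
      also have "\<dots> \<le> norm_l2 N (\<lambda>i. C * ku G u t i)"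
        unfolding norm_l2_def
      proof (rule L2_set_mono)
        fix i assume "i \<in> {..<N}"
        then have i: "i < N" by simp
        show "\<bar>pu t i - u t i\<bar> \<le> C * ku G u t i"
          using C[OF S i index_cell_exists[OF i t]] by (simp add: ku_def Let_def)
      qed auto
      also have "\<dots> = C * norm_l2 N (ku G u t)"
        unfolding norm_l2_def using C1 by (simp add: L2_set_right_distrib)
      also have "\<dots> \<le> C * ?K"
        using C1 cSUP_upper[OF t norm_l2_ku_bdd] by (intro mult_left_mono) auto
      finally have "norm_l2 N (\<lambda>i. pu t i - u t i) * norm_l2 N (?a t) \<le> C * ?K * norm_l2 N (?a t)"
        by (intro mult_right_mono) (auto simp: norm_l2_def)
      then show ?thesis using inner_le_norm_l2[of N "\<lambda>i. pu t i - u t i" "?a t"] by linarith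
    qed
    have 1: "Lfun G \<psi> g (\<lambda>t i. U t i - pu t i) = integral {0<..T} (\<lambda>t. inner_N N (\<lambda>i. pu t i - u t i) (?a t))"
      unfolding integral_Ioc by (rule error_representation)
    have 2: "norm (integral {0<..T} (\<lambda>t. inner_N N (\<lambda>i. pu t i - u t i) (?a t)))
        \<le> integral {0<..T} (\<lambda>t. C * ?K * norm_l2 N (?a t))"
      by (rule integral_norm_bound_integral[OF i2 integrable_on_mult_right[OF i1]])
         (simp only: real_norm_def pt)
    have 3: "integral {0<..T} (\<lambda>t. C * ?K * norm_l2 N (?a t)) = C * ?K * stab_S G f u \<Phi>"
      unfolding stab_S_def integral_Ioc adjoint_rhs_def by (rule integral_mult_right)
    show ?thesis
      using 2 unfolding 1 3 real_norm_def by (simp only: mult.assoc mult.left_commute mult.commute)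
  qed
  moreover have "C > 0" using C1 by simp
  ultimately show ?thesis by (intro exI[of _ C] conjI allI impI)
qed

section \<open>Local polynomial approximability\<close>

text \<open>
  A substitute for bounds \<open>M c\<^sup>m\<close> of the derivatives of order \<open>m \<le> r\<close> that makes sense for
  discontinuous functions. In the application \<open>s\<close> is the rescaled time \<open>c (t - t\<^sub>0)\<close>, and \<open>e\<close> is
  its size on \<open>W\<close> up to a constant; the coefficients correspond to the derivatives at \<open>t\<^sub>0\<close> and
  the error to the remainder of Taylor's formula.
\<close>

definition apx :: "nat \<Rightarrow> real \<Rightarrow> real set \<Rightarrow> (real \<Rightarrow> real) \<Rightarrow> real \<Rightarrow> (real \<Rightarrow> real) \<Rightarrow> bool" where
  "apx r M W s e h \<longleftrightarrow> (\<exists>p::real poly. (\<forall>m. \<bar>coeff p m\<bar> \<le> M) \<and> (\<forall>m\<ge>r. coeff p m = 0) \<and>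
     (\<forall>t\<in>W. \<bar>h t - poly p (s t)\<bar> \<le> M * e ^ r))"

lemma poly_as_sum:
  fixes p :: "'a :: comm_semiring_1 poly"
  assumes "\<forall>m\<ge>r. coeff p m = 0"
  shows "poly p x = (\<Sum>m<r. coeff p m * x ^ m)"
proof -
  have "p = (\<Sum>m<r. monom (coeff p m) m)"
    using assms by (auto simp: poly_eq_iff coeff_sum)
  then have "poly p x = poly (\<Sum>m<r. monom (coeff p m) m) x" by simp
  then show ?thesis by (simp add: poly_sum poly_monom)
qed

lemma poly_bound_by_coeffs:
  fixes p :: "real poly"
  assumes "\<And>m. \<bar>coeff p m\<bar> \<le> M" "\<forall>m\<ge>r. coeff p m = 0" "\<bar>x\<bar> \<le> \<rho>"
  shows "\<bar>poly p x\<bar> \<le> M * (\<Sum>m<r. \<rho> ^ m)"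
proof -
  have M0: "0 \<le> M" using assms(1)[of 0] by linarith
  have "\<bar>poly p x\<bar> \<le> (\<Sum>m<r. M * \<rho> ^ m)"
    unfolding poly_as_sum[OF assms(2)]
    by (rule order.trans[OF sum_abs], intro sum_mono)
       (use assms M0 in \<open>auto simp: abs_mult power_abs intro!: mult_mono power_mono\<close>)
  then show ?thesis by (simp add: sum_distrib_left)
qed

lemma apx_mono:
  assumes "apx r M W s e h" "M \<le> M'" "W' \<subseteq> W" "0 \<le> e"
  shows "apx r M' W' s e h"
proof -
  obtain p where p: "\<forall>m. \<bar>coeff p m\<bar> \<le> M" "\<forall>m\<ge>r. coeff p m = 0" "\<forall>t\<in>W. \<bar>h t - poly p (s t)\<bar> \<le> M * e ^ r"
    using assms(1) by (auto simp: apx_def)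
  have "M * e ^ r \<le> M' * e ^ r" using assms by (intro mult_right_mono) auto
  then have "\<bar>h t - poly p (s t)\<bar> \<le> M' * e ^ r" if "t \<in> W'" for t
    using p(3)[rule_format, of t] assms(3) that by (meson order.trans subsetD)
  moreover have "\<bar>coeff p m\<bar> \<le> M'" for m using p(1)[rule_format, of m] assms(2) by linarith
  ultimately show ?thesis unfolding apx_def using p(2) by (intro exI[of _ p]) blast
qed

lemma apx_cong: "(\<And>t. t \<in> W \<Longrightarrow> h t = h' t) \<Longrightarrow> apx r M W s e h \<longleftrightarrow> apx r M W s e h'"
  unfolding apx_def by auto

lemma apx_0: "(\<And>t. t \<in> W \<Longrightarrow> \<bar>h t\<bar> \<le> M) \<Longrightarrow> 0 \<le> M \<Longrightarrow> apx 0 M W s e h"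
  unfolding apx_def by (intro exI[of _ 0]) auto

lemma apx_add:
  assumes "apx r M W s e h" "apx r M' W s e h'"
  shows "apx r (M + M') W s e (\<lambda>t. h t + h' t)"
proof -
  obtain p where p: "\<forall>m. \<bar>coeff p m\<bar> \<le> M" "\<forall>m\<ge>r. coeff p m = 0" "\<forall>t\<in>W. \<bar>h t - poly p (s t)\<bar> \<le> M * e ^ r"
    using assms(1) by (auto simp: apx_def)
  obtain p' where p': "\<forall>m. \<bar>coeff p' m\<bar> \<le> M'" "\<forall>m\<ge>r. coeff p' m = 0" "\<forall>t\<in>W. \<bar>h' t - poly p' (s t)\<bar> \<le> M' * e ^ r"
    using assms(2) by (auto simp: apx_def)
  have "\<bar>coeff (p + p') m\<bar> \<le> M + M'" for m
    using p(1)[rule_format, of m] p'(1)[rule_format, of m] by simp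
  moreover have "\<bar>h t + h' t - poly (p + p') (s t)\<bar> \<le> (M + M') * e ^ r" if "t \<in> W" for t
  proof -
    have "\<bar>h t - poly p (s t)\<bar> \<le> M * e ^ r" "\<bar>h' t - poly p' (s t)\<bar> \<le> M' * e ^ r" using p p' that by auto
    then show ?thesis by (simp add: distrib_right)
  qed
  ultimately show ?thesis unfolding apx_def using p(2) p'(2) by (intro exI[of _ "p + p'"]) auto
qed

lemma apx_sum:
  assumes "\<And>m. m < (l::nat) \<Longrightarrow> apx r (M m) W s e (h m)"
  shows "apx r (\<Sum>m<l. M m) W s e (\<lambda>t. \<Sum>m<l. h m t)"
  using assms
proof (induction l)
  case 0
  then show ?case by (auto simp: apx_def intro!: exI[of _ 0])
next
  case (Suc l)
  then show ?case using apx_add[of r "\<Sum>m<l. M m" W s e "\<lambda>t. \<Sum>m<l. h m t" "M l" "h l"] by simp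
qed

lemma apx_const:
  assumes "1 \<le> r" "\<bar>a\<bar> \<le> M" "0 \<le> e"
  shows "apx r M W s e (\<lambda>_. a)"
proof -
  have "0 \<le> M * e ^ r" using assms by (intro mult_nonneg_nonneg) auto
  moreover have "0 \<le> M" using assms by linarith
  ultimately show ?thesis using assms
    unfolding apx_def by (intro exI[of _ "[:a:]"]) (auto simp: coeff_pCons split: nat.split)
qed

text \<open>
  At order 1 the approximating polynomial is constant.
\<close>

lemma apx_lipschitz:
  assumes "apx 1 M W s e h" "t0 \<in> W" "h t0 = 0" "t \<in> W"
  shows "\<bar>h t\<bar> \<le> 2 * M * e"
proof -
  obtain p where p: "\<forall>m\<ge>1. coeff p m = 0" "\<forall>t\<in>W. \<bar>h t - poly p (s t)\<bar> \<le> M * e ^ 1"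
    using assms(1) by (auto simp: apx_def)
  have "poly p x = coeff p 0" for x using poly_as_sum[OF p(1), of x] by simp
  then have "\<bar>h t0 - coeff p 0\<bar> \<le> M * e" "\<bar>h t - coeff p 0\<bar> \<le> M * e" using p(2) assms by auto
  then show ?thesis using assms(3) by linarith
qed

text \<open>
  A power \<open>s\<^sup>m\<close> with \<open>m \<ge> r\<close> is of size \<open>e\<^sup>r\<close> and belongs to the error. This is where boundedness
  of \<open>e\<close> by \<open>E\<close> enters: surplus powers of \<open>e\<close> are absorbed into the constant.
\<close>

lemma truncation:
  assumes "0 \<le> R" "0 \<le> E"
  shows "\<exists>K\<ge>1. \<forall>r M W s e h (p::real poly). degree p \<le> D \<longrightarrow> (\<forall>m. \<bar>coeff p m\<bar> \<le> M) \<longrightarrow> 0 \<le> e \<longrightarrow> e \<le> E \<longrightarrow>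
     (\<forall>t\<in>W. \<bar>s t\<bar> \<le> R * e) \<longrightarrow> (\<forall>t\<in>W. \<bar>h t - poly p (s t)\<bar> \<le> M * e ^ r) \<longrightarrow> apx r (K * M) W s e h"
proof -
  define S where "S = (\<Sum>m\<le>D. \<Sum>l\<le>D. R ^ m * E ^ l)"
  have S0: "0 \<le> S" unfolding S_def using assms by (intro sum_nonneg) auto
  have "apx r ((1 + S) * M) W s e h"
    if p: "degree p \<le> D" and M: "\<forall>m. \<bar>coeff p m\<bar> \<le> M" and e: "0 \<le> e" "e \<le> E"
      and s: "\<forall>t\<in>W. \<bar>s t\<bar> \<le> R * e" and h: "\<forall>t\<in>W. \<bar>h t - poly p (s t)\<bar> \<le> M * e ^ r"
    for r M W s e h and p :: "real poly"
  proof -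
    have M0: "0 \<le> M" using M[rule_format, of 0] by linarith
    have tail: "\<bar>poly p (s t) - poly (poly_cutoff r p) (s t)\<bar> \<le> S * M * e ^ r" if t: "t \<in> W" for t
    proof -
      have "poly p (s t) - poly (poly_cutoff r p) (s t) = poly (p - poly_cutoff r p) (s t)" by simp
      also have "\<dots> = (\<Sum>m<Suc D. coeff (p - poly_cutoff r p) m * s t ^ m)"
        by (rule poly_as_sum) (use p in \<open>auto simp: coeff_poly_cutoff coeff_eq_0\<close>)
      also have "\<bar>\<dots>\<bar> \<le> (\<Sum>m<Suc D. (\<Sum>l\<le>D. R ^ m * E ^ l) * (M * e ^ r))"
      proof (rule order.trans[OF sum_abs], intro sum_mono)
        fix m assume m: "m \<in> {..<Suc D}"
        have nn: "0 \<le> (\<Sum>l\<le>D. R ^ m * E ^ l)" using assms by (intro sum_nonneg) auto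
        show "\<bar>coeff (p - poly_cutoff r p) m * s t ^ m\<bar> \<le> (\<Sum>l\<le>D. R ^ m * E ^ l) * (M * e ^ r)"
        proof (cases "m < r")
          case True
          then show ?thesis using nn M0 e by (simp add: coeff_poly_cutoff)
        next
          case False
          have "\<bar>s t ^ m\<bar> \<le> (R * e) ^ m" unfolding power_abs using s t by (intro power_mono) auto
          also have "\<dots> = R ^ m * (e ^ r * e ^ (m - r))"
            using False by (simp add: power_mult_distrib power_add[symmetric])
          also have "\<dots> \<le> R ^ m * (e ^ r * E ^ (m - r))"
            using e assms by (intro mult_left_mono power_mono) auto
          also have "\<dots> = (R ^ m * E ^ (m - r)) * e ^ r" by simp
          also have "\<dots> \<le> (\<Sum>l\<le>D. R ^ m * E ^ l) * e ^ r"
            using m assms e by (intro mult_right_mono member_le_sum) auto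
          finally have "\<bar>coeff p m\<bar> * \<bar>s t ^ m\<bar> \<le> M * ((\<Sum>l\<le>D. R ^ m * E ^ l) * e ^ r)"
            using M M0 by (intro mult_mono) auto
          then show ?thesis using False by (simp add: coeff_poly_cutoff abs_mult mult.left_commute)
        qed
      qed
      also have "\<dots> = S * M * e ^ r"
        unfolding S_def lessThan_Suc_atMost by (simp add: sum_distrib_right mult.assoc)
      finally show ?thesis .
    qed
    have "\<bar>h t - poly (poly_cutoff r p) (s t)\<bar> \<le> (1 + S) * M * e ^ r" if t: "t \<in> W" for t
      using tail[OF t] h[rule_format, OF t] by (simp add: algebra_simps)
    moreover have "\<bar>coeff (poly_cutoff r p) m\<bar> \<le> (1 + S) * M" for m
    proof -
      have "\<bar>coeff (poly_cutoff r p) m\<bar> \<le> M" using M M0 by (auto simp: coeff_poly_cutoff)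
      also have "\<dots> \<le> (1 + S) * M" using mult_right_mono[of 1 "1 + S" M] S0 M0 by simp
      finally show ?thesis .
    qed
    ultimately show ?thesis unfolding apx_def
      by (intro exI[of _ "poly_cutoff r p"]) (auto simp: coeff_poly_cutoff)
  qed
  moreover have "1 + S \<ge> 1" using S0 by simp
  ultimately show ?thesis by (intro exI[of _ "1 + S"] conjI allI impI)
qed

text \<open>
  Converts a bound of the values on the unit interval into \<open>apx\<close>; only the degree of \<open>p\<close> and not
  its origin matters for the constant.
\<close>

definition unit_const :: "nat \<Rightarrow> real \<Rightarrow> real \<Rightarrow> real \<Rightarrow> bool" where
  "unit_const D R E K \<longleftrightarrow> K \<ge> 1 \<and> (\<forall>r B W s e h (p::real poly). degree p \<le> D \<longrightarrow> (\<forall>x\<in>{0..1}. \<bar>poly p x\<bar> \<le> B) \<longrightarrow> 0 \<le> e \<longrightarrow> e \<le> E \<longrightarrow>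
     (\<forall>t\<in>W. \<bar>s t\<bar> \<le> R * e) \<longrightarrow> (\<forall>t\<in>W. \<bar>h t - poly p (s t)\<bar> \<le> B * e ^ r) \<longrightarrow> apx r (K * B) W s e h)"

lemma apx_from_unit_bound:
  assumes "0 \<le> R" "0 \<le> E"
  shows "\<exists>K. unit_const D R E K"
proof -
  obtain C where C: "C > 0" and cb: "\<And>(p::real poly) B m. degree p \<le> D \<Longrightarrow> (\<forall>x\<in>{0..1}. \<bar>poly p x\<bar> \<le> B) \<Longrightarrow> \<bar>coeff p m\<bar> \<le> C * B"
    using coeff_bound[of D] by blast
  obtain K where K1: "K \<ge> 1" and K': "\<forall>r M W s e h (p::real poly). degree p \<le> D \<longrightarrow> (\<forall>m. \<bar>coeff p m\<bar> \<le> M) \<longrightarrow> 0 \<le> e \<longrightarrow> e \<le> E \<longrightarrow>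
     (\<forall>t\<in>W. \<bar>s t\<bar> \<le> R * e) \<longrightarrow> (\<forall>t\<in>W. \<bar>h t - poly p (s t)\<bar> \<le> M * e ^ r) \<longrightarrow> apx r (K * M) W s e h"
    using truncation[OF assms, of D] by blast
  note K = K'[rule_format]
  have "apx r ((K * (1 + C)) * B) W s e h"
    if p: "degree p \<le> D" and B: "\<forall>x\<in>{0..1}. \<bar>poly p x\<bar> \<le> B" and e: "0 \<le> e" "e \<le> E"
      and s: "\<forall>t\<in>W. \<bar>s t\<bar> \<le> R * e" and h: "\<forall>t\<in>W. \<bar>h t - poly p (s t)\<bar> \<le> B * e ^ r"
    for r B W s e h and p :: "real poly"
  proof -
    have B0: "0 \<le> B" using B[rule_format, of 0] by auto
    have le: "C * B \<le> (1 + C) * B" "B \<le> (1 + C) * B" using B0 C by (auto simp: algebra_simps)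
    have "apx r (K * ((1 + C) * B)) W s e h"
    proof (rule K[OF p _ e])
      show "\<bar>coeff p m\<bar> \<le> (1 + C) * B" for m using cb[OF p B, of m] le by linarith
      show "\<bar>s t\<bar> \<le> R * e" if "t \<in> W" for t using s that by blast
      show "\<bar>h t - poly p (s t)\<bar> \<le> (1 + C) * B * e ^ r" if "t \<in> W" for t
        using h[rule_format, OF that] mult_right_mono[OF le(2), of "e ^ r"] e by auto
    qed
    then show ?thesis by (simp add: mult.assoc)
  qed
  moreover have "K * (1 + C) \<ge> 1" using K1 C mult_mono[of 1 K 1 "1 + C"] by simp
  ultimately show ?thesis unfolding unit_const_def by (intro exI[of _ "K * (1 + C)"] conjI allI impI)
qed

lemma apx_power_mult:
  assumes "0 \<le> R" "0 \<le> E"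
  shows "\<exists>K\<ge>1. \<forall>M W s e h. apx r M W s e h \<longrightarrow> 0 \<le> e \<longrightarrow> e \<le> E \<longrightarrow>
     (\<forall>t\<in>W. \<bar>s t\<bar> \<le> R * e) \<longrightarrow> apx r (K * M) W s e (\<lambda>t. s t ^ m * h t)"
proof -
  obtain K where K1: "K \<ge> 1" and K': "\<forall>r' M W s e h (p::real poly). degree p \<le> r + m \<longrightarrow> (\<forall>m. \<bar>coeff p m\<bar> \<le> M) \<longrightarrow> 0 \<le> e \<longrightarrow> e \<le> E \<longrightarrow>
     (\<forall>t\<in>W. \<bar>s t\<bar> \<le> R * e) \<longrightarrow> (\<forall>t\<in>W. \<bar>h t - poly p (s t)\<bar> \<le> M * e ^ r') \<longrightarrow> apx r' (K * M) W s e h"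
    using truncation[OF assms, of "r + m"] by blast
  note K = K'[rule_format]
  define L where "L = 1 + (R * E) ^ m"
  have L: "L \<ge> 1" "(R * E) ^ m \<le> L" using assms by (auto simp: L_def)
  have "apx r ((K * L) * M) W s e (\<lambda>t. s t ^ m * h t)"
    if h: "apx r M W s e h" and e: "0 \<le> e" "e \<le> E" and s: "\<forall>t\<in>W. \<bar>s t\<bar> \<le> R * e" for M W s e h
  proof -
    obtain p where p: "\<forall>m. \<bar>coeff p m\<bar> \<le> M" "\<forall>m\<ge>r. coeff p m = 0" "\<forall>t\<in>W. \<bar>h t - poly p (s t)\<bar> \<le> M * e ^ r"
      using h by (auto simp: apx_def)
    have M0: "0 \<le> M" using p(1)[rule_format, of 0] by linarith
    have LM: "M \<le> L * M" using mult_right_mono[OF L(1) M0] by simp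
    have "apx r (K * (L * M)) W s e (\<lambda>t. s t ^ m * h t)"
    proof (rule K[where p = "monom 1 m * p", OF _ _ e])
      show "degree (monom 1 m * p) \<le> r + m"
        using p(2) by (intro degree_le) (auto simp: coeff_monom_mult)
      show "\<bar>coeff (monom 1 m * p) l\<bar> \<le> L * M" for l
        using p(1) M0 LM by (auto simp: coeff_monom_mult intro: order.trans)
      show "\<bar>s t\<bar> \<le> R * e" if "t \<in> W" for t using s that by blast
      show "\<bar>s t ^ m * h t - poly (monom 1 m * p) (s t)\<bar> \<le> L * M * e ^ r" if t: "t \<in> W" for t
      proof -
        have "\<bar>s t\<bar> \<le> R * E" using s t e assms by (meson mult_left_mono order.trans)
        then have "\<bar>s t ^ m\<bar> \<le> L" unfolding power_abs using L(2) power_mono[of "\<bar>s t\<bar>" "R * E" m] by linarith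
        then have "\<bar>s t ^ m\<bar> * \<bar>h t - poly p (s t)\<bar> \<le> L * (M * e ^ r)"
          using p(3) t L(1) by (intro mult_mono) auto
        then show ?thesis by (simp add: poly_monom abs_mult[symmetric] right_diff_distrib mult.assoc)
      qed
    qed
    then show ?thesis by (simp add: mult.assoc)
  qed
  moreover have "K * L \<ge> 1" using K1 L(1) mult_mono[of 1 K 1 L] by simp
  ultimately show ?thesis by (intro exI[of _ "K * L"] conjI allI impI)
qed

section \<open>Substitution into polynomial maps\<close>

text \<open>
  A polynomial of degree less than \<open>r\<close> in \<open>N\<close> variables, the monomials being indexed by lists of
  variables.
\<close>

definition polymap :: "nat \<Rightarrow> nat \<Rightarrow> (nat list \<Rightarrow> real) \<Rightarrow> rvec \<Rightarrow> real" where
  "polymap N r a d = (\<Sum>n<r. \<Sum>js | set js \<subseteq> {..<N} \<and> length js = n. a js * (\<Prod>k<n. d (js ! k)))"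

text \<open>
  The univariate polynomial obtained by substituting \<open>P i\<close> for the variable \<open>i\<close>.
\<close>

definition polymap_poly :: "nat \<Rightarrow> nat \<Rightarrow> (nat list \<Rightarrow> real) \<Rightarrow> (nat \<Rightarrow> real poly) \<Rightarrow> real poly" where
  "polymap_poly N r a P = (\<Sum>n<r. \<Sum>js | set js \<subseteq> {..<N} \<and> length js = n. smult (a js) (\<Prod>k<n. P (js ! k)))"

lemma poly_polymap_poly: "poly (polymap_poly N r a P) x = polymap N r a (\<lambda>i. poly (P i) x)"
  by (simp add: polymap_poly_def polymap_def poly_sum poly_prod)

lemma polymap_cong: "(\<And>i. i < N \<Longrightarrow> d i = d' i) \<Longrightarrow> polymap N r a d = polymap N r a d'"
  unfolding polymap_def by (intro sum.cong refl arg_cong2[where f = "(*)"] prod.cong) (auto simp: subset_eq)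

lemma degree_polymap_poly:
  assumes "\<And>i. i < N \<Longrightarrow> degree (P i) \<le> D"
  shows "degree (polymap_poly N r a P) \<le> r * D"
  unfolding polymap_poly_def
proof (intro degree_sum_le finite_lessThan finite_indices)
  fix n js assume n: "n \<in> {..<r}" and js: "js \<in> {js. set js \<subseteq> {..<N} \<and> length js = n}"
  have "degree (smult (a js) (\<Prod>k<n. P (js ! k))) \<le> degree (\<Prod>k<n. P (js ! k))" by (rule degree_smult_le)
  also have "\<dots> \<le> (\<Sum>k<n. degree (P (js ! k)))" using degree_prod_sum_le[of "{..<n}" "\<lambda>k. P (js ! k)"] by (simp add: o_def)
  also have "\<dots> \<le> (\<Sum>k<n. D)"
  proof (rule sum_mono)
    fix k assume "k \<in> {..<n}"
    then have "js ! k \<in> set js" using js by auto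
    then show "degree (P (js ! k)) \<le> D" using js assms by auto
  qed
  also have "\<dots> \<le> r * D" using n by simp
  finally show "degree (smult (a js) (\<Prod>k<n. P (js ! k))) \<le> r * D" .
qed

text \<open>
  The polynomial map is controlled only through its values: bounding its monomials one by one
  would make the constants depend on \<open>N\<close>. The values of the composition on \<open>[0, 1]\<close> are bounded
  since those of the \<open>P i\<close> are. The effect of replacing \<open>y\<close> by the polynomials is estimated along
  the segment between the two points, on which the map is a univariate polynomial with bounded
  coefficients.
\<close>

lemma polymap_composition:
  fixes r :: nat and R E M :: real
  assumes "0 \<le> R" "0 \<le> E" "0 \<le> M"
  shows "\<exists>K\<ge>1. \<forall>N a B P y (W::real set) s e.
     (\<forall>\<eta>\<ge>0. \<forall>d. (\<forall>i<N. \<bar>d i\<bar> \<le> \<eta>) \<longrightarrow> \<bar>polymap N r a d\<bar> \<le> B * (1 + \<eta>) ^ r) \<longrightarrow>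
     0 \<le> e \<longrightarrow> e \<le> E \<longrightarrow> (\<forall>t\<in>W. \<bar>s t\<bar> \<le> R * e) \<longrightarrow>
     (\<forall>i<N. (\<forall>m. \<bar>coeff (P i) m\<bar> \<le> M) \<and> (\<forall>m\<ge>r. coeff (P i) m = 0) \<and> (\<forall>t\<in>W. \<bar>y t i - poly (P i) (s t)\<bar> \<le> M * e ^ r)) \<longrightarrow>
     degree (polymap_poly N r a P) \<le> r * r \<and>
     (\<forall>x\<in>{0..1}. \<bar>poly (polymap_poly N r a P) x\<bar> \<le> K * B) \<and>
     (\<forall>t\<in>W. \<bar>polymap N r a (y t) - poly (polymap_poly N r a P) (s t)\<bar> \<le> K * B * e ^ r)"
proof -
  obtain C where C: "C > 0" and cb: "\<And>(p::real poly) B m. degree p \<le> r \<Longrightarrow> (\<forall>x\<in>{0..1}. \<bar>poly p x\<bar> \<le> B) \<Longrightarrow> \<bar>coeff p m\<bar> \<le> C * B"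
    using coeff_bound[of r] by blast
  define M1 where "M1 = M * (\<Sum>m<r. (R * E) ^ m)"
  define K1 where "K1 = (1 + M * r) ^ r"
  define K2 where "K2 = C * (2 + M1) ^ r * M * (\<Sum>m<r. (M * E ^ r) ^ m)"
  have M1: "0 \<le> M1" unfolding M1_def using assms by (intro mult_nonneg_nonneg sum_nonneg) auto
  have K1: "1 \<le> K1" unfolding K1_def using assms by (intro one_le_power) simp
  have K2: "0 \<le> K2" unfolding K2_def using assms C M1 by (intro mult_nonneg_nonneg sum_nonneg) auto
  have main: "degree (polymap_poly N r a P) \<le> r * r \<and>
     (\<forall>x\<in>{0..1}. \<bar>poly (polymap_poly N r a P) x\<bar> \<le> (K1 + K2) * B) \<and>
     (\<forall>t\<in>W. \<bar>polymap N r a (y t) - poly (polymap_poly N r a P) (s t)\<bar> \<le> (K1 + K2) * B * e ^ r)"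
    if B: "\<forall>\<eta>\<ge>0. \<forall>d. (\<forall>i<N. \<bar>d i\<bar> \<le> \<eta>) \<longrightarrow> \<bar>polymap N r a d\<bar> \<le> B * (1 + \<eta>) ^ r"
      and e: "0 \<le> e" "e \<le> E" and s: "\<forall>t\<in>W. \<bar>s t\<bar> \<le> R * e"
      and P: "\<forall>i<N. (\<forall>m. \<bar>coeff (P i) m\<bar> \<le> M) \<and> (\<forall>m\<ge>r. coeff (P i) m = 0) \<and> (\<forall>t\<in>W. \<bar>y t i - poly (P i) (s t)\<bar> \<le> M * e ^ r)"
    for N a B P y s e and W :: "real set"
  proof (intro conjI ballI)
    have "\<bar>polymap N r a (\<lambda>_. 0)\<bar> \<le> B * (1 + 0) ^ r" by (rule B[rule_format]) auto
    then have B0: "0 \<le> B" by (auto intro: order.trans[OF abs_ge_zero])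
    show "degree (polymap_poly N r a P) \<le> r * r"
      by (rule degree_polymap_poly, rule degree_le) (use P in auto)
    fix x :: real assume x: "x \<in> {0..1}"
    have "\<bar>poly (P i) x\<bar> \<le> M * r" if "i < N" for i
      using poly_bound_by_coeffs[of "P i" M r x 1] P that x by simp
    then have "\<bar>poly (polymap_poly N r a P) x\<bar> \<le> B * (1 + M * r) ^ r"
      unfolding poly_polymap_poly by (intro B[rule_format]) (use assms in auto)
    also have "\<dots> \<le> (K1 + K2) * B" using K2 B0 by (simp add: K1_def algebra_simps)
    finally show "\<bar>poly (polymap_poly N r a P) x\<bar> \<le> (K1 + K2) * B" .
  next
    have "\<bar>polymap N r a (\<lambda>_. 0)\<bar> \<le> B * (1 + 0) ^ r" by (rule B[rule_format]) auto
    then have B0: "0 \<le> B" by (auto intro: order.trans[OF abs_ge_zero])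
    fix t assume t: "t \<in> W"
    define z where "z i = poly (P i) (s t)" for i
    define \<eta> where "\<eta> = M * e ^ r"
    have \<eta>0: "0 \<le> \<eta>" using assms e by (simp add: \<eta>_def)
    have st: "\<bar>s t\<bar> \<le> R * E" using s t e assms by (meson mult_left_mono order.trans)
    have z: "\<bar>z i\<bar> \<le> M1" if "i < N" for i
      unfolding z_def M1_def by (rule poly_bound_by_coeffs[OF _ _ st]) (use P that in auto)
    have yz: "\<bar>y t i - z i\<bar> \<le> \<eta>" if "i < N" for i using P that t by (simp add: z_def \<eta>_def)
    have goal: "\<bar>polymap N r a (y t) - polymap N r a z\<bar> \<le> K2 * B * e ^ r"
    proof (cases "\<eta> = 0")
      case True
      then have "polymap N r a (y t) = polymap N r a z" using yz by (intro polymap_cong) force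
      then show ?thesis using K2 B0 e by simp
    next
      case False
      then have \<eta>: "0 < \<eta>" using \<eta>0 by simp
      (* The map along the segment from z to y, parametrized so that y is reached at the small
         parameter eta while L is bounded on [0, 1]; hence L eta - L 0 is of order eta. *)
      define L where "L = polymap_poly N r a (\<lambda>i. [:z i, (y t i - z i) / \<eta>:])"
      have pL: "poly L x = polymap N r a (\<lambda>i. z i + x * ((y t i - z i) / \<eta>))" for x
        by (simp add: L_def poly_polymap_poly)
      have dL: "degree L \<le> r" unfolding L_def using degree_polymap_poly[of N "\<lambda>i. [:z i, (y t i - z i) / \<eta>:]" 1 r a] by simp
      have "\<bar>poly L x\<bar> \<le> B * (1 + (M1 + 1)) ^ r" if x: "x \<in> {0..1}" for x
        unfolding pL
      proof (rule B[rule_format])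
        fix i assume i: "i < N"
        have "\<bar>x * ((y t i - z i) / \<eta>)\<bar> \<le> 1 * 1"
          unfolding abs_mult using x yz[OF i] \<eta> by (intro mult_mono) auto
        then show "\<bar>z i + x * ((y t i - z i) / \<eta>)\<bar> \<le> M1 + 1" using z[OF i] by linarith
      qed (use M1 in simp)
      then have cL: "\<bar>coeff L m\<bar> \<le> C * (B * (2 + M1) ^ r)" for m
        using cb[OF dL, of "B * (2 + M1) ^ r" m] by (simp add: add.commute add.left_commute)
      have "poly L \<eta> - poly L 0 = (\<Sum>m<r. coeff L (Suc m) * \<eta> ^ Suc m)"
      proof -
        have "poly L x = (\<Sum>m<Suc r. coeff L m * x ^ m)" for x
          by (rule poly_as_sum) (use dL in \<open>auto simp: coeff_eq_0\<close>)
        then show ?thesis by (simp add: sum.lessThan_Suc_shift del: sum.lessThan_Suc)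
      qed
      also have "\<bar>\<dots>\<bar> \<le> (\<Sum>m<r. C * (B * (2 + M1) ^ r) * (\<eta> * (M * E ^ r) ^ m))"
      proof (rule order.trans[OF sum_abs], intro sum_mono)
        fix m
        have "\<eta> \<le> M * E ^ r" unfolding \<eta>_def using assms e by (intro mult_left_mono power_mono) auto
        then have "\<eta> * \<eta> ^ m \<le> \<eta> * (M * E ^ r) ^ m" using \<eta>0 by (intro mult_left_mono power_mono) auto
        then show "\<bar>coeff L (Suc m) * \<eta> ^ Suc m\<bar> \<le> C * (B * (2 + M1) ^ r) * (\<eta> * (M * E ^ r) ^ m)"
          unfolding abs_mult using cL[of "Suc m"] \<eta>0 by (intro mult_mono[OF cL]) auto
      qed
      also have "\<dots> = K2 * B * e ^ r"
        by (simp add: K2_def \<eta>_def sum_distrib_left sum_distrib_right mult_ac)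
      finally have "\<bar>poly L \<eta> - poly L 0\<bar> \<le> K2 * B * e ^ r" .
      moreover have "poly L \<eta> = polymap N r a (y t)" "poly L 0 = polymap N r a z"
        using \<eta> by (auto simp: pL)
      ultimately show ?thesis by simp
    qed
    also have "\<dots> \<le> (K1 + K2) * B * e ^ r" using K1 B0 e by (intro mult_right_mono) auto
    finally show "\<bar>polymap N r a (y t) - poly (polymap_poly N r a P) (s t)\<bar> \<le> (K1 + K2) * B * e ^ r"
      by (simp add: poly_polymap_poly z_def[abs_def])
  qed
  have le: "1 \<le> K1 + K2" using K1 K2 by simp
  show ?thesis by (rule exI[of _ "K1 + K2"], rule conjI, rule le, (rule allI)+, (rule impI)+, rule main, assumption+)
qed

section \<open>Taylor expansion along curves\<close>

definition taylor_coeff :: "nat \<Rightarrow> (nat \<Rightarrow> real) \<Rightarrow> (nat \<Rightarrow> rvec \<Rightarrow> real) \<Rightarrow> rvec \<Rightarrow> nat list \<Rightarrow> real" where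
  "taylor_coeff J b v x js = (\<Sum>j<J. b j * pds js (v j) x) / fact (length js)"

lemma polymap_taylor_coeff:
  "polymap N r (taylor_coeff J b v x) d = (\<Sum>n<r. (\<Sum>j<J. b j * Dn N n (v j) (\<lambda>_. d) x) / fact n)"
  unfolding polymap_def
proof (rule sum.cong[OF refl])
  fix n
  have "(\<Sum>js | set js \<subseteq> {..<N} \<and> length js = n. taylor_coeff J b v x js * (\<Prod>k<n. d (js ! k)))
      = (\<Sum>js | set js \<subseteq> {..<N} \<and> length js = n. (\<Sum>j<J. b j * (pds js (v j) x * (\<Prod>k<n. d (js ! k)))) / fact n)"
    by (rule sum.cong) (auto simp: taylor_coeff_def sum_distrib_right sum_divide_distrib mult.assoc)
  also have "\<dots> = (\<Sum>j<J. b j * Dn N n (v j) (\<lambda>_. d) x) / fact n"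
    unfolding Dn_def sum_distrib_left sum_divide_distrib by (rule sum.swap)
  finally show "(\<Sum>js | set js \<subseteq> {..<N} \<and> length js = n. taylor_coeff J b v x js * (\<Prod>k<n. d (js ! k)))
      = (\<Sum>j<J. b j * Dn N n (v j) (\<lambda>_. d) x) / fact n" .
qed

text \<open>
  \<open>x0\<close> is the base point and \<open>d\<close> the deviation of a curve from it, which is approximated by the
  polynomials \<open>P\<close>. The lower derivatives are bounded at \<open>x0\<close> only and the highest one on the
  segments to the curve, since the derivatives of \<open>f\<close> are controlled only near the trajectories.
  The polynomial is given explicitly, because it will be averaged over a parameter.
\<close>

definition taylor_const :: "nat \<Rightarrow> real \<Rightarrow> real \<Rightarrow> real \<Rightarrow> real \<Rightarrow> bool" where
  "taylor_const r R E M K \<longleftrightarrow> K \<ge> 1 \<and> (\<forall>N J b v x0 d B P (W::real set) s e.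
     (\<forall>j<J. Ck N r (v j) \<and> dep N (v j)) \<longrightarrow>
     (\<forall>n<r. \<forall>\<eta>\<ge>0. \<forall>d. (\<forall>i<N. \<bar>d i\<bar> \<le> \<eta>) \<longrightarrow> \<bar>\<Sum>j<J. b j * Dn N n (v j) (\<lambda>_. d) x0\<bar> \<le> B * \<eta> ^ n) \<longrightarrow>
     (\<forall>t\<in>W. \<forall>\<theta>\<in>{0..1}. \<bar>\<Sum>j<J. b j * Dn N r (v j) (\<lambda>_. d t) (\<lambda>i. x0 i + \<theta> * d t i)\<bar> \<le> B * (M * e) ^ r) \<longrightarrow>
     0 \<le> B \<longrightarrow> 0 \<le> e \<longrightarrow> e \<le> E \<longrightarrow> (\<forall>t\<in>W. \<bar>s t\<bar> \<le> R * e) \<longrightarrow>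
     (\<forall>i<N. (\<forall>m. \<bar>coeff (P i) m\<bar> \<le> M) \<and> (\<forall>m\<ge>r. coeff (P i) m = 0) \<and> (\<forall>t\<in>W. \<bar>d t i - poly (P i) (s t)\<bar> \<le> M * e ^ r)) \<longrightarrow>
     (let p = polymap_poly N r (taylor_coeff J b v x0) P in
     degree p \<le> r * r \<and> (\<forall>x\<in>{0..1}. \<bar>poly p x\<bar> \<le> K * B) \<and>
     (\<forall>t\<in>W. \<bar>(\<Sum>j<J. b j * v j (\<lambda>i. x0 i + d t i)) - poly p (s t)\<bar> \<le> K * B * e ^ r)))"

text \<open>
  The Taylor polynomial at the base point is a polynomial map, to which \<open>polymap_composition\<close>
  applies; the remainder is of order \<open>r\<close> because the curve stays at distance \<open>M e\<close> from the base
  point.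
\<close>

lemma taylor_composition:
  fixes r :: nat and R E M :: real
  assumes "0 \<le> R" "0 \<le> E" "0 \<le> M"
  shows "\<exists>K. taylor_const r R E M K"
proof -
  obtain K where K1: "K \<ge> 1" and K': "\<forall>N a B P y (W::real set) s e.
     (\<forall>\<eta>\<ge>0. \<forall>d. (\<forall>i<N. \<bar>d i\<bar> \<le> \<eta>) \<longrightarrow> \<bar>polymap N r a d\<bar> \<le> B * (1 + \<eta>) ^ r) \<longrightarrow>
     0 \<le> e \<longrightarrow> e \<le> E \<longrightarrow> (\<forall>t\<in>W. \<bar>s t\<bar> \<le> R * e) \<longrightarrow>
     (\<forall>i<N. (\<forall>m. \<bar>coeff (P i) m\<bar> \<le> M) \<and> (\<forall>m\<ge>r. coeff (P i) m = 0) \<and> (\<forall>t\<in>W. \<bar>y t i - poly (P i) (s t)\<bar> \<le> M * e ^ r)) \<longrightarrow>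
     degree (polymap_poly N r a P) \<le> r * r \<and>
     (\<forall>x\<in>{0..1}. \<bar>poly (polymap_poly N r a P) x\<bar> \<le> K * B) \<and>
     (\<forall>t\<in>W. \<bar>polymap N r a (y t) - poly (polymap_poly N r a P) (s t)\<bar> \<le> K * B * e ^ r)"
    using polymap_composition[OF assms, of r] by blast
  define L where "L = K * real r + M ^ r + 1"
  have L1: "L \<ge> 1" using K1 assms by (simp add: L_def)
  have main: "let p = polymap_poly N r (taylor_coeff J b v x0) P in
     degree p \<le> r * r \<and> (\<forall>x\<in>{0..1}. \<bar>poly p x\<bar> \<le> L * B) \<and>
     (\<forall>t\<in>W. \<bar>(\<Sum>j<J. b j * v j (\<lambda>i. x0 i + d t i)) - poly p (s t)\<bar> \<le> L * B * e ^ r)"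
    if v: "\<forall>j<J. Ck N r (v j) \<and> dep N (v j)"
      and D: "\<forall>n<r. \<forall>\<eta>\<ge>0. \<forall>d. (\<forall>i<N. \<bar>d i\<bar> \<le> \<eta>) \<longrightarrow> \<bar>\<Sum>j<J. b j * Dn N n (v j) (\<lambda>_. d) x0\<bar> \<le> B * \<eta> ^ n"
      and D2: "\<forall>t\<in>W. \<forall>\<theta>\<in>{0..1}. \<bar>\<Sum>j<J. b j * Dn N r (v j) (\<lambda>_. d t) (\<lambda>i. x0 i + \<theta> * d t i)\<bar> \<le> B * (M * e) ^ r"
      and B0: "0 \<le> B" and e: "0 \<le> e" "e \<le> E" and s: "\<forall>t\<in>W. \<bar>s t\<bar> \<le> R * e"
      and P: "\<forall>i<N. (\<forall>m. \<bar>coeff (P i) m\<bar> \<le> M) \<and> (\<forall>m\<ge>r. coeff (P i) m = 0) \<and> (\<forall>t\<in>W. \<bar>d t i - poly (P i) (s t)\<bar> \<le> M * e ^ r)"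
    for N J b v x0 d B P s e and W :: "real set"
  proof -
    let ?a = "taylor_coeff J b v x0"
    have bd: "\<forall>\<eta>\<ge>0. \<forall>d. (\<forall>i<N. \<bar>d i\<bar> \<le> \<eta>) \<longrightarrow> \<bar>polymap N r ?a d\<bar> \<le> (real r * B) * (1 + \<eta>) ^ r"
    proof (intro allI impI)
      fix \<eta> d assume \<eta>: "0 \<le> (\<eta>::real)" and d: "\<forall>i<N. \<bar>d i\<bar> \<le> \<eta>"
      have "\<bar>polymap N r ?a d\<bar> \<le> (\<Sum>n<r. B * (1 + \<eta>) ^ r)"
        unfolding polymap_taylor_coeff
      proof (rule order.trans[OF sum_abs], intro sum_mono)
        fix n assume n: "n \<in> {..<r}"
        let ?X = "\<Sum>j<J. b j * Dn N n (v j) (\<lambda>_. d) x0"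
        have "\<bar>?X / fact n\<bar> \<le> \<bar>?X\<bar> / 1"
          unfolding abs_divide by (simp add: divide_le_eq mult_le_cancel_left1 fact_ge_1)
        also have "\<dots> \<le> B * \<eta> ^ n" using D n \<eta> d by simp
        also have "\<dots> \<le> B * (1 + \<eta>) ^ n" using B0 \<eta> by (intro mult_left_mono power_mono) auto
        also have "\<dots> \<le> B * (1 + \<eta>) ^ r" using B0 \<eta> n by (intro mult_left_mono power_increasing) auto
        finally show "\<bar>?X / fact n\<bar> \<le> B * (1 + \<eta>) ^ r" .
      qed
      then show "\<bar>polymap N r ?a d\<bar> \<le> (real r * B) * (1 + \<eta>) ^ r" by simp
    qed
    have Kp: "degree (polymap_poly N r ?a P) \<le> r * r"
      "\<forall>x\<in>{0..1}. \<bar>poly (polymap_poly N r ?a P) x\<bar> \<le> K * (real r * B)"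
      "\<forall>t\<in>W. \<bar>polymap N r ?a (d t) - poly (polymap_poly N r ?a P) (s t)\<bar> \<le> K * (real r * B) * e ^ r"
    proof -
      have "degree (polymap_poly N r ?a P) \<le> r * r \<and>
         (\<forall>x\<in>{0..1}. \<bar>poly (polymap_poly N r ?a P) x\<bar> \<le> K * (real r * B)) \<and>
         (\<forall>t\<in>W. \<bar>polymap N r ?a (d t) - poly (polymap_poly N r ?a P) (s t)\<bar> \<le> K * (real r * B) * e ^ r)"
        by (rule K'[rule_format]) (use bd e s P in blast)+
      then show "degree (polymap_poly N r ?a P) \<le> r * r"
        "\<forall>x\<in>{0..1}. \<bar>poly (polymap_poly N r ?a P) x\<bar> \<le> K * (real r * B)"
        "\<forall>t\<in>W. \<bar>polymap N r ?a (d t) - poly (polymap_poly N r ?a P) (s t)\<bar> \<le> K * (real r * B) * e ^ r"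
        by blast+
    qed
    have LB: "K * (real r * B) \<le> L * B"
      using mult_right_mono[OF _ B0, of "K * real r" L] assms by (simp add: L_def mult.assoc)
    have "\<bar>(\<Sum>j<J. b j * v j (\<lambda>i. x0 i + d t i)) - poly (polymap_poly N r ?a P) (s t)\<bar> \<le> L * B * e ^ r"
      if t: "t \<in> W" for t
    proof -
      obtain \<theta> where \<theta>: "\<theta> \<in> {0..1}" and eq: "(\<Sum>j<J. b j * v j (\<lambda>i. x0 i + d t i)) =
        (\<Sum>k<r. (\<Sum>j<J. b j * Dn N k (v j) (\<lambda>_. d t) x0) / fact k)
        + (\<Sum>j<J. b j * Dn N r (v j) (\<lambda>_. d t) (\<lambda>i. x0 i + \<theta> * d t i)) / fact r"
        using taylor_line[of J N r v r b x0 "d t"] v by auto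
      let ?X = "\<Sum>j<J. b j * Dn N r (v j) (\<lambda>_. d t) (\<lambda>i. x0 i + \<theta> * d t i)"
      have "\<bar>?X / fact r\<bar> \<le> \<bar>?X\<bar> / 1"
        unfolding abs_divide by (simp add: divide_le_eq mult_le_cancel_left1 fact_ge_1)
      also have "\<dots> \<le> M ^ r * B * e ^ r" using D2 t \<theta> by (simp add: power_mult_distrib mult_ac)
      finally have 1: "\<bar>(\<Sum>j<J. b j * v j (\<lambda>i. x0 i + d t i)) - polymap N r ?a (d t)\<bar> \<le> M ^ r * B * e ^ r"
        unfolding eq polymap_taylor_coeff by simp
      have "M ^ r * B * e ^ r + K * (real r * B) * e ^ r = (M ^ r + K * real r) * (B * e ^ r)" by (simp add: algebra_simps)
      also have "\<dots> \<le> L * (B * e ^ r)" using B0 e by (intro mult_right_mono) (auto simp: L_def)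
      finally show ?thesis using 1 Kp(3)[rule_format, OF t] by (simp add: mult.assoc)
    qed
    then show ?thesis using Kp(1,2) LB by (auto simp: Let_def intro: order.trans)
  qed
  show ?thesis unfolding taylor_const_def by (rule exI[of _ L], rule conjI, rule L1, (rule allI)+, (rule impI)+, rule main, assumption+)
qed

section \<open>Averages and linear combinations\<close>

text \<open>
  The form in which the averaged Jacobian between two curves \<open>X\<close> and \<open>Y\<close> occurs.
\<close>

definition averaged_const :: "nat \<Rightarrow> real \<Rightarrow> real \<Rightarrow> real \<Rightarrow> real \<Rightarrow> bool" where
  "averaged_const r R E M K \<longleftrightarrow> K \<ge> 1 \<and> (\<forall>N v b x0 y0 X Y B (W::real set) s e.
     (\<forall>j<N. Ck N r (v j) \<and> dep N (v j)) \<longrightarrow>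
     (\<forall>n\<le>r. \<forall>\<eta>\<ge>0. \<forall>d x. (\<forall>i<N. \<bar>d i\<bar> \<le> \<eta>) \<longrightarrow> \<bar>\<Sum>j<N. b j * Dn N n (v j) (\<lambda>_. d) x\<bar> \<le> B * \<eta> ^ n) \<longrightarrow>
     0 \<le> B \<longrightarrow> 0 \<le> e \<longrightarrow> e \<le> E \<longrightarrow> (\<forall>t\<in>W. \<bar>s t\<bar> \<le> R * e) \<longrightarrow>
     (\<forall>i<N. apx r M W s e (\<lambda>t. X t i - x0 i) \<and> apx r M W s e (\<lambda>t. Y t i - y0 i)) \<longrightarrow>
     (\<forall>i<N. \<forall>t\<in>W. \<bar>X t i - x0 i\<bar> \<le> M * e \<and> \<bar>Y t i - y0 i\<bar> \<le> M * e) \<longrightarrow>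
     apx r (K * B) W s e (\<lambda>t. \<Sum>j<N. b j * integral {0..1} (\<lambda>z. v j (\<lambda>l. z * X t l + (1 - z) * Y t l))))"

text \<open>
  For every \<open>z\<close> the point on the segment between the two curves is approximable, with base point
  on the segment between the base points, and \<open>taylor_composition\<close> provides a polynomial. The
  average of these polynomials over \<open>z\<close> is again a polynomial, as is seen from its values at the
  interpolation nodes.
\<close>

lemma averaged_composition:
  fixes r :: nat and R E M :: real
  assumes "0 \<le> R" "0 \<le> E" "0 \<le> M"
  shows "\<exists>K. averaged_const r R E M K"
proof -
  define D where "D = r * r"
  obtain K where K0: "taylor_const r R E M K" using taylor_composition[OF assms] by blast
  note K1 = K0[unfolded taylor_const_def, THEN conjunct1] and K' = K0[unfolded taylor_const_def, THEN conjunct2]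
  obtain L where L0: "unit_const D R E L" using apx_from_unit_bound[OF assms(1,2)] by blast
  note L1 = L0[unfolded unit_const_def, THEN conjunct1] and L' = L0[unfolded unit_const_def, THEN conjunct2]
  have main: "apx r ((L * K) * B) W s e (\<lambda>t. \<Sum>j<N. b j * integral {0..1} (\<lambda>z. v j (\<lambda>l. z * X t l + (1 - z) * Y t l)))"
    if v: "\<forall>j<N. Ck N r (v j) \<and> dep N (v j)"
      and D: "\<forall>n\<le>r. \<forall>\<eta>\<ge>0. \<forall>d x. (\<forall>i<N. \<bar>d i\<bar> \<le> \<eta>) \<longrightarrow> \<bar>\<Sum>j<N. b j * Dn N n (v j) (\<lambda>_. d) x\<bar> \<le> B * \<eta> ^ n"
      and B0: "0 \<le> B" and e: "0 \<le> e" "e \<le> E" and s: "\<forall>t\<in>W. \<bar>s t\<bar> \<le> R * e"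
      and XY: "\<forall>i<N. apx r M W s e (\<lambda>t. X t i - x0 i) \<and> apx r M W s e (\<lambda>t. Y t i - y0 i)"
      and XYb: "\<forall>i<N. \<forall>t\<in>W. \<bar>X t i - x0 i\<bar> \<le> M * e \<and> \<bar>Y t i - y0 i\<bar> \<le> M * e"
    for N v b x0 y0 X Y B s e and W :: "real set"
  proof -
    have "\<forall>i<N. \<exists>p::real poly. (\<forall>m. \<bar>coeff p m\<bar> \<le> M) \<and> (\<forall>m\<ge>r. coeff p m = 0) \<and> (\<forall>t\<in>W. \<bar>X t i - x0 i - poly p (s t)\<bar> \<le> M * e ^ r)"
      using XY unfolding apx_def by blast
    then obtain PX where PX: "\<And>i m. i < N \<Longrightarrow> \<bar>coeff (PX i) m\<bar> \<le> M" "\<And>i m. i < N \<Longrightarrow> m \<ge> r \<Longrightarrow> coeff (PX i) m = 0"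
      "\<And>i t. i < N \<Longrightarrow> t \<in> W \<Longrightarrow> \<bar>X t i - x0 i - poly (PX i) (s t)\<bar> \<le> M * e ^ r" by metis
    have "\<forall>i<N. \<exists>p::real poly. (\<forall>m. \<bar>coeff p m\<bar> \<le> M) \<and> (\<forall>m\<ge>r. coeff p m = 0) \<and> (\<forall>t\<in>W. \<bar>Y t i - y0 i - poly p (s t)\<bar> \<le> M * e ^ r)"
      using XY unfolding apx_def by blast
    then obtain PY where PY: "\<And>i m. i < N \<Longrightarrow> \<bar>coeff (PY i) m\<bar> \<le> M" "\<And>i m. i < N \<Longrightarrow> m \<ge> r \<Longrightarrow> coeff (PY i) m = 0"
      "\<And>i t. i < N \<Longrightarrow> t \<in> W \<Longrightarrow> \<bar>Y t i - y0 i - poly (PY i) (s t)\<bar> \<le> M * e ^ r" by metis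
    define w where "w z i = z * x0 i + (1 - z) * y0 i" for z i
    define d where "d z t i = z * (X t i - x0 i) + (1 - z) * (Y t i - y0 i)" for z t i
    define P where "P z i = smult z (PX i) + smult (1 - z) (PY i)" for z i
    define p where "p z = polymap_poly N r (taylor_coeff N b v (w z)) (P z)" for z
    have convex: "\<bar>z * \<xi> + (1 - z) * \<zeta>\<bar> \<le> C" if "z \<in> {0..1}" "\<bar>\<xi>\<bar> \<le> C" "\<bar>\<zeta>\<bar> \<le> C" for z \<xi> \<zeta> C :: real
    proof -
      have "\<bar>z * \<xi> + (1 - z) * \<zeta>\<bar> \<le> z * \<bar>\<xi>\<bar> + (1 - z) * \<bar>\<zeta>\<bar>"
        using that(1) by (intro order.trans[OF abs_triangle_ineq]) (simp add: abs_mult)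
      also have "\<dots> \<le> z * C + (1 - z) * C" using that by (intro add_mono mult_left_mono) auto
      finally show ?thesis by (simp add: algebra_simps)
    qed
    have arg: "(\<lambda>i. w z i + d z t i) = (\<lambda>l. z * X t l + (1 - z) * Y t l)" for z t
      by (simp add: w_def d_def algebra_simps)
    have pz: "degree (p z) \<le> r * r \<and> (\<forall>x\<in>{0..1}. \<bar>poly (p z) x\<bar> \<le> K * B) \<and>
       (\<forall>t\<in>W. \<bar>(\<Sum>j<N. b j * v j (\<lambda>i. w z i + d z t i)) - poly (p z) (s t)\<bar> \<le> K * B * e ^ r)" if z: "z \<in> {0..1}" for z
    proof -
      have "let p = polymap_poly N r (taylor_coeff N b v (w z)) (P z) in
          degree p \<le> r * r \<and> (\<forall>x\<in>{0..1}. \<bar>poly p x\<bar> \<le> K * B) \<and>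
          (\<forall>t\<in>W. \<bar>(\<Sum>j<N. b j * v j (\<lambda>i. w z i + d z t i)) - poly p (s t)\<bar> \<le> K * B * e ^ r)"
      proof (rule K'[rule_format])
        show "\<bar>\<Sum>j<N. b j * Dn N r (v j) (\<lambda>_. d z t) (\<lambda>i. w z i + \<theta> * d z t i)\<bar> \<le> B * (M * e) ^ r"
          if t: "t \<in> W" and "\<theta> \<in> {0..1}" for t \<theta>
        proof (rule D[rule_format, OF order.refl])
          show "0 \<le> M * e" using assms e by simp
          show "\<bar>d z t i\<bar> \<le> M * e" if "i < N" for i
            unfolding d_def using XYb that t by (intro convex[OF z]) auto
        qed
        show "(\<forall>m. \<bar>coeff (P z i) m\<bar> \<le> M) \<and> (\<forall>m\<ge>r. coeff (P z i) m = 0) \<and>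
            (\<forall>t\<in>W. \<bar>d z t i - poly (P z i) (s t)\<bar> \<le> M * e ^ r)" if i: "i < N" for i
        proof (intro conjI allI impI ballI)
          show "\<bar>coeff (P z i) m\<bar> \<le> M" for m unfolding P_def using convex[OF z PX(1)[OF i] PY(1)[OF i]] by simp
          show "coeff (P z i) m = 0" if "m \<ge> r" for m using PX(2)[OF i that] PY(2)[OF i that] by (simp add: P_def)
          show "\<bar>d z t i - poly (P z i) (s t)\<bar> \<le> M * e ^ r" if "t \<in> W" for t
          proof -
            have "d z t i - poly (P z i) (s t) = z * (X t i - x0 i - poly (PX i) (s t)) + (1 - z) * (Y t i - y0 i - poly (PY i) (s t))"
              by (simp add: d_def P_def algebra_simps)
            then show ?thesis using convex[OF z PX(3)[OF i that] PY(3)[OF i that]] by simp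
          qed
        qed
        show "\<bar>\<Sum>j<N. b j * Dn N n (v j) (\<lambda>_. d') (w z)\<bar> \<le> B * \<eta> ^ n"
          if "n < r" "0 \<le> \<eta>" "\<And>i. i < N \<Longrightarrow> \<bar>d' i\<bar> \<le> \<eta>" for n \<eta> d'
          using D that by simp
        show "Ck N r (v j) \<and> dep N (v j)" if "j < N" for j using v that by blast
        show "\<bar>s t\<bar> \<le> R * e" if "t \<in> W" for t using s that by blast
      qed (rule B0 e)+
      then show ?thesis unfolding p_def Let_def .
    qed
    have pcont: "continuous_on {0..1} (\<lambda>z. poly (p z) x)" for x
      unfolding p_def poly_polymap_poly polymap_def
    proof (intro continuous_on_sum continuous_on_mult)
      fix n js assume n: "n \<in> {..<r}" and js: "js \<in> {js. set js \<subseteq> {..<N} \<and> length js = n}"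
      show "continuous_on {0..1} (\<lambda>z. taylor_coeff N b v (w z) js)"
        unfolding taylor_coeff_def
      proof (intro continuous_on_divide continuous_on_sum continuous_on_mult continuous_on_const)
        fix j assume j: "j \<in> {..<N}"
        have "continuous_on UNIV (pds js (v j))"
          using v j n js by (intro Ck_continuous[OF Ck_pds[of N r "v j" js 0]]) auto
        then show "continuous_on {0..1} (\<lambda>z. pds js (v j) (w z))"
          unfolding w_def by (rule continuous_on_compose2[OF _ continuous_line_in_rvec]) simp
      qed simp
      show "continuous_on {0..1} (\<lambda>z. \<Prod>k<n. poly (P z (js ! k)) x)"
      proof (rule continuous_on_prod)
        fix k
        have eq: "poly (P z (js ! k)) x = z * poly (PX (js ! k)) x + (1 - z) * poly (PY (js ! k)) x" for z
          by (simp add: P_def)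
        show "continuous_on {0..1} (\<lambda>z. poly (P z (js ! k)) x)" unfolding eq by (intro continuous_intros)
      qed
    qed
    have vcont: "continuous_on {0..1} (\<lambda>z. v j (\<lambda>l. z * X t l + (1 - z) * Y t l))" if "j < N" for j t
    proof -
      have "continuous_on UNIV (v j)" using Ck_continuous[of N r "v j"] v that by simp
      then show ?thesis by (rule continuous_on_compose2[OF _ continuous_line_in_rvec]) simp
    qed
    define pb where "pb = (\<Sum>l\<le>D. smult (integral {0..1} (\<lambda>z. poly (p z) (lag_node D l))) (lag_poly D l))"
    have pb: "poly pb x = integral {0..1} (\<lambda>z. poly (p z) x)" for x
    proof -
      have "integral {0..1} (\<lambda>z. poly (p z) x) = integral {0..1} (\<lambda>z. \<Sum>l\<le>D. poly (p z) (lag_node D l) * poly (lag_poly D l) x)"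
      proof (rule integral_cong)
        fix z :: real assume z: "z \<in> {0..1}"
        have "poly (p z) x = poly (\<Sum>l\<le>D. smult (poly (p z) (lag_node D l)) (lag_poly D l)) x"
          by (subst lagrange_interpolation[of "p z" D, symmetric]) (use pz[OF z] in \<open>simp_all add: D_def\<close>)
        then show "poly (p z) x = (\<Sum>l\<le>D. poly (p z) (lag_node D l) * poly (lag_poly D l) x)"
          by (simp add: poly_sum)
      qed
      also have "\<dots> = (\<Sum>l\<le>D. integral {0..1} (\<lambda>z. poly (p z) (lag_node D l) * poly (lag_poly D l) x))"
        by (intro integral_sum integrable_continuous_interval continuous_intros pcont) auto
      also have "\<dots> = poly pb x" by (simp add: pb_def poly_sum)
      finally show ?thesis by simp
    qed
    have "apx r (L * (K * B)) W s e (\<lambda>t. \<Sum>j<N. b j * integral {0..1} (\<lambda>z. v j (\<lambda>l. z * X t l + (1 - z) * Y t l)))"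
    proof (rule L'[rule_format, where p = pb, OF _ _ e])
      show "degree pb \<le> D" unfolding pb_def
        by (intro degree_sum_le) (auto intro: order.trans[OF degree_smult_le] degree_lag_poly)
      show "\<bar>poly pb x\<bar> \<le> K * B" if "x \<in> {0..1}" for x
        unfolding pb using integral_bound[of 0 1 "\<lambda>z. poly (p z) x" "K * B"] pcont pz that by simp
      show "\<bar>s t\<bar> \<le> R * e" if "t \<in> W" for t using s that by blast
      show "\<bar>(\<Sum>j<N. b j * integral {0..1} (\<lambda>z. v j (\<lambda>l. z * X t l + (1 - z) * Y t l))) - poly pb (s t)\<bar> \<le> K * B * e ^ r"
        if t: "t \<in> W" for t
      proof -
        have c1: "continuous_on {0..1} (\<lambda>z. \<Sum>j<N. b j * v j (\<lambda>l. z * X t l + (1 - z) * Y t l))"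
          by (intro continuous_intros vcont) auto
        have "(\<Sum>j<N. b j * integral {0..1} (\<lambda>z. v j (\<lambda>l. z * X t l + (1 - z) * Y t l)))
            = integral {0..1} (\<lambda>z. \<Sum>j<N. b j * v j (\<lambda>l. z * X t l + (1 - z) * Y t l))"
          by (subst integral_sum) (auto intro!: integrable_continuous_interval continuous_intros vcont)
        then have "(\<Sum>j<N. b j * integral {0..1} (\<lambda>z. v j (\<lambda>l. z * X t l + (1 - z) * Y t l))) - poly pb (s t)
           = integral {0..1} (\<lambda>z. (\<Sum>j<N. b j * v j (\<lambda>l. z * X t l + (1 - z) * Y t l)) - poly (p z) (s t))"
          unfolding pb by (subst integral_diff) (auto intro!: integrable_continuous_interval c1 pcont)
        moreover have "norm (integral {0..1} (\<lambda>z. (\<Sum>j<N. b j * v j (\<lambda>l. z * X t l + (1 - z) * Y t l)) - poly (p z) (s t))) \<le> K * B * e ^ r * (1 - 0)"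
          by (rule integral_bound) (use pz t in \<open>auto simp: arg intro!: continuous_on_diff c1 pcont\<close>)
        ultimately show ?thesis by simp
      qed
    qed
    then show ?thesis by (simp only: mult.assoc)
  qed
  have le: "1 \<le> L * K" using L1 K1 mult_mono[of 1 L 1 K] by simp
  show ?thesis unfolding averaged_const_def
    by (rule exI[of _ "L * K"], rule conjI, rule le, (rule allI)+, (rule impI)+, rule main, assumption+)
qed

text \<open>
  The factors \<open>A t j\<close> are known to be approximable only in combinations with constant weights,
  with the bound \<open>C max |b j|\<close> of an operator norm.
\<close>

definition linear_const :: "nat \<Rightarrow> real \<Rightarrow> real \<Rightarrow> real \<Rightarrow> bool" where
  "linear_const r R E K \<longleftrightarrow> K \<ge> 1 \<and> (\<forall>N A C Z \<Phi> (W::real set) s e.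
     (\<forall>b B. (\<forall>j<N. \<bar>b j\<bar> \<le> B) \<longrightarrow> 0 \<le> B \<longrightarrow> apx r (C * B) W s e (\<lambda>t. \<Sum>j<(N::nat). b j * A t j)
        \<and> (\<forall>t\<in>W. \<bar>\<Sum>j<N. b j * A t j\<bar> \<le> C * B)) \<longrightarrow>
     0 \<le> C \<longrightarrow> 0 \<le> Z \<longrightarrow> 0 \<le> e \<longrightarrow> e \<le> E \<longrightarrow> (\<forall>t\<in>W. \<bar>s t\<bar> \<le> R * e) \<longrightarrow>
     (\<forall>j<N. apx r Z W s e (\<lambda>t. \<Phi> t j)) \<longrightarrow>
     apx r (K * C * Z) W s e (\<lambda>t. \<Sum>j<N. \<Phi> t j * A t j))"

text \<open>
  Replace the weights \<open>\<Phi> t j\<close> by their approximating polynomials and sort by powers of \<open>s\<close>: every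
  power is multiplied by a combination with constant weights. The remainder is covered by the
  operator bound at fixed time.
\<close>

lemma linear_combination_composition:
  fixes r :: nat and R E :: real
  assumes "0 \<le> R" "0 \<le> E"
  shows "\<exists>K. linear_const r R E K"
proof -
  define k where "k m = (SOME K. K \<ge> (1::real) \<and> (\<forall>M W s e h. apx r M W s e h \<longrightarrow> 0 \<le> e \<longrightarrow> e \<le> E \<longrightarrow>
     (\<forall>t\<in>W. \<bar>s t\<bar> \<le> R * e) \<longrightarrow> apx r (K * M) W s e (\<lambda>t. s t ^ m * h t)))" for m
  have k': "k m \<ge> 1 \<and> (\<forall>M W s e h. apx r M W s e h \<longrightarrow> 0 \<le> e \<longrightarrow> e \<le> E \<longrightarrow>
     (\<forall>t\<in>W. \<bar>s t\<bar> \<le> R * e) \<longrightarrow> apx r (k m * M) W s e (\<lambda>t. s t ^ m * h t))" for m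
    unfolding k_def by (rule someI_ex[OF apx_power_mult[OF assms]])
  note k1 = k'[THEN conjunct1] and k = k'[THEN conjunct2, THEN spec, THEN spec, THEN spec, THEN spec, THEN spec, THEN mp, THEN mp, THEN mp, THEN mp]
  define K where "K = (\<Sum>m<r. k m) + 1"
  have K1: "K \<ge> 1" unfolding K_def using k1 by (simp add: sum_nonneg order.trans[OF zero_le_one])
  have main: "apx r (K * C * Z) W s e (\<lambda>t. \<Sum>j<N. \<Phi> t j * A t j)"
    if A: "\<forall>b B. (\<forall>j<N. \<bar>b j\<bar> \<le> B) \<longrightarrow> 0 \<le> B \<longrightarrow> apx r (C * B) W s e (\<lambda>t. \<Sum>j<(N::nat). b j * A t j)
        \<and> (\<forall>t\<in>W. \<bar>\<Sum>j<N. b j * A t j\<bar> \<le> C * B)"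
      and C0: "0 \<le> C" and Z0: "0 \<le> Z" and e: "0 \<le> e" "e \<le> E" and s: "\<forall>t\<in>W. \<bar>s t\<bar> \<le> R * e"
      and Phi: "\<forall>j<N. apx r Z W s e (\<lambda>t. \<Phi> t j)"
    for N A C Z \<Phi> s e and W :: "real set"
  proof -
    have "\<forall>j<N. \<exists>p::real poly. (\<forall>m. \<bar>coeff p m\<bar> \<le> Z) \<and> (\<forall>m\<ge>r. coeff p m = 0) \<and> (\<forall>t\<in>W. \<bar>\<Phi> t j - poly p (s t)\<bar> \<le> Z * e ^ r)"
      using Phi unfolding apx_def by blast
    then obtain P where P: "\<And>j m. j < N \<Longrightarrow> \<bar>coeff (P j) m\<bar> \<le> Z" "\<And>j m. j < N \<Longrightarrow> m \<ge> r \<Longrightarrow> coeff (P j) m = 0"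
      "\<And>j t. j < N \<Longrightarrow> t \<in> W \<Longrightarrow> \<bar>\<Phi> t j - poly (P j) (s t)\<bar> \<le> Z * e ^ r" by metis
    define \<rho> where "\<rho> t j = \<Phi> t j - poly (P j) (s t)" for t j
    have 1: "apx r (\<Sum>m<r. k m * (C * Z)) W s e (\<lambda>t. \<Sum>m<r. s t ^ m * (\<Sum>j<N. coeff (P j) m * A t j))"
    proof (rule apx_sum)
      fix m
      have "apx r (C * Z) W s e (\<lambda>t. \<Sum>j<N. coeff (P j) m * A t j)"
        by (rule A[rule_format, THEN conjunct1]) (use P(1) Z0 in auto)
      from k[OF this e s] show "apx r (k m * (C * Z)) W s e (\<lambda>t. s t ^ m * (\<Sum>j<N. coeff (P j) m * A t j))" .
    qed
    have 2: "apx r (C * Z) W s e (\<lambda>t. \<Sum>j<N. \<rho> t j * A t j)"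
      unfolding apx_def
    proof (intro exI[of _ 0] conjI ballI allI impI)
      fix t assume t: "t \<in> W"
      have "\<bar>\<Sum>j<N. \<rho> t j * A t j\<bar> \<le> C * (Z * e ^ r)"
      proof (rule A[rule_format, THEN conjunct2, rule_format, OF _ _ t])
        show "\<bar>\<rho> t j\<bar> \<le> Z * e ^ r" if "j < N" for j using P(3)[OF that t] by (simp add: \<rho>_def)
        show "0 \<le> Z * e ^ r" using Z0 e by simp
      qed
      then show "\<bar>(\<Sum>j<N. \<rho> t j * A t j) - poly 0 (s t)\<bar> \<le> C * Z * e ^ r" by (simp add: mult.assoc)
    qed (use C0 Z0 in auto)
    have eq: "(\<Sum>m<r. s t ^ m * (\<Sum>j<N. coeff (P j) m * A t j)) + (\<Sum>j<N. \<rho> t j * A t j) = (\<Sum>j<N. \<Phi> t j * A t j)" for t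
    proof -
      have "(\<Sum>m<r. s t ^ m * (\<Sum>j<N. coeff (P j) m * A t j)) = (\<Sum>j<N. (\<Sum>m<r. coeff (P j) m * s t ^ m) * A t j)"
        unfolding sum_distrib_left sum_distrib_right by (subst sum.swap) (simp add: mult_ac)
      also have "\<dots> = (\<Sum>j<N. poly (P j) (s t) * A t j)"
        by (rule sum.cong[OF refl]) (subst poly_as_sum[of r], use P(2) in auto)
      finally show ?thesis by (simp add: sum.distrib[symmetric] \<rho>_def algebra_simps)
    qed
    have "(\<Sum>m<r. k m * (C * Z)) + C * Z = K * C * Z"
      by (simp add: K_def sum_distrib_left sum_distrib_right algebra_simps)
    then show ?thesis using apx_add[OF 1 2] by (simp add: eq)
  qed
  show ?thesis unfolding linear_const_def
    by (rule exI[of _ K], rule conjI, rule K1, (rule allI)+, (rule impI)+, rule main, assumption+)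
qed

section \<open>Bounds provided by the constant of a slab\<close>

lemma norm_linf_le: "1 \<le> N \<Longrightarrow> (\<And>i. i < N \<Longrightarrow> \<bar>x i\<bar> \<le> B) \<Longrightarrow> norm_linf N x \<le> B"
  unfolding norm_linf_def by (subst Max_le_iff) (auto simp: lessThan_empty_iff)

lemma abs_le_norm_linf: "i < N \<Longrightarrow> \<bar>x i\<bar> \<le> norm_linf N x"
  unfolding norm_linf_def by (rule Max_ge) auto

text \<open>
  Scaling to the unit ball, over which the supremum of the operator norm is taken.
\<close>

lemma opnorm_linf_bound:
  assumes N: "1 \<le> N" and A: "opnorm_linf N A \<le> K" and i: "i < N" and b: "\<And>j. j < N \<Longrightarrow> \<bar>b j\<bar> \<le> B"
  shows "\<bar>\<Sum>j<N. A i j * b j\<bar> \<le> K * B"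
proof (cases "B = 0")
  case True
  then have "(\<Sum>j<N. A i j * b j) = 0" using b by (intro sum.neutral) force
  then show ?thesis using True by simp
next
  case False
  have B: "0 < B" using b[OF i] False by linarith
  let ?S = "{w. norm_linf N w \<le> 1}"
  let ?w = "\<lambda>j. b j / B"
  have w: "?w \<in> ?S" using b B by (auto intro!: norm_linf_le[OF N] simp: field_simps)
  have "norm_linf N (mat_vec N A w) \<le> (\<Sum>i<N. \<Sum>j<N. \<bar>A i j\<bar>)" if "w \<in> ?S" for w
  proof (rule norm_linf_le[OF N])
    fix i assume i: "i < N"
    have "\<bar>mat_vec N A w i\<bar> \<le> (\<Sum>j<N. \<bar>A i j\<bar>)"
      unfolding mat_vec_def
    proof (rule order.trans[OF sum_abs], intro sum_mono)
      fix j assume "j \<in> {..<N}"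
      then have "\<bar>w j\<bar> \<le> 1" using that abs_le_norm_linf[of j N w] by auto
      then show "\<bar>A i j * w j\<bar> \<le> \<bar>A i j\<bar>" by (simp add: abs_mult mult_left_le)
    qed
    also have "\<dots> \<le> (\<Sum>i<N. \<Sum>j<N. \<bar>A i j\<bar>)"
      by (rule member_le_sum) (use i in \<open>auto intro: sum_nonneg\<close>)
    finally show "\<bar>mat_vec N A w i\<bar> \<le> (\<Sum>i<N. \<Sum>j<N. \<bar>A i j\<bar>)" .
  qed
  then have bdd: "bdd_above ((\<lambda>w. norm_linf N (mat_vec N A w)) ` ?S)"
    unfolding bdd_above_def by (intro exI[of _ "\<Sum>i<N. \<Sum>j<N. \<bar>A i j\<bar>"]) blast
  have "\<bar>mat_vec N A ?w i\<bar> \<le> norm_linf N (mat_vec N A ?w)" by (rule abs_le_norm_linf[OF i])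
  also have "\<dots> \<le> opnorm_linf N A" unfolding opnorm_linf_def by (rule cSUP_upper[OF w bdd])
  also have "\<dots> \<le> K" by (rule A)
  finally have "\<bar>(\<Sum>j<N. A i j * b j) / B\<bar> \<le> K"
    by (simp add: mat_vec_def sum_divide_distrib)
  then show ?thesis using B by (simp add: abs_divide pos_divide_le_eq)
qed

lemma deriv_iterate_cong_open:
  fixes g h :: "real \<Rightarrow> real"
  assumes S: "open S" and eq: "\<And>s. s \<in> S \<Longrightarrow> g s = h s" and t: "t \<in> S"
  shows "(deriv ^^ k) g t = (deriv ^^ k) h t"
  using t
proof (induction k arbitrary: t)
  case 0
  then show ?case using eq by simp
next
  case (Suc k)
  have "\<forall>\<^sub>F s in nhds t. (deriv ^^ k) g s = (deriv ^^ k) h s"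
    using eventually_nhds_in_open[OF S Suc.prems] by eventually_elim (rule Suc.IH)
  then show ?case by (simp add: deriv_cong_ev)
qed

lemma deriv_iterate_affine:
  fixes x d c :: real
  shows "(deriv ^^ k) (\<lambda>s. x + (s - c) * d) = (\<lambda>s. if k = 0 then x + (s - c) * d else if k = 1 then d else 0)"
proof (induction k)
  case (Suc k)
  have 1: "deriv (\<lambda>s. x + (s - c) * d) = (\<lambda>_. d)"
    by (rule ext, rule DERIV_imp_deriv) (auto intro!: derivative_eq_intros)
  show ?case by (cases "k = 0") (auto simp: Suc.IH 1)
qed simp

text \<open>
  Affine curves are the test curves in the condition on \<open>C\<^sub>f\<close>.
\<close>

lemma pw_smooth_affine: "pw_smooth m a b {} (\<lambda>s. x + (s - c) * d)"
  unfolding pw_smooth_def deriv_iterate_affine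
proof (intro conjI allI ballI impI)
  fix n :: nat and t :: real
  have D: "(\<lambda>s. if n = 0 then x + (s - c) * d else if n = 1 then d else 0) differentiable at t" for t
    by (cases "n = 0"; cases "n = 1") (auto intro!: derivative_intros)
  then show "(\<lambda>s. if n = 0 then x + (s - c) * d else if n = 1 then d else 0) differentiable at t" .
  have C: "continuous_on UNIV (\<lambda>s. if n = 0 then x + (s - c) * d else if n = 1 then d else 0)"
    by (cases "n = 0"; cases "n = 1") (auto intro!: continuous_intros)
  then show "continuous_on ({a<..<b} - {}) (\<lambda>s. if n = 0 then x + (s - c) * d else if n = 1 then d else 0)"
    by (rule continuous_on_subset) simp
  have "\<exists>l. ((\<lambda>s. if n = 0 then x + (s - c) * d else if n = 1 then d else 0) \<longlongrightarrow> l) (at t within S)" for S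
  proof -
    have "isCont (\<lambda>s. if n = 0 then x + (s - c) * d else if n = 1 then d else 0) t"
      using C unfolding continuous_on_eq_continuous_at[OF open_UNIV] by blast
    then show ?thesis unfolding isCont_def by (blast intro: tendsto_within_subset[OF _ subset_UNIV])
  qed
  then show "\<exists>l. ((\<lambda>s. if n = 0 then x + (s - c) * d else if n = 1 then d else 0) \<longlongrightarrow> l) (at_right t)"
    "\<exists>l. ((\<lambda>s. if n = 0 then x + (s - c) * d else if n = 1 then d else 0) \<longlongrightarrow> l) (at_left t)" by blast+
qed simp_all

lemma norm_linf_nonneg: "1 \<le> N \<Longrightarrow> 0 \<le> norm_linf N x"
  using abs_le_norm_linf[of 0 N x] by (meson abs_ge_zero less_le_trans order.trans zero_less_one)

text \<open>
  The norm is an infimum of admissible constants, which is again admissible.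
\<close>

lemma Dn_norm_bound:
  assumes N: "1 \<le> N" and D: "Dn_norm N n v A \<le> ereal c" and x: "(x, t) \<in> A"
  shows "\<bar>Dn N n (\<lambda>z. v z t) w x\<bar> \<le> c * (\<Prod>k<n. norm_linf N (w k))" and "0 \<le> c"
proof -
  let ?S = "{c. 0 \<le> c \<and> (\<forall>(x, t)\<in>A. \<forall>w. \<bar>Dn N n (\<lambda>z. v z t) w x\<bar> \<le> c * (\<Prod>k<n. norm_linf N (w k)))}"
  have ex: "\<exists>c'. c' \<in> ?S \<and> c' < b" if "c < b" for b
  proof -
    have "Inf (ereal ` ?S) < ereal b" using D that unfolding Dn_norm_def by (meson less_ereal.simps(1) order.strict_trans1)
    then show ?thesis unfolding Inf_less_iff by auto
  qed
  show "0 \<le> c"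
  proof (rule ccontr)
    assume "\<not> 0 \<le> c"
    then show False using ex[of 0] by auto
  qed
  define X where "X = (\<Prod>k<n. norm_linf N (w k))"
  have X: "0 \<le> X" unfolding X_def by (intro prod_nonneg norm_linf_nonneg N)
  have "\<bar>Dn N n (\<lambda>z. v z t) w x\<bar> \<le> c * X"
  proof (rule field_le_epsilon)
    fix \<epsilon> :: real assume \<epsilon>: "0 < \<epsilon>"
    have "c < c + \<epsilon> / (1 + X)" using \<epsilon> X by simp
    from ex[OF this] obtain c' where c': "c' \<in> ?S" "c' < c + \<epsilon> / (1 + X)" by blast
    then have le: "\<bar>Dn N n (\<lambda>z. v z t) w x\<bar> \<le> c' * X" using x by (auto simp: X_def)
    have "(c' - c) * X \<le> \<epsilon> / (1 + X) * (1 + X)"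
      using c'(2) X \<epsilon> by (intro mult_mono) auto
    also have "\<dots> = \<epsilon>" using X by simp
    finally show "\<bar>Dn N n (\<lambda>z. v z t) w x\<bar> \<le> c * X + \<epsilon>" using le by (simp add: algebra_simps)
  qed
  then show "\<bar>Dn N n (\<lambda>z. v z t) w x\<bar> \<le> c * (\<Prod>k<n. norm_linf N (w k))" by (simp add: X_def)
qed

lemma conv_hull_segment:
  assumes "x \<in> X" "y \<in> X" "\<theta> \<in> {0..1}"
  shows "(\<lambda>i. x i + \<theta> * (y i - x i)) \<in> conv_hull X"
  unfolding conv_hull_def
proof (intro CollectI exI conjI)
  let ?c = "\<lambda>k::nat. if k = 0 then 1 - \<theta> else \<theta>"
  let ?y = "\<lambda>k::nat. if k = 0 then x else y"
  show "\<forall>k<2. 0 \<le> ?c k \<and> ?y k \<in> X" using assms by auto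
  show "(\<Sum>k<2. ?c k) = 1" by (simp add: eval_nat_numeral)
  show "(\<lambda>i. x i + \<theta> * (y i - x i)) = (\<lambda>i. \<Sum>k<2. ?c k * ?y k i)"
    by (auto simp: eval_nat_numeral algebra_simps)
qed

section \<open>Equations on a cell as weighted projections\<close>

text \<open>
  Tested with \<open>\<omega> (p - w)\<close>, the Galerkin equation says that \<open>p - w\<close> is the weighted projection of
  \<open>F - w\<close>.
\<close>

lemma weighted_projection_error:
  fixes p w :: "real poly"
  assumes P: "projection_const d C" and ab: "a < b" and \<omega>: "end_weight a b (poly \<omega>)"
    and deg: "degree (p - w) \<le> d"
    and F: "\<And>r. (\<lambda>t. F t * poly r t) integrable_on {a..b}" and Fw: "\<And>t. t \<in> {a<..<b} \<Longrightarrow> \<bar>F t - poly w t\<bar> \<le> \<delta>"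
    and orth: "integral {a..b} (\<lambda>t. poly p t * poly (\<omega> * (p - w)) t) = integral {a..b} (\<lambda>t. F t * poly (\<omega> * (p - w)) t)"
    and x: "x \<in> {a..b}"
  shows "\<bar>poly p x - poly w x\<bar> \<le> C * \<delta>"
proof -
  let ?z = "p - w"
  have c: "(\<lambda>t. poly r t) integrable_on {a..b}" for r :: "real poly"
    by (intro integrable_continuous_interval continuous_intros)
  have i1: "(\<lambda>t. F t * poly (\<omega> * ?z) t - poly (w * (\<omega> * ?z)) t) integrable_on {a..b}"
    by (intro integrable_diff F c)
  have "integral {a..b} (\<lambda>t. poly \<omega> t * (poly ?z t)\<^sup>2)
      = integral {a..b} (\<lambda>t. poly (p * (\<omega> * ?z)) t - poly (w * (\<omega> * ?z)) t)"
    by (rule integral_cong) (simp add: power2_eq_square algebra_simps)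
  also have "\<dots> = integral {a..b} (\<lambda>t. poly (p * (\<omega> * ?z)) t) - integral {a..b} (\<lambda>t. poly (w * (\<omega> * ?z)) t)"
    by (rule integral_diff[OF c c])
  also have "integral {a..b} (\<lambda>t. poly (p * (\<omega> * ?z)) t) = integral {a..b} (\<lambda>t. F t * poly (\<omega> * ?z) t)"
    using orth by simp
  also have "\<dots> - integral {a..b} (\<lambda>t. poly (w * (\<omega> * ?z)) t)
      = integral {a..b} (\<lambda>t. F t * poly (\<omega> * ?z) t - poly (w * (\<omega> * ?z)) t)"
    by (rule integral_diff[OF F c, symmetric])
  also have "\<dots> = integral {a..b} (\<lambda>t. poly \<omega> t * poly ?z t * (F t - poly w t))"
    by (rule integral_cong) (simp add: algebra_simps)
  finally have "\<bar>poly ?z x\<bar> \<le> C * \<delta>"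
    using P x deg ab \<omega> Fw i1 unfolding projection_const_def
    by (elim conjE) (erule allE[of _ ?z], erule allE[of _ a], erule allE[of _ b], erule allE[of _ "poly \<omega>"],
        erule allE[of _ "\<lambda>t. F t - poly w t"], erule allE[of _ \<delta>], simp add: algebra_simps)
  then show ?thesis by simp
qed

lemma degree_le_of_coeffs: "\<forall>m\<ge>q. coeff (p :: real poly) m = 0 \<Longrightarrow> degree p \<le> q"
  by (intro degree_le) auto

lemma degree_linear_mult:
  assumes "\<forall>m\<ge>q. coeff (p :: real poly) m = 0"
  shows "degree ([:a, b:] * p) \<le> q"
proof (cases "p = 0")
  case False
  have "degree ([:a, b:] * p) \<le> degree [:a, b:] + degree p" by (rule degree_mult_le)
  also have "\<dots> \<le> 1 + degree p" by simp
  also have "\<dots> \<le> q" using coeff_zero_imp_degree[OF assms False] by simp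
  finally show ?thesis .
qed simp

context mdG
begin

lemma cell_integrable:
  assumes h: "mble T h" and B: "\<And>t. t \<in> {0<..T} \<Longrightarrow> \<bar>h t\<bar> \<le> B" and i: "i < N" and j: "j \<in> {1..M i}"
  shows "(\<lambda>t. h t * poly r t) integrable_on {nd i (j - 1)..nd i j}"
proof -
  have "\<exists>z\<in>{0..T}. \<forall>t\<in>{0..T}. \<bar>poly r t\<bar> \<le> \<bar>poly r z\<bar>"
    using T_pos by (intro continuous_attains_sup continuous_intros) auto
  then obtain L where L: "\<And>t. t \<in> {0..T} \<Longrightarrow> \<bar>poly r t\<bar> \<le> L" by blast
  have "(\<lambda>t. h t * poly r t) absolutely_integrable_on {0<..T}"
  proof (rule mble_bounded_integrable)
    show "mble T (\<lambda>t. h t * poly r t)" by (intro mble_mult h mble_continuous continuous_intros)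
    show "\<bar>h t * poly r t\<bar> \<le> B * L" if "t \<in> {0<..T}" for t
    proof -
      have "\<bar>h t\<bar> \<le> B" "\<bar>poly r t\<bar> \<le> L" using B[OF that] L[of t] that by auto
      then show ?thesis unfolding abs_mult by (intro mult_mono) auto
    qed
  qed
  then have "(\<lambda>t. h t * poly r t) integrable_on {0<..T}"
    by (rule absolutely_integrable_on_def[THEN iffD1, THEN conjunct1])
  then have "(\<lambda>t. h t * poly r t) integrable_on {0..T}" using integrable_Ioc by blast
  then show ?thesis by (rule integrable_subinterval_real[OF _ cell_closure_subset[OF i j]])
qed

lemma f_cell_integrable:
  assumes y: "\<And>l. l < N \<Longrightarrow> mble T (\<lambda>t. y t l)" and i: "i < N" and j: "j \<in> {1..M i}"
  shows "(\<lambda>t. f (y t) t i * poly r t) integrable_on {nd i (j - 1)..nd i j}"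
proof -
  obtain B where "\<And>x t i. t \<in> {0<..T} \<Longrightarrow> i < N \<Longrightarrow> \<bar>f x t i\<bar> \<le> B" using f_bounded by blast
  then show ?thesis by (intro cell_integrable[OF f_mble[OF i y] _ i j]) (use i in auto)
qed

lemma adjoint_cell_integrable:
  assumes x: "\<And>l. l < N \<Longrightarrow> mble T (\<lambda>t. x t l)" and y: "\<And>l. l < N \<Longrightarrow> mble T (\<lambda>t. y t l)" and i: "i < N" and j: "j \<in> {1..M i}"
  shows "(\<lambda>t. adjoint_rhs f x y \<Phi> t i * poly r t) integrable_on {nd i (j - 1)..nd i j}"
proof -
  obtain B where "\<And>x y t i. t \<in> {0<..T} \<Longrightarrow> i < N \<Longrightarrow> \<bar>adjoint_rhs f x y \<Phi> t i\<bar> \<le> B" using adjoint_bounded by blast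
  then show ?thesis by (intro cell_integrable[OF adjoint_mble[OF i x y] _ i j]) (use i in auto)
qed

text \<open>
  Partial integration moves the derivative from the test function to \<open>\<Phi>\<close>; the value at the left
  node disappears.
\<close>

lemma dual_cell_equation_strong:
  assumes i: "i < N" and j: "j \<in> {1..M i}" and w: "degree w \<le> deg G i j"
    and g: "\<And>t. t \<in> cell G i j \<Longrightarrow> g t i = 0"
  shows "poly w (nd i j) * poly (cell_poly G \<Phi> i j) (nd i j)
      - integral {nd i (j - 1)..nd i j} (\<lambda>t. poly (pderiv (cell_poly G \<Phi> i j)) t * poly w t)
      = poly w (nd i j) * (if j = M i then \<psi> i else poly (cell_poly G \<Phi> i (Suc j)) (nd i j))
      + integral {nd i (j - 1)..nd i j} (\<lambda>t. adjoint_rhs f pu U \<Phi> t i * poly w t)"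
proof -
  let ?a = "nd i (j - 1)" and ?b = "nd i j" and ?p = "cell_poly G \<Phi> i j"
  have ab: "?a < ?b" by (rule nd_step[OF i j])
  have 1: "((\<lambda>t. poly (pderiv w) t * poly ?p t + poly (pderiv ?p) t * poly w t) has_integral
     (poly w ?b * poly ?p ?b - poly w ?a * poly ?p ?a)) {?a..?b}"
  proof (rule fundamental_theorem_of_calculus)
    fix t
    from DERIV_mult[OF poly_DERIV[of w t] poly_DERIV[of ?p t]]
    have "((\<lambda>t. poly w t * poly ?p t) has_real_derivative poly (pderiv w) t * poly ?p t + poly (pderiv ?p) t * poly w t) (at t)"
      by (simp add: algebra_simps)
    then show "((\<lambda>t. poly w t * poly ?p t) has_vector_derivative poly (pderiv w) t * poly ?p t + poly (pderiv ?p) t * poly w t) (at t within {?a..?b})"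
      unfolding has_real_derivative_iff_has_vector_derivative[symmetric] by (rule DERIV_subset) simp
  qed (use ab in simp)
  have 2: "(\<lambda>t. poly (pderiv w) t * poly ?p t) integrable_on {?a..?b}" "(\<lambda>t. poly (pderiv ?p) t * poly w t) integrable_on {?a..?b}"
    by (intro integrable_continuous_interval continuous_intros)+
  have "integral {?a..?b} (\<lambda>t. poly (pderiv w) t * poly ?p t) + integral {?a..?b} (\<lambda>t. poly (pderiv ?p) t * poly w t)
      = poly w ?b * poly ?p ?b - poly w ?a * poly ?p ?a"
    using integral_add[OF 2] integral_unique[OF 1] by simp
  moreover have "poly w ?a * poly ?p ?a + integral {?a..?b} (\<lambda>t. poly (pderiv w) t * poly ?p t)
      = poly w ?b * (if j = M i then \<psi> i else poly (cell_poly G \<Phi> i (Suc j)) ?b)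
      + integral {?a..?b} (\<lambda>t. poly w t * adjoint_rhs f pu U \<Phi> t i)"
    using dual_cell_equation[OF Phisol i j w g] unfolding cell_def integral_Ioc .
  moreover have "integral {?a..?b} (\<lambda>t. poly w t * adjoint_rhs f pu U \<Phi> t i) = integral {?a..?b} (\<lambda>t. adjoint_rhs f pu U \<Phi> t i * poly w t)"
    by (simp only: mult.commute)
  ultimately show ?thesis by simp
qed

end

section \<open>A slab with comparable steps\<close>

text \<open>
  The hypotheses of the second estimate on one slab: \<open>c\<close> is the value of \<open>C\<^sub>f\<close>, all steps lie
  between \<open>\<beta> \<kappa>\<close> and \<open>\<kappa>\<close>, and \<open>E\<close> bounds \<open>c \<kappa>\<close>.
\<close>

locale slab_ctx = mdG G Q f u0 u U \<psi> g \<Phi> for G Q f u0 u U \<psi> g \<Phi> +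
  fixes n q :: nat and c \<kappa> \<beta> E :: real
  assumes n: "n \<in> {1..nslab G}"
    and degs: "\<And>i j. (i, j) \<in> slab G n \<Longrightarrow> deg G i j = q"
    and steps: "\<And>i j. (i, j) \<in> slab G n \<Longrightarrow> \<beta> * \<kappa> \<le> step G i j \<and> step G i j \<le> \<kappa>"
    and pos: "0 < \<beta>" "0 < \<kappa>"
    and autonomous: "\<And>i x t. i < N \<Longrightarrow> t \<in> slab_ival G n \<Longrightarrow> f x t i = f x (level G n) i"
    and fCk: "\<And>i. i < N \<Longrightarrow> Ck N (q + 1) (\<lambda>x. f x (level G n) i)"
    and isCf: "is_Cf N q (level G (n - 1)) (level G n) f (slab_args G u U n) c"
    and small: "c * \<kappa> \<le> E"
    and g0: "\<And>i t. 0 < q \<Longrightarrow> i < N \<Longrightarrow> t \<in> slab_ival G n \<Longrightarrow> g t i = 0"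
begin

abbreviation "tn \<equiv> level G n"
abbreviation "args \<equiv> conv_hull (u ` slab_ival G n \<union> pu ` slab_ival G n \<union> U ` slab_ival G n)"

lemma tn_slab: "tn \<in> slab_ival G n"
  using lv_step[OF n] by (simp add: slab_ival_def)

lemma slab_T: "t \<in> slab_ival G n \<Longrightarrow> t \<in> {0<..T}"
  using slab_ival_subset[OF n] by blast

lemma slab_index:
  assumes i: "i < N" and t: "t \<in> slab_ival G n"
  shows "index_at (nd i) t \<in> {1..M i}" "t \<in> cell G i (index_at (nd i) t)" "(i, index_at (nd i) t) \<in> slab G n"
  using index_cell_exists[OF i slab_T[OF t]] slab_cell_iff[OF n i _ _ t] by auto

lemma q_le_Q: "q \<le> Q"
proof -
  have "0 < N" using N_pos by simp
  from slab_index[OF this tn_slab] show ?thesis using degQ degs \<open>0 < N\<close> by metis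
qed

lemma \<beta>_le_1: "\<beta> \<le> 1"
proof -
  have "0 < N" using N_pos by simp
  from steps[OF slab_index(3)[OF this tn_slab]] have "\<beta> * \<kappa> \<le> 1 * \<kappa>" by simp
  then show ?thesis using pos mult_le_cancel_right_pos by blast
qed

lemma f_dep_slab: "i < N \<Longrightarrow> dep N (\<lambda>x. f x tn i)"
  by (rule f_dep[OF slab_T[OF tn_slab]])

lemma Dn_norm_slab:
  assumes "i < N" "m \<le> q + 1"
  shows "Dn_norm N m (\<lambda>x t. f x t i) (slab_args G u U n) \<le> ereal c"
proof -
  have "Dp_norm N (q + 1) (\<lambda>x t. f x t i) (slab_args G u U n) \<le> ereal c"
    using isCf assms(1) by (auto simp: is_Cf_def)
  moreover have "Dn_norm N m (\<lambda>x t. f x t i) (slab_args G u U n) \<le> Dp_norm N (q + 1) (\<lambda>x t. f x t i) (slab_args G u U n)"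
    unfolding Dp_norm_def by (rule Max_ge) (use assms in auto)
  ultimately show ?thesis by (rule order.trans[rotated])
qed

lemma f_derivative_bound:
  assumes i: "i < N" and m: "m \<le> q + 1" and x: "x \<in> args" and d: "\<And>l. l < N \<Longrightarrow> \<bar>d l\<bar> \<le> \<eta>"
  shows "\<bar>Dn N m (\<lambda>z. f z tn i) (\<lambda>_. d) x\<bar> \<le> c * \<eta> ^ m" and "0 \<le> c"
proof -
  have A: "(x, tn) \<in> slab_args G u U n" using x tn_slab by (simp add: slab_args_def)
  note B = Dn_norm_bound[OF N_pos Dn_norm_slab[OF i m] A]
  show c0: "0 \<le> c" by (rule B(2))
  have "\<bar>Dn N m (\<lambda>z. f z tn i) (\<lambda>_. d) x\<bar> \<le> c * norm_linf N d ^ m"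
    using B(1)[of "\<lambda>_. d"] by simp
  also have "\<dots> \<le> c * \<eta> ^ m"
    using c0 d by (intro mult_left_mono power_mono norm_linf_le[OF N_pos] norm_linf_nonneg[OF N_pos]) auto
  finally show "\<bar>Dn N m (\<lambda>z. f z tn i) (\<lambda>_. d) x\<bar> \<le> c * \<eta> ^ m" .
qed

text \<open>
  Taylor remainders are evaluated on segments between points of the trajectories; this is the use
  of the convex hull in \<open>slab_args\<close>.
\<close>

lemma args_segment:
  assumes "x \<in> u ` slab_ival G n \<union> pu ` slab_ival G n \<union> U ` slab_ival G n"
    "y \<in> u ` slab_ival G n \<union> pu ` slab_ival G n \<union> U ` slab_ival G n" "\<theta> \<in> {0..1}"
  shows "(\<lambda>i. x i + \<theta> * (y i - x i)) \<in> args"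
  by (rule conv_hull_segment[OF assms])

lemma c_nonneg: "0 \<le> c"
proof -
  have "(\<lambda>i. u tn i + 0 * (u tn i - u tn i)) \<in> args" by (rule args_segment) (use tn_slab in auto)
  then show ?thesis using f_derivative_bound(2)[of 0 0 _ "\<lambda>_. 0" 0] N_pos by fastforce
qed

lemma slab_pd_eq: "t \<in> slab_ival G n \<Longrightarrow> j < N \<Longrightarrow> pd i (\<lambda>z. f z t j) = pd i (\<lambda>z. f z tn j)"
  using autonomous by simp

text \<open>
  The condition on \<open>C\<^sub>f\<close> bounds time derivatives of the transposed Jacobian along curves. Along
  an affine curve with velocity \<open>d\<close> the time derivative of order \<open>m\<close> is the derivative \<open>D\<^sup>m\<close> in
  direction \<open>d\<close>, and the curve may pass through any point \<open>x\<close> at an interior time of the slab.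
\<close>

lemma adjoint_derivative_bound_pos:
  assumes i: "i < N" and m: "m \<le> q" and \<eta>: "0 < \<eta>" and d: "\<And>l. l < N \<Longrightarrow> \<bar>d l\<bar> \<le> \<eta>" and b: "\<And>j. j < N \<Longrightarrow> \<bar>b j\<bar> \<le> B"
  shows "\<bar>\<Sum>j<N. b j * Dn N m (pd i (\<lambda>z. f z tn j)) (\<lambda>_. d) x\<bar> \<le> c * \<eta> ^ m * B"
proof -
  obtain t where t: "t \<in> {level G (n - 1)<..<tn}" using dense[OF lv_step[OF n]] by auto
  define y where "y s = (\<lambda>l. x l + (s - t) * d l)" for s
  have smooth: "pw_smooth m (level G (n - 1)) tn {} (\<lambda>s. y s l)" for l
    unfolding y_def by (rule pw_smooth_affine)
  have bound: "norm_linf N (\<lambda>l. (deriv ^^ k) (\<lambda>s. y s l) s) \<le> \<eta> ^ k" if "k \<in> {1..m}" for k s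
    unfolding y_def deriv_iterate_affine
  proof (rule norm_linf_le[OF N_pos])
    fix l assume l: "l < N"
    show "\<bar>if k = 0 then x l + (s - t) * d l else if k = 1 then d l else 0\<bar> \<le> \<eta> ^ k"
      using d[OF l] \<eta> that by (cases "k = 1") auto
  qed
  have "opnorm_linf N (\<lambda>i j. (deriv ^^ m) (\<lambda>s. transp (dfdu f (y s) s) i j) t) \<le> c * \<eta> ^ m"
    using isCf m \<eta> smooth bound t unfolding is_Cf_def
    by (elim conjE) (erule allE[of _ m], erule impE, assumption, erule allE[of _ y], erule allE[of _ "{}"], erule allE[of _ \<eta>], auto)
  from opnorm_linf_bound[OF N_pos this i b]
  have "\<bar>\<Sum>j<N. (deriv ^^ m) (\<lambda>s. transp (dfdu f (y s) s) i j) t * b j\<bar> \<le> c * \<eta> ^ m * B" .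
  moreover have "(deriv ^^ m) (\<lambda>s. transp (dfdu f (y s) s) i j) t = Dn N m (pd i (\<lambda>z. f z tn j)) (\<lambda>_. d) x" if j: "j < N" for j
  proof -
    have "(deriv ^^ m) (\<lambda>s. transp (dfdu f (y s) s) i j) t
        = (deriv ^^ m) (\<lambda>s. pd i (\<lambda>z. f z tn j) (\<lambda>l. (x l - t * d l) + s * d l)) t"
    proof (rule deriv_iterate_cong_open[OF open_greaterThanLessThan _ t])
      fix s assume "s \<in> {level G (n - 1)<..<tn}"
      then have s: "s \<in> slab_ival G n" by (simp add: slab_ival_def)
      have "y s = (\<lambda>l. (x l - t * d l) + s * d l)" by (simp add: y_def algebra_simps)
      then show "transp (dfdu f (y s) s) i j = pd i (\<lambda>z. f z tn j) (\<lambda>l. (x l - t * d l) + s * d l)"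
        by (simp add: transp_def dfdu_def slab_pd_eq[OF s j])
    qed
    also have "\<dots> = Dn N m (pd i (\<lambda>z. f z tn j)) (\<lambda>_. d) (\<lambda>l. (x l - t * d l) + t * d l)"
      using Ck_pd[of N q, OF _ i] fCk[OF j] dep_pd[OF f_dep_slab[OF j] i]
      by (subst deriv_iterate_line[of N q _ m]) (use m in auto)
    finally show ?thesis by simp
  qed
  ultimately show ?thesis by (simp add: mult.commute)
qed

lemma adjoint_derivative_bound:
  assumes i: "i < N" and m: "m \<le> q" and \<eta>: "0 \<le> \<eta>" and d: "\<And>l. l < N \<Longrightarrow> \<bar>d l\<bar> \<le> \<eta>" and b: "\<And>j. j < N \<Longrightarrow> \<bar>b j\<bar> \<le> B"
  shows "\<bar>\<Sum>j<N. b j * Dn N m (pd i (\<lambda>z. f z tn j)) (\<lambda>_. d) x\<bar> \<le> c * \<eta> ^ m * B"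
proof (cases "\<eta> = 0")
  case False
  then show ?thesis using adjoint_derivative_bound_pos[OF i m _ d b] \<eta> by simp
next
  case True
  then have d0: "d l = 0" if "l < N" for l using d[OF that] by simp
  have B0: "0 \<le> B" using b[OF i] by linarith
  show ?thesis
  proof (cases "m = 0")
    case True
    have "\<bar>\<Sum>j<N. b j * Dn N m (pd i (\<lambda>z. f z tn j)) (\<lambda>_. d) x\<bar> \<le> c * 1 ^ m * B"
      by (rule adjoint_derivative_bound_pos[OF i m _ _ b]) (use d0 in auto)
    then show ?thesis using True by simp
  next
    case False
    have "Dn N m v (\<lambda>_. d) x = 0" for v
      unfolding Dn_def
    proof (rule sum.neutral, rule ballI)
      fix js assume js: "js \<in> {js. set js \<subseteq> {..<N} \<and> length js = m}"
      have "js ! 0 \<in> set js" using js False by auto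
      then have "d (js ! 0) = 0" using js by (intro d0) auto
      then have "(\<Prod>k<m. d (js ! k)) = 0" using False by (intro prod_zero) (auto intro!: bexI[of _ 0])
      then show "pds js v x * (\<Prod>k<m. d (js ! k)) = 0" by simp
    qed
    then show ?thesis using c_nonneg B0 \<eta> by simp
  qed
qed

lemma Jmat_slab:
  assumes "t \<in> slab_ival G n" "j < N"
  shows "Jmat f x y t j i = integral {0..1} (\<lambda>z. pd i (\<lambda>w. f w tn j) (\<lambda>l. z * x t l + (1 - z) * y t l))"
  unfolding Jmat_def dfdu_def slab_pd_eq[OF assms] ..

text \<open>
  Case \<open>m = 0\<close> of the preceding bound, averaged over the segment.
\<close>

lemma adjoint_bound:
  assumes i: "i < N" and t: "t \<in> slab_ival G n" and b: "\<And>j. j < N \<Longrightarrow> \<bar>b j\<bar> \<le> B"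
  shows "\<bar>\<Sum>j<N. b j * Jmat f x y t j i\<bar> \<le> c * B"
proof -
  let ?h = "\<lambda>j z. pd i (\<lambda>w. f w tn j) (\<lambda>l. z * x t l + (1 - z) * y t l)"
  have cont: "continuous_on {0..1} (?h j)" if "j < N" for j
    by (rule Jmat_integrand_continuous[OF slab_T[OF tn_slab] that i])
  have "(\<Sum>j<N. b j * Jmat f x y t j i) = (\<Sum>j<N. integral {0..1} (\<lambda>z. b j * ?h j z))"
    by (rule sum.cong) (auto simp: Jmat_slab[OF t])
  also have "\<dots> = integral {0..1} (\<lambda>z. \<Sum>j<N. b j * ?h j z)"
    by (rule integral_sum[symmetric]) (auto intro!: integrable_continuous_interval continuous_intros cont)
  also have "norm \<dots> \<le> c * B * (1 - 0)"
  proof (rule integral_bound)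
    show "continuous_on {0..1} (\<lambda>z. \<Sum>j<N. b j * ?h j z)" by (intro continuous_intros cont) auto
    show "norm (\<Sum>j<N. b j * ?h j z) \<le> c * B" for z
      using adjoint_derivative_bound[OF i _ _ _ b, of 0 0 "\<lambda>_. 0"] by (simp add: Dn_0)
  qed simp
  finally show ?thesis by simp
qed

section \<open>Piecewise polynomials driven by a right-hand side\<close>

text \<open>
  All that is used of the equations for \<open>U\<close> and \<open>\<Phi>\<close> to raise the order. The statement is local:
  it needs \<open>F\<close> to be close to \<open>w\<close> only on the cells concerned, so a window around the base point
  suffices. For \<open>q = 0\<close> the only admissible \<open>w\<close> is \<open>0\<close>.
\<close>

definition drives :: "real \<Rightarrow> nat \<Rightarrow> (real \<Rightarrow> real) \<Rightarrow> (real \<Rightarrow> rvec) \<Rightarrow> bool" where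
  "drives C i F v \<longleftrightarrow> (\<forall>w \<delta>. (\<forall>m\<ge>q. coeff w m = 0) \<longrightarrow>
     (\<forall>j. (i, j) \<in> slab G n \<longrightarrow> (\<forall>t\<in>cell G i j. \<bar>F t - poly w t\<bar> \<le> \<delta>) \<longrightarrow>
        (\<forall>t\<in>{nd i (j - 1)..nd i j}. \<bar>poly (pderiv (cell_poly G v i j)) t - poly w t\<bar> \<le> C * \<delta>)) \<and>
     (\<forall>j. (i, j) \<in> slab G n \<longrightarrow> (i, Suc j) \<in> slab G n \<longrightarrow>
        (\<forall>t\<in>cell G i j \<union> cell G i (Suc j). \<bar>F t - poly w t\<bar> \<le> \<delta>) \<longrightarrow>
        \<bar>poly (cell_poly G v i (Suc j)) (nd i j) - poly (cell_poly G v i j) (nd i j)\<bar> \<le> C * \<delta> * \<kappa>))"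

lemma coeff_pderiv_zero:
  assumes "v \<in> Vspace G" "(i, j) \<in> slab G n" "\<forall>m\<ge>q. coeff w m = 0"
  shows "\<forall>m\<ge>q. coeff (pderiv (cell_poly G v i j) - w) m = 0"
proof -
  have ij: "i < N" "j \<in> {1..M i}" using slab_cell_subset[OF assms(2)] by auto
  have "degree (cell_poly G v i j) \<le> q" using cell_poly(1)[OF assms(1) ij] degs[OF assms(2)] by simp
  then show ?thesis using assms(3) by (auto simp: coeff_pderiv coeff_eq_0)
qed

text \<open>
  The local defect: with the constant test function the Galerkin equation expresses the jump by
  this difference.
\<close>

lemma cell_defect_integral:
  assumes ij: "(i, j) \<in> slab G n" and P: "0 \<le> C" "0 \<le> \<delta>"
    and F: "\<And>r. (\<lambda>t. F t * poly r t) integrable_on {nd i (j - 1)..nd i j}"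
    and Fw: "\<And>t. t \<in> cell G i j \<Longrightarrow> \<bar>F t - poly w t\<bar> \<le> \<delta>"
    and pw: "\<And>t. t \<in> {nd i (j - 1)..nd i j} \<Longrightarrow> \<bar>poly p t - poly w t\<bar> \<le> C * \<delta>"
  shows "\<bar>integral {nd i (j - 1)..nd i j} F - integral {nd i (j - 1)..nd i j} (poly p)\<bar> \<le> (C + 1) * \<delta> * \<kappa>"
proof -
  let ?a = "nd i (j - 1)" and ?b = "nd i j"
  have i: "i < N" and j: "j \<in> {1..M i}" using slab_cell_subset[OF ij] by auto
  have iF: "F integrable_on {?a..?b}" using F[of 1] by simp
  have ip: "poly p integrable_on {?a..?b}" by (intro integrable_continuous_interval continuous_intros)
  have i0: "(\<lambda>t. F t - poly p t) integrable_on {?a<..?b}"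
    using integrable_diff[OF iF ip] integrable_Ioc by blast
  have 1: "integral {?a..?b} F - integral {?a..?b} (poly p) = integral {?a<..?b} (\<lambda>t. F t - poly p t)"
    unfolding integral_Ioc by (rule integral_diff[OF iF ip, symmetric])
  have 2: "norm (integral {?a<..?b} (\<lambda>t. F t - poly p t)) \<le> integral {?a<..?b} (\<lambda>t. (C + 1) * \<delta>)"
  proof (rule integral_norm_bound_integral[OF i0])
    show "(\<lambda>t. (C + 1) * \<delta>) integrable_on {?a<..?b}" using integrable_Ioc integrable_const_ivl by blast
    fix t assume t: "t \<in> {?a<..?b}"
    have "\<bar>F t - poly w t\<bar> \<le> \<delta>" "\<bar>poly p t - poly w t\<bar> \<le> C * \<delta>" using Fw[of t] pw[of t] t by (auto simp: cell_def)
    then show "norm (F t - poly p t) \<le> (C + 1) * \<delta>" by (simp add: algebra_simps)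
  qed
  have 3: "integral {?a<..?b} (\<lambda>t. (C + 1) * \<delta>) = (?b - ?a) * ((C + 1) * \<delta>)"
    unfolding integral_Ioc using nd_step[OF i j] by simp
  have 4: "(?b - ?a) * ((C + 1) * \<delta>) \<le> \<kappa> * ((C + 1) * \<delta>)"
    using steps[OF ij] P by (intro mult_right_mono) (auto simp: step_def)
  show ?thesis using 2 4 unfolding 1 3 real_norm_def by (simp only: mult.commute)
qed

lemma slab_delta_nonneg: "(i, j) \<in> slab G n \<Longrightarrow> (\<And>t. t \<in> cell G i j \<Longrightarrow> \<bar>F t - poly w t\<bar> \<le> \<delta>) \<Longrightarrow> 0 \<le> \<delta>"
proof -
  assume ij: "(i, j) \<in> slab G n" and F: "\<And>t. t \<in> cell G i j \<Longrightarrow> \<bar>F t - poly w t\<bar> \<le> \<delta>"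
  have "nd i j \<in> cell G i j" using slab_cell_subset[OF ij] nd_step[of i j] by (simp add: cell_def)
  from F[OF this] show ?thesis by linarith
qed

text \<open>
  Test functions that vanish at the left node see no jump, whence the weight \<open>t - a\<close>; the
  constant test function then gives the jump at the left node.
\<close>

lemma U_drives:
  assumes P: "projection_const Q C" and i: "i < N"
  shows "drives (C + 1) i (\<lambda>t. f (U t) t i) U"
proof -
  have C0: "0 < C" using P by (simp add: projection_const_def)
  have main: "\<bar>poly (pderiv (cell_poly G U i j)) t - poly w t\<bar> \<le> C * \<delta>"
    if ij: "(i, j) \<in> slab G n" and w: "\<forall>m\<ge>q. coeff w m = 0" and F: "\<And>t. t \<in> cell G i j \<Longrightarrow> \<bar>f (U t) t i - poly w t\<bar> \<le> \<delta>"
      and t: "t \<in> {nd i (j - 1)..nd i j}" for j w \<delta> t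
  proof -
    have j: "j \<in> {1..M i}" using slab_cell_subset[OF ij] by auto
    let ?z = "pderiv (cell_poly G U i j) - w" and ?\<omega> = "[:- nd i (j - 1), 1:]"
    note z = coeff_pderiv_zero[OF U_V ij w]
    have d: "degree (?\<omega> * ?z) \<le> deg G i j" unfolding degs[OF ij] by (rule degree_linear_mult[OF z])
    show ?thesis
    proof (rule weighted_projection_error[OF P nd_step[OF i j], where \<omega> = ?\<omega> and F = "\<lambda>t. f (U t) t i"])
      show "end_weight (nd i (j - 1)) (nd i j) (poly ?\<omega>)" by (auto simp: end_weight_def)
      show "degree ?z \<le> Q" using degree_le_of_coeffs[OF z] q_le_Q by simp
      show "(\<lambda>t. f (U t) t i * poly r t) integrable_on {nd i (j - 1)..nd i j}" for r
        by (rule f_cell_integrable[OF U_mble i j])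
      show "\<bar>f (U t) t i - poly w t\<bar> \<le> \<delta>" if "t \<in> {nd i (j - 1)<..<nd i j}" for t
        using F that by (simp add: cell_def)
      have "poly (?\<omega> * ?z) (nd i (j - 1)) = 0" by simp
      then show "integral {nd i (j - 1)..nd i j} (\<lambda>t. poly (pderiv (cell_poly G U i j)) t * poly (?\<omega> * ?z) t)
          = integral {nd i (j - 1)..nd i j} (\<lambda>t. f (U t) t i * poly (?\<omega> * ?z) t)"
        using mdG_cell_equation[OF Usol i j d] unfolding cell_def integral_Ioc by simp
    qed (rule t)
  qed
  show ?thesis
    unfolding drives_def
  proof (intro allI impI conjI ballI)
    (* Off jumps the constant C suffices; C + 1 is used so that both clauses share one
       constant. *)
    fix w \<delta> j t
    assume w: "\<forall>m\<ge>q. coeff w m = 0" and ij: "(i, j) \<in> slab G n" and F: "\<forall>t\<in>cell G i j. \<bar>f (U t) t i - poly w t\<bar> \<le> \<delta>"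
      and t: "t \<in> {nd i (j - 1)..nd i j}"
    have "\<bar>poly (pderiv (cell_poly G U i j)) t - poly w t\<bar> \<le> C * \<delta>" by (rule main[OF ij w _ t]) (use F in blast)
    also have "\<dots> \<le> (C + 1) * \<delta>" using slab_delta_nonneg[OF ij, of "\<lambda>t. f (U t) t i" w \<delta>] F by (simp add: algebra_simps)
    finally show "\<bar>poly (pderiv (cell_poly G U i j)) t - poly w t\<bar> \<le> (C + 1) * \<delta>" .
  next
    fix w \<delta> j
    assume w: "\<forall>m\<ge>q. coeff w m = 0" and ij': "(i, j) \<in> slab G n" and ij: "(i, Suc j) \<in> slab G n"
      and F: "\<forall>t\<in>cell G i j \<union> cell G i (Suc j). \<bar>f (U t) t i - poly w t\<bar> \<le> \<delta>"
    have j: "Suc j \<in> {1..M i}" "Suc j \<in> {2..M i}" using slab_cell_subset[OF ij] slab_cell_subset[OF ij'] by auto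
    have J: "jump (\<lambda>s. U s i) (nd i j) = poly (cell_poly G U i (Suc j)) (nd i j) - poly (cell_poly G U i j) (nd i j)"
      using Vspace_jump[OF U_V i j(2)] by simp
    have "jump (\<lambda>s. U s i) (nd i j) + integral {nd i j..nd i (Suc j)} (poly (pderiv (cell_poly G U i (Suc j))))
       = integral {nd i j..nd i (Suc j)} (\<lambda>t. f (U t) t i)"
      using mdG_cell_equation[OF Usol i j(1), of 1] unfolding cell_def integral_Ioc by simp
    moreover have "\<bar>integral {nd i (Suc j - 1)..nd i (Suc j)} (\<lambda>t. f (U t) t i)
        - integral {nd i (Suc j - 1)..nd i (Suc j)} (poly (pderiv (cell_poly G U i (Suc j))))\<bar> \<le> (C + 1) * \<delta> * \<kappa>"
    proof (rule cell_defect_integral[OF ij])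
      show "0 \<le> \<delta>" using slab_delta_nonneg[OF ij, of "\<lambda>t. f (U t) t i" w \<delta>] F by blast
      show "\<bar>poly (pderiv (cell_poly G U i (Suc j))) t - poly w t\<bar> \<le> C * \<delta>" if "t \<in> {nd i (Suc j - 1)..nd i (Suc j)}" for t
        by (rule main[OF ij w _ that]) (use F in blast)
    qed (use C0 F f_cell_integrable[OF U_mble i j(1)] in auto)
    ultimately show "\<bar>poly (cell_poly G U i (Suc j)) (nd i j) - poly (cell_poly G U i j) (nd i j)\<bar> \<le> (C + 1) * \<delta> * \<kappa>"
      unfolding J by (simp add: algebra_simps)
  qed
qed

text \<open>
  The dual problem runs backwards in time, so the weight is \<open>b - t\<close> and the jump is taken at the
  right node. Both cells being in the slab, the node is not the final time, and \<open>\<psi>\<close> does not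
  enter.
\<close>

lemma Phi_drives:
  assumes P: "projection_const Q C" and i: "i < N" and q: "0 < q"
  shows "drives (C + 1) i (\<lambda>t. - adjoint_rhs f pu U \<Phi> t i) \<Phi>"
proof -
  let ?A = "\<lambda>t. adjoint_rhs f pu U \<Phi> t i"
  have C0: "0 < C" using P by (simp add: projection_const_def)
  have int: "(\<lambda>t. - ?A t * poly r t) integrable_on {nd i (j - 1)..nd i j}" if "j \<in> {1..M i}" for j r
    using integrable_neg[OF adjoint_cell_integrable[OF pu_mble U_mble i that, where r = r]] by simp
  have eqn: "poly w (nd i j) * poly (cell_poly G \<Phi> i j) (nd i j)
      - integral {nd i (j - 1)..nd i j} (\<lambda>t. poly (pderiv (cell_poly G \<Phi> i j)) t * poly w t)
      = poly w (nd i j) * (if j = M i then \<psi> i else poly (cell_poly G \<Phi> i (Suc j)) (nd i j))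
      - integral {nd i (j - 1)..nd i j} (\<lambda>t. - ?A t * poly w t)"
    if ij: "(i, j) \<in> slab G n" and w: "degree w \<le> q" for j w
  proof -
    have j: "j \<in> {1..M i}" using slab_cell_subset[OF ij] by auto
    have "g t i = 0" if "t \<in> cell G i j" for t using g0[OF q i] slab_cell_subset[OF ij] that by blast
    from dual_cell_equation_strong[OF i j _ this, of w] show ?thesis using w degs[OF ij] by simp
  qed
  have main: "\<bar>poly (pderiv (cell_poly G \<Phi> i j)) t - poly w t\<bar> \<le> C * \<delta>"
    if ij: "(i, j) \<in> slab G n" and w: "\<forall>m\<ge>q. coeff w m = 0" and F: "\<And>t. t \<in> cell G i j \<Longrightarrow> \<bar>- ?A t - poly w t\<bar> \<le> \<delta>"
      and t: "t \<in> {nd i (j - 1)..nd i j}" for j w \<delta> t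
  proof -
    have j: "j \<in> {1..M i}" using slab_cell_subset[OF ij] by auto
    let ?z = "pderiv (cell_poly G \<Phi> i j) - w" and ?\<omega> = "[:nd i j, - 1:]"
    note z = coeff_pderiv_zero[OF Phi_V ij w]
    have d: "degree (?\<omega> * ?z) \<le> q" by (rule degree_linear_mult[OF z])
    show ?thesis
    proof (rule weighted_projection_error[OF P nd_step[OF i j], where \<omega> = ?\<omega> and F = "\<lambda>t. - ?A t"])
      show "end_weight (nd i (j - 1)) (nd i j) (poly ?\<omega>)" by (auto simp: end_weight_def)
      show "degree ?z \<le> Q" using degree_le_of_coeffs[OF z] q_le_Q by simp
      show "(\<lambda>t. - ?A t * poly r t) integrable_on {nd i (j - 1)..nd i j}" for r by (rule int[OF j])
      show "\<bar>- ?A t - poly w t\<bar> \<le> \<delta>" if "t \<in> {nd i (j - 1)<..<nd i j}" for t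
        using F that by (simp add: cell_def)
      have "poly (?\<omega> * ?z) (nd i j) = 0" by (simp add: algebra_simps)
      then show "integral {nd i (j - 1)..nd i j} (\<lambda>t. poly (pderiv (cell_poly G \<Phi> i j)) t * poly (?\<omega> * ?z) t)
          = integral {nd i (j - 1)..nd i j} (\<lambda>t. - ?A t * poly (?\<omega> * ?z) t)"
        using eqn[OF ij d] by simp
    qed (rule t)
  qed
  show ?thesis
    unfolding drives_def
  proof (intro allI impI conjI ballI)
    fix w \<delta> j t
    assume w: "\<forall>m\<ge>q. coeff w m = 0" and ij: "(i, j) \<in> slab G n" and F: "\<forall>t\<in>cell G i j. \<bar>- ?A t - poly w t\<bar> \<le> \<delta>"
      and t: "t \<in> {nd i (j - 1)..nd i j}"
    have "\<bar>poly (pderiv (cell_poly G \<Phi> i j)) t - poly w t\<bar> \<le> C * \<delta>" by (rule main[OF ij w _ t]) (use F in blast)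
    also have "\<dots> \<le> (C + 1) * \<delta>" using slab_delta_nonneg[OF ij, of "\<lambda>t. - ?A t" w \<delta>] F by (simp add: algebra_simps)
    finally show "\<bar>poly (pderiv (cell_poly G \<Phi> i j)) t - poly w t\<bar> \<le> (C + 1) * \<delta>" .
  next
    fix w \<delta> j
    assume w: "\<forall>m\<ge>q. coeff w m = 0" and ij: "(i, j) \<in> slab G n" and ij': "(i, Suc j) \<in> slab G n"
      and F: "\<forall>t\<in>cell G i j \<union> cell G i (Suc j). \<bar>- ?A t - poly w t\<bar> \<le> \<delta>"
    have j: "j \<in> {1..M i}" "j \<noteq> M i" using slab_cell_subset[OF ij] slab_cell_subset[OF ij'] by auto
    have "poly (cell_poly G \<Phi> i j) (nd i j) - integral {nd i (j - 1)..nd i j} (poly (pderiv (cell_poly G \<Phi> i j)))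
       = poly (cell_poly G \<Phi> i (Suc j)) (nd i j) - integral {nd i (j - 1)..nd i j} (\<lambda>t. - ?A t)"
      using eqn[OF ij, of 1] j(2) by simp
    moreover have "\<bar>integral {nd i (j - 1)..nd i j} (\<lambda>t. - ?A t)
        - integral {nd i (j - 1)..nd i j} (poly (pderiv (cell_poly G \<Phi> i j)))\<bar> \<le> (C + 1) * \<delta> * \<kappa>"
    proof (rule cell_defect_integral[OF ij])
      show "0 \<le> \<delta>" using slab_delta_nonneg[OF ij, of "\<lambda>t. - ?A t" w \<delta>] F by blast
      show "\<bar>poly (pderiv (cell_poly G \<Phi> i j)) t - poly w t\<bar> \<le> C * \<delta>" if "t \<in> {nd i (j - 1)..nd i j}" for t
        by (rule main[OF ij w _ that]) (use F in blast)
    qed (use C0 F int[OF j(1)] in auto)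
    ultimately show "\<bar>poly (cell_poly G \<Phi> i (Suc j)) (nd i j) - poly (cell_poly G \<Phi> i j) (nd i j)\<bar> \<le> (C + 1) * \<delta> * \<kappa>"
      by (simp add: algebra_simps)
  qed
qed

end

lemma apx_uminus: "apx r M W s e h \<Longrightarrow> apx r M W s e (\<lambda>t. - h t)"
proof -
  assume "apx r M W s e h"
  then obtain p where p: "\<forall>m. \<bar>coeff p m\<bar> \<le> M" "\<forall>m\<ge>r. coeff p m = 0" "\<forall>t\<in>W. \<bar>h t - poly p (s t)\<bar> \<le> M * e ^ r"
    by (auto simp: apx_def)
  have "\<bar>- h t - poly (- p) (s t)\<bar> = \<bar>h t - poly p (s t)\<bar>" for t by simp
  then show ?thesis unfolding apx_def using p by (intro exI[of _ "- p"]) (simp only: coeff_minus abs_minus_cancel, simp)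
qed

section \<open>A curve is one order better than its velocity\<close>

text \<open>
  An antiderivative with respect to time of a polynomial in the rescaled time \<open>c (t - t\<^sub>0)\<close>. If
  \<open>c = 0\<close> the division yields \<open>0\<close>, which is right in the application, where the coefficients are
  bounded by a multiple of \<open>c\<close>.
\<close>

definition antiderivative_poly :: "real \<Rightarrow> real poly \<Rightarrow> real poly" where
  "antiderivative_poly c p = (\<Sum>m\<le>degree p. monom (coeff p m / (c * real (Suc m))) (Suc m))"

lemma coeff_antiderivative_poly:
  "coeff (antiderivative_poly c p) m = (case m of 0 \<Rightarrow> 0 | Suc k \<Rightarrow> coeff p k / (c * real (Suc k)))"
proof (cases m)
  case 0
  then show ?thesis by (simp add: antiderivative_poly_def coeff_sum)
next
  case (Suc k)
  have "coeff (antiderivative_poly c p) m = (\<Sum>l\<le>degree p. if l = k then coeff p k / (c * real (Suc k)) else 0)"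
    unfolding antiderivative_poly_def coeff_sum by (rule sum.cong) (auto simp: Suc)
  then show ?thesis using Suc by (auto simp: coeff_eq_0)
qed

lemma pderiv_antiderivative_poly: "pderiv (antiderivative_poly c p) = smult (1 / c) p"
  by (auto simp: poly_eq_iff coeff_pderiv coeff_antiderivative_poly)

context slab_ctx
begin

definition win :: "real \<Rightarrow> real \<Rightarrow> real set" where
  "win t0 R = {t \<in> slab_ival G n. \<bar>t - t0\<bar> \<le> R * \<kappa>}"

abbreviation "sc t0 \<equiv> (\<lambda>t::real. c * (t - t0))"
abbreviation "eps \<equiv> c * \<kappa>"

lemma eps_nonneg: "0 \<le> eps" using c_nonneg pos by simp

lemma sc_bound: "t \<in> win t0 R \<Longrightarrow> \<bar>c * (t - t0)\<bar> \<le> R * eps"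
proof -
  assume "t \<in> win t0 R"
  then have "c * \<bar>t - t0\<bar> \<le> c * (R * \<kappa>)" using c_nonneg by (intro mult_left_mono) (auto simp: win_def)
  then show ?thesis using c_nonneg by (simp add: abs_mult mult_ac)
qed

lemma win_center: "t0 \<in> slab_ival G n \<Longrightarrow> 0 \<le> R \<Longrightarrow> t0 \<in> win t0 R"
  using pos by (simp add: win_def)

lemma slab_ival_between:
  "a \<in> slab_ival G n \<Longrightarrow> b \<in> slab_ival G n \<Longrightarrow> a \<le> t \<Longrightarrow> t \<le> b \<Longrightarrow> t \<in> slab_ival G n"
  by (auto simp: slab_ival_def)

lemma cell_in_win:
  assumes ij: "(i, j) \<in> slab G n" and t: "t \<in> cell G i j" and tw: "t \<in> win t0 R"
  shows "cell G i j \<subseteq> win t0 (R + 1)"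
proof
  fix x assume x: "x \<in> cell G i j"
  have "x \<in> slab_ival G n" using slab_cell_subset[OF ij] x by blast
  moreover have "\<bar>x - t\<bar> \<le> \<kappa>" using x t steps[OF ij] by (auto simp: cell_def step_def)
  moreover have "\<bar>t - t0\<bar> \<le> R * \<kappa>" using tw by (simp add: win_def)
  ultimately show "x \<in> win t0 (R + 1)" by (simp add: win_def distrib_right)
qed

text \<open>
  \<open>Wf\<close> is an antiderivative of \<open>w\<close>. Inside cells the difference \<open>v - Wf\<close> grows at most at rate
  \<open>D\<close>. A complete cell has length at least \<open>\<beta> \<kappa>\<close> and can pay for the jump at its left node, which
  doubles the rate and divides it by \<open>\<beta>\<close>; the extra \<open>D \<kappa>\<close> is for the jump into the last,
  incomplete cell.
\<close>

lemma growth: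
  assumes v: "v \<in> Vspace G" and i: "i < N" and a: "a \<in> slab_ival G n" and b: "b \<in> slab_ival G n" and ab: "a \<le> b"
    and Wf: "\<And>t. (Wf has_real_derivative poly w t) (at t)" and D0: "0 \<le> D"
    and dr: "\<And>j t. (i, j) \<in> slab G n \<Longrightarrow> nd i (j - 1) < b \<Longrightarrow> a \<le> nd i j \<Longrightarrow> t \<in> {nd i (j - 1)..nd i j} \<Longrightarrow>
        \<bar>poly (pderiv (cell_poly G v i j)) t - poly w t\<bar> \<le> D"
    and jp: "\<And>j. (i, j) \<in> slab G n \<Longrightarrow> (i, Suc j) \<in> slab G n \<Longrightarrow> a \<le> nd i j \<Longrightarrow> nd i j < b \<Longrightarrow>
        \<bar>poly (cell_poly G v i (Suc j)) (nd i j) - poly (cell_poly G v i j) (nd i j)\<bar> \<le> D * \<kappa>"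
  shows "\<bar>(v b i - Wf b) - (v a i - Wf a)\<bar> \<le> 2 * D / \<beta> * (b - a) + D * \<kappa>"
proof -
  define ja where "ja = index_at (nd i) a"
  define jb where "jb = index_at (nd i) b"
  have A: "ja \<in> {1..M i}" "a \<in> cell G i ja" "(i, ja) \<in> slab G n" using slab_index[OF i a] by (auto simp: ja_def)
  have B: "jb \<in> {1..M i}" "b \<in> cell G i jb" "(i, jb) \<in> slab G n" using slab_index[OF i b] by (auto simp: jb_def)
  have le: "ja \<le> jb"
    unfolding ja_def index_at_def by (rule Least_le) (use B(2) ab in \<open>auto simp: cell_def\<close>)
  have S: "(i, l) \<in> slab G n" if "ja \<le> l" "l \<le> jb" for l
  proof -
    have "nd i (ja - 1) \<le> nd i (l - 1)" "nd i l \<le> nd i jb" using that A B by (auto intro!: nd_le[OF i])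
    then show ?thesis using A B that i by (auto simp: slab_def)
  qed
  define e where "e l x = poly (cell_poly G v i l) x - Wf x" for l x
  have lip: "\<bar>e l y - e l x\<bar> \<le> D * (y - x)"
    if l: "ja \<le> l" "l \<le> jb" and xy: "nd i (l - 1) \<le> x" "x \<le> y" "y \<le> nd i l" for l x y
  proof (cases "x = y")
    case False
    then have "x < y" using xy by simp
    have lb: "nd i (l - 1) < b"
    proof -
      have "nd i (l - 1) \<le> nd i (jb - 1)" using l B by (intro nd_le[OF i]) auto
      then show ?thesis using B(2) by (simp add: cell_def)
    qed
    have la: "a \<le> nd i l"
    proof -
      have "nd i ja \<le> nd i l" using l B by (intro nd_le[OF i]) auto
      then show ?thesis using A(2) by (simp add: cell_def)
    qed
    have "\<exists>z>x. z < y \<and> e l y - e l x = (y - x) * (poly (pderiv (cell_poly G v i l)) z - poly w z)"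
      by (rule MVT2[OF \<open>x < y\<close>]) (auto simp: e_def[abs_def] intro!: DERIV_diff poly_DERIV Wf)
    then obtain z where z: "x < z" "z < y" "e l y - e l x = (y - x) * (poly (pderiv (cell_poly G v i l)) z - poly w z)" by blast
    have "\<bar>poly (pderiv (cell_poly G v i l)) z - poly w z\<bar> \<le> D"
      by (rule dr[OF S[OF l] lb la]) (use z xy in auto)
    then have "(y - x) * \<bar>poly (pderiv (cell_poly G v i l)) z - poly w z\<bar> \<le> (y - x) * D"
      using \<open>x < y\<close> by (intro mult_left_mono) auto
    then show ?thesis unfolding z(3) using \<open>x < y\<close> by (simp add: abs_mult mult.commute)
  qed (use D0 in simp)
  have jmp: "\<bar>e (Suc l) (nd i l) - e l (nd i l)\<bar> \<le> D * \<kappa>" if l: "ja \<le> l" "l < jb" for l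
  proof -
    have "nd i ja \<le> nd i l" using l B by (intro nd_le[OF i]) auto
    then have la: "a \<le> nd i l" using A(2) by (simp add: cell_def)
    have "nd i l \<le> nd i (jb - 1)" using l B by (intro nd_le[OF i]) auto
    then have lb: "nd i l < b" using B(2) by (simp add: cell_def)
    show ?thesis using jp[OF S[of l] S[of "Suc l"] la lb] l by (simp add: e_def)
  qed
  have D\<beta>: "D \<le> D / \<beta>" using D0 pos \<beta>_le_1 by (simp add: le_divide_eq mult_left_le)
  have chain: "\<bar>e l (nd i l) - e ja (nd i ja)\<bar> \<le> 2 * D / \<beta> * (nd i l - nd i ja)" if "ja \<le> l" "l < jb" for l
    using that
  proof (induction l rule: dec_induct)
    case base
    then show ?case by simp
  next
    case (step l)
    have sl: "ja \<le> Suc l" "Suc l \<le> jb" using step by auto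
    have st: "\<beta> * \<kappa> \<le> nd i (Suc l) - nd i l" using steps[OF S[OF sl]] by (simp add: step_def)
    have lt: "nd i l < nd i (Suc l)" using sl B by (intro nd_less[OF i]) auto
    have "\<bar>e (Suc l) (nd i (Suc l)) - e (Suc l) (nd i l)\<bar> \<le> D * (nd i (Suc l) - nd i l)"
      by (rule lip[OF sl]) (use lt in auto)
    also have "\<dots> \<le> D / \<beta> * (nd i (Suc l) - nd i l)" using lt D\<beta> by (intro mult_right_mono) auto
    finally have 1: "\<bar>e (Suc l) (nd i (Suc l)) - e (Suc l) (nd i l)\<bar> \<le> D / \<beta> * (nd i (Suc l) - nd i l)" .
    have "D * \<kappa> = D / \<beta> * (\<beta> * \<kappa>)" using pos by simp
    also have "\<dots> \<le> D / \<beta> * (nd i (Suc l) - nd i l)" using st D0 pos by (intro mult_left_mono) auto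
    finally have 2: "\<bar>e (Suc l) (nd i l) - e l (nd i l)\<bar> \<le> D / \<beta> * (nd i (Suc l) - nd i l)"
      using jmp[of l] step by simp
    have 3: "\<bar>e l (nd i l) - e ja (nd i ja)\<bar> \<le> 2 * D / \<beta> * (nd i l - nd i ja)" using step by simp
    have "2 * D / \<beta> * (nd i (Suc l) - nd i ja)
       = D / \<beta> * (nd i (Suc l) - nd i l) + D / \<beta> * (nd i (Suc l) - nd i l) + 2 * D / \<beta> * (nd i l - nd i ja)"
      by (simp add: algebra_simps diff_divide_distrib)
    then show ?case using 1 2 3 by linarith
  qed
  have va: "v a i - Wf a = e ja a" and vb: "v b i - Wf b = e jb b"
    using cell_poly(2)[OF v i A(1,2)] cell_poly(2)[OF v i B(1,2)] by (simp_all add: e_def)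
  have Dx: "D * x \<le> 2 * D / \<beta> * x" if "0 \<le> x" for x
  proof -
    have "D \<le> 2 * D / \<beta>" using D\<beta> D0 pos by (simp add: field_simps)
    then show ?thesis using that by (rule mult_right_mono)
  qed
  show ?thesis
  proof (cases "ja = jb")
    case True
    have "\<bar>e jb b - e jb a\<bar> \<le> D * (b - a)"
      by (rule lip) (use True A B ab in \<open>auto simp: cell_def\<close>)
    also have "\<dots> \<le> 2 * D / \<beta> * (b - a)" using Dx ab by simp
    finally have "\<bar>e jb b - e jb a\<bar> \<le> 2 * D / \<beta> * (b - a)" .
    moreover have "0 \<le> D * \<kappa>" using D0 pos by simp
    ultimately show ?thesis unfolding va vb True by linarith
  next
    case False
    then have lt: "ja < jb" using le by simp
    define l where "l = jb - 1"
    have l: "ja \<le> l" "l < jb" "jb = Suc l" using lt by (auto simp: l_def)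
    have "l \<le> M i" using l(2) B(1) by auto
    then have x: "a \<le> nd i ja" "nd i ja \<le> nd i l" "nd i l < b"
      using A(2) B(2) nd_le[OF i l(1)] by (auto simp: cell_def l_def)
    have 1: "\<bar>e ja (nd i ja) - e ja a\<bar> \<le> D * (nd i ja - a)"
      by (rule lip) (use A le x in \<open>auto simp: cell_def\<close>)
    have 2: "\<bar>e l (nd i l) - e ja (nd i ja)\<bar> \<le> 2 * D / \<beta> * (nd i l - nd i ja)" by (rule chain[OF l(1,2)])
    have 3: "\<bar>e jb (nd i l) - e l (nd i l)\<bar> \<le> D * \<kappa>" using jmp[OF l(1,2)] l(3) by simp
    have 4: "\<bar>e jb b - e jb (nd i l)\<bar> \<le> D * (b - nd i l)"
      by (rule lip) (use B le x in \<open>auto simp: cell_def l_def\<close>)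
    have "D * (nd i ja - a) \<le> 2 * D / \<beta> * (nd i ja - a)" "D * (b - nd i l) \<le> 2 * D / \<beta> * (b - nd i l)"
      using x by - (rule Dx, simp)+
    moreover have "2 * D / \<beta> * (b - a) = 2 * D / \<beta> * (nd i ja - a) + 2 * D / \<beta> * (nd i l - nd i ja) + 2 * D / \<beta> * (b - nd i l)"
      by (simp add: algebra_simps diff_divide_distrib)
    ultimately show ?thesis unfolding va vb using 1 2 3 4 by linarith
  qed
qed

lemma antiderivative_along_sc:
  assumes p: "\<And>m. \<bar>coeff p m\<bar> \<le> c * K" and K: "0 \<le> K"
  shows "((\<lambda>t. poly (antiderivative_poly c p) (c * (t - t0))) has_real_derivative poly p (c * (t - t0))) (at t)"
    and "\<bar>coeff (antiderivative_poly c p) m\<bar> \<le> K"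
proof -
  have c0: "p = 0" if "c = 0" using p that by (simp add: poly_eq_iff)
  have D: "((\<lambda>t. poly (antiderivative_poly c p) (c * (t - t0))) has_real_derivative poly (pderiv (antiderivative_poly c p)) (c * (t - t0)) * c) (at t)"
    by (rule DERIV_chain2[OF poly_DERIV]) (auto intro!: derivative_eq_intros)
  show "((\<lambda>t. poly (antiderivative_poly c p) (c * (t - t0))) has_real_derivative poly p (c * (t - t0))) (at t)"
    using D c0 by (cases "c = 0") (auto simp: pderiv_antiderivative_poly)
  show "\<bar>coeff (antiderivative_poly c p) m\<bar> \<le> K"
  proof (cases m)
    case (Suc k)
    show ?thesis
    proof (cases "c = 0")
      case False
      then have c: "0 < c" using c_nonneg by simp
      have "\<bar>coeff p k\<bar> \<le> c * K * 1" using p[of k] by simp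
      also have "\<dots> \<le> c * K * real (Suc k)" using c K by (intro mult_left_mono) auto
      finally show ?thesis using Suc c by (simp add: coeff_antiderivative_poly abs_divide abs_mult divide_le_eq mult_ac)
    qed (use Suc K in \<open>simp add: coeff_antiderivative_poly\<close>)
  qed (simp add: coeff_antiderivative_poly K)
qed

text \<open>
  The polynomial as a function of unscaled time, in which the Galerkin relations are stated.
\<close>

lemma shifted_poly:
  assumes "\<forall>m\<ge>r. coeff (p :: real poly) m = 0" "r \<le> k"
  shows "\<forall>m\<ge>k. coeff (pcompose p [:- (c * t0), c:]) m = 0" and "poly (pcompose p [:- (c * t0), c:]) t = poly p (c * (t - t0))"
proof -
  show "\<forall>m\<ge>k. coeff (pcompose p [:- (c * t0), c:]) m = 0"
  proof (cases "p = 0")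
    case False
    then have "degree p < r" using coeff_zero_imp_degree[OF assms(1)] by blast
    moreover have "degree (pcompose p [:- (c * t0), c:]) \<le> degree p"
      using degree_pcompose_le[of p "[:- (c * t0), c:]"] by (auto intro: order.trans simp: mult_le_cancel1)
    ultimately show ?thesis using assms(2) by (auto intro!: coeff_eq_0)
  qed simp
  show "poly (pcompose p [:- (c * t0), c:]) t = poly p (c * (t - t0))"
    by (simp add: poly_pcompose algebra_simps)
qed

text \<open>
  The antiderivative of the polynomial that approximates the velocity approximates the increment
  of \<open>v\<close>. Integration over a time of order \<open>\<kappa>\<close> and the factor \<open>c\<close> in the bound of the velocity
  together supply the additional power of \<open>c \<kappa>\<close>.
\<close>

lemma drive_step:
  assumes v: "v \<in> Vspace G" and i: "i < N" and t0: "t0 \<in> slab_ival G n" and R: "0 \<le> R"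
    and dr: "drives C i F v" and C: "0 \<le> C" and K: "0 \<le> K"
    and F: "apx r (c * K) (win t0 (R + 1)) (sc t0) eps F" and r: "r \<le> q"
  shows "apx (Suc r) ((1 + C * (2 * R / \<beta> + 1)) * K) (win t0 R) (sc t0) eps (\<lambda>t. v t i - v t0 i)"
proof -
  obtain p where p: "\<And>m. \<bar>coeff p m\<bar> \<le> c * K" "\<forall>m\<ge>r. coeff p m = 0"
    "\<And>t. t \<in> win t0 (R + 1) \<Longrightarrow> \<bar>F t - poly p (c * (t - t0))\<bar> \<le> c * K * eps ^ r"
    using F by (auto simp: apx_def)
  define w where "w = pcompose p [:- (c * t0), c:]"
  have w: "\<forall>m\<ge>q. coeff w m = 0" "\<And>t. poly w t = poly p (c * (t - t0))"
    using shifted_poly[OF p(2) r] by (auto simp: w_def)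
  define P where "P = antiderivative_poly c p"
  define Wf where "Wf t = poly P (c * (t - t0))" for t
  have Wf: "(Wf has_real_derivative poly w t) (at t)" for t
    unfolding Wf_def P_def w(2) by (rule antiderivative_along_sc[OF p(1) K])
  have Wf0: "Wf t0 = 0" by (simp add: Wf_def P_def coeff_antiderivative_poly poly_0_coeff_0)
  define \<delta> where "\<delta> = c * K * eps ^ r"
  have \<delta>0: "0 \<le> \<delta>" unfolding \<delta>_def using c_nonneg K eps_nonneg by simp
  have Fw: "\<bar>F t - poly w t\<bar> \<le> \<delta>" if "t \<in> win t0 (R + 1)" for t using p(3)[OF that] by (simp add: w \<delta>_def)
  (* Every cell between the base point and t meets the window, so the velocity is controlled on
     all of it by the approximation on the window enlarged by one step. *)
  have inwin: "cell G i j \<subseteq> win t0 (R + 1)"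
    if ij: "(i, j) \<in> slab G n" and x: "nd i (j - 1) < max t0 t" "min t0 t \<le> nd i j" and t: "t \<in> win t0 R" for j t
  proof -
    have j: "j \<in> {1..M i}" using slab_cell_subset[OF ij] by blast
    have tn: "t \<in> slab_ival G n" "\<bar>t - t0\<bar> \<le> R * \<kappa>" using t by (auto simp: win_def)
    define y where "y = min (max t0 t) (nd i j)"
    have y: "y \<in> cell G i j" using x nd_step[OF i j] by (auto simp: y_def cell_def)
    have "\<bar>y - t0\<bar> \<le> R * \<kappa>" using tn(2) x by (auto simp: y_def min_def max_def split: if_splits)
    moreover have "y \<in> slab_ival G n" using y slab_cell_subset[OF ij] by blast
    ultimately have "y \<in> win t0 R" by (simp add: win_def)
    from cell_in_win[OF ij y this] show ?thesis .
  qed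
  have est: "\<bar>(v t i - v t0 i) - Wf t\<bar> \<le> 2 * (C * \<delta>) / \<beta> * \<bar>t - t0\<bar> + C * \<delta> * \<kappa>" if t: "t \<in> win t0 R" for t
  proof -
    have tn: "t \<in> slab_ival G n" using t by (simp add: win_def)
    have D0: "0 \<le> C * \<delta>" using C \<delta>0 by simp
    have G: "\<bar>(v (max t0 t) i - Wf (max t0 t)) - (v (min t0 t) i - Wf (min t0 t))\<bar>
        \<le> 2 * (C * \<delta>) / \<beta> * (max t0 t - min t0 t) + C * \<delta> * \<kappa>"
    proof (rule growth[OF v i _ _ _ Wf D0])
      show "min t0 t \<in> slab_ival G n" "max t0 t \<in> slab_ival G n" using tn t0 by (auto simp: min_def max_def)
      show "min t0 t \<le> max t0 t" by simp
      show "\<bar>poly (pderiv (cell_poly G v i j)) x - poly w x\<bar> \<le> C * \<delta>"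
        if "(i, j) \<in> slab G n" "nd i (j - 1) < max t0 t" "min t0 t \<le> nd i j" "x \<in> {nd i (j - 1)..nd i j}" for j x
        using dr w(1) that Fw inwin[OF that(1-3) t] unfolding drives_def by blast
      show "\<bar>poly (cell_poly G v i (Suc j)) (nd i j) - poly (cell_poly G v i j) (nd i j)\<bar> \<le> C * \<delta> * \<kappa>"
        if ij: "(i, j) \<in> slab G n" "(i, Suc j) \<in> slab G n" and x: "min t0 t \<le> nd i j" "nd i j < max t0 t" for j
      proof -
        have j: "j \<in> {1..M i}" "Suc j \<in> {1..M i}" using slab_cell_subset[OF ij(1)] slab_cell_subset[OF ij(2)] by auto
        have "cell G i j \<subseteq> win t0 (R + 1)"
          by (rule inwin[OF ij(1) _ _ t]) (use x nd_step[OF i j(1)] in auto)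
        moreover have "cell G i (Suc j) \<subseteq> win t0 (R + 1)"
          by (rule inwin[OF ij(2) _ _ t]) (use x nd_step[OF i j(2)] in auto)
        ultimately show ?thesis using dr w(1) ij Fw unfolding drives_def by blast
      qed
    qed
    moreover have "max t0 t - min t0 t = \<bar>t - t0\<bar>" by auto
    moreover have "\<bar>(v (max t0 t) i - Wf (max t0 t)) - (v (min t0 t) i - Wf (min t0 t))\<bar> = \<bar>(v t i - v t0 i) - Wf t\<bar>"
      using Wf0 by (auto simp: max_def min_def)
    ultimately show ?thesis by simp
  qed
  have L: "0 \<le> C * (2 * R / \<beta> + 1)" using C R pos by simp
  show ?thesis
    unfolding apx_def
  proof (intro exI[of _ P] conjI allI impI ballI)
    have KK: "K \<le> (1 + C * (2 * R / \<beta> + 1)) * K" using L K mult_right_mono[of 1 "1 + C * (2 * R / \<beta> + 1)" K] by simp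
    show "\<bar>coeff P m\<bar> \<le> (1 + C * (2 * R / \<beta> + 1)) * K" for m
      unfolding P_def using antiderivative_along_sc(2)[OF p(1) K, of m] KK by linarith
    show "coeff P m = 0" if "Suc r \<le> m" for m
      using that p(2) by (auto simp: P_def coeff_antiderivative_poly split: nat.split)
    fix t assume t: "t \<in> win t0 R"
    have "\<bar>t - t0\<bar> \<le> R * \<kappa>" using t by (simp add: win_def)
    then have "2 * (C * \<delta>) / \<beta> * \<bar>t - t0\<bar> \<le> 2 * (C * \<delta>) / \<beta> * (R * \<kappa>)"
      using C \<delta>0 pos by (intro mult_left_mono) auto
    then have "\<bar>(v t i - v t0 i) - Wf t\<bar> \<le> 2 * (C * \<delta>) / \<beta> * (R * \<kappa>) + C * \<delta> * \<kappa>" using est[OF t] by linarith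
    also have "\<dots> = C * (2 * R / \<beta> + 1) * K * eps ^ Suc r" by (simp add: \<delta>_def algebra_simps)
    also have "\<dots> \<le> (1 + C * (2 * R / \<beta> + 1)) * K * eps ^ Suc r"
      using K eps_nonneg by (intro mult_right_mono) auto
    finally show "\<bar>v t i - v t0 i - poly P (c * (t - t0))\<bar> \<le> (1 + C * (2 * R / \<beta> + 1)) * K * eps ^ Suc r"
      by (simp add: Wf_def)
  qed
qed

text \<open>
  For the exact solution the mean value theorem replaces \<open>growth\<close>, and the window is not
  enlarged.
\<close>

lemma u_step:
  assumes i: "i < N" and t0: "t0 \<in> slab_ival G n" and R: "0 \<le> R" and K: "0 \<le> K"
    and F: "apx r (c * K) (win t0 R) (sc t0) eps (\<lambda>t. f (u t) t i)"
  shows "apx (Suc r) ((1 + R) * K) (win t0 R) (sc t0) eps (\<lambda>t. u t i - u t0 i)"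
proof -
  obtain p where p: "\<And>m. \<bar>coeff p m\<bar> \<le> c * K" "\<forall>m\<ge>r. coeff p m = 0"
    "\<And>t. t \<in> win t0 R \<Longrightarrow> \<bar>f (u t) t i - poly p (c * (t - t0))\<bar> \<le> c * K * eps ^ r"
    using F by (auto simp: apx_def)
  define P where "P = antiderivative_poly c p"
  define Wf where "Wf t = poly P (c * (t - t0))" for t
  have Wf: "(Wf has_real_derivative poly p (c * (t - t0))) (at t)" for t
    unfolding Wf_def P_def by (rule antiderivative_along_sc[OF p(1) K])
  have Wf0: "Wf t0 = 0" by (simp add: Wf_def P_def coeff_antiderivative_poly poly_0_coeff_0)
  define \<delta> where "\<delta> = c * K * eps ^ r"
  have mv: "\<bar>(u y i - Wf y) - (u x i - Wf x)\<bar> \<le> \<delta> * (y - x)" if x: "x \<in> win t0 R" and y: "y \<in> win t0 R" and xy: "x < y" for x y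
  proof -
    have S: "x \<in> slab_ival G n" "y \<in> slab_ival G n" using x y by (auto simp: win_def)
    have D: "((\<lambda>t. u t i - Wf t) has_real_derivative f (u t) t i - poly p (c * (t - t0))) (at t)" if "x < t" "t < y" for t
    proof -
      have "0 < x" "y \<le> T" using slab_T[OF S(1)] slab_T[OF S(2)] by auto
      then have t: "0 < t" "t < T" using that by auto
      then have "((\<lambda>s. u s i) has_real_derivative f (u t) t i) (at t within {0..T})" by (intro u_deriv[OF i]) auto
      then have "((\<lambda>s. u s i) has_real_derivative f (u t) t i) (at t)" unfolding at_within_Icc_at[OF t] .
      then show ?thesis by (intro DERIV_diff Wf)
    qed
    have sub: "{x..y} \<subseteq> {0..T}" using slab_T[OF S(1)] slab_T[OF S(2)] by auto
    have "continuous_on {x..y} Wf" by (intro continuous_at_imp_continuous_on ballI DERIV_isCont[OF Wf])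
    then have cont: "continuous_on {x..y} (\<lambda>t. u t i - Wf t)"
      by (intro continuous_on_diff continuous_on_subset[OF u_continuous[OF i] sub])
    have diff: "(\<lambda>t. u t i - Wf t) differentiable (at t)" if "x < t" "t < y" for t
      unfolding real_differentiable_def using D[OF that] by (rule exI)
    obtain l z where z: "x < z" "z < y" "((\<lambda>t. u t i - Wf t) has_real_derivative l) (at z)"
      "(u y i - Wf y) - (u x i - Wf x) = (y - x) * l"
      using MVT[OF xy cont diff] by auto
    have l: "l = f (u z) z i - poly p (c * (z - t0))" by (rule DERIV_unique[OF z(3) D[OF z(1,2)]])
    have "z \<in> win t0 R"
      using slab_ival_between[OF S, of z] z(1,2) x y by (auto simp: win_def)
    then have "\<bar>l\<bar> \<le> \<delta>" using p(3) by (simp add: l \<delta>_def)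
    then have "(y - x) * \<bar>l\<bar> \<le> (y - x) * \<delta>" using xy by (intro mult_left_mono) auto
    then show ?thesis unfolding z(4) using xy by (simp add: abs_mult mult.commute)
  qed
  have est: "\<bar>(u t i - u t0 i) - Wf t\<bar> \<le> \<delta> * \<bar>t - t0\<bar>" if t: "t \<in> win t0 R" for t
  proof -
    consider "t < t0" | "t = t0" | "t0 < t" by linarith
    then show ?thesis
    proof cases
      case 1
      then show ?thesis using mv[OF t win_center[OF t0 R] 1] Wf0 by (simp add: abs_minus_commute)
    next
      case 2
      then show ?thesis using Wf0 by simp
    next
      case 3
      then show ?thesis using mv[OF win_center[OF t0 R] t 3] Wf0 by simp
    qed
  qed
  show ?thesis
    unfolding apx_def
  proof (intro exI[of _ P] conjI allI impI ballI)
    have KK: "K \<le> (1 + R) * K" using R K by (simp add: algebra_simps)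
    show "\<bar>coeff P m\<bar> \<le> (1 + R) * K" for m
      unfolding P_def using antiderivative_along_sc(2)[OF p(1) K, of m] KK by linarith
    show "coeff P m = 0" if "Suc r \<le> m" for m
      using that p(2) by (auto simp: P_def coeff_antiderivative_poly split: nat.split)
    fix t assume t: "t \<in> win t0 R"
    have "\<bar>t - t0\<bar> \<le> R * \<kappa>" using t by (simp add: win_def)
    moreover have "0 \<le> \<delta>" unfolding \<delta>_def using c_nonneg K eps_nonneg by simp
    ultimately have "\<bar>(u t i - u t0 i) - Wf t\<bar> \<le> \<delta> * (R * \<kappa>)" using est[OF t] by (meson mult_left_mono order.trans)
    also have "\<dots> = R * K * eps ^ Suc r" by (simp add: \<delta>_def algebra_simps)
    also have "\<dots> \<le> (1 + R) * K * eps ^ Suc r"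
      using K eps_nonneg by (intro mult_right_mono) auto
    finally show "\<bar>u t i - u t0 i - poly P (c * (t - t0))\<bar> \<le> (1 + R) * K * eps ^ Suc r"
      by (simp add: Wf_def)
  qed
qed

text \<open>
  Interpolation acts cell by cell and reproduces the approximating polynomials, which have degree
  at most \<open>q\<close>.
\<close>

lemma pu_step:
  assumes C: "interpolation_const Q C" and i: "i < N" and t0: "t0 \<in> slab_ival G n" and r: "r \<le> q + 1"
    and u: "apx r K (win t0 (R + 1)) (sc t0) eps (\<lambda>t. u t i - u t0 i)"
    and ub: "\<And>t. t \<in> win t0 (R + 1) \<Longrightarrow> \<bar>u t i - u t0 i\<bar> \<le> K * eps" and K: "0 \<le> K"
  shows "apx r (C * K) (win t0 R) (sc t0) eps (\<lambda>t. pu t i - u t0 i)"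
    and "\<And>t. t \<in> win t0 R \<Longrightarrow> \<bar>pu t i - u t0 i\<bar> \<le> C * K * eps"
proof -
  have C1: "1 \<le> C" using C by (simp add: interpolation_const_def)
  have key: "\<bar>pu t i - poly w t\<bar> \<le> C * B"
    if w: "degree w \<le> q" and B: "\<And>x. x \<in> win t0 (R + 1) \<Longrightarrow> \<bar>u x i - poly w x\<bar> \<le> B" and t: "t \<in> win t0 R" for w B t
  proof -
    have tn: "t \<in> slab_ival G n" using t by (simp add: win_def)
    define j where "j = index_at (nd i) t"
    have j: "j \<in> {1..M i}" "t \<in> cell G i j" "(i, j) \<in> slab G n" using slab_index[OF i tn] by (auto simp: j_def)
    have sub: "cell G i j \<subseteq> win t0 (R + 1)" by (rule cell_in_win[OF j(3,2) t])
    have dG: "is_dG q (nd i (j - 1)) (nd i j) (\<lambda>s. u s i) (ipoly i j)"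
      using ipoly_is_dG[OF i j(1)] degs[OF j(3)] by simp
    have "\<forall>x\<in>{nd i (j - 1)<..<nd i j}. \<bar>u x i - poly w x\<bar> \<le> B"
    proof
      fix x assume "x \<in> {nd i (j - 1)<..<nd i j}"
      then have "x \<in> cell G i j" by (simp add: cell_def)
      then show "\<bar>u x i - poly w x\<bar> \<le> B" using B sub by blast
    qed
    moreover have "t \<in> {nd i (j - 1)..nd i j}" using j(2) by (auto simp: cell_def)
    ultimately have "\<bar>poly (ipoly i j) t - poly w t\<bar> \<le> C * B"
      using C[unfolded interpolation_const_def, THEN conjunct2, rule_format, OF q_le_Q nd_step[OF i j(1)] u_cell_continuous[OF i j(1)] dG w] by blast
    then show ?thesis using pu_cell[OF i j(1,2)] by simp
  qed
  show "\<bar>pu t i - u t0 i\<bar> \<le> C * K * eps" if t: "t \<in> win t0 R" for t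
    using key[of "[:u t0 i:]" "K * eps" t] ub t by (simp add: mult.assoc)
  obtain p where p: "\<And>m. \<bar>coeff p m\<bar> \<le> K" "\<forall>m\<ge>r. coeff p m = 0"
    "\<And>t. t \<in> win t0 (R + 1) \<Longrightarrow> \<bar>u t i - u t0 i - poly p (c * (t - t0))\<bar> \<le> K * eps ^ r"
    using u by (auto simp: apx_def)
  define w where "w = [:u t0 i:] + pcompose p [:- (c * t0), c:]"
  have pw: "poly w t = u t0 i + poly p (c * (t - t0))" for t
    using shifted_poly(2)[OF p(2) order.refl] by (simp add: w_def)
  have "degree w \<le> q"
  proof -
    have "coeff (pcompose p [:- (c * t0), c:]) m = 0" if "q < m" for m
      using shifted_poly(1)[OF p(2) r] that by simp
    then have "degree (pcompose p [:- (c * t0), c:]) \<le> q" by (intro degree_le) auto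
    then show ?thesis unfolding w_def by (intro degree_add_le) auto
  qed
  then have "\<bar>pu t i - poly w t\<bar> \<le> C * (K * eps ^ r)" if "t \<in> win t0 R" for t
    by (rule key[OF _ _ that]) (use p(3) in \<open>simp add: pw algebra_simps\<close>)
  then have "\<bar>pu t i - u t0 i - poly p (c * (t - t0))\<bar> \<le> C * K * eps ^ r" if "t \<in> win t0 R" for t
    using that unfolding pw diff_diff_eq mult.assoc by blast
  moreover have "\<bar>coeff p m\<bar> \<le> C * K" for m
    using p(1)[of m] mult_right_mono[OF C1 K] by simp
  ultimately show "apx r (C * K) (win t0 R) (sc t0) eps (\<lambda>t. pu t i - u t0 i)"
    unfolding apx_def using p(2) by (intro exI[of _ p]) blast
qed

section \<open>A composition is as good as its arguments\<close>

lemma f_along_bound: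
  assumes "y ` slab_ival G n \<subseteq> u ` slab_ival G n \<union> pu ` slab_ival G n \<union> U ` slab_ival G n" "i < N" "t \<in> slab_ival G n"
  shows "\<bar>f (y t) t i\<bar> \<le> c"
proof -
  have yt: "y t \<in> u ` slab_ival G n \<union> pu ` slab_ival G n \<union> U ` slab_ival G n" using assms by blast
  have "(\<lambda>i. y t i + 0 * (y t i - y t i)) \<in> args" by (rule args_segment[OF yt yt]) simp
  then have "y t \<in> args" by simp
  from f_derivative_bound(1)[OF assms(2) _ this, of 0 "\<lambda>_. 0" 0] autonomous[OF assms(2,3)] show ?thesis
    by (simp add: Dn_0)
qed

text \<open>
  Taylor expansion of one component of \<open>f\<close> at the point \<open>y(t\<^sub>0)\<close>. The factor \<open>c\<close> in the bound is
  the size of \<open>f\<close> and its derivatives.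
\<close>

lemma flow_composition:
  assumes K: "taylor_const r R E M' K" and L: "unit_const (r * r) R E L"
    and y: "y ` slab_ival G n \<subseteq> u ` slab_ival G n \<union> pu ` slab_ival G n \<union> U ` slab_ival G n"
    and i: "i < N" and t0: "t0 \<in> slab_ival G n" and r: "r \<le> q + 1" and M': "0 \<le> M'"
    and a: "\<And>l. l < N \<Longrightarrow> apx r M' (win t0 R) (sc t0) eps (\<lambda>t. y t l - y t0 l)"
    and b: "\<And>l t. l < N \<Longrightarrow> t \<in> win t0 R \<Longrightarrow> \<bar>y t l - y t0 l\<bar> \<le> M' * eps"
  shows "apx r (c * (L * K)) (win t0 R) (sc t0) eps (\<lambda>t. f (y t) t i)"
proof -
  have "\<forall>l<N. \<exists>p::real poly. (\<forall>m. \<bar>coeff p m\<bar> \<le> M') \<and> (\<forall>m\<ge>r. coeff p m = 0) \<and> (\<forall>t\<in>win t0 R. \<bar>y t l - y t0 l - poly p (c * (t - t0))\<bar> \<le> M' * eps ^ r)"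
    using a unfolding apx_def by blast
  then obtain P where P: "\<forall>l<N. (\<forall>m. \<bar>coeff (P l) m\<bar> \<le> M') \<and> (\<forall>m\<ge>r. coeff (P l) m = 0) \<and> (\<forall>t\<in>win t0 R. \<bar>y t l - y t0 l - poly (P l) (c * (t - t0))\<bar> \<le> M' * eps ^ r)"
    by metis
  have yy: "y t \<in> u ` slab_ival G n \<union> pu ` slab_ival G n \<union> U ` slab_ival G n" if "t \<in> slab_ival G n" for t
    using y that by blast
  have seg: "(\<lambda>l. y t0 l + \<theta> * (y t l - y t0 l)) \<in> args" if "t \<in> slab_ival G n" "\<theta> \<in> {0..1}" for t \<theta>
    by (rule args_segment[OF yy[OF t0] yy[OF that(1)] that(2)])
  have A: "y t0 \<in> args" using seg[OF t0, of 0] by simp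
  let ?p = "polymap_poly N r (taylor_coeff 1 (\<lambda>_. 1) (\<lambda>_ x. f x tn i) (y t0)) P"
  have "let p = ?p in degree p \<le> r * r \<and> (\<forall>x\<in>{0..1}. \<bar>poly p x\<bar> \<le> K * c) \<and>
     (\<forall>t\<in>win t0 R. \<bar>(\<Sum>j<(1::nat). (\<lambda>_. 1) j * (\<lambda>_ x. f x tn i) j (\<lambda>l. y t0 l + (y t l - y t0 l))) - poly p (c * (t - t0))\<bar> \<le> K * c * eps ^ r)"
  proof (rule K[unfolded taylor_const_def, THEN conjunct2, rule_format])
    show "Ck N r (\<lambda>x. f x tn i) \<and> dep N (\<lambda>x. f x tn i)"
      using Ck_mono[OF fCk[OF i] r] f_dep_slab[OF i] by simp
    show "\<bar>\<Sum>j<(1::nat). 1 * Dn N m (\<lambda>x. f x tn i) (\<lambda>_. d) (y t0)\<bar> \<le> c * \<eta> ^ m"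
      if "m < r" "0 \<le> \<eta>" "\<And>l. l < N \<Longrightarrow> \<bar>d l\<bar> \<le> \<eta>" for m \<eta> d
      using f_derivative_bound(1)[OF i _ A that(3)] that r by simp
    show "\<bar>\<Sum>j<(1::nat). 1 * Dn N r (\<lambda>x. f x tn i) (\<lambda>_ l. y t l - y t0 l) (\<lambda>l. y t0 l + \<theta> * (y t l - y t0 l))\<bar> \<le> c * (M' * eps) ^ r"
      if t: "t \<in> win t0 R" and "\<theta> \<in> {0..1}" for t \<theta>
      using f_derivative_bound(1)[OF i r seg[of t \<theta>] b[OF _ t]] that by (simp add: win_def)
    show "\<bar>c * (t - t0)\<bar> \<le> R * eps" if "t \<in> win t0 R" for t by (rule sc_bound[OF that])
  qed (use c_nonneg eps_nonneg small P in \<open>blast+\<close>)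
  then have p: "degree ?p \<le> r * r" "\<forall>x\<in>{0..1}. \<bar>poly ?p x\<bar> \<le> K * c"
    "\<forall>t\<in>win t0 R. \<bar>f (y t) tn i - poly ?p (c * (t - t0))\<bar> \<le> K * c * eps ^ r"
    by (simp_all add: Let_def)
  have "apx r (L * (K * c)) (win t0 R) (sc t0) eps (\<lambda>t. f (y t) t i)"
  proof (rule L[unfolded unit_const_def, THEN conjunct2, rule_format, OF p(1) _ eps_nonneg small])
    show "\<bar>poly ?p x\<bar> \<le> K * c" if "x \<in> {0..1}" for x using p(2) that by blast
    show "\<bar>c * (t - t0)\<bar> \<le> R * eps" if "t \<in> win t0 R" for t by (rule sc_bound[OF that])
    show "\<bar>f (y t) t i - poly ?p (c * (t - t0))\<bar> \<le> K * c * eps ^ r" if "t \<in> win t0 R" for t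
      using p(3)[rule_format, OF that] autonomous[OF i, of t] that by (simp add: win_def)
  qed
  then show ?thesis by (simp only: mult_ac)
qed

text \<open>
  For fixed \<open>b\<close> the combination \<open>\<Sum> b\<^sub>j J\<^sub>j\<^sub>i\<close> is approximable with a bound proportional to
  \<open>max |b\<^sub>j|\<close> by \<open>averaged_composition\<close>; then \<open>b\<close> is replaced by \<open>\<Phi>\<close>.
\<close>

lemma adjoint_apx:
  assumes K: "averaged_const r R E M' K" and L: "linear_const r R E L"
    and i: "i < N" and t0: "t0 \<in> slab_ival G n" and r: "r \<le> q"
    and X: "\<And>l. l < N \<Longrightarrow> apx r M' (win t0 R) (sc t0) eps (\<lambda>t. X t l - x0 l)"
      "\<And>l t. l < N \<Longrightarrow> t \<in> win t0 R \<Longrightarrow> \<bar>X t l - x0 l\<bar> \<le> M' * eps"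
    and Y: "\<And>l. l < N \<Longrightarrow> apx r M' (win t0 R) (sc t0) eps (\<lambda>t. Y t l - y0 l)"
      "\<And>l t. l < N \<Longrightarrow> t \<in> win t0 R \<Longrightarrow> \<bar>Y t l - y0 l\<bar> \<le> M' * eps"
    and Z: "0 \<le> Z" "\<And>l. l < N \<Longrightarrow> apx r Z (win t0 R) (sc t0) eps (\<lambda>t. \<Phi> t l)"
  shows "apx r (c * (L * K * Z)) (win t0 R) (sc t0) eps (\<lambda>t. adjoint_rhs f X Y \<Phi> t i)"
proof -
  have K1: "1 \<le> K" using K by (simp add: averaged_const_def)
  have A: "apx r (K * c * B) (win t0 R) (sc t0) eps (\<lambda>t. \<Sum>j<N. b j * Jmat f X Y t j i)
     \<and> (\<forall>t\<in>win t0 R. \<bar>\<Sum>j<N. b j * Jmat f X Y t j i\<bar> \<le> K * c * B)"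
    if b: "\<forall>j<N. \<bar>b j\<bar> \<le> B" and B: "0 \<le> B" for b B
  proof
    have "apx r (K * (c * B)) (win t0 R) (sc t0) eps
        (\<lambda>t. \<Sum>j<N. b j * integral {0..1} (\<lambda>z. (\<lambda>j. pd i (\<lambda>w. f w tn j)) j (\<lambda>l. z * X t l + (1 - z) * Y t l)))"
    proof (rule K[unfolded averaged_const_def, THEN conjunct2, rule_format])
      show "Ck N r (pd i (\<lambda>w. f w tn j)) \<and> dep N (pd i (\<lambda>w. f w tn j))" if "j < N" for j
        using Ck_mono[OF Ck_pd[of N q "\<lambda>w. f w tn j" i] r] fCk[OF that] i dep_pd[OF f_dep_slab[OF that] i] by simp
      show "\<bar>\<Sum>j<N. b j * Dn N m (pd i (\<lambda>w. f w tn j)) (\<lambda>_. d) x\<bar> \<le> c * B * \<eta> ^ m"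
        if "m \<le> r" "0 \<le> \<eta>" "\<And>l. l < N \<Longrightarrow> \<bar>d l\<bar> \<le> \<eta>" for m \<eta> d x
        using adjoint_derivative_bound[OF i _ that(2,3), where m = m and b = b and B = B and x = x] b that r by (simp add: mult_ac)
      show "\<bar>c * (t - t0)\<bar> \<le> R * eps" if "t \<in> win t0 R" for t by (rule sc_bound[OF that])
      show "apx r M' (win t0 R) (sc t0) eps (\<lambda>t. X t l - x0 l) \<and> apx r M' (win t0 R) (sc t0) eps (\<lambda>t. Y t l - y0 l)" if "l < N" for l
        using X(1) Y(1) that by blast
      show "\<bar>X t l - x0 l\<bar> \<le> M' * eps \<and> \<bar>Y t l - y0 l\<bar> \<le> M' * eps" if "l < N" "t \<in> win t0 R" for l t
        using X(2) Y(2) that by blast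
    qed (use c_nonneg B eps_nonneg small in auto)
    then show "apx r (K * c * B) (win t0 R) (sc t0) eps (\<lambda>t. \<Sum>j<N. b j * Jmat f X Y t j i)"
      by (subst apx_cong[of _ _ "\<lambda>t. \<Sum>j<N. b j * integral {0..1} (\<lambda>z. pd i (\<lambda>w. f w tn j) (\<lambda>l. z * X t l + (1 - z) * Y t l))"])
         (auto simp: win_def Jmat_slab mult.assoc intro!: sum.cong)
    show "\<forall>t\<in>win t0 R. \<bar>\<Sum>j<N. b j * Jmat f X Y t j i\<bar> \<le> K * c * B"
    proof
      fix t assume t: "t \<in> win t0 R"
      have "\<bar>\<Sum>j<N. b j * Jmat f X Y t j i\<bar> \<le> c * B" by (rule adjoint_bound[OF i]) (use t b in \<open>auto simp: win_def\<close>)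
      also have "\<dots> \<le> K * (c * B)" using mult_right_mono[OF K1, of "c * B"] c_nonneg B by simp
      finally show "\<bar>\<Sum>j<N. b j * Jmat f X Y t j i\<bar> \<le> K * c * B" by (simp add: mult.assoc)
    qed
  qed
  have "apx r (L * (K * c) * Z) (win t0 R) (sc t0) eps (\<lambda>t. \<Sum>j<N. \<Phi> t j * (\<lambda>t j. Jmat f X Y t j i) t j)"
  proof (rule L[unfolded linear_const_def, THEN conjunct2, rule_format])
    show "apx r (K * c * B) (win t0 R) (sc t0) eps (\<lambda>t. \<Sum>j<N. b j * Jmat f X Y t j i)
     \<and> (\<forall>t\<in>win t0 R. \<bar>\<Sum>j<N. b j * Jmat f X Y t j i\<bar> \<le> K * c * B)"
      if "\<And>j. j < N \<Longrightarrow> \<bar>b j\<bar> \<le> B" "0 \<le> B" for b B using A that by blast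
    show "\<bar>c * (t - t0)\<bar> \<le> R * eps" if "t \<in> win t0 R" for t by (rule sc_bound[OF that])
  qed (use K1 c_nonneg Z eps_nonneg small in auto)
  moreover have "adjoint_rhs f X Y \<Phi> t i = (\<Sum>j<N. \<Phi> t j * Jmat f X Y t j i)" for t
    by (simp add: adjoint_rhs_def mat_vec_def transp_def mult.commute)
  ultimately show ?thesis by (simp only: mult_ac)
qed

lemma Phi_bound: "t \<in> slab_ival G n \<Longrightarrow> i < N \<Longrightarrow> \<bar>\<Phi> t i\<bar> \<le> slab_norm G \<Phi> n"
proof -
  assume t: "t \<in> slab_ival G n" and i: "i < N"
  obtain B where B: "\<And>i t. i < N \<Longrightarrow> t \<in> {0<..T} \<Longrightarrow> \<bar>\<Phi> t i\<bar> \<le> B" using Vspace_bounded[OF Phi_V] by blast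
  have "norm_linf N (\<Phi> t) \<le> B" if "t \<in> slab_ival G n" for t
    by (rule norm_linf_le[OF N_pos]) (use B slab_T[OF that] in blast)
  then have "bdd_above ((\<lambda>t. norm_linf N (\<Phi> t)) ` slab_ival G n)"
    unfolding bdd_above_def by (intro exI[of _ B]) blast
  from cSUP_upper[OF t this] have "norm_linf N (\<Phi> t) \<le> slab_norm G \<Phi> n" by (simp add: slab_norm_def)
  then show ?thesis using abs_le_norm_linf[OF i, of "\<Phi> t"] by linarith
qed

lemma slab_norm_nonneg: "0 \<le> slab_norm G \<Phi> n"
  using Phi_bound[OF tn_slab, of 0] N_pos by (meson abs_ge_zero less_le_trans order.trans zero_less_one)

end

section \<open>Regularity of all orders\<close>

context slab_ctx
begin

text \<open>
  \<open>y0 t0\<close> is the base value at \<open>t0\<close>; it differs from \<open>y t0\<close> for the interpolant, whose base value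
  is taken from \<open>u\<close>. The second clause provides the distance \<open>K e\<close> from the base value, which
  \<open>apx\<close> does not give for \<open>r = 0\<close>.
\<close>

definition regular :: "nat \<Rightarrow> real \<Rightarrow> real \<Rightarrow> (real \<Rightarrow> rvec) \<Rightarrow> (real \<Rightarrow> rvec) \<Rightarrow> bool" where
  "regular r R K y0 y \<longleftrightarrow> (\<forall>t0\<in>slab_ival G n. \<forall>i<N. apx r K (win t0 R) (sc t0) eps (\<lambda>t. y t i - y0 t0 i)
     \<and> (\<forall>t\<in>win t0 R. \<bar>y t i - y0 t0 i\<bar> \<le> K * eps))"

text \<open>
  No base value is subtracted: \<open>\<Phi>\<close> enters the adjoint linearly.
\<close>

definition Phi_regular :: "nat \<Rightarrow> real \<Rightarrow> real \<Rightarrow> bool" where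
  "Phi_regular r R K \<longleftrightarrow> (\<forall>t0\<in>slab_ival G n. \<forall>i<N. apx r (K * slab_norm G \<Phi> n) (win t0 R) (sc t0) eps (\<lambda>t. \<Phi> t i))"

lemma regular_mono:
  assumes reg: "regular r R K y0 y" and K: "K \<le> K'"
  shows "regular r R K' y0 y"
  unfolding regular_def
proof (intro ballI allI impI conjI)
  fix t0 i assume *: "t0 \<in> slab_ival G n" "i < N"
  show "apx r K' (win t0 R) (sc t0) eps (\<lambda>t. y t i - y0 t0 i)"
    by (rule apx_mono[of _ K]) (use reg * K eps_nonneg in \<open>auto simp: regular_def\<close>)
  fix t assume "t \<in> win t0 R"
  then have "\<bar>y t i - y0 t0 i\<bar> \<le> K * eps" using reg * by (auto simp: regular_def)
  then show "\<bar>y t i - y0 t0 i\<bar> \<le> K' * eps" using mult_right_mono[OF K eps_nonneg] by linarith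
qed

lemma regular_of_apx:
  assumes "\<And>t0 i. t0 \<in> slab_ival G n \<Longrightarrow> i < N \<Longrightarrow> apx r K (win t0 R) (sc t0) eps (\<lambda>t. y t i - y0 t0 i)"
    and "\<And>t0 i t. t0 \<in> slab_ival G n \<Longrightarrow> i < N \<Longrightarrow> t \<in> win t0 R \<Longrightarrow> \<bar>y t i - y0 t0 i\<bar> \<le> L * eps"
    and "0 \<le> K" "0 \<le> L"
  shows "regular r R (K + L) y0 y"
  unfolding regular_def
proof (intro ballI allI impI conjI)
  fix t0 i assume *: "t0 \<in> slab_ival G n" "i < N"
  show "apx r (K + L) (win t0 R) (sc t0) eps (\<lambda>t. y t i - y0 t0 i)"
    by (rule apx_mono[OF assms(1)[OF *]]) (use assms(4) eps_nonneg in auto)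
  fix t assume "t \<in> win t0 R"
  from assms(2)[OF * this] show "\<bar>y t i - y0 t0 i\<bar> \<le> (K + L) * eps"
    using mult_right_mono[of L "K + L" eps] assms(3) eps_nonneg by linarith
qed

lemma regular_zero:
  assumes "\<And>t0 i t. t0 \<in> slab_ival G n \<Longrightarrow> i < N \<Longrightarrow> t \<in> win t0 R \<Longrightarrow> \<bar>y t i - y0 t0 i\<bar> \<le> L * eps" and "0 \<le> L"
  shows "regular 0 R (L * E + L) y0 y"
proof -
  have "0 \<le> E" using eps_nonneg small by linarith
  have le: "L * eps \<le> L * E" using assms(2) small by (rule mult_left_mono[rotated])
  show ?thesis
  proof (rule regular_of_apx[OF _ assms(1)])
    show "apx 0 (L * E) (win t0 R) (sc t0) eps (\<lambda>t. y t i - y0 t0 i)" if "t0 \<in> slab_ival G n" "i < N" for t0 i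
      by (rule apx_0) (use assms(1)[OF that] le \<open>0 \<le> E\<close> assms(2) in \<open>auto intro: order.trans\<close>)
  qed (use \<open>0 \<le> E\<close> assms(2) in auto)
qed

text \<open>
  The first-order case of \<open>drive_step\<close>, with the velocity bounded by \<open>c\<close>.
\<close>

lemma U_lipschitz:
  assumes C: "projection_const Q C" and R: "0 \<le> R" and t0: "t0 \<in> slab_ival G n" and i: "i < N" and t: "t \<in> win t0 R"
  shows "\<bar>U t i - U t0 i\<bar> \<le> 2 * (1 + (C + 1) * (2 * R / \<beta> + 1)) * eps"
proof -
  have C0: "0 < C" using C by (simp add: projection_const_def)
  have "apx 0 (c * 1) (win t0 (R + 1)) (sc t0) eps (\<lambda>t. f (U t) t i)"
    by (rule apx_0) (use f_along_bound[of U, OF _ i] c_nonneg in \<open>auto simp: win_def\<close>)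
  from drive_step[OF U_V i t0 R U_drives[OF C i] _ _ this]
  have "apx 1 ((1 + (C + 1) * (2 * R / \<beta> + 1)) * 1) (win t0 R) (sc t0) eps (\<lambda>t. U t i - U t0 i)"
    using C0 by simp
  from apx_lipschitz[OF this win_center[OF t0 R] _ t] show ?thesis by simp
qed

lemma u_lipschitz:
  assumes R: "0 \<le> R" and t0: "t0 \<in> slab_ival G n" and i: "i < N" and t: "t \<in> win t0 R"
  shows "\<bar>u t i - u t0 i\<bar> \<le> 2 * (1 + R) * eps"
proof -
  have "apx 0 (c * 1) (win t0 R) (sc t0) eps (\<lambda>t. f (u t) t i)"
    by (rule apx_0) (use f_along_bound[of u, OF _ i] c_nonneg in \<open>auto simp: win_def\<close>)
  from u_step[OF i t0 R _ this]
  have "apx 1 ((1 + R) * 1) (win t0 R) (sc t0) eps (\<lambda>t. u t i - u t0 i)" by simp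
  from apx_lipschitz[OF this win_center[OF t0 R] _ t] show ?thesis by simp
qed

lemma U_regular_Suc:
  assumes C: "projection_const Q C" and R: "0 \<le> R" and r: "r \<le> q"
    and K: "taylor_const r (R + 1) E K0 K" and L: "unit_const (r * r) (R + 1) E L" and K0: "0 \<le> K0"
    and reg: "regular r (R + 1) K0 U U"
  shows "regular (Suc r) R ((1 + (C + 1) * (2 * R / \<beta> + 1)) * (L * K) + 2 * (1 + (C + 1) * (2 * R / \<beta> + 1))) U U"
proof (rule regular_of_apx)
  have C0: "0 < C" using C by (simp add: projection_const_def)
  have KL: "0 \<le> L * K" using K L by (simp add: taylor_const_def unit_const_def)
  have S: "0 \<le> 1 + (C + 1) * (2 * R / \<beta> + 1)" using C0 R pos by simp
  show "0 \<le> (1 + (C + 1) * (2 * R / \<beta> + 1)) * (L * K)" "0 \<le> 2 * (1 + (C + 1) * (2 * R / \<beta> + 1))" using S KL by auto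
  fix t0 i assume *: "t0 \<in> slab_ival G n" "i < N"
  show "\<bar>U t i - U t0 i\<bar> \<le> 2 * (1 + (C + 1) * (2 * R / \<beta> + 1)) * eps" if "t \<in> win t0 R" for t
    by (rule U_lipschitz[OF C R * that])
  have "apx r (c * (L * K)) (win t0 (R + 1)) (sc t0) eps (\<lambda>t. f (U t) t i)"
    by (rule flow_composition[OF K L _ *(2,1) _ K0]) (use r reg *(1) in \<open>auto simp: regular_def\<close>)
  from drive_step[OF U_V *(2,1) R U_drives[OF C *(2)] _ KL this r]
  show "apx (Suc r) ((1 + (C + 1) * (2 * R / \<beta> + 1)) * (L * K)) (win t0 R) (sc t0) eps (\<lambda>t. U t i - U t0 i)"
    using C0 by simp
qed

lemma u_regular_Suc:
  assumes R: "0 \<le> R" and r: "r \<le> q"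
    and K: "taylor_const r R E K0 K" and L: "unit_const (r * r) R E L" and K0: "0 \<le> K0"
    and reg: "regular r R K0 u u"
  shows "regular (Suc r) R ((1 + R) * (L * K) + 2 * (1 + R)) u u"
proof (rule regular_of_apx)
  have KL: "0 \<le> L * K" using K L by (simp add: taylor_const_def unit_const_def)
  show "0 \<le> (1 + R) * (L * K)" "0 \<le> 2 * (1 + R)" using R KL by auto
  fix t0 i assume *: "t0 \<in> slab_ival G n" "i < N"
  show "\<bar>u t i - u t0 i\<bar> \<le> 2 * (1 + R) * eps" if "t \<in> win t0 R" for t
    by (rule u_lipschitz[OF R * that])
  have "apx r (c * (L * K)) (win t0 R) (sc t0) eps (\<lambda>t. f (u t) t i)"
    by (rule flow_composition[OF K L _ *(2,1) _ K0]) (use r reg *(1) in \<open>auto simp: regular_def\<close>)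
  from u_step[OF *(2,1) R KL this]
  show "apx (Suc r) ((1 + R) * (L * K)) (win t0 R) (sc t0) eps (\<lambda>t. u t i - u t0 i)" .
qed

lemma pu_regular:
  assumes C: "interpolation_const Q C" and r: "r \<le> q + 1" and K: "0 \<le> K" and reg: "regular r (R + 1) K u u"
  shows "regular r R (C * K) u pu"
  unfolding regular_def
proof (intro ballI allI impI)
  fix t0 i assume *: "t0 \<in> slab_ival G n" "i < N"
  have a: "apx r K (win t0 (R + 1)) (sc t0) eps (\<lambda>t. u t i - u t0 i)"
    and b: "\<And>t. t \<in> win t0 (R + 1) \<Longrightarrow> \<bar>u t i - u t0 i\<bar> \<le> K * eps"
    using reg * by (auto simp: regular_def)
  show "apx r (C * K) (win t0 R) (sc t0) eps (\<lambda>t. pu t i - u t0 i) \<and> (\<forall>t\<in>win t0 R. \<bar>pu t i - u t0 i\<bar> \<le> C * K * eps)"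
    using pu_step[OF C *(2,1) r a b K] by blast
qed

lemma regularD:
  assumes "regular r R K y0 y" "t0 \<in> slab_ival G n"
  shows "l < N \<Longrightarrow> apx r K (win t0 R) (sc t0) eps (\<lambda>t. y t l - y0 t0 l)"
    and "l < N \<Longrightarrow> t \<in> win t0 R \<Longrightarrow> \<bar>y t l - y0 t0 l\<bar> \<le> K * eps"
  using assms by (auto simp: regular_def)

lemma Phi_regular_zero: "Phi_regular 0 R 1"
  unfolding Phi_regular_def
  by (intro ballI allI impI apx_0) (auto simp: win_def slab_norm_nonneg intro: Phi_bound)

text \<open>
  The increment of \<open>\<Phi>\<close> is covered by \<open>drive_step\<close>; its value at the base point is a constant,
  which has order at least 1.
\<close>

lemma Phi_regular_Suc:
  assumes C: "projection_const Q C" and R: "0 \<le> R" and r: "Suc r \<le> q"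
    and K: "averaged_const r (R + 1) E K0 K" and L: "linear_const r (R + 1) E L"
    and pu: "regular r (R + 1) K0 u pu" and U: "regular r (R + 1) K0 U U" and P: "Phi_regular r (R + 1) K1" "0 \<le> K1"
  shows "Phi_regular (Suc r) R ((1 + (C + 1) * (2 * R / \<beta> + 1)) * (L * K * K1) + 1)"
  unfolding Phi_regular_def
proof (intro ballI allI impI)
  fix t0 i assume *: "t0 \<in> slab_ival G n" "i < N"
  let ?Z = "slab_norm G \<Phi> n"
  have C0: "0 < C" using C by (simp add: projection_const_def)
  have KZ: "0 \<le> L * K * (K1 * ?Z)" using K L P(2) slab_norm_nonneg by (simp add: averaged_const_def linear_const_def)
  have "apx r (c * (L * K * (K1 * ?Z))) (win t0 (R + 1)) (sc t0) eps (\<lambda>t. adjoint_rhs f pu U \<Phi> t i)"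
    by (rule adjoint_apx[OF K L *(2,1) _ regularD[OF pu *(1)] regularD[OF U *(1)]])
       (use r P slab_norm_nonneg *(1) in \<open>auto simp: Phi_regular_def\<close>)
  then have "apx r (c * (L * K * (K1 * ?Z))) (win t0 (R + 1)) (sc t0) eps (\<lambda>t. - adjoint_rhs f pu U \<Phi> t i)"
    by (rule apx_uminus)
  from drive_step[OF Phi_V *(2,1) R Phi_drives[OF C *(2)] _ KZ this]
  have 1: "apx (Suc r) ((1 + (C + 1) * (2 * R / \<beta> + 1)) * (L * K * (K1 * ?Z))) (win t0 R) (sc t0) eps (\<lambda>t. \<Phi> t i - \<Phi> t0 i)"
    using C0 r by simp
  have 2: "apx (Suc r) ?Z (win t0 R) (sc t0) eps (\<lambda>_. \<Phi> t0 i)"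
    by (rule apx_const) (use Phi_bound[OF *] eps_nonneg in auto)
  have "(1 + (C + 1) * (2 * R / \<beta> + 1)) * (L * K * (K1 * ?Z)) + ?Z = ((1 + (C + 1) * (2 * R / \<beta> + 1)) * (L * K * K1) + 1) * ?Z"
    by (simp add: algebra_simps)
  then show "apx (Suc r) (((1 + (C + 1) * (2 * R / \<beta> + 1)) * (L * K * K1) + 1) * ?Z) (win t0 R) (sc t0) eps (\<lambda>t. \<Phi> t i)"
    using apx_add[OF 1 2] by simp
qed

lemma adjoint_regular:
  assumes K: "averaged_const q R E K0 K" and L: "linear_const q R E L"
    and pu: "regular q R K0 u pu" and u: "regular q R K0 u u" and P: "Phi_regular q R K1" "0 \<le> K1"
    and t0: "t0 \<in> slab_ival G n" and i: "i < N"
  shows "apx q (c * (L * K * K1 * slab_norm G \<Phi> n)) (win t0 R) (sc t0) eps (\<lambda>t. adjoint_rhs f pu u \<Phi> t i)"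
proof -
  have "apx q (c * (L * K * (K1 * slab_norm G \<Phi> n))) (win t0 R) (sc t0) eps (\<lambda>t. adjoint_rhs f pu u \<Phi> t i)"
    by (rule adjoint_apx[OF K L i t0 _ regularD[OF pu t0] regularD[OF u t0]])
       (use P slab_norm_nonneg t0 in \<open>auto simp: Phi_regular_def\<close>)
  then show ?thesis by (simp only: mult.assoc)
qed

text \<open>
  The interpolation error is orthogonal to the polynomial of degree less than \<open>q\<close> that
  approximates the adjoint, so only the approximation error counts.
\<close>

lemma cell_integral_estimate:
  assumes ij: "(i, j) \<in> slab G n" and K: "0 \<le> K"
    and A: "apx q (c * (K * slab_norm G \<Phi> n)) (win (nd i j) 1) (sc (nd i j)) eps (\<lambda>t. adjoint_rhs f pu u \<Phi> t i)"
    and e: "\<And>t. t \<in> cell G i j \<Longrightarrow> \<bar>pu t i - u t i\<bar> \<le> B"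
  shows "\<bar>integral (cell G i j) (\<lambda>t. (pu t i - u t i) * adjoint_rhs f pu u \<Phi> t i)\<bar>
     \<le> step G i j * (B * (c * (K * slab_norm G \<Phi> n) * eps ^ q))"
proof -
  let ?a = "nd i (j - 1)" and ?b = "nd i j" and ?A = "\<lambda>t. adjoint_rhs f pu u \<Phi> t i"
  have i: "i < N" and j: "j \<in> {1..M i}" and sub: "cell G i j \<subseteq> slab_ival G n" using slab_cell_subset[OF ij] by auto
  define D where "D = c * (K * slab_norm G \<Phi> n) * eps ^ q"
  have D0: "0 \<le> D" unfolding D_def using c_nonneg K slab_norm_nonneg eps_nonneg by simp
  have ab: "?a < ?b" by (rule nd_step[OF i j])
  have bc: "?b \<in> cell G i j" using ab by (simp add: cell_def)
  have cw: "cell G i j \<subseteq> win ?b 1"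
  proof -
    have "?b \<in> win ?b 0" using bc sub by (auto simp: win_def)
    from cell_in_win[OF ij bc this] show ?thesis by simp
  qed
  obtain p where p: "\<forall>m\<ge>q. coeff p m = 0"
    "\<And>t. t \<in> win ?b 1 \<Longrightarrow> \<bar>?A t - poly p (c * (t - ?b))\<bar> \<le> D"
    using A by (auto simp: apx_def D_def)
  define w where "w = pcompose p [:- (c * ?b), c:]"
  have w: "\<forall>m\<ge>q. coeff w m = 0" "\<And>t. poly w t = poly p (c * (t - ?b))"
    using shifted_poly[OF p(1) order.refl] by (auto simp: w_def)
  have dG: "is_dG q ?a ?b (\<lambda>s. u s i) (ipoly i j)" using ipoly_is_dG[OF i j] degs[OF ij] by simp
  have orth: "integral {?a..?b} (\<lambda>t. (u t i - poly (ipoly i j) t) * poly w t) = 0"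
  proof (cases "w = 0")
    case False
    then have "degree w < q" using coeff_zero_imp_degree[OF w(1)] by blast
    then show ?thesis using dG by (simp add: is_dG_def)
  qed simp
  have iu: "(\<lambda>t. (u t i - poly (ipoly i j) t) * poly w t) integrable_on {?a..?b}"
    by (intro integrable_continuous_interval continuous_intros u_cell_continuous i j)
  have iA: "(\<lambda>t. (pu t i - u t i) * ?A t) integrable_on {?a<..?b}"
  proof -
    have "(\<lambda>t. (pu t i - u t i) * ?A t) integrable_on {0..T}" using error_adjoint_integrable[OF i] integrable_Ioc by blast
    then have "(\<lambda>t. (pu t i - u t i) * ?A t) integrable_on {?a..?b}"
      by (rule integrable_subinterval_real) (rule cell_closure_subset[OF i j])
    then show ?thesis using integrable_Ioc by blast
  qed
  have iw: "(\<lambda>t. (u t i - poly (ipoly i j) t) * poly w t) integrable_on {?a<..?b}" using iu integrable_Ioc by blast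
  (* Adding the vanishing integral against w turns the factor A into A - w. *)
  have eq: "integral {?a<..?b} (\<lambda>t. (pu t i - u t i) * ?A t)
      = integral {?a<..?b} (\<lambda>t. (pu t i - u t i) * ?A t + (u t i - poly (ipoly i j) t) * poly w t)"
    unfolding integral_add[OF iA iw] using orth unfolding integral_Ioc by simp
  have "norm (integral {?a<..?b} (\<lambda>t. (pu t i - u t i) * ?A t + (u t i - poly (ipoly i j) t) * poly w t))
      \<le> integral {?a<..?b} (\<lambda>t. B * D)"
  proof (rule integral_norm_bound_integral[OF integrable_add[OF iA iw]])
    show "(\<lambda>t. B * D) integrable_on {?a<..?b}" using integrable_Ioc integrable_const_ivl by blast
    fix t assume t: "t \<in> {?a<..?b}"
    then have tc: "t \<in> cell G i j" by (simp add: cell_def)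
    have "(pu t i - u t i) * ?A t + (u t i - poly (ipoly i j) t) * poly w t = (pu t i - u t i) * (?A t - poly w t)"
      using pu_cell[OF i j tc] by (simp add: algebra_simps)
    moreover have "\<bar>?A t - poly w t\<bar> \<le> D" using p(2)[of t] cw tc by (auto simp: w)
    ultimately show "norm ((pu t i - u t i) * ?A t + (u t i - poly (ipoly i j) t) * poly w t) \<le> B * D"
      using e[OF tc] by (auto simp: abs_mult intro!: mult_mono)
  qed
  also have "integral {?a<..?b} (\<lambda>t. B * D) = step G i j * (B * D)"
    unfolding integral_Ioc using ab by (simp add: step_def)
  finally show ?thesis unfolding cell_def eq D_def real_norm_def .
qed

end

text \<open>
  The constant has to be chosen before the data. Going from order \<open>r\<close> to \<open>r + 1\<close> uses the
  induction hypothesis on the window enlarged by one step, which is why \<open>R\<close> is arbitrary in the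
  induction.
\<close>

lemma uniform_U_regularity:
  assumes E: "0 \<le> E" and \<beta>: "0 < \<beta>" and R: "0 \<le> R"
  shows "\<exists>K\<ge>0. \<forall>G f u0 u U \<psi> g \<Phi> n q c \<kappa>. slab_ctx G Q f u0 u U \<psi> g \<Phi> n q c \<kappa> \<beta> E \<longrightarrow> r \<le> q + 1 \<longrightarrow>
     slab_ctx.regular G n c \<kappa> r R K U U"
  using R
proof (induction r arbitrary: R)
  case 0
  obtain C where C: "projection_const Q C" using weighted_projection_bound by blast
  define L where "L = 2 * (1 + (C + 1) * (2 * R / \<beta> + 1))"
  have L0: "0 \<le> L" using C 0 \<beta> by (simp add: L_def projection_const_def)
  have "slab_ctx.regular G n c \<kappa> 0 R (L * E + L) U U" if "slab_ctx G Q f u0 u U \<psi> g \<Phi> n q c \<kappa> \<beta> E"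
    for G f u0 u U \<psi> g \<Phi> n q c \<kappa>
  proof -
    interpret slab_ctx G Q f u0 u U \<psi> g \<Phi> n q c \<kappa> \<beta> E by (rule that)
    show ?thesis by (rule regular_zero[OF _ L0]) (unfold L_def, rule U_lipschitz[OF C 0])
  qed
  moreover have "0 \<le> L * E + L" using L0 E by simp
  ultimately show ?case by (intro exI[of _ "L * E + L"] conjI allI impI)
next
  case (Suc r)
  obtain C where C: "projection_const Q C" using weighted_projection_bound by blast
  have R1: "0 \<le> R + 1" using Suc.prems by simp
  obtain K0 where K0: "0 \<le> K0" and IH: "\<forall>G f u0 u U \<psi> g \<Phi> n q c \<kappa>. slab_ctx G Q f u0 u U \<psi> g \<Phi> n q c \<kappa> \<beta> E \<longrightarrow> r \<le> q + 1 \<longrightarrow>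
     slab_ctx.regular G n c \<kappa> r (R + 1) K0 U U"
    using Suc.IH[OF R1] by blast
  obtain K where K: "taylor_const r (R + 1) E K0 K" using taylor_composition[OF R1 E K0] by blast
  obtain L where L: "unit_const (r * r) (R + 1) E L" using apx_from_unit_bound[OF R1 E] by blast
  define S where "S = 1 + (C + 1) * (2 * R / \<beta> + 1)"
  have S0: "0 \<le> S" using C Suc.prems \<beta> by (simp add: S_def projection_const_def)
  have "slab_ctx.regular G n c \<kappa> (Suc r) R (S * (L * K) + 2 * S) U U"
    if ctx: "slab_ctx G Q f u0 u U \<psi> g \<Phi> n q c \<kappa> \<beta> E" and r: "Suc r \<le> q + 1"
    for G f u0 u U \<psi> g \<Phi> n q c \<kappa>
  proof -
    interpret slab_ctx G Q f u0 u U \<psi> g \<Phi> n q c \<kappa> \<beta> E by (rule ctx)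
    have rq: "r \<le> q" "r \<le> q + 1" using r by auto
    show ?thesis unfolding S_def
      by (rule U_regular_Suc[OF C Suc.prems rq(1) K L K0 IH[rule_format, OF ctx rq(2)]])
  qed
  moreover have "0 \<le> S * (L * K) + 2 * S" using S0 K L by (simp add: taylor_const_def unit_const_def)
  ultimately show ?case by (intro exI[of _ "S * (L * K) + 2 * S"] conjI allI impI)
qed

text \<open>
  The same induction, without enlargement of the window.
\<close>

lemma uniform_u_regularity:
  assumes E: "0 \<le> E" and R: "0 \<le> R"
  shows "\<exists>K\<ge>0. \<forall>G f u0 u U \<psi> g \<Phi> n q c \<kappa>. slab_ctx G Q f u0 u U \<psi> g \<Phi> n q c \<kappa> \<beta> E \<longrightarrow> r \<le> q + 1 \<longrightarrow>
     slab_ctx.regular G n c \<kappa> r R K u u"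
proof (induction r)
  case 0
  define L where "L = 2 * (1 + R)"
  have L0: "0 \<le> L" using R by (simp add: L_def)
  have "slab_ctx.regular G n c \<kappa> 0 R (L * E + L) u u" if "slab_ctx G Q f u0 u U \<psi> g \<Phi> n q c \<kappa> \<beta> E"
    for G f u0 u U \<psi> g \<Phi> n q c \<kappa>
  proof -
    interpret slab_ctx G Q f u0 u U \<psi> g \<Phi> n q c \<kappa> \<beta> E by (rule that)
    show ?thesis by (rule regular_zero[OF _ L0]) (unfold L_def, rule u_lipschitz[OF R])
  qed
  moreover have "0 \<le> L * E + L" using L0 E by simp
  ultimately show ?case by (intro exI[of _ "L * E + L"] conjI allI impI)
next
  case (Suc r)
  then obtain K0 where K0: "0 \<le> K0" and IH: "\<forall>G f u0 u U \<psi> g \<Phi> n q c \<kappa>. slab_ctx G Q f u0 u U \<psi> g \<Phi> n q c \<kappa> \<beta> E \<longrightarrow> r \<le> q + 1 \<longrightarrow>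
     slab_ctx.regular G n c \<kappa> r R K0 u u"
    by blast
  obtain K where K: "taylor_const r R E K0 K" using taylor_composition[OF R E K0] by blast
  obtain L where L: "unit_const (r * r) R E L" using apx_from_unit_bound[OF R E] by blast
  have "slab_ctx.regular G n c \<kappa> (Suc r) R ((1 + R) * (L * K) + 2 * (1 + R)) u u"
    if ctx: "slab_ctx G Q f u0 u U \<psi> g \<Phi> n q c \<kappa> \<beta> E" and r: "Suc r \<le> q + 1"
    for G f u0 u U \<psi> g \<Phi> n q c \<kappa>
  proof -
    interpret slab_ctx G Q f u0 u U \<psi> g \<Phi> n q c \<kappa> \<beta> E by (rule ctx)
    have rq: "r \<le> q" "r \<le> q + 1" using r by auto
    show ?thesis by (rule u_regular_Suc[OF R rq(1) K L K0 IH[rule_format, OF ctx rq(2)]])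
  qed
  moreover have "0 \<le> (1 + R) * (L * K) + 2 * (1 + R)" using R K L by (simp add: taylor_const_def unit_const_def)
  ultimately show ?case by (intro exI[of _ "(1 + R) * (L * K) + 2 * (1 + R)"] conjI allI impI)
qed

lemma uniform_curve_regularity:
  assumes E: "0 \<le> E" and \<beta>: "0 < \<beta>" and R: "0 \<le> R"
  shows "\<exists>K\<ge>0. \<forall>G f u0 u U \<psi> g \<Phi> n q c \<kappa>. slab_ctx G Q f u0 u U \<psi> g \<Phi> n q c \<kappa> \<beta> E \<longrightarrow> r \<le> q + 1 \<longrightarrow>
     slab_ctx.regular G n c \<kappa> r R K U U \<and> slab_ctx.regular G n c \<kappa> r R K u u \<and> slab_ctx.regular G n c \<kappa> r R K u (dG_interp G u)"
proof -
  obtain K1 where K1: "0 \<le> K1" and h1: "\<forall>G f u0 u U \<psi> g \<Phi> n q c \<kappa>. slab_ctx G Q f u0 u U \<psi> g \<Phi> n q c \<kappa> \<beta> E \<longrightarrow> r \<le> q + 1 \<longrightarrow>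
     slab_ctx.regular G n c \<kappa> r R K1 U U" using uniform_U_regularity[OF assms] by blast
  obtain K2 where K2: "0 \<le> K2" and h2: "\<forall>G f u0 u U \<psi> g \<Phi> n q c \<kappa>. slab_ctx G Q f u0 u U \<psi> g \<Phi> n q c \<kappa> \<beta> E \<longrightarrow> r \<le> q + 1 \<longrightarrow>
     slab_ctx.regular G n c \<kappa> r R K2 u u" using uniform_u_regularity[OF E R] by blast
  have R1: "0 \<le> R + 1" using R by simp
  obtain K3 where K3: "0 \<le> K3" and h3: "\<forall>G f u0 u U \<psi> g \<Phi> n q c \<kappa>. slab_ctx G Q f u0 u U \<psi> g \<Phi> n q c \<kappa> \<beta> E \<longrightarrow> r \<le> q + 1 \<longrightarrow>
     slab_ctx.regular G n c \<kappa> r (R + 1) K3 u u" using uniform_u_regularity[OF E R1] by blast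
  obtain C where C: "interpolation_const Q C" using dG_error by blast
  define K where "K = K1 + K2 + C * K3"
  have C1: "1 \<le> C" using C by (simp add: interpolation_const_def)
  have le: "K1 \<le> K" "K2 \<le> K" "C * K3 \<le> K" "0 \<le> K" using K1 K2 K3 C1 by (auto simp: K_def)
  have "slab_ctx.regular G n c \<kappa> r R K U U \<and> slab_ctx.regular G n c \<kappa> r R K u u \<and> slab_ctx.regular G n c \<kappa> r R K u (dG_interp G u)"
    if ctx: "slab_ctx G Q f u0 u U \<psi> g \<Phi> n q c \<kappa> \<beta> E" and r: "r \<le> q + 1"
    for G f u0 u U \<psi> g \<Phi> n q c \<kappa>
  proof -
    interpret slab_ctx G Q f u0 u U \<psi> g \<Phi> n q c \<kappa> \<beta> E by (rule ctx)
    show ?thesis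
      using regular_mono[OF h1[rule_format, OF ctx r] le(1)] regular_mono[OF h2[rule_format, OF ctx r] le(2)]
        regular_mono[OF pu_regular[OF C r K3 h3[rule_format, OF ctx r]] le(3)] by blast
  qed
  then show ?thesis using le(4) by (intro exI[of _ K] conjI[of "0 \<le> K"] allI impI)
qed

text \<open>
  The approximability of \<open>U\<close> and \<open>\<pi>u\<close> is already available to order \<open>r\<close>, so the induction
  concerns \<open>\<Phi>\<close> alone.
\<close>

lemma uniform_Phi_regularity:
  assumes E: "0 \<le> E" and \<beta>: "0 < \<beta>" and R: "0 \<le> R"
  shows "\<exists>K\<ge>0. \<forall>G f u0 u U \<psi> g \<Phi> n q c \<kappa>. slab_ctx G Q f u0 u U \<psi> g \<Phi> n q c \<kappa> \<beta> E \<longrightarrow> r \<le> q \<longrightarrow>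
     slab_ctx.Phi_regular G \<Phi> n c \<kappa> r R K"
  using R
proof (induction r arbitrary: R)
  case 0
  have "slab_ctx.Phi_regular G \<Phi> n c \<kappa> 0 R 1" if "slab_ctx G Q f u0 u U \<psi> g \<Phi> n q c \<kappa> \<beta> E"
    for G f u0 u U \<psi> g \<Phi> n q c \<kappa>
    by (rule slab_ctx.Phi_regular_zero[OF that])
  then show ?case by (intro exI[of _ 1] conjI allI impI) auto
next
  case (Suc r)
  obtain C where C: "projection_const Q C" using weighted_projection_bound by blast
  have R1: "0 \<le> R + 1" using Suc.prems by simp
  obtain K1 where K1: "0 \<le> K1" and IH: "\<forall>G f u0 u U \<psi> g \<Phi> n q c \<kappa>. slab_ctx G Q f u0 u U \<psi> g \<Phi> n q c \<kappa> \<beta> E \<longrightarrow> r \<le> q \<longrightarrow>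
     slab_ctx.Phi_regular G \<Phi> n c \<kappa> r (R + 1) K1"
    using Suc.IH[OF R1] by blast
  obtain K0 where K0: "0 \<le> K0" and reg: "\<forall>G f u0 u U \<psi> g \<Phi> n q c \<kappa>. slab_ctx G Q f u0 u U \<psi> g \<Phi> n q c \<kappa> \<beta> E \<longrightarrow> r \<le> q + 1 \<longrightarrow>
     slab_ctx.regular G n c \<kappa> r (R + 1) K0 U U \<and> slab_ctx.regular G n c \<kappa> r (R + 1) K0 u u \<and> slab_ctx.regular G n c \<kappa> r (R + 1) K0 u (dG_interp G u)"
    using uniform_curve_regularity[OF E \<beta> R1] by blast
  obtain K where K: "averaged_const r (R + 1) E K0 K" using averaged_composition[OF R1 E K0] by blast
  obtain L where L: "linear_const r (R + 1) E L" using linear_combination_composition[OF R1 E] by blast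
  define S where "S = (1 + (C + 1) * (2 * R / \<beta> + 1)) * (L * K * K1) + 1"
  have S0: "0 \<le> S" using C Suc.prems \<beta> K L K1 by (simp add: S_def projection_const_def averaged_const_def linear_const_def)
  have "slab_ctx.Phi_regular G \<Phi> n c \<kappa> (Suc r) R S"
    if ctx: "slab_ctx G Q f u0 u U \<psi> g \<Phi> n q c \<kappa> \<beta> E" and r: "Suc r \<le> q"
    for G f u0 u U \<psi> g \<Phi> n q c \<kappa>
  proof -
    interpret slab_ctx G Q f u0 u U \<psi> g \<Phi> n q c \<kappa> \<beta> E by (rule ctx)
    have rq: "r \<le> q" "r \<le> q + 1" using r by auto
    note rr = reg[rule_format, OF ctx rq(2)]
    show ?thesis unfolding S_def
      by (rule Phi_regular_Suc[OF C Suc.prems r K L rr[THEN conjunct2, THEN conjunct2] rr[THEN conjunct1] IH[rule_format, OF ctx rq(1)] K1])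
  qed
  then show ?case using S0 by (intro exI[of _ S] conjI allI impI)
qed

lemma uniform_adjoint_regularity:
  assumes E: "0 \<le> E" and \<beta>: "0 < \<beta>"
  shows "\<exists>K\<ge>0. \<forall>G f u0 u U \<psi> g \<Phi> n c \<kappa> t0 i. slab_ctx G Q f u0 u U \<psi> g \<Phi> n q c \<kappa> \<beta> E \<longrightarrow>
     t0 \<in> slab_ival G n \<longrightarrow> i < ncomp G \<longrightarrow>
     apx q (c * (K * slab_norm G \<Phi> n)) (slab_ctx.win G n \<kappa> t0 1) (\<lambda>t. c * (t - t0)) (c * \<kappa>)
       (\<lambda>t. valid_grid.adjoint_rhs G f (dG_interp G u) u \<Phi> t i)"
proof -
  have R: "0 \<le> (1::real)" by simp
  obtain K1 where K1: "0 \<le> K1" and P: "\<forall>G f u0 u U \<psi> g \<Phi> n q' c \<kappa>. slab_ctx G Q f u0 u U \<psi> g \<Phi> n q' c \<kappa> \<beta> E \<longrightarrow> q \<le> q' \<longrightarrow>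
     slab_ctx.Phi_regular G \<Phi> n c \<kappa> q 1 K1"
    using uniform_Phi_regularity[OF E \<beta> R] by blast
  obtain K0 where K0: "0 \<le> K0" and reg: "\<forall>G f u0 u U \<psi> g \<Phi> n q' c \<kappa>. slab_ctx G Q f u0 u U \<psi> g \<Phi> n q' c \<kappa> \<beta> E \<longrightarrow> q \<le> q' + 1 \<longrightarrow>
     slab_ctx.regular G n c \<kappa> q 1 K0 U U \<and> slab_ctx.regular G n c \<kappa> q 1 K0 u u \<and> slab_ctx.regular G n c \<kappa> q 1 K0 u (dG_interp G u)"
    using uniform_curve_regularity[OF E \<beta> R] by blast
  obtain K where K: "averaged_const q 1 E K0 K" using averaged_composition[OF R E K0] by blast
  obtain L where L: "linear_const q 1 E L" using linear_combination_composition[OF R E] by blast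
  have "apx q (c * (L * K * K1 * slab_norm G \<Phi> n)) (slab_ctx.win G n \<kappa> t0 1) (\<lambda>t. c * (t - t0)) (c * \<kappa>)
       (\<lambda>t. valid_grid.adjoint_rhs G f (dG_interp G u) u \<Phi> t i)"
    if ctx: "slab_ctx G Q f u0 u U \<psi> g \<Phi> n q c \<kappa> \<beta> E" and t0: "t0 \<in> slab_ival G n" and i: "i < ncomp G"
    for G f u0 u U \<psi> g \<Phi> n c \<kappa> t0 i
  proof -
    interpret slab_ctx G Q f u0 u U \<psi> g \<Phi> n q c \<kappa> \<beta> E by (rule ctx)
    have rq: "q \<le> q" "q \<le> q + 1" by auto
    note rr = reg[rule_format, OF ctx rq(2)]
    show ?thesis
      by (rule adjoint_regular[OF K L rr[THEN conjunct2, THEN conjunct2] rr[THEN conjunct2, THEN conjunct1] P[rule_format, OF ctx rq(1)] K1 t0 i])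
  qed
  moreover have "0 \<le> L * K * K1" using K L K1 by (simp add: averaged_const_def linear_const_def)
  ultimately show ?thesis by (intro exI[of _ "L * K * K1"] conjI allI impI)
qed

section \<open>The improved estimate\<close>

text \<open>
  The integrand of the stability factor.
\<close>

definition sbar_weight :: "grid \<Rightarrow> (nat \<Rightarrow> real) \<Rightarrow> (real \<Rightarrow> rvec) \<Rightarrow> real \<Rightarrow> real" where
  "sbar_weight G Cf v t = Cf (index_at (level G) t) * slab_norm G v (index_at (level G) t)"

context valid_grid
begin

lemma cellwise_constant_Vspace:
  assumes "\<And>i j. i < N \<Longrightarrow> j \<in> {1..M i} \<Longrightarrow> \<exists>a. \<forall>t\<in>cell G i j. v t i = a"
  shows "v \<in> Vspace G"
  unfolding Vspace_def
proof (intro CollectI allI impI ballI)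
  fix i j assume "i < N" "j \<in> {1..M i}"
  then obtain a where "\<forall>t\<in>cell G i j. v t i = a" using assms by blast
  then show "\<exists>p. degree p \<le> deg G i j \<and> (\<forall>t\<in>cell G i j. v t i = poly p t)"
    by (intro exI[of _ "[:a:]"]) auto
qed

lemma Vspace_integrable:
  assumes v: "v \<in> Vspace G" and i: "i < N"
  shows "(\<lambda>t. v t i) integrable_on {0<..T}"
proof -
  obtain B where "\<And>t i. t \<in> {0<..T} \<Longrightarrow> i < N \<Longrightarrow> \<bar>v t i\<bar> \<le> B" using Vspace_bounded[OF v] by blast
  then have "(\<lambda>t. v t i) absolutely_integrable_on {0<..T}" by (intro mble_bounded_integrable[OF Vspace_mble[OF v i]]) (use i in auto)
  then show ?thesis by (rule absolutely_integrable_on_def[THEN iffD1, THEN conjunct1])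
qed

lemma sbar_weight_cell:
  assumes "n \<in> {1..nslab G}" "t \<in> slab_ival G n"
  shows "sbar_weight G Cf v t = Cf n * slab_norm G v n"
  using index_slab[OF assms] by (simp add: sbar_weight_def)

lemma weight_Vspace: "(\<lambda>t i. sbar_weight G Cf v t) \<in> Vspace G"
proof (rule cellwise_constant_Vspace)
  fix i j assume ij: "i < N" "j \<in> {1..M i}"
  obtain n where "\<And>t. t \<in> cell G i j \<Longrightarrow> index_at (level G) t = n" using cell_in_slab[OF ij] by metis
  then show "\<exists>a. \<forall>t\<in>cell G i j. sbar_weight G Cf v t = a"
    by (intro exI[of _ "Cf n * slab_norm G v n"]) (simp add: sbar_weight_def)
qed

lemma sbar_weight_integrable: "sbar_weight G Cf v integrable_on {0<..T}"
  using Vspace_integrable[OF weight_Vspace, of 0 Cf v] N_pos by simp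

lemma stab_Sbar_eq_sum:
  "stab_Sbar G Cf v = (\<Sum>n=1..nslab G. (level G n - level G (n - 1)) * Cf n * slab_norm G v n)"
proof -
  have "stab_Sbar G Cf v = integral {0..T} (sbar_weight G Cf v)"
    by (simp add: stab_Sbar_def sbar_weight_def[abs_def])
  also have "\<dots> = (\<Sum>n=1..nslab G. integral (slab_ival G n) (sbar_weight G Cf v))"
    by (rule integral_slabs[OF sbar_weight_integrable])
  also have "\<dots> = (\<Sum>n=1..nslab G. (level G n - level G (n - 1)) * Cf n * slab_norm G v n)"
  proof (rule sum.cong[OF refl])
    fix n assume n: "n \<in> {1..nslab G}"
    have "integral (slab_ival G n) (sbar_weight G Cf v) = integral (slab_ival G n) (\<lambda>_. Cf n * slab_norm G v n)"
      by (rule integral_cong) (rule sbar_weight_cell[OF n])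
    also have "\<dots> = (level G n - level G (n - 1)) * (Cf n * slab_norm G v n)"
      unfolding slab_ival_def integral_Ioc using lv_step[OF n] by simp
    finally show "integral (slab_ival G n) (sbar_weight G Cf v) = (level G n - level G (n - 1)) * Cf n * slab_norm G v n"
      by simp
  qed
  finally show ?thesis .
qed

end

text \<open>
  The largest step of the slab is at most \<open>k\<^sub>i\<^sub>j / \<alpha>\<close> for the given cell and the smallest one at
  least \<open>\<alpha> k\<^sub>i\<^sub>j\<close>, which gives the ratio \<open>\<beta> = \<alpha>\<^sup>2\<close>.
\<close>

lemma slab_ctx_of_assms:
  assumes S: "mdG_setting Q G f u0 u U \<psi> g \<Phi>" and A: "slab_assms G f u U g Cf ck \<alpha>" and \<alpha>: "0 < \<alpha>"
    and n: "n \<in> {1..nslab G}" and ij: "(i, j) \<in> slab G n"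
  shows "slab_ctx G Q f u0 u U \<psi> g \<Phi> n (deg G i j) (Cf n) (step G i j / \<alpha>) (\<alpha>\<^sup>2) (ck / \<alpha>)"
proof -
  interpret mdG G Q f u0 u U \<psi> g \<Phi> by (rule mdG_setting_locale[OF S])
  from A[unfolded slab_assms_def, THEN bspec, OF n] obtain qb where
    d: "\<forall>(i, j)\<in>slab G n. deg G i j = qb"
    and s: "\<forall>(i, j)\<in>slab G n. \<forall>(l, m)\<in>slab G n. step G i j > \<alpha> * step G l m"
    and au: "\<forall>i<ncomp G. \<forall>x. \<forall>t\<in>slab_ival G n.
           ((\<lambda>s. f x s i) has_real_derivative 0) (at t within slab_ival G n)"
    and Ckf: "\<forall>i<ncomp G. \<forall>t\<in>slab_ival G n. Ck (ncomp G) (qb + 1) (\<lambda>x. f x t i)"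
    and Cfn: "is_Cf (ncomp G) qb (level G (n - 1)) (level G n) f (slab_args G u U n) (Cf n)"
    and sC: "\<forall>(i, j)\<in>slab G n. step G i j * Cf n \<le> ck"
    and g0: "0 < qb \<longrightarrow> (\<forall>i<ncomp G. \<forall>t\<in>slab_ival G n. g t i = 0)"
    by (elim exE conjE) (rule that)
  have q: "deg G i j = qb" using bspec[OF d ij] by simp
  have st: "\<alpha> * step G l m < step G l' m'" if "(l, m) \<in> slab G n" "(l', m') \<in> slab G n" for l m l' m'
    using bspec[OF s that(2)] that(1) by auto
  have tn: "level G n \<in> slab_ival G n" using lv_step[OF n] by (simp add: slab_ival_def)
  have i: "i < N" "j \<in> {1..M i}" using slab_cell_subset[OF ij] by auto
  show ?thesis
  proof (intro slab_ctx.intro slab_ctx_axioms.intro)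
    show "mdG G Q f u0 u U \<psi> g \<Phi>" by (rule mdG_setting_locale[OF S])
    show "n \<in> {1..nslab G}" by (rule n)
    show "deg G l m = deg G i j" if "(l, m) \<in> slab G n" for l m using bspec[OF d that] q by simp
    show "\<alpha>\<^sup>2 * (step G i j / \<alpha>) \<le> step G l m \<and> step G l m \<le> step G i j / \<alpha>" if "(l, m) \<in> slab G n" for l m
      using st[OF ij that] st[OF that ij] \<alpha> by (simp add: power2_eq_square field_simps)
    show "0 < \<alpha>\<^sup>2" using \<alpha> by simp
    show "0 < step G i j / \<alpha>" using \<alpha> step_pos[OF i] by simp
    show "f x t l = f x (level G n) l" if l: "l < N" and t: "t \<in> slab_ival G n" for l x t
    proof -
      have "\<exists>k. \<forall>t\<in>slab_ival G n. f x t l = k"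
        by (rule has_field_derivative_zero_constant) (use au l in \<open>auto simp: slab_ival_def\<close>)
      then show ?thesis using t tn by metis
    qed
    show "Ck N (deg G i j + 1) (\<lambda>x. f x (level G n) l)" if "l < N" for l using Ckf[rule_format, OF that tn] q by simp
    show "is_Cf N (deg G i j) (level G (n - 1)) (level G n) f (slab_args G u U n) (Cf n)" using Cfn q by simp
    have "step G i j * Cf n \<le> ck" using bspec[OF sC ij] by simp
    then show "Cf n * (step G i j / \<alpha>) \<le> ck / \<alpha>" using \<alpha> by (simp add: field_simps)
    show "g t l = 0" if "0 < deg G i j" "l < N" "t \<in> slab_ival G n" for l t using g0 q that by simp
  qed
qed

text \<open>
  The adjoint contributes \<open>(C\<^sub>f k)\<^sup>q\<close> and the interpolation error \<open>k\<^sup>q\<^sup>+\<^sup>1\<close>; the degree of the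
  cell is at most \<open>Q\<close>, so finitely many constants \<open>k q\<close> can be added up.
\<close>

lemma uniform_cell_estimate:
  assumes ck: "0 < ck" and \<alpha>: "0 < \<alpha>" "\<alpha> < 1"
  shows "\<exists>C>0. \<forall>G f u0 u U \<psi> g \<Phi> Cf n i j. mdG_setting Q G f u0 u U \<psi> g \<Phi> \<longrightarrow> slab_assms G f u U g Cf ck \<alpha> \<longrightarrow>
     n \<in> {1..nslab G} \<longrightarrow> (i, j) \<in> slab G n \<longrightarrow>
     \<bar>integral (cell G i j) (\<lambda>t. (dG_interp G u t i - u t i) * valid_grid.adjoint_rhs G f (dG_interp G u) u \<Phi> t i)\<bar>
     \<le> C * (step G i j * ((step G i j ^ (2 * deg G i j + 1) * Cf n ^ deg G i j * cell_norm G u i j) * (Cf n * slab_norm G \<Phi> n)))"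
proof -
  obtain C where C1: "C \<ge> 1" and C': "\<forall>G f u0 u U \<psi> g \<Phi>. mdG_setting Q G f u0 u U \<psi> g \<Phi> \<longrightarrow>
     (\<forall>i<ncomp G. \<forall>j\<in>{1..ncell G i}. \<forall>t\<in>cell G i j.
        \<bar>dG_interp G u t i - u t i\<bar> \<le> C * (step G i j ^ (deg G i j + 1) * cell_norm G u i j))"
    using interpolation_error[of Q] by blast
  note C = C'[rule_format]
  have E: "0 \<le> ck / \<alpha>" and \<beta>: "0 < \<alpha>\<^sup>2" using ck \<alpha> by auto
  define P where "P q K \<longleftrightarrow> 0 \<le> K \<and> (\<forall>G f u0 u U \<psi> g \<Phi> n c \<kappa> t0 i. slab_ctx G Q f u0 u U \<psi> g \<Phi> n q c \<kappa> (\<alpha>\<^sup>2) (ck / \<alpha>) \<longrightarrow>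
     t0 \<in> slab_ival G n \<longrightarrow> i < ncomp G \<longrightarrow>
     apx q (c * (K * slab_norm G \<Phi> n)) (slab_ctx.win G n \<kappa> t0 1) (\<lambda>t. c * (t - t0)) (c * \<kappa>)
       (\<lambda>t. valid_grid.adjoint_rhs G f (dG_interp G u) u \<Phi> t i))" for q K
  define k where "k q = (SOME K. P q K)" for q
  have k: "P q (k q)" for q
    unfolding k_def by (rule someI_ex) (use uniform_adjoint_regularity[OF E \<beta>, of Q q] in \<open>simp only: P_def\<close>)
  define K where "K = (\<Sum>q\<le>Q. k q)"
  have k0: "0 \<le> k q" for q using k[of q] by (simp add: P_def)
  have kK: "k q \<le> K" if "q \<le> Q" for q unfolding K_def by (rule member_le_sum) (use that k0 in auto)
  define D where "D = C * K * (1 / \<alpha>) ^ Q"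
  have K0: "0 \<le> K" unfolding K_def using k0 by (intro sum_nonneg) auto
  have D0: "0 \<le> D" using C1 K0 \<alpha> by (simp add: D_def)
  have main: "\<bar>integral (cell G i j) (\<lambda>t. (dG_interp G u t i - u t i) * valid_grid.adjoint_rhs G f (dG_interp G u) u \<Phi> t i)\<bar>
     \<le> (D + 1) * (step G i j * ((step G i j ^ (2 * deg G i j + 1) * Cf n ^ deg G i j * cell_norm G u i j) * (Cf n * slab_norm G \<Phi> n)))"
    if S: "mdG_setting Q G f u0 u U \<psi> g \<Phi>" and A: "slab_assms G f u U g Cf ck \<alpha>" and n: "n \<in> {1..nslab G}" and ij: "(i, j) \<in> slab G n"
    for G f u0 u U \<psi> g \<Phi> Cf n i j
  proof -
    note ctx = slab_ctx_of_assms[OF S A \<alpha>(1) n ij]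
    interpret slab_ctx G Q f u0 u U \<psi> g \<Phi> n "deg G i j" "Cf n" "step G i j / \<alpha>" "\<alpha>\<^sup>2" "ck / \<alpha>" by (rule ctx)
    have i: "i < N" and j: "j \<in> {1..M i}" and sub: "cell G i j \<subseteq> slab_ival G n" using slab_cell_subset[OF ij] by auto
    have nd: "nd i j \<in> slab_ival G n" using sub nd_step[OF i j] by (auto simp: cell_def)
    let ?q = "deg G i j" and ?s = "step G i j" and ?Z = "slab_norm G \<Phi> n" and ?cn = "cell_norm G u i j"
    have Ap: "apx ?q (Cf n * (k ?q * ?Z)) (win (nd i j) 1) (sc (nd i j)) eps (\<lambda>t. adjoint_rhs f pu u \<Phi> t i)"
      using k[of ?q, unfolded P_def, THEN conjunct2, rule_format, OF ctx nd i] .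
    have s0: "0 < ?s" by (rule step_pos[OF i j])
    have cn: "0 \<le> ?cn" by (rule cell_norm_nonneg[OF i j])
    have "\<bar>integral (cell G i j) (\<lambda>t. (pu t i - u t i) * adjoint_rhs f pu u \<Phi> t i)\<bar>
       \<le> ?s * (C * (?s ^ (?q + 1) * ?cn) * (Cf n * (k ?q * ?Z) * eps ^ ?q))"
      by (rule cell_integral_estimate[OF ij k0 Ap C[OF S i j]])
    also have "\<dots> = (C * k ?q * (1 / \<alpha>) ^ ?q) * (?s * ((?s ^ (2 * ?q + 1) * Cf n ^ ?q * ?cn) * (Cf n * ?Z)))"
    proof -
      have "?s ^ (2 * ?q + 1) = ?s ^ (?q + 1) * ?s ^ ?q" by (simp add: power_add[symmetric] mult_2)
      moreover have "eps ^ ?q = Cf n ^ ?q * ?s ^ ?q * (1 / \<alpha>) ^ ?q"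
        by (simp add: power_mult_distrib[symmetric] power_divide)
      ultimately show ?thesis by (simp only: mult_ac)
    qed
    also have "\<dots> \<le> (D + 1) * (?s * ((?s ^ (2 * ?q + 1) * Cf n ^ ?q * ?cn) * (Cf n * ?Z)))"
    proof (rule mult_right_mono)
      have "(1 / \<alpha>) ^ ?q \<le> (1 / \<alpha>) ^ Q" using \<alpha> q_le_Q by (intro power_increasing) auto
      then have "C * k ?q * (1 / \<alpha>) ^ ?q \<le> C * K * (1 / \<alpha>) ^ Q"
        using C1 k0 kK[OF q_le_Q] K0 \<alpha> by (intro mult_mono) auto
      then show "C * k ?q * (1 / \<alpha>) ^ ?q \<le> D + 1" by (simp add: D_def)
      show "0 \<le> ?s * ((?s ^ (2 * ?q + 1) * Cf n ^ ?q * ?cn) * (Cf n * ?Z))"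
        using s0 cn c_nonneg slab_norm_nonneg by simp
    qed
    finally show ?thesis .
  qed
  have "0 < D + 1" using D0 by simp
  then show ?thesis by (intro exI[of _ "D + 1"] conjI allI impI main)
qed

text \<open>
  Sum the cell estimates. Both \<open>kkCu\<close> and the weight are constant on cells, so that the sum over
  the cells of component \<open>i\<close> is an integral; summed over \<open>i\<close>, the integrand is at most the
  supremum of the \<open>l\<^sub>1\<close>-norm times the weight.
\<close>

theorem improved_estimate:
  assumes ck: "0 < ck" and \<alpha>: "0 < \<alpha>" "\<alpha> < 1"
  shows "\<exists>C>0. \<forall>G f u0 u U \<psi> g \<Phi> Cf.
          mdG_setting Q G f u0 u U \<psi> g \<Phi> \<and> slab_assms G f u U g Cf ck \<alpha> \<longrightarrow>
          \<bar>Lfun G \<psi> g (\<lambda>t i. U t i - dG_interp G u t i)\<bar>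
          \<le> C * stab_Sbar G Cf \<Phi> * (SUP t\<in>{0<..tfin G}. norm_l1 (ncomp G) (kkCu G Cf u t))
          \<and> stab_Sbar G Cf \<Phi>
            = (\<Sum>n=1..nslab G. (level G n - level G (n - 1)) * Cf n * slab_norm G \<Phi> n)"
proof -
  obtain C where C0: "C > 0" and C': "\<forall>G f u0 u U \<psi> g \<Phi> Cf n i j. mdG_setting Q G f u0 u U \<psi> g \<Phi> \<longrightarrow> slab_assms G f u U g Cf ck \<alpha> \<longrightarrow>
     n \<in> {1..nslab G} \<longrightarrow> (i, j) \<in> slab G n \<longrightarrow>
     \<bar>integral (cell G i j) (\<lambda>t. (dG_interp G u t i - u t i) * valid_grid.adjoint_rhs G f (dG_interp G u) u \<Phi> t i)\<bar>
     \<le> C * (step G i j * ((step G i j ^ (2 * deg G i j + 1) * Cf n ^ deg G i j * cell_norm G u i j) * (Cf n * slab_norm G \<Phi> n)))"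
    using uniform_cell_estimate[OF assms, of Q] by blast
  have main: "\<bar>Lfun G \<psi> g (\<lambda>t i. U t i - dG_interp G u t i)\<bar>
          \<le> C * stab_Sbar G Cf \<Phi> * (SUP t\<in>{0<..tfin G}. norm_l1 (ncomp G) (kkCu G Cf u t))
          \<and> stab_Sbar G Cf \<Phi>
            = (\<Sum>n=1..nslab G. (level G n - level G (n - 1)) * Cf n * slab_norm G \<Phi> n)"
    if S: "mdG_setting Q G f u0 u U \<psi> g \<Phi>" and A: "slab_assms G f u U g Cf ck \<alpha>" for G f u0 u U \<psi> g \<Phi> Cf
  proof
    interpret mdG G Q f u0 u U \<psi> g \<Phi> by (rule mdG_setting_locale[OF S])
    show "stab_Sbar G Cf \<Phi> = (\<Sum>n=1..nslab G. (level G n - level G (n - 1)) * Cf n * slab_norm G \<Phi> n)"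
      by (rule stab_Sbar_eq_sum)
    define K where "K = (SUP t\<in>{0<..T}. norm_l1 N (kkCu G Cf u t))"
    let ?a = "\<lambda>t i. adjoint_rhs f pu u \<Phi> t i"
    let ?W = "sbar_weight G Cf \<Phi>"
    have cell_facts: "\<exists>n. n \<in> {1..nslab G} \<and> (i, j) \<in> slab G n \<and> 0 \<le> Cf n \<and> 0 \<le> slab_norm G \<Phi> n \<and>
         (\<forall>t\<in>cell G i j. ?W t = Cf n * slab_norm G \<Phi> n) \<and>
         (\<forall>t\<in>cell G i j. kkCu G Cf u t i = step G i j ^ (2 * deg G i j + 1) * Cf n ^ deg G i j * cell_norm G u i j)"
      if ij: "i < N" "j \<in> {1..M i}" for i j
    proof -
      obtain n where n: "n \<in> {1..nslab G}" "(i, j) \<in> slab G n" "\<And>t. t \<in> cell G i j \<Longrightarrow> index_at (level G) t = n"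
        using cell_in_slab[OF ij] by blast
      interpret sc: slab_ctx G Q f u0 u U \<psi> g \<Phi> n "deg G i j" "Cf n" "step G i j / \<alpha>" "\<alpha>\<^sup>2" "ck / \<alpha>"
        by (rule slab_ctx_of_assms[OF S A \<alpha>(1) n(1,2)])
      show ?thesis
        using n sc.c_nonneg sc.slab_norm_nonneg index_cell[OF ij]
        by (intro exI[of _ n]) (auto simp: sbar_weight_def kkCu_def Let_def)
    qed
    have kV: "kkCu G Cf u \<in> Vspace G"
    proof (rule cellwise_constant_Vspace)
      fix i j assume "i < N" "j \<in> {1..M i}"
      from cell_facts[OF this] show "\<exists>a. \<forall>t\<in>cell G i j. kkCu G Cf u t i = a" by blast
    qed
    have hV: "(\<lambda>t i. kkCu G Cf u t i * ?W t) \<in> Vspace G"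
    proof (rule cellwise_constant_Vspace)
      fix i j assume "i < N" "j \<in> {1..M i}"
      from cell_facts[OF this] obtain a b where "\<forall>t\<in>cell G i j. ?W t = a" "\<forall>t\<in>cell G i j. kkCu G Cf u t i = b" by blast
      then show "\<exists>a. \<forall>t\<in>cell G i j. kkCu G Cf u t i * ?W t = a" by (intro exI[of _ "b * a"]) simp
    qed
    have k0: "0 \<le> kkCu G Cf u t i" and W0: "0 \<le> ?W t" if i: "i < N" and t: "t \<in> {0<..T}" for i t
    proof -
      note j = index_cell_exists[OF i t]
      from cell_facts[OF i j(1)] j(2) show "0 \<le> kkCu G Cf u t i" "0 \<le> ?W t"
        using step_pos[OF i j(1)] cell_norm_nonneg[OF i j(1)] by auto
    qed
    have l1: "norm_l1 N (kkCu G Cf u t) = (\<Sum>i<N. kkCu G Cf u t i)" if "t \<in> {0<..T}" for t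
      unfolding norm_l1_def using k0 that by (intro sum.cong) auto
    have bdd: "bdd_above ((\<lambda>t. norm_l1 N (kkCu G Cf u t)) ` {0<..T})"
    proof -
      obtain B where B: "\<And>t i. t \<in> {0<..T} \<Longrightarrow> i < N \<Longrightarrow> \<bar>kkCu G Cf u t i\<bar> \<le> B" using Vspace_bounded[OF kV] by blast
      have "norm_l1 N (kkCu G Cf u t) \<le> (\<Sum>i<N. B)" if "t \<in> {0<..T}" for t
        unfolding norm_l1_def using B[OF that] by (intro sum_mono) auto
      then show ?thesis unfolding bdd_above_def by (intro exI[of _ "\<Sum>i<N. B"]) blast
    qed
    have K: "norm_l1 N (kkCu G Cf u t) \<le> K" if "t \<in> {0<..T}" for t
      unfolding K_def by (rule cSUP_upper[OF that bdd])
    note int_e = error_adjoint_integrable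
    have int_h: "(\<lambda>t. kkCu G Cf u t i * ?W t) integrable_on {0<..T}" if "i < N" for i
      using Vspace_integrable[OF hV that] .
    have Icc: "g integrable_on {0..T}" if "g integrable_on {0<..T}" for g :: "real \<Rightarrow> real"
      using that integrable_Ioc by blast
    have comp: "\<bar>integral {0..T} (\<lambda>t. (pu t i - u t i) * ?a t i)\<bar> \<le> C * integral {0..T} (\<lambda>t. kkCu G Cf u t i * ?W t)"
      if i: "i < N" for i
    proof -
      have cellw: "\<bar>integral (cell G i j) (\<lambda>t. (pu t i - u t i) * ?a t i)\<bar> \<le> C * integral (cell G i j) (\<lambda>t. kkCu G Cf u t i * ?W t)"
        if j: "j \<in> {1..M i}" for j
      proof -
        obtain n where n: "n \<in> {1..nslab G}" "(i, j) \<in> slab G n"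
         "\<forall>t\<in>cell G i j. ?W t = Cf n * slab_norm G \<Phi> n"
         "\<forall>t\<in>cell G i j. kkCu G Cf u t i = step G i j ^ (2 * deg G i j + 1) * Cf n ^ deg G i j * cell_norm G u i j"
          using cell_facts[OF i j] by blast
        let ?X = "(step G i j ^ (2 * deg G i j + 1) * Cf n ^ deg G i j * cell_norm G u i j) * (Cf n * slab_norm G \<Phi> n)"
        have "integral (cell G i j) (\<lambda>t. kkCu G Cf u t i * ?W t) = integral (cell G i j) (\<lambda>t. ?X)"
          by (rule integral_cong) (use n(3,4) in simp)
        also have "\<dots> = step G i j * ?X"
          unfolding cell_def integral_Ioc using nd_step[OF i j] by (simp add: step_def)
        finally have eq: "integral (cell G i j) (\<lambda>t. kkCu G Cf u t i * ?W t) = step G i j * ?X" .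
        show ?thesis unfolding eq by (rule C'[rule_format, OF S A n(1,2)])
      qed
      have "\<bar>integral {0..T} (\<lambda>t. (pu t i - u t i) * ?a t i)\<bar> \<le> (\<Sum>j=1..M i. C * integral (cell G i j) (\<lambda>t. kkCu G Cf u t i * ?W t))"
        unfolding integral_cells[OF i int_e[OF i]] by (rule order.trans[OF sum_abs], intro sum_mono cellw)
      also have "\<dots> = C * integral {0..T} (\<lambda>t. kkCu G Cf u t i * ?W t)"
        unfolding integral_cells[OF i int_h[OF i]] by (rule sum_distrib_left[symmetric])
      finally show ?thesis .
    qed
    have L: "Lfun G \<psi> g (\<lambda>t i. U t i - pu t i) = (\<Sum>i<N. integral {0..T} (\<lambda>t. (pu t i - u t i) * ?a t i))"
      unfolding error_representation inner_N_def
      by (rule integral_sum) (use int_e Icc in auto)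
    have "\<bar>Lfun G \<psi> g (\<lambda>t i. U t i - pu t i)\<bar> \<le> (\<Sum>i<N. C * integral {0..T} (\<lambda>t. kkCu G Cf u t i * ?W t))"
      unfolding L by (rule order.trans[OF sum_abs], intro sum_mono comp) auto
    also have "\<dots> = C * integral {0..T} (\<lambda>t. \<Sum>i<N. kkCu G Cf u t i * ?W t)"
      unfolding sum_distrib_left[symmetric]
      by (rule arg_cong[where f = "\<lambda>x. C * x"], rule integral_sum[symmetric]) (use int_h Icc in auto)
    also have "\<dots> \<le> C * (K * stab_Sbar G Cf \<Phi>)"
    proof (rule mult_left_mono)
      have "integral {0..T} (\<lambda>t. \<Sum>i<N. kkCu G Cf u t i * ?W t) = integral {0<..T} (\<lambda>t. \<Sum>i<N. kkCu G Cf u t i * ?W t)"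
        by (rule integral_Ioc[symmetric])
      also have "\<dots> \<le> integral {0<..T} (\<lambda>t. K * ?W t)"
      proof (rule integral_le)
        show "(\<lambda>t. \<Sum>i<N. kkCu G Cf u t i * ?W t) integrable_on {0<..T}" by (intro integrable_sum) (use int_h in auto)
        show "(\<lambda>t. K * ?W t) integrable_on {0<..T}" by (rule integrable_on_mult_right[OF sbar_weight_integrable])
        fix t assume t: "t \<in> {0<..T}"
        have "0 \<le> ?W t" using W0[of 0 t] N_pos t by simp
        then show "(\<Sum>i<N. kkCu G Cf u t i * ?W t) \<le> K * ?W t"
          unfolding sum_distrib_right[symmetric] l1[OF t, symmetric] by (intro mult_right_mono K t)
      qed
      also have "\<dots> = K * integral {0..T} ?W" unfolding integral_Ioc by (rule integral_mult_right)
      also have "integral {0..T} ?W = stab_Sbar G Cf \<Phi>" by (simp add: stab_Sbar_def sbar_weight_def[abs_def])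
      finally show "integral {0..T} (\<lambda>t. \<Sum>i<N. kkCu G Cf u t i * ?W t) \<le> K * stab_Sbar G Cf \<Phi>" .
    qed (use C0 in simp)
    also have "\<dots> = C * stab_Sbar G Cf \<Phi> * K" by simp
    finally show "\<bar>Lfun G \<psi> g (\<lambda>t i. U t i - pu t i)\<bar> \<le> C * stab_Sbar G Cf \<Phi> * (SUP t\<in>{0<..T}. norm_l1 N (kkCu G Cf u t))"
      unfolding K_def .
  qed
  show ?thesis by (rule exI[of _ C], rule conjI, rule C0, (rule allI)+, rule impI, erule conjE, rule main, assumption+)
qed

theorem theorem6p6:
  fixes Q :: nat
  shows
    "(\<exists>C>0. \<forall>G f u0 u U \<psi> g \<Phi>.
        mdG_setting Q G f u0 u U \<psi> g \<Phi> \<longrightarrow>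
        \<bar>Lfun G \<psi> g (\<lambda>t i. U t i - dG_interp G u t i)\<bar>
        \<le> C * stab_S G f u \<Phi> * (SUP t\<in>{0<..tfin G}. norm_l2 (ncomp G) (ku G u t)))
     \<and>
     (\<forall>ck>0. \<forall>\<alpha>. 0 < \<alpha> \<and> \<alpha> < 1 \<longrightarrow>
       (\<exists>C>0. \<forall>G f u0 u U \<psi> g \<Phi> Cf.
          mdG_setting Q G f u0 u U \<psi> g \<Phi> \<and> slab_assms G f u U g Cf ck \<alpha> \<longrightarrow>
          \<bar>Lfun G \<psi> g (\<lambda>t i. U t i - dG_interp G u t i)\<bar>
          \<le> C * stab_Sbar G Cf \<Phi> * (SUP t\<in>{0<..tfin G}. norm_l1 (ncomp G) (kkCu G Cf u t))
          \<and> stab_Sbar G Cf \<Phi>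
            = (\<Sum>n=1..nslab G. (level G n - level G (n - 1)) * Cf n * slab_norm G \<Phi> n)))"
proof (rule conjI[OF a_priori_estimate], intro allI impI, elim conjE)
  fix ck \<alpha> :: real assume "ck > 0" "0 < \<alpha>" "\<alpha> < 1"
  then show "\<exists>C>0. \<forall>G f u0 u U \<psi> g \<Phi> Cf.
          mdG_setting Q G f u0 u U \<psi> g \<Phi> \<and> slab_assms G f u U g Cf ck \<alpha> \<longrightarrow>
          \<bar>Lfun G \<psi> g (\<lambda>t i. U t i - dG_interp G u t i)\<bar>
          \<le> C * stab_Sbar G Cf \<Phi> * (SUP t\<in>{0<..tfin G}. norm_l1 (ncomp G) (kkCu G Cf u t))
          \<and> stab_Sbar G Cf \<Phi>
            = (\<Sum>n=1..nslab G. (level G n - level G (n - 1)) * Cf n * slab_norm G \<Phi> n)"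
    by (rule improved_estimate)
qed

end
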